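(* The intertwining relations $$\Lambda^\vee\circ\Omega=\Theta\circ\Lambda\quad\text{on }\mathcal{ID}(\mathbb R_+,\ast)\qquad\text{and}\qquad \Omega\circ\mathcal X=\mathcal X^\vee\circ\Xi\quad\text{on }\mathcal P(\mathbb R_+)$$ hold. Consequently, the diagram of semigroup homomorphisms with top row $$(\mathcal P(\mathbb R_+),\uplus)\xrightarrow{\ \mathcal X\ }(\mathcal{ID}(\mathbb R_+,\ast),\ast)\xrightarrow{\ \Lambda\ }(\mathcal{ID}(\mathbb R_+,\boxplus),\boxplus),$$ bottom row $$(\mathcal P(\mathbb R_+),\vee_{\mathrm b})\xrightarrow{\ \mathcal X^\vee\ }(\mathcal P(\mathbb R_+),\vee)\xrightarrow{\ \Lambda^\vee\ }(\mathcal P(\mathbb R_+),\vee_{\mathrm f}),$$ and vertical arrows (from top to bottom) $\Xi$, $\Omega$, $\Theta$ on the left, middle and right, respectively, commutes.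
   Context: $\mathbb R_+=[0,\infty)$ and $\mathcal P(\mathbb R_+)$ is the set of Borel probability measures on $\mathbb R_+$. For a measure $\nu$ on $\mathbb R_+$ and $\alpha\in\mathbb R$, $\nu^\alpha$ is the push-forward of $\nu$ by $x\mapsto x^\alpha$ (for $\alpha<0$ used only when $\nu(\{0\})=0$). Transforms. For $\mu\in\mathcal P(\mathbb R_+)$: $C_\mu(t)=\log\int_{\mathbb R_+}e^{tu}\,d\mu(u)$ for $t\le0$; $\psi_\mu(t)=\int_{\mathbb R_+}\frac{tu}{1-tu}\,d\mu(u)$ and $\eta_\mu(t)=\frac{\psi_\mu(t)}{1+\psi_\mu(t)}$ for $t<0$; $G_\mu(s)=\int_0^\infty\frac1{s-x}\,d\mu(x)$ for $s<0$; $\kappa_\mu=\int_0^\infty x^{-1}\,d\mu(x)\in(0,\infty]$ (with $\kappa_\mu=\infty$ if $\mu(\{0\})>0$). $G_\mu$ is a bijection from $(-\infty,0)$ onto $(-\kappa_\mu,0)$ and $R_\mu(t)=tG_\mu^{-1}(t)-1$ for $t\in(-\kappa_\mu,0)$. For $\mu\ne\delta_0$, $\psi_\mu$ is a bijection from $(-\infty,0)$ onto $(-1+\mu(\{0\}),0)$ and $S_\mu(t)=\frac{1+t}t\psi_\mu^{-1}(t)$ on $(-1+\mu(\{0\}),0)$. Convolutions on $\mathcal P(\mathbb R_+)$. $\ast$: classical additive convolution. $\boxplus$: $R_{\mu\boxplus\nu}=R_\mu+R_\nu$ on $(-\kappa_{\mu\boxplus\nu},0)$. $\uplus$: $\eta_{\mu\uplus\nu}=\eta_\mu+\eta_\nu$.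 $\boxtimes$: for $\mu,\nu\ne\delta_0$, $S_{\mu\boxtimes\nu}=S_\mu S_\nu$ on $(-1+\max\{\mu(\{0\}),\nu(\{0\})\},0)$, and $\mu\boxtimes\delta_0=\delta_0\boxtimes\mu=\delta_0$. Max-convolutions, for $t\ge0$: $(\mu\vee\nu)([0,t])=\mu([0,t])\nu([0,t])$; $(\mu\vee_{\mathrm f}\nu)([0,t])=\max\{\mu([0,t])+\nu([0,t])-1,0\}$; $\frac1{(\mu\vee_{\mathrm b}\nu)([0,t])}=\frac1{\mu([0,t])}+\frac1{\nu([0,t])}-1$, with $(\mu\vee_{\mathrm b}\nu)([0,t])=0$ when $\mu([0,t])=0$ or $\nu([0,t])=0$. For $\star\in\{\ast,\boxplus\}$, $\mathcal{ID}(\mathbb R_+,\star)$ is the set of $\mu\in\mathcal P(\mathbb R_+)$ such that for every $n\in\mathbb N$ there is $\mu_n\in\mathcal P(\mathbb R_+)$ with $\mu=\mu_n\star\cdots\star\mu_n$ ($n$ factors). Maps. $\Phi(\mu)$ is the weak limit of $(\mu^{\boxtimes n})^{1/n}$ as $n\to\infty$ (which exists for every $\mu\in\mathcal P(\mathbb R_+)$). $\pi$ is the standard Marchenko--Pastur law $\frac{\sqrt{x(4-x)}}{2\pi x}\mathbf 1_{(0,4)}(x)\,dx$ (the $\pi$ in the denominator is the number). $\Theta(\mu)=\Phi(\pi^{-1}\boxtimes\mu)$ and $\Xi(\mu)=\Phi(\pi^{-1}\boxtimes\pi\boxtimes\mu)$ for $\mu\in\mathcal P(\mathbb R_+)$.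 $\Omega(\mu)\in\mathcal P(\mathbb R_+)$ is defined by $\Omega(\mu)([0,t])=\exp\left(\int_0^\infty C_\mu(-x/t)e^{-x}\,dx\right)$ for $t>0$ and $\Omega(\mu)(\{0\})=\mu(\{0\})$. $\Lambda$ is the Bercovici--Pata bijection restricted to $\mathcal{ID}(\mathbb R_+,\ast)$, a bijective homomorphism $(\mathcal{ID}(\mathbb R_+,\ast),\ast)\to(\mathcal{ID}(\mathbb R_+,\boxplus),\boxplus)$ characterized by $R_{\Lambda(\mu)}(t)=\int_0^\infty C_\mu(tx)e^{-x}\,dx$ for $t\in(-\kappa_{\Lambda(\mu)},0)$ (the right-hand side giving an analytic continuation of $R_{\Lambda(\mu)}$ to $(-\infty,0)$). $\mathcal X$ is the bijective homomorphism $(\mathcal P(\mathbb R_+),\uplus)\to(\mathcal{ID}(\mathbb R_+,\ast),\ast)$ characterized by $\eta_{\mathcal X^{-1}(\mu)}(t)=\int_0^\infty C_\mu(tx)e^{-x}\,dx$, $t<0$, for $\mu\in\mathcal{ID}(\mathbb R_+,\ast)$. $\Lambda^\vee$ is the homomorphism $(\mathcal P(\mathbb R_+),\vee)\to(\mathcal P(\mathbb R_+),\vee_{\mathrm f})$ given by $\Lambda^\vee(\mu)([0,t])=\max\{1+\log\mu([0,t]),0\}$, $t\ge0$ (equal to $0$ if $\mu([0,t])=0$). $\mathcal X^\vee$ is the homomorphism $(\mathcal P(\mathbb R_+),\vee_{\mathrm b})\to(\mathcal P(\mathbb R_+),\vee)$ given by $\mathcal X^\vee(\mu)([0,t])=\exp(1-\mu([0,t])^{-1})$,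 $t\ge0$ (equal to $0$ if $\mu([0,t])=0$). *)

theory Defs
  imports "HOL-Probability.Probability"
begin

(* Borel probability measures on [0,oo), realised as Borel probability measures on the real
   line that are concentrated on [0,oo). *)
definition Pplus :: "real measure set" where
  "Pplus = {\<mu>. real_distribution \<mu> \<and> measure \<mu> {0..} = 1}"

abbreviation delta0 :: "real measure" where
  "delta0 \<equiv> return borel 0"

(* Here 0 powr a = 0 for every a, which is the correct value for a > 0; for a < 0 the operation
   is only applied to measures without atom at 0. *)
definition mpow :: "real measure \<Rightarrow> real \<Rightarrow> real measure" where
  "mpow \<mu> a = distr \<mu> borel (\<lambda>x. x powr a)"


section \<open>Transforms\<close>

definition C_tr :: "real measure \<Rightarrow> real \<Rightarrow> real" where
  "C_tr \<mu> t = ln (LINT u|\<mu>. exp (t * u))"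

definition psi_tr :: "real measure \<Rightarrow> real \<Rightarrow> real" where
  "psi_tr \<mu> t = (LINT u|\<mu>. (t * u) / (1 - t * u))"

definition eta_tr :: "real measure \<Rightarrow> real \<Rightarrow> real" where
  "eta_tr \<mu> t = psi_tr \<mu> t / (1 + psi_tr \<mu> t)"

definition G_tr :: "real measure \<Rightarrow> real \<Rightarrow> real" where
  "G_tr \<mu> s = (LINT x|\<mu>. 1 / (s - x))"

(* In ennreal, the inverse of 0 is infinity, so an atom at 0 gives the value infinity. *)
definition kappa :: "real measure \<Rightarrow> ennreal" where
  "kappa \<mu> = (\<integral>\<^sup>+ x. inverse (ennreal x) \<partial>\<mu>)"

(* The open interval (-kappa, 0). *)
definition R_dom :: "real measure \<Rightarrow> real set" where
  "R_dom \<mu> = {t. t < 0 \<and> ennreal (- t) < kappa \<mu>}"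

(* Only meaningful for t in R_dom mu. *)
definition R_tr :: "real measure \<Rightarrow> real \<Rightarrow> real" where
  "R_tr \<mu> t = t * inv_into {..<0} (G_tr \<mu>) t - 1"

(* Only meaningful for mu different from delta0 and t in the interval (-1 + mu {0}, 0). *)
definition S_tr :: "real measure \<Rightarrow> real \<Rightarrow> real" where
  "S_tr \<mu> t = (1 + t) / t * inv_into {..<0} (psi_tr \<mu>) t"

(* The transform of C_mu occurring in the definitions of Lambda, X and Omega. *)
definition LC :: "real measure \<Rightarrow> real \<Rightarrow> real" where
  "LC \<mu> t = (LINT x:{0<..}|lborel. C_tr \<mu> (t * x) * exp (- x))"


section \<open>Convolutions\<close>

definition boxplus :: "real measure \<Rightarrow> real measure \<Rightarrow> real measure" where
  "boxplus \<mu> \<nu> = (THE \<rho>. \<rho> \<in> Pplus \<and> (\<forall>t\<in>R_dom \<rho>. R_tr \<rho> t = R_tr \<mu> t + R_tr \<nu> t))"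

definition uplus :: "real measure \<Rightarrow> real measure \<Rightarrow> real measure" where
  "uplus \<mu> \<nu> = (THE \<rho>. \<rho> \<in> Pplus \<and> (\<forall>t<0. eta_tr \<rho> t = eta_tr \<mu> t + eta_tr \<nu> t))"

definition boxtimes :: "real measure \<Rightarrow> real measure \<Rightarrow> real measure" where
  "boxtimes \<mu> \<nu> =
     (if \<mu> = delta0 \<or> \<nu> = delta0 then delta0
      else (THE \<rho>. \<rho> \<in> Pplus \<and> \<rho> \<noteq> delta0 \<and>
             (\<forall>t\<in>{-1 + max (measure \<mu> {0}) (measure \<nu> {0}) <..< 0}.
                S_tr \<rho> t = S_tr \<mu> t * S_tr \<nu> t)))"

(* The measure on [0,oo) that gives mass F t to [0,t] for every t >= 0. *)
definition of_df :: "(real \<Rightarrow> real) \<Rightarrow> real measure" where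
  "of_df F = interval_measure (\<lambda>t. if t < 0 then 0 else F t)"

definition max_conv :: "real measure \<Rightarrow> real measure \<Rightarrow> real measure" where
  "max_conv \<mu> \<nu> = of_df (\<lambda>t. measure \<mu> {0..t} * measure \<nu> {0..t})"

definition free_max_conv :: "real measure \<Rightarrow> real measure \<Rightarrow> real measure" where
  "free_max_conv \<mu> \<nu> = of_df (\<lambda>t. max (measure \<mu> {0..t} + measure \<nu> {0..t} - 1) 0)"

definition bool_max_conv :: "real measure \<Rightarrow> real measure \<Rightarrow> real measure" where
  "bool_max_conv \<mu> \<nu> = of_df (\<lambda>t.
     if measure \<mu> {0..t} = 0 \<or> measure \<nu> {0..t} = 0 then 0
     else 1 / (1 / measure \<mu> {0..t} + 1 / measure \<nu> {0..t} - 1))"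

(* The product of n factors mu, for n >= 1. *)
definition nfold :: "('a \<Rightarrow> 'a \<Rightarrow> 'a) \<Rightarrow> nat \<Rightarrow> 'a \<Rightarrow> 'a" where
  "nfold f n \<mu> = (f \<mu> ^^ (n - 1)) \<mu>"

definition ID :: "(real measure \<Rightarrow> real measure \<Rightarrow> real measure) \<Rightarrow> real measure set" where
  "ID f = {\<mu> \<in> Pplus. \<forall>n\<ge>1. \<exists>\<nu>\<in>Pplus. \<mu> = nfold f n \<nu>}"


section \<open>Maps\<close>

definition Phi_map :: "real measure \<Rightarrow> real measure" where
  "Phi_map \<mu> = (THE \<rho>. \<rho> \<in> Pplus \<and>
     weak_conv_m (\<lambda>n. mpow (nfold boxtimes n \<mu>) (1 / real n)) \<rho>)"

definition MP :: "real measure" where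
  "MP = density lborel
     (\<lambda>x. ennreal (sqrt (x * (4 - x)) / (2 * pi * x) * indicator {0<..<4} x))"

definition Theta_map :: "real measure \<Rightarrow> real measure" where
  "Theta_map \<mu> = Phi_map (boxtimes (mpow MP (-1)) \<mu>)"

definition Xi_map :: "real measure \<Rightarrow> real measure" where
  "Xi_map \<mu> = Phi_map (boxtimes (boxtimes (mpow MP (-1)) MP) \<mu>)"

definition Omega_map :: "real measure \<Rightarrow> real measure" where
  "Omega_map \<mu> = of_df (\<lambda>t. if t = 0 then measure \<mu> {0} else exp (LC \<mu> (- 1 / t)))"

definition Lambda_map :: "real measure \<Rightarrow> real measure" where
  "Lambda_map \<mu> = (THE \<nu>. \<nu> \<in> ID boxplus \<and> (\<forall>t\<in>R_dom \<nu>. R_tr \<nu> t = LC \<mu> t))"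

definition X_map :: "real measure \<Rightarrow> real measure" where
  "X_map \<mu> = (THE \<nu>. \<nu> \<in> ID convolution \<and> (\<forall>t<0. eta_tr \<mu> t = LC \<nu> t))"

definition Lambda_max :: "real measure \<Rightarrow> real measure" where
  "Lambda_max \<mu> = of_df (\<lambda>t.
     if measure \<mu> {0..t} = 0 then 0 else max (1 + ln (measure \<mu> {0..t})) 0)"

definition X_max :: "real measure \<Rightarrow> real measure" where
  "X_max \<mu> = of_df (\<lambda>t.
     if measure \<mu> {0..t} = 0 then 0 else exp (1 - 1 / measure \<mu> {0..t}))"


section \<open>Semigroups with explicit carriers\<close>

definition semigroup_on :: "'a set \<Rightarrow> ('a \<Rightarrow> 'a \<Rightarrow> 'a) \<Rightarrow> bool" where
  "semigroup_on A f \<longleftrightarrow>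
     (\<forall>x\<in>A. \<forall>y\<in>A. f x y \<in> A) \<and>
     (\<forall>x\<in>A. \<forall>y\<in>A. \<forall>z\<in>A. f (f x y) z = f x (f y z))"

definition semigroup_hom ::
  "'a set \<Rightarrow> ('a \<Rightarrow> 'a \<Rightarrow> 'a) \<Rightarrow> 'b set \<Rightarrow> ('b \<Rightarrow> 'b \<Rightarrow> 'b) \<Rightarrow> ('a \<Rightarrow> 'b) \<Rightarrow> bool" where
  "semigroup_hom A f B g h \<longleftrightarrow>
     semigroup_on A f \<and> semigroup_on B g \<and>
     (\<forall>x\<in>A. h x \<in> B) \<and>
     (\<forall>x\<in>A. \<forall>y\<in>A. h (f x y) = g (h x) (h y))"

end

theory Submission
  imports Defs "HOL-Computational_Algebra.Fundamental_Theorem_Algebra" "HOL-Real_Asymp.Real_Asymp"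
begin

text \<open>For \<open>M(t) = \<integral> 1 / (1 - t u) d\<mu>(u)\<close> one has \<open>\<psi> = M - 1\<close> and \<open>\<eta> = 1 - 1 / M\<close>, and \<open>h\<close> is the R-transform
  of \<open>\<mu>\<close> iff \<open>M(t) = 1 + h(t M(t))\<close>. The transforms \<open>\<eta>\<close> of probability measures, \<open>R\<close> of freely and \<open>LC\<close> of
  classically infinitely divisible measures all range over the same class: negatives of complete Bernstein
  functions of \<open>- t\<close> that vanish at \<open>0\<close>. This class is stable under sums, limits, composition and
  \<open>g \<mapsto> t / (1 - g)\<close> (the last one being a statement on zeros of rational functions), so that all
  convolutions and bijections can be built on the negative half-line, without complex analysis.

  If \<open>\<mu>\<close> has R-transform \<open>h\<close>, the S-transform of \<open>\<pi>\<^sup>-\<^sup>1 \<boxtimes> \<mu>\<close> is minus the inverse function of \<open>h\<close>, and its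
  \<open>n\<close>-th \<open>\<boxtimes>\<close>-power has the same form with \<open>h(- (- t) powr (1/n))\<close> in place of \<open>h\<close>. As \<open>1 / (1 + (a x)\<^sup>n)\<close>
  becomes an indicator function, the limit \<open>\<Theta>(\<mu>)\<close> has the distribution function \<open>max(1 + h(-1/x), 0)\<close>.
  Since \<open>\<pi> \<boxtimes> \<mu>\<close> has R-transform \<open>\<psi>\<close>, \<open>\<Xi>(\<mu>)\<close> has the distribution function \<open>M(-1/x)\<close>. So all vertical arrows
  evaluate a transform at \<open>-1/x\<close>, and the diagram commutes because \<open>R(\<Lambda>(\<mu>)) = LC(\<mu>)\<close> and
  \<open>LC(\<X>(\<mu>)) = \<eta> = 1 - 1 / M\<close>.\<close>


section \<open>Complete Bernstein functions on the negative half-line\<close>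

text \<open>Every operation is given by a unique-existence description, so each needs an existence
  and a uniqueness proof. Existence means placing the transform in the class and reading off the
  measure (\<open>cbf_prob\<close>). Where no formula is available the transform is a limit;
  compactness (\<open>cbf_compact\<close>) and the monotonicity of h(t) and of h(t) / t control it.
  Uniqueness rests on the Laplace transform L: M is the average of L(t x) over the exponential law,
  LC is the same average of C = ln L, and this averaging is injective on continuous functions of
  linear growth (\<open>expm_fun_unique\<close>). The n-th roots in the multiplicative powers
  require fractional powers of - t in the class; they come from iterated arithmetic and harmonic
  means. The product of \<mu> with the inverse Marchenko-Pastur law is built directly when no atoms
  at 0 interfere, and in general by adding t / k to its R-transform and letting k grow.
  \<open>delta0\<close> has no S-transform and is treated apart. Distribution functions are compared
  on x > 0 only; right continuity then settles the atom at 0.\<close>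

text \<open>Up to sign, an element of \<open>cbf\<close> is a complete Bernstein function of \<open>- t\<close>, with an integral
  representation over \<open>v = u / (1 + u) \<in> [0, 1]\<close> that makes the class compact: \<open>v = 0\<close> is the drift and
  \<open>v = 1\<close> a constant (killing) term. Clipping makes \<open>cbf_kernel\<close> harmless for measures on the whole line.\<close>

definition unit_clip :: "real \<Rightarrow> real" where
  "unit_clip v = max 0 (min 1 v)"

definition cbf_kernel :: "real \<Rightarrow> real \<Rightarrow> real" where
  "cbf_kernel t v = t / (1 - (1 + t) * v)"

definition cbf :: "(real \<Rightarrow> real) set" where
  "cbf = {h. \<exists>\<sigma>. finite_measure \<sigma> \<and> sets \<sigma> = sets borel \<and> (\<forall>t<0. h t = (LINT v|\<sigma>. cbf_kernel t (unit_clip v)))}"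

lemma unit_clip_in [simp]: "0 \<le> unit_clip v" "unit_clip v \<le> 1"
  by (auto simp: unit_clip_def)

lemma unit_clip_id [simp]: "0 \<le> v \<Longrightarrow> v \<le> 1 \<Longrightarrow> unit_clip v = v"
  by (auto simp: unit_clip_def)

lemma continuous_unit_clip [continuous_intros]: "continuous_on S unit_clip"
  unfolding unit_clip_def by (intro continuous_intros)

lemma unit_clip_measurable [measurable]: "unit_clip \<in> borel_measurable borel"
  unfolding unit_clip_def by measurable

lemma cbf_kernel_measurable [measurable]: "cbf_kernel t \<in> borel_measurable borel"
  unfolding cbf_kernel_def by measurable

lemma cbf_kernel_m1 [simp]: "cbf_kernel (-1) v = -1"
  by (simp add: cbf_kernel_def)

text \<open>The denominator is affine in v, with end values 1 at v = 0 and - t at v = 1. The bound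
  is uniform in v, which makes the kernel bounded on [0, 1] for each t < 0.\<close>

lemma cbf_kernel_denom_ge:
  fixes t v :: real
  assumes "t < 0" "0 \<le> v" "v \<le> 1"
  shows "1 - (1 + t) * v \<ge> min 1 (- t)"
proof (cases "-t \<le> 1")
  case True
  then have "(1 + t) * v \<le> (1 + t) * 1" using assms by (intro mult_left_mono) auto
  then show ?thesis using True by auto
next
  case False
  then have "(1 + t) * v \<le> 0" using assms by (intro mult_nonpos_nonneg) auto
  then show ?thesis using False by auto
qed

lemma cbf_kernel_denom_pos:
  fixes t v :: real
  assumes "t < 0" "0 \<le> v" "v \<le> 1"
  shows "1 - (1 + t) * v > 0"
  using cbf_kernel_denom_ge[OF assms] assms by (auto simp: min_def split: if_splits)

lemma cbf_kernel_neg: "t < 0 \<Longrightarrow> 0 \<le> v \<Longrightarrow> v \<le> 1 \<Longrightarrow> cbf_kernel t v < 0"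
  using cbf_kernel_denom_pos by (simp add: cbf_kernel_def divide_neg_pos)

lemma cbf_kernel_bound:
  assumes "t < 0" "0 \<le> v" "v \<le> 1"
  shows "\<bar>cbf_kernel t v\<bar> \<le> max 1 (- t)"
proof -
  have d: "1 - (1 + t) * v \<ge> min 1 (- t)" "1 - (1 + t) * v > 0"
    using cbf_kernel_denom_ge[OF assms] cbf_kernel_denom_pos[OF assms] by auto
  have "- t \<le> max 1 (-t) * min 1 (-t)" using assms by (auto simp: max_def min_def)
  also have "\<dots> \<le> max 1 (-t) * (1 - (1 + t) * v)" using d by (intro mult_left_mono) auto
  finally have "- t / (1 - (1 + t) * v) \<le> max 1 (- t)" using d by (simp only: divide_le_eq) simp
  then show ?thesis using d assms by (simp add: cbf_kernel_def abs_divide)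
qed

lemma continuous_on_cbf_kernel [continuous_intros]: "t < 0 \<Longrightarrow> continuous_on {0..1} (cbf_kernel t)"
  unfolding cbf_kernel_def using cbf_kernel_denom_pos by (intro continuous_intros) (force)+

section \<open>Integrals of continuous functions over [0, 1] and their Riemann sums\<close>

lemma integrable_continuous_clip:
  fixes \<phi> :: "real \<Rightarrow> real"
  assumes "finite_measure \<sigma>" and S: "sets \<sigma> = sets borel" and \<phi>: "continuous_on {0..1} \<phi>"
  shows "integrable \<sigma> (\<lambda>v. \<phi> (unit_clip v))" "(\<lambda>v. \<phi> (unit_clip v)) \<in> borel_measurable \<sigma>"
    "\<exists>B. \<forall>v. \<bar>\<phi> (unit_clip v)\<bar> \<le> B"
proof -
  interpret finite_measure \<sigma> by fact
  have "continuous_on UNIV (\<lambda>v. \<phi> (unit_clip v))"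
    by (rule continuous_on_compose2[OF \<phi> continuous_unit_clip]) auto
  then have "(\<lambda>v. \<phi> (unit_clip v)) \<in> borel_measurable borel"
    by (rule borel_measurable_continuous_onI)
  then show m: "(\<lambda>v. \<phi> (unit_clip v)) \<in> borel_measurable \<sigma>"
    using S by (simp cong: measurable_cong_sets)
  have "compact (\<phi> ` {0..1})" using \<phi> by (intro compact_continuous_image) auto
  then obtain B where B: "\<And>v. v \<in> {0..1} \<Longrightarrow> \<bar>\<phi> v\<bar> \<le> B"
    by (metis compact_imp_bounded bounded_real imageI)
  then show "\<exists>B. \<forall>v. \<bar>\<phi> (unit_clip v)\<bar> \<le> B" by (intro exI[of _ B]) auto
  show "integrable \<sigma> (\<lambda>v. \<phi> (unit_clip v))"
    by (rule integrable_const_bound[where B=B]) (use B m in auto)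
qed

lemma integrable_cbf_kernel:
  assumes "finite_measure \<sigma>" "sets \<sigma> = sets borel" "t < 0"
  shows "integrable \<sigma> (\<lambda>v. cbf_kernel t (unit_clip v))"
  using integrable_continuous_clip(1)[OF assms(1,2) continuous_on_cbf_kernel[OF assms(3)]] .

text \<open>Riemann sums for \<sigma> over cells of width 1 / n. The weights do not depend on
  \<phi>, so one choice serves all t at once. The nodes (i + 1) / (n + 2) stay strictly inside (0,
  1), which keeps drift and killing out of the approximants.\<close>

lemma discretise:
  assumes "finite_measure \<sigma>" and S[measurable_cong]: "sets \<sigma> = sets borel"
  obtains w :: "nat \<Rightarrow> nat \<Rightarrow> real" where "\<And>n i. 0 \<le> w n i"
    "\<And>\<phi>. continuous_on {0..1} \<phi> \<Longrightarrow>
      (\<lambda>n. \<Sum>i\<le>n. w n i * \<phi> ((real i + 1) / (real n + 2))) \<longlonglongrightarrow> (LINT v|\<sigma>. \<phi> (unit_clip v))"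
proof -
  interpret finite_measure \<sigma> by fact
  define A where "A n i = {v \<in> space \<sigma>. nat \<lfloor>real n * unit_clip v\<rfloor> = i}" for n i
  have [measurable]: "A n i \<in> sets \<sigma>" for n i unfolding A_def by measurable
  define w where "w n i = measure \<sigma> (A n i)" for n i
  \<comment> \<open>The node of the cell that contains v. It converges to v at every point, so
    dominated convergence suffices.\<close>
  define q where "q n v = (real (nat \<lfloor>real n * unit_clip v\<rfloor>) + 1) / (real n + 2)" for n v
  have floor_eq: "real (nat \<lfloor>real n * unit_clip v\<rfloor>) = of_int \<lfloor>real n * unit_clip v\<rfloor>" for n v
    by (simp add: floor_le_iff)
  have q_in: "q n v \<in> {0..1}" for n v
  proof -
    have "of_int \<lfloor>real n * unit_clip v\<rfloor> \<le> real n * unit_clip v" by simp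
    also have "\<dots> \<le> real n" by (simp add: mult_left_le)
    finally have "q n v \<le> (real n + 1) / (real n + 2)"
      unfolding q_def floor_eq by (intro divide_right_mono) auto
    also have "\<dots> \<le> 1" by simp
    finally show ?thesis unfolding q_def by simp
  qed
  have q_lim: "(\<lambda>n. q n v) \<longlonglongrightarrow> unit_clip v" for v
  proof (rule tendsto_sandwich)
    define c where "c = unit_clip v"
    show "\<forall>\<^sub>F n in sequentially. real n * c / (real n + 2) \<le> q n v"
      unfolding q_def floor_eq c_def by (intro always_eventually allI divide_right_mono) linarith+
    show "\<forall>\<^sub>F n in sequentially. q n v \<le> (real n * c + 1) / (real n + 2)"
      unfolding q_def floor_eq c_def by (intro always_eventually allI divide_right_mono) linarith+
    have l: "(\<lambda>n. real n / (real n + 2)) \<longlonglongrightarrow> 1" "(\<lambda>n. 1 / (real n + 2)) \<longlonglongrightarrow> 0"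
      by real_asymp+
    from tendsto_mult[OF l(1) tendsto_const[of c]]
    show l1: "(\<lambda>n. real n * c / (real n + 2)) \<longlonglongrightarrow> unit_clip v" by (simp add: c_def)
    from tendsto_add[OF l1 l(2)]
    show "(\<lambda>n. (real n * c + 1) / (real n + 2)) \<longlonglongrightarrow> unit_clip v" by (simp add: add_divide_distrib)
  qed
  show ?thesis
  proof
    show "0 \<le> w n i" for n i by (simp add: w_def)
    fix \<phi> :: "real \<Rightarrow> real" assume \<phi>: "continuous_on {0..1} \<phi>"
    obtain B where B: "\<And>v. \<bar>\<phi> (unit_clip v)\<bar> \<le> B"
      using integrable_continuous_clip(3)[OF assms \<phi>] by auto
    have eq: "\<phi> (q n v) = (\<Sum>i\<le>n. \<phi> ((real i + 1) / (real n + 2)) * indicator (A n i) v)"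
      if v: "v \<in> space \<sigma>" for n v
    proof -
      have "real n * unit_clip v \<le> real n" by (simp add: mult_left_le)
      then have le: "nat \<lfloor>real n * unit_clip v\<rfloor> \<le> n" by linarith
      have "(\<Sum>i\<le>n. \<phi> ((real i + 1) / (real n + 2)) * indicator (A n i) v)
         = (\<Sum>i\<le>n. if i = nat \<lfloor>real n * unit_clip v\<rfloor> then \<phi> ((real i + 1) / (real n + 2)) else 0)"
        by (intro sum.cong) (auto simp: A_def v)
      also have "\<dots> = \<phi> (q n v)" using le by (simp add: q_def)
      finally show ?thesis by simp
    qed
    have int: "(LINT v|\<sigma>. \<phi> (q n v)) = (\<Sum>i\<le>n. w n i * \<phi> ((real i + 1) / (real n + 2)))" for n
    proof -
      have "(LINT v|\<sigma>. \<phi> (q n v)) = (LINT v|\<sigma>. (\<Sum>i\<le>n. \<phi> ((real i + 1) / (real n + 2)) * indicator (A n i) v))"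
        by (intro Bochner_Integration.integral_cong eq refl)
      also have "\<dots> = (\<Sum>i\<le>n. (LINT v|\<sigma>. \<phi> ((real i + 1) / (real n + 2)) * indicator (A n i) v))"
        by (rule Bochner_Integration.integral_sum)
           (auto intro!: integrable_mult_right integrable_real_indicator simp: less_top[symmetric])
      finally show ?thesis by (simp add: w_def mult.commute)
    qed
    have "(\<lambda>n. LINT v|\<sigma>. \<phi> (q n v)) \<longlonglongrightarrow> (LINT v|\<sigma>. \<phi> (unit_clip v))"
    proof (rule integral_dominated_convergence[where w="\<lambda>_. B"])
      show "(\<lambda>v. \<phi> (unit_clip v)) \<in> borel_measurable \<sigma>" by (rule integrable_continuous_clip[OF assms \<phi>])
      show "(\<lambda>v. \<phi> (q n v)) \<in> borel_measurable \<sigma>" for n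
        by (subst measurable_cong[OF eq]) measurable
      show "AE v in \<sigma>. (\<lambda>n. \<phi> (q n v)) \<longlonglongrightarrow> \<phi> (unit_clip v)"
        by (intro AE_I2 continuous_on_tendsto_compose[OF \<phi> q_lim] always_eventually allI q_in) simp
      show "AE v in \<sigma>. norm (\<phi> (q n v)) \<le> B" for n
        using q_in[of n] B by (intro AE_I2) (metis unit_clip_id atLeastAtMost_iff real_norm_def)
    qed simp
    then show "(\<lambda>n. \<Sum>i\<le>n. w n i * \<phi> ((real i + 1) / (real n + 2))) \<longlonglongrightarrow> (LINT v|\<sigma>. \<phi> (unit_clip v))"
      by (simp add: int)
  qed
qed

section \<open>Elementary members and normalised representing measures\<close>

lemma cbf_cong:
  assumes "h \<in> cbf" "\<And>t. t < 0 \<Longrightarrow> h' t = h t"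
  shows "h' \<in> cbf"
  using assms unfolding cbf_def by auto

lemma cbf_finite_sum:
  assumes "finite I" and c: "\<And>i. i \<in> I \<Longrightarrow> 0 \<le> c i" and v: "\<And>i. i \<in> I \<Longrightarrow> 0 \<le> v i \<and> v i \<le> 1"
  shows "(\<lambda>t. \<Sum>i\<in>I. c i * cbf_kernel t (v i)) \<in> cbf"
proof -
  let ?M = "point_measure I (\<lambda>i. ennreal (c i))"
  interpret M: finite_measure ?M
    using assms by (intro finite_measureI) (auto simp: space_point_measure emeasure_point_measure_finite sum_ennreal)
  have v_meas [measurable]: "v \<in> borel_measurable ?M" by (simp add: space_point_measure)
  let ?\<sigma> = "distr ?M borel v"
  have fin: "finite_measure ?\<sigma>" by (rule M.finite_measure_distr) measurable
  have "(LINT x|?\<sigma>. cbf_kernel t (unit_clip x)) = (\<Sum>i\<in>I. c i * cbf_kernel t (v i))" for t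
  proof -
    have "(LINT x|?\<sigma>. cbf_kernel t (unit_clip x)) = (LINT i|?M. cbf_kernel t (unit_clip (v i)))"
      by (rule integral_distr) measurable
    also have "\<dots> = (\<Sum>i\<in>I. c i *\<^sub>R cbf_kernel t (unit_clip (v i)))"
      using assms by (intro lebesgue_integral_point_measure_finite) auto
    also have "\<dots> = (\<Sum>i\<in>I. c i * cbf_kernel t (v i))" using v by (intro sum.cong) auto
    finally show ?thesis .
  qed
  then show ?thesis unfolding cbf_def using fin by (intro CollectI exI[of _ ?\<sigma>]) auto
qed

lemma cbf_cbf_kernel: "0 \<le> c \<Longrightarrow> 0 \<le> v \<Longrightarrow> v \<le> 1 \<Longrightarrow> (\<lambda>t. c * cbf_kernel t v) \<in> cbf"
  using cbf_finite_sum[of "{()}" "\<lambda>_. c" "\<lambda>_. v"] by simp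

text \<open>The kernel is -1 at t = -1 for every v, so - h(-1) is the total mass of the representing
  measure. Dividing by it gives a probability measure, to which selection theorems for distributions
  apply.\<close>

lemma cbf_prob_repr:
  assumes "h \<in> cbf"
  obtains P where "real_distribution P" "\<And>t. t < 0 \<Longrightarrow> h t = - h (-1) * (LINT v|P. cbf_kernel t (unit_clip v))" "h (-1) \<le> 0"
proof -
  obtain \<sigma> where \<sigma>: "finite_measure \<sigma>" "sets \<sigma> = sets borel"
    and h: "\<And>t. t < 0 \<Longrightarrow> h t = (LINT v|\<sigma>. cbf_kernel t (unit_clip v))"
    using assms unfolding cbf_def by auto
  interpret finite_measure \<sigma> by fact
  have sp: "space \<sigma> = UNIV" using sets_eq_imp_space_eq[OF \<sigma>(2)] by simp
  define m where "m = measure \<sigma> (space \<sigma>)"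
  have hm: "h (-1) = - m" using h[of "-1"] by (simp add: m_def)
  show ?thesis
  proof (cases "m = 0")
    case True
    then have "emeasure \<sigma> (space \<sigma>) = 0" by (simp add: m_def emeasure_eq_measure)
    then have "AE v in \<sigma>. cbf_kernel t (unit_clip v) = 0" for t by (intro AE_I[where N="space \<sigma>"]) auto
    then have "(LINT v|\<sigma>. cbf_kernel t (unit_clip v)) = 0" for t by (rule integral_eq_zero_AE)
    then have z: "h t = 0" if "t < 0" for t using h that by simp
    have "real_distribution (return borel (0::real))"
      by (simp add: real_distribution_def real_distribution_axioms_def prob_space_return)
    then show ?thesis using z by (intro that[of "return borel 0"]) auto
  next
    case False
    then have m: "m > 0" by (simp add: m_def zero_less_measure_iff)
    define P where "P = density \<sigma> (\<lambda>_. ennreal (1/m))"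
    have "emeasure P (space P) = ennreal (1/m * m)"
      using m by (simp add: P_def emeasure_density emeasure_eq_measure m_def[symmetric] ennreal_mult'[symmetric])
    then have "prob_space P" using m by (intro prob_spaceI) simp
    then have rd: "real_distribution P"
      by (simp add: real_distribution_def real_distribution_axioms_def P_def \<sigma> sp)
    have "h t = - h (-1) * (LINT v|P. cbf_kernel t (unit_clip v))" if t: "t < 0" for t
    proof -
      have "(LINT v|P. cbf_kernel t (unit_clip v)) = (LINT v|\<sigma>. (1/m) *\<^sub>R cbf_kernel t (unit_clip v))"
        unfolding P_def using m \<sigma>(2) by (subst integral_density) (auto cong: measurable_cong_sets)
      then show ?thesis using m h[OF t] by (simp add: hm)
    qed
    then show ?thesis using that[OF rd] hm m by simp
  qed
qed


section \<open>Resolvents of rational functions\<close>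

text \<open>Lagrange interpolation of Q at the points of W reproduces Q because of the degree bound;
  division by the product gives the expansion.\<close>

lemma partial_fractions:
  fixes Q :: "'a::field poly"
  assumes W: "finite W" and deg: "degree Q < card W" and s: "s \<notin> W"
  shows "poly Q s / (\<Prod>w\<in>W. s - w) = (\<Sum>w\<in>W. (poly Q w / (\<Prod>v\<in>W - {w}. w - v)) / (s - w))"
proof -
  define L where "L = (\<Sum>w\<in>W. smult (poly Q w / (\<Prod>v\<in>W - {w}. w - v)) (\<Prod>v\<in>W - {w}. [:- v, 1:]))"
  have "card W > 0" using deg by simp
  have "degree L \<le> card W - 1" unfolding L_def
  proof (intro degree_sum_le W)
    fix w assume "w \<in> W"
    have "degree (\<Prod>v\<in>W - {w}. [:- v, 1:]) \<le> (\<Sum>v\<in>W - {w}. degree [:- v, 1:])"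
      using degree_prod_sum_le[of "W - {w}" "\<lambda>v. [:- v, 1:]"] W by (simp add: o_def)
    also have "\<dots> = card W - 1" using \<open>w \<in> W\<close> W by simp
    finally show "degree (smult (poly Q w / (\<Prod>v\<in>W - {w}. w - v)) (\<Prod>v\<in>W - {w}. [:- v, 1:])) \<le> card W - 1"
      using degree_smult_le order_trans by blast
  qed
  then have degL: "degree L < card W" using \<open>card W > 0\<close> by linarith
  have "poly Q x = poly L x" if "x \<in> W" for x
  proof -
    have "poly L x = (\<Sum>w\<in>W. (poly Q w / (\<Prod>v\<in>W - {w}. w - v)) * (\<Prod>v\<in>W - {w}. x - v))"
      by (simp add: L_def poly_sum poly_prod)
    also have "\<dots> = (\<Sum>w\<in>W. if w = x then poly Q x else 0)"
      using W that by (intro sum.cong) auto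
    finally show ?thesis using W that by simp
  qed
  then have "Q = L" using deg degL by (intro poly_eqI_degree[where A=W])
  then have "poly Q s / (\<Prod>w\<in>W. s - w) = (\<Sum>w\<in>W. (poly Q w / (\<Prod>v\<in>W - {w}. w - v)) * (\<Prod>v\<in>W - {w}. s - v) / (\<Prod>w\<in>W. s - w))"
    by (subst \<open>Q = L\<close>, subst L_def) (simp add: poly_sum poly_prod sum_divide_distrib)
  also have "\<dots> = (\<Sum>w\<in>W. (poly Q w / (\<Prod>v\<in>W - {w}. w - v)) / (s - w))"
  proof (intro sum.cong refl)
    fix w assume "w \<in> W"
    have "(\<Prod>w\<in>W. s - w) = (s - w) * (\<Prod>v\<in>W - {w}. s - v)"
      using W \<open>w \<in> W\<close> by (simp add: prod.remove)
    moreover have "(\<Prod>v\<in>W - {w}. s - v) \<noteq> 0" using W s by auto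
    ultimately show "(poly Q w / (\<Prod>v\<in>W - {w}. w - v)) * (\<Prod>v\<in>W - {w}. s - v) / (\<Prod>w\<in>W. s - w)
       = (poly Q w / (\<Prod>v\<in>W - {w}. w - v)) / (s - w)" by simp
  qed
  finally show ?thesis .
qed

text \<open>At a root only the summand that differentiates the factor of this root survives. This
  expresses the denominators in \<open>partial_fractions\<close> through a derivative.\<close>

lemma poly_pderiv_prod_roots:
  fixes w :: "'a::field"
  assumes "finite W" "w \<in> W"
  shows "poly (pderiv (\<Prod>v\<in>W. [:- v, 1:])) w = (\<Prod>v\<in>W - {w}. w - v)"
proof -
  have "poly (pderiv (\<Prod>v\<in>W. [:- v, 1:])) w = (\<Sum>a\<in>W. (\<Prod>v\<in>W - {a}. w - v))"
    by (simp add: pderiv_prod poly_sum poly_prod pderiv_pCons)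
  also have "\<dots> = (\<Sum>a\<in>W. if a = w then (\<Prod>v\<in>W - {w}. w - v) else 0)"
    using assms by (intro sum.cong) auto
  finally show ?thesis using assms by simp
qed

text \<open>With s = 1 / t the left side is 1 / \<psi>(s) for \<psi>(s) = 1 - \<Sum> c / (s - x).
  The imaginary part of \<psi> has the sign of Im s, so all zeros of \<psi> are real; \<psi> \<ge> 1
  on s \<le> 0, so they are positive; \<psi>' > 0 on the real line off the poles, so they are simple
  and 1 / \<psi> has positive residues there.\<close>

lemma rational_resolvent:
  fixes X :: "real set"
  assumes X: "finite X" and pos: "\<And>x. x \<in> X \<Longrightarrow> x > 0" "\<And>x. x \<in> X \<Longrightarrow> c x > 0"
  obtains Y m where "finite Y" "\<And>y. y \<in> Y \<Longrightarrow> 0 \<le> y \<and> 0 \<le> m y"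
    "\<And>t. t < 0 \<Longrightarrow> 1 / (1 - (\<Sum>x\<in>X. c x * (t / (1 - t * x)))) = (\<Sum>y\<in>Y. m y / (1 - t * y))"
proof (cases "X = {}")
  case True
  then show ?thesis by (intro that[of "{0}" "\<lambda>_. 1"]) auto
next
  case ne: False
  define Q where "Q = (\<Prod>x\<in>X. [:- complex_of_real x, 1:])"
  \<comment> \<open>Q times \<psi> with the denominators cleared; the function to be expanded is Q /
    P.\<close>
  define P where "P = Q - (\<Sum>x\<in>X. smult (complex_of_real (c x)) (\<Prod>v\<in>X - {x}. [:- complex_of_real v, 1:]))"
  define \<psi> where "\<psi> z = 1 - (\<Sum>x\<in>X. complex_of_real (c x) / (z - of_real x))" for z
  define \<rho> where "\<rho> y = (\<Sum>x\<in>X. c x / (y - x)^2)" for y :: real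
  have polyQ: "poly Q z = (\<Prod>x\<in>X. z - of_real x)" for z by (simp add: Q_def poly_prod)
  have Q0: "poly Q z \<noteq> 0" if "z \<notin> of_real ` X" for z using that X by (auto simp: polyQ)
  have PQ: "poly P z = poly Q z * \<psi> z" if z: "z \<notin> of_real ` X" for z
  proof -
    have "poly P z = poly Q z - (\<Sum>x\<in>X. of_real (c x) * (\<Prod>v\<in>X - {x}. z - of_real v))"
      by (simp add: P_def poly_sum poly_prod)
    also have "(\<Sum>x\<in>X. of_real (c x) * (\<Prod>v\<in>X - {x}. z - of_real v)) = (\<Sum>x\<in>X. poly Q z * (of_real (c x) / (z - of_real x)))"
    proof (intro sum.cong refl)
      fix x assume x: "x \<in> X"
      have "poly Q z = (z - of_real x) * (\<Prod>v\<in>X - {x}. z - of_real v)"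
        unfolding polyQ using X x by (simp add: prod.remove)
      moreover have "z - of_real x \<noteq> 0" using z x by auto
      ultimately show "of_real (c x) * (\<Prod>v\<in>X - {x}. z - of_real v) = poly Q z * (of_real (c x) / (z - of_real x))"
        by simp
    qed
    finally show ?thesis by (simp add: \<psi>_def sum_distrib_left right_diff_distrib)
  qed
  \<comment> \<open>At a pole x only the term belonging to x survives, so P and Q have no common
    zero.\<close>
  have Pne: "poly P (of_real x) \<noteq> 0" if x: "x \<in> X" for x
  proof -
    have "poly P (of_real x) = - (\<Sum>y\<in>X. of_real (c y) * (\<Prod>v\<in>X - {y}. of_real x - complex_of_real v))"
      using x X by (simp add: P_def poly_sum poly_prod polyQ)
    also have "(\<Sum>y\<in>X. of_real (c y) * (\<Prod>v\<in>X - {y}. of_real x - complex_of_real v))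
        = (\<Sum>y\<in>X. if y = x then of_real (c x) * (\<Prod>v\<in>X - {x}. of_real x - complex_of_real v) else 0)"
      using x X by (intro sum.cong) auto
    finally show ?thesis using x X pos(2)[OF x] by auto
  qed
  have root: "\<exists>y>0. z = of_real y \<and> y \<notin> X" if "poly P z = 0" for z
  proof -
    have z: "z \<notin> of_real ` X" using Pne that by auto
    then have \<psi>0: "\<psi> z = 0" using PQ that Q0 by auto
    have "Im (of_real (c x) / (z - of_real x)) = - (Im z * (c x / (cmod (z - of_real x))^2))" if "x \<in> X" for x
      by (simp add: Im_divide cmod_power2)
    then have "Im (\<psi> z) = Im z * (\<Sum>x\<in>X. c x / (cmod (z - of_real x))^2)"
      by (simp add: \<psi>_def sum_distrib_left sum_negf)
    moreover have "(\<Sum>x\<in>X. c x / (cmod (z - of_real x))^2) > 0"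
      using ne X pos(2) z by (intro sum_pos divide_pos_pos) (auto simp: image_iff)
    ultimately have "Im z = 0" using \<psi>0 by simp
    then have zr: "z = of_real (Re z)" by (simp add: complex_eq_iff)
    have "Re z > 0"
    proof (rule ccontr)
      assume "\<not> Re z > 0"
      have "\<psi> z = of_real (1 - (\<Sum>x\<in>X. c x / (Re z - x)))"
        by (subst zr) (simp add: \<psi>_def)
      \<comment> \<open>On the nonpositive axis every summand is negative, hence \<psi> \<ge> 1
        there.\<close>
      moreover have "(\<Sum>x\<in>X. c x / (Re z - x)) \<le> 0"
      proof (intro sum_nonpos divide_nonneg_neg)
        fix x assume "x \<in> X"
        then show "0 \<le> c x" "Re z - x < 0" using pos[of x] \<open>\<not> Re z > 0\<close> by auto
      qed
      ultimately show False using \<psi>0 by (simp del: of_real_diff)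
    qed
    then show ?thesis using zr z by (intro exI[of _ "Re z"]) auto
  qed
  \<comment> \<open>At a zero of P the product rule leaves only Q \<psi>', and \<psi>' =
    \<open>\<rho>\<close> is a sum of positive terms.\<close>
  have der: "poly (pderiv P) (of_real y) = poly Q (of_real y) * of_real (\<rho> y)"
    if y: "poly P (of_real y) = 0" for y :: real
  proof -
    have yX: "of_real y \<notin> complex_of_real ` X" using Pne y by auto
    have \<psi>0: "\<psi> (of_real y) = 0" using PQ[OF yX] y Q0[OF yX] by simp
    have "(\<psi> has_field_derivative - (\<Sum>x\<in>X. - (of_real (c x) / (of_real y - of_real x)^2))) (at (of_real y))"
      unfolding \<psi>_def using yX
      by (auto intro!: derivative_eq_intros simp: power2_eq_square sum_negf)
    then have "((\<lambda>z. poly Q z * \<psi> z) has_field_derivative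
        poly (pderiv Q) (of_real y) * \<psi> (of_real y) + (- (\<Sum>x\<in>X. - (of_real (c x) / (of_real y - of_real x)^2))) * poly Q (of_real y)) (at (of_real y))"
      by (intro DERIV_mult poly_DERIV)
    then have "((\<lambda>z. poly Q z * \<psi> z) has_field_derivative poly Q (of_real y) * of_real (\<rho> y)) (at (of_real y))"
      by (simp add: \<psi>0 \<rho>_def sum_negf mult.commute)
    then have "(poly P has_field_derivative poly Q (of_real y) * of_real (\<rho> y)) (at (of_real y))"
    proof (rule has_field_derivative_transform_within_open[where S="- complex_of_real ` X"])
      show "open (- complex_of_real ` X)" using X by (intro open_Compl finite_imp_closed) auto
      show "of_real y \<in> - complex_of_real ` X" using yX by auto
      show "poly Q z * \<psi> z = poly P z" if "z \<in> - complex_of_real ` X" for z using PQ that by auto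
    qed
    then show ?thesis using poly_DERIV DERIV_unique by blast
  qed
  have \<rho>pos: "\<rho> y > 0" if "y \<notin> X" for y
    unfolding \<rho>_def using ne X pos(2) that by (intro sum_pos divide_pos_pos) auto
  have "rsquarefree P"
    unfolding rsquarefree_roots
  proof (intro allI notI)
    fix a assume a: "poly P a = 0 \<and> poly (pderiv P) a = 0"
    then obtain y where y: "a = of_real y" "y \<notin> X" using root by blast
    moreover have "a \<notin> of_real ` X" using y by auto
    ultimately show False using a der[of y] \<rho>pos[of y] Q0[of a] by auto
  qed
  define Z where "Z = {z. poly P z = 0}"
  define lc where "lc = lead_coeff P"
  have P_eq: "P = smult lc (\<Prod>z\<in>Z. [:- z, 1:])"
    using complex_poly_decompose_rsquarefree[OF \<open>rsquarefree P\<close>] by (simp add: Z_def lc_def)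
  have Pn0: "P \<noteq> 0" using \<open>rsquarefree P\<close> by (simp add: rsquarefree_def)
  then have finZ: "finite Z" unfolding Z_def by (rule poly_roots_finite)
  have lc0: "lc \<noteq> 0" using Pn0 by (simp add: lc_def)
  have degQ: "degree Q = card X" unfolding Q_def by (subst degree_prod_eq_sum_degree) auto
  have "degree P = card Z" using lc0 unfolding P_eq by (simp, subst degree_prod_eq_sum_degree) auto
  moreover have "degree P = card X"
  proof -
    define S where "S = (\<Sum>x\<in>X. smult (complex_of_real (c x)) (\<Prod>v\<in>X - {x}. [:- complex_of_real v, 1:]))"
    have "degree S \<le> card X - 1" unfolding S_def
    proof (intro degree_sum_le X)
      fix x assume "x \<in> X"
      then show "degree (smult (complex_of_real (c x)) (\<Prod>v\<in>X - {x}. [:- complex_of_real v, 1:])) \<le> card X - 1"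
        using degree_prod_eq_sum_degree[of "X - {x}" "\<lambda>v. [:- complex_of_real v, 1:]"] X by auto
    qed
    moreover have "card X > 0" using ne X by (simp add: card_gt_0_iff)
    ultimately have "degree S < degree Q" using degQ by linarith
    then show ?thesis unfolding P_def S_def[symmetric] using degQ
      by (metis degree_add_eq_left degree_minus uminus_add_conv_diff add.commute)
  qed
  ultimately have cardZ: "card Z = card X" by simp
  have zero: "0 \<notin> Z" using root by (force simp: Z_def)
  \<comment> \<open>The extra pole at 0 makes the degree of Q smaller than \<open>card W\<close>,
    and multiplication by s turns each partial fraction into s / (s - y) = 1 / (1 - t y).\<close>
  define W where "W = insert 0 Z"
  have finW: "finite W" and cardW: "card W = card X + 1" using finZ zero cardZ by (auto simp: W_def)
  have prodW: "(\<Prod>w\<in>W. [:- w, 1:]) = [:0, 1:] * (\<Prod>z\<in>Z. [:- z, 1:])"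
    unfolding W_def using finZ zero by simp
  have sP: "[:0, 1:] * P = smult lc (\<Prod>w\<in>W. [:- w, 1:])"
    unfolding prodW by (subst P_eq) simp
  have W_real: "\<exists>y\<ge>0. w = of_real y \<and> (\<exists>r\<ge>0. poly Q w / (lc * (\<Prod>v\<in>W - {w}. w - v)) = of_real r)"
    if w: "w \<in> W" for w
  proof -
    have d: "lc * (\<Prod>v\<in>W - {w}. w - v) = poly (pderiv ([:0, 1:] * P)) w"
      unfolding sP pderiv_smult using poly_pderiv_prod_roots[OF finW w] by simp
    also have "\<dots> = poly P w + w * poly (pderiv P) w"
      by (simp add: pderiv_mult pderiv_pCons algebra_simps)
    finally have D: "lc * (\<Prod>v\<in>W - {w}. w - v) = poly P w + w * poly (pderiv P) w" .
    \<comment> \<open>The coefficient is 1 / \<psi>(0) at w = 0 and 1 / (y \<rho>(y)) at a zero y of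
      P.\<close>
    show ?thesis
    proof (cases "w = 0")
      case True
      have nX: "(0::complex) \<notin> of_real ` X" using pos(1) by force
      have "\<psi> 0 = of_real (1 + (\<Sum>x\<in>X. c x / x))" by (simp add: \<psi>_def sum_negf)
      moreover have "(\<Sum>x\<in>X. c x / x) \<ge> 0" using pos by (intro sum_nonneg) (simp add: less_imp_le)
      ultimately show ?thesis using D True PQ[OF nX] Q0[OF nX]
        by (intro exI[of _ 0] conjI exI[of _ "1 / (1 + (\<Sum>x\<in>X. c x / x))"]) auto
    next
      case False
      then have "poly P w = 0" using w by (auto simp: W_def Z_def)
      then obtain y where y: "y > 0" "w = of_real y" "y \<notin> X" using root by blast
      have q: "poly Q w \<noteq> 0" using y by (intro Q0) auto
      have "lc * (\<Prod>v\<in>W - {w}. w - v) = poly Q w * of_real (y * \<rho> y)"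
        using D der[of y] \<open>poly P w = 0\<close> y by simp
      then show ?thesis using q y \<rho>pos[OF y(3)]
        by (intro exI[of _ y] conjI exI[of _ "1 / (y * \<rho> y)"]) auto
    qed
  qed
  define m where "m y = Re (poly Q (of_real y) / (lc * (\<Prod>v\<in>W - {of_real y}. of_real y - v)))" for y
  define Y where "Y = Re ` W"
  have WY: "W = of_real ` Y" unfolding Y_def image_image using W_real by force
  show ?thesis
  proof
    show "finite Y" using finW by (simp add: Y_def)
    show "0 \<le> y \<and> 0 \<le> m y" if "y \<in> Y" for y
    proof -
      have "of_real y \<in> W" using that WY by blast
      from W_real[OF this] show ?thesis by (auto simp: m_def)
    qed
    fix t :: real assume t: "t < 0"
    define s where "s = complex_of_real (1 / t)"
    have sX: "s \<notin> of_real ` X"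
    proof
      assume "s \<in> of_real ` X"
      then obtain x where "x \<in> X" "x = 1 / t" by (auto simp: s_def simp del: of_real_divide)
      then show False using pos(1)[of x] t by (simp add: divide_less_0_iff)
    qed
    have sY: "s \<notin> W"
    proof
      assume "s \<in> W"
      from W_real[OF this] obtain y where "y \<ge> 0" "y = 1 / t" by (auto simp: s_def simp del: of_real_divide)
      then show False using t by (simp add: divide_less_0_iff zero_le_divide_iff)
    qed
    have tx: "t / (1 - t * x) = 1 / (1 / t - x)" for x using t by (simp add: field_simps)
    have "\<psi> s = of_real (1 - (\<Sum>x\<in>X. c x * (t / (1 - t * x))))"
      by (simp add: \<psi>_def s_def tx)
    then have "complex_of_real (1 / (1 - (\<Sum>x\<in>X. c x * (t / (1 - t * x))))) = 1 / \<psi> s" by simp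
    also have "\<dots> = poly Q s / poly P s" using PQ[OF sX] Q0[OF sX] by simp
    also have "\<dots> = s * (poly Q s / poly ([:0, 1:] * P) s)" using t by (simp add: s_def)
    also have "poly ([:0, 1:] * P) s = lc * (\<Prod>w\<in>W. s - w)" unfolding sP by (simp add: poly_prod)
    also have "poly Q s / (lc * (\<Prod>w\<in>W. s - w)) = (poly Q s / (\<Prod>w\<in>W. s - w)) / lc" by simp
    also have "poly Q s / (\<Prod>w\<in>W. s - w) = (\<Sum>w\<in>W. (poly Q w / (\<Prod>v\<in>W - {w}. w - v)) / (s - w))"
      using finW degQ cardW sY by (intro partial_fractions) auto
    also have "s * ((\<Sum>w\<in>W. (poly Q w / (\<Prod>v\<in>W - {w}. w - v)) / (s - w)) / lc)
       = (\<Sum>w\<in>W. (poly Q w / (lc * (\<Prod>v\<in>W - {w}. w - v))) * (s / (s - w)))"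
      by (simp add: sum_distrib_left sum_divide_distrib mult_ac)
    also have "\<dots> = (\<Sum>y\<in>Y. (poly Q (of_real y) / (lc * (\<Prod>v\<in>W - {of_real y}. of_real y - v))) * (s / (s - of_real y)))"
      by (subst (1) WY, subst sum.reindex) (auto simp: inj_on_def)
    also have "\<dots> = (\<Sum>y\<in>Y. of_real (m y / (1 - t * y)))"
    proof (intro sum.cong refl)
      fix y assume "y \<in> Y"
      then have "of_real y \<in> W" using WY by blast
      from W_real[OF this] obtain r where r: "y \<ge> 0" "poly Q (of_real y) / (lc * (\<Prod>v\<in>W - {of_real y}. of_real y - v)) = of_real r"
        by auto
      have "t * y \<le> 0" using t r by (simp add: mult_nonpos_nonneg)
      then have "1 / t / (1 / t - y) = 1 / (1 - t * y)" using t by (simp add: field_simps)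
      then have "s / (s - of_real y) = of_real (1 / (1 - t * y))"
        unfolding s_def by (metis of_real_diff of_real_divide)
      then show "poly Q (of_real y) / (lc * (\<Prod>v\<in>W - {of_real y}. of_real y - v)) * (s / (s - of_real y)) = of_real (m y / (1 - t * y))"
        using r by (simp add: m_def)
    qed
    finally show "1 / (1 - (\<Sum>x\<in>X. c x * (t / (1 - t * x)))) = (\<Sum>y\<in>Y. m y / (1 - t * y))"
      by (simp only: of_real_sum[symmetric] of_real_eq_iff)
  qed
qed


section \<open>Closure properties\<close>

lemma cbf_scaled_prob:
  assumes "real_distribution M" "m \<ge> 0"
  shows "(\<lambda>t. m * (LINT v|M. cbf_kernel t (unit_clip v))) \<in> cbf"
proof -
  interpret real_distribution M by fact
  define \<sigma> where "\<sigma> = density M (\<lambda>_. ennreal m)"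
  have "emeasure \<sigma> (space \<sigma>) = ennreal m"
    by (simp add: \<sigma>_def emeasure_density nn_integral_cmult emeasure_space_1[simplified])
  then have "finite_measure \<sigma>" by (intro finite_measureI) simp
  moreover have "m * (LINT v|M. cbf_kernel t (unit_clip v)) = (LINT v|\<sigma>. cbf_kernel t (unit_clip v))" for t
    unfolding \<sigma>_def using assms(2) by (subst integral_density) auto
  ultimately show ?thesis unfolding cbf_def
    by (intro CollectI exI[of _ \<sigma>]) (auto simp: \<sigma>_def)
qed

text \<open>The values at -1 bound the masses, and the normalised measures live on the compact
  interval [0, 1], so none of their mass escapes. For fixed t < 0 the clipped kernel is bounded and
  continuous in v, hence weak convergence of the measures gives convergence of the
  functions.\<close>

lemma cbf_compact:
  assumes h: "\<And>n. h n \<in> cbf" and B: "\<And>n. - h n (-1) \<le> B"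
  obtains r h' where "strict_mono (r :: nat \<Rightarrow> nat)" "h' \<in> cbf" "\<And>t. t < 0 \<Longrightarrow> (\<lambda>n. h (r n) t) \<longlonglongrightarrow> h' t"
proof -
  have "\<exists>P. real_distribution P \<and> (\<forall>t<0. h n t = - h n (-1) * (LINT v|P. cbf_kernel t (unit_clip v))) \<and> h n (-1) \<le> 0" for n
    using cbf_prob_repr[OF h[of n]] by metis
  then obtain P where P: "\<And>n. real_distribution (P n)"
    "\<And>n t. t < 0 \<Longrightarrow> h n t = - h n (-1) * (LINT v|P n. cbf_kernel t (unit_clip v))" "\<And>n. h n (-1) \<le> 0"
    by metis
  define Q where "Q n = distr (P n) borel unit_clip" for n
  have Q: "real_distribution (Q n)" for n
  proof -
    interpret real_distribution "P n" by (rule P)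
    show ?thesis unfolding Q_def by (rule real_distribution_distr) simp
  qed
  have "compact {0..B}" by simp
  moreover have "\<forall>n. - h n (-1) \<in> {0..B}" using P(3) B by auto
  ultimately obtain m s where m: "m \<in> {0..B}" and s: "strict_mono (s :: nat \<Rightarrow> nat)" "((\<lambda>n. - h n (-1)) \<circ> s) \<longlonglongrightarrow> m"
    using compact_imp_seq_compact seq_compactE by metis
  have "tight Q" unfolding tight_def
  proof (intro conjI allI impI Q)
    fix \<epsilon> :: real assume "\<epsilon> > 0"
    \<comment> \<open>The left end -1 is chosen because the interval is half open and v = 0 may
      carry mass.\<close>
    have "measure (Q n) {-1<..1} = 1" for n
    proof -
      interpret real_distribution "P n" by (rule P)
      have "measure (Q n) {-1<..1} = measure (P n) (unit_clip -` {-1<..1} \<inter> space (P n))"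
        unfolding Q_def by (rule measure_distr) auto
      also have "unit_clip -` {-1<..1} = UNIV" by (auto simp: vimage_def intro: less_le_trans[of _ 0])
      finally show ?thesis using prob_space by simp
    qed
    then show "\<exists>a b. a < b \<and> (\<forall>n. 1 - \<epsilon> < measure (Q n) {a<..b})"
      using \<open>\<epsilon> > 0\<close> by (intro exI[of _ "-1"] exI[of _ 1]) auto
  qed
  then obtain r M where r: "strict_mono (r :: nat \<Rightarrow> nat)" and M: "real_distribution M" "weak_conv_m (Q \<circ> s \<circ> r) M"
    using tight_imp_convergent_subsubsequence s(1) by blast
  show ?thesis
  proof
    show "strict_mono (s \<circ> r)" using s(1) r by (rule strict_mono_o)
    show "(\<lambda>t. m * (LINT v|M. cbf_kernel t (unit_clip v))) \<in> cbf" using M(1) m by (intro cbf_scaled_prob) auto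
    fix t :: real assume t: "t < 0"
    have "continuous_on UNIV (\<lambda>v. cbf_kernel t (unit_clip v))"
      by (rule continuous_on_compose2[OF continuous_on_cbf_kernel[OF t] continuous_unit_clip]) auto
    then have ic: "isCont (\<lambda>v. cbf_kernel t (unit_clip v)) x" for x
      by (simp add: continuous_on_eq_continuous_at)
    have "(\<lambda>n. LINT v|(Q \<circ> s \<circ> r) n. cbf_kernel t (unit_clip v)) \<longlonglongrightarrow> (LINT v|M. cbf_kernel t (unit_clip v))"
      by (rule weak_conv_imp_integral_bdd_continuous_conv[where \<mu>="Q \<circ> s \<circ> r" and B="max 1 (-t)"]) (use Q M ic t in \<open>auto intro!: cbf_kernel_bound\<close>)
    moreover have "(LINT v|Q n. cbf_kernel t (unit_clip v)) = (LINT v|P n. cbf_kernel t (unit_clip v))" for n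
    proof -
      interpret real_distribution "P n" by (rule P)
      show ?thesis unfolding Q_def by (subst integral_distr) auto
    qed
    ultimately have 1: "(\<lambda>n. LINT v|P (s (r n)). cbf_kernel t (unit_clip v)) \<longlonglongrightarrow> (LINT v|M. cbf_kernel t (unit_clip v))" by simp
    have 2: "(\<lambda>n. - h (s (r n)) (-1)) \<longlonglongrightarrow> m" using LIMSEQ_subseq_LIMSEQ[OF s(2) r] by (simp add: o_def)
    show "(\<lambda>n. h ((s \<circ> r) n) t) \<longlonglongrightarrow> m * (LINT v|M. cbf_kernel t (unit_clip v))"
      using tendsto_mult[OF 2 1] P(2)[OF t] by simp
  qed
qed

text \<open>Convergence at the single point -1 already bounds the masses; a subsequence then has a
  limit in the class, which agrees with h'.\<close>

lemma cbf_limit: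
  assumes h: "\<And>n. h n \<in> cbf" and lim: "\<And>t. t < 0 \<Longrightarrow> (\<lambda>n. h n t) \<longlonglongrightarrow> h' t"
  shows "h' \<in> cbf"
proof -
  have "Bseq (\<lambda>n. h n (-1))" using lim[of "-1"] by (intro convergent_imp_Bseq convergentI) auto
  then obtain B where "\<And>n. \<bar>h n (-1)\<bar> \<le> B" unfolding Bseq_def by auto
  then have "- h n (-1) \<le> B" for n by (rule abs_le_D2)
  from cbf_compact[of h B, OF h this] obtain r g where r: "strict_mono (r :: nat \<Rightarrow> nat)" "g \<in> cbf"
    "\<And>t. t < 0 \<Longrightarrow> (\<lambda>n. h (r n) t) \<longlonglongrightarrow> g t" by blast
  have "h' t = g t" if "t < 0" for t
    using LIMSEQ_unique[OF r(3)[OF that]] LIMSEQ_subseq_LIMSEQ[OF lim[OF that] r(1)] by (simp add: o_def)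
  then show ?thesis using cbf_cong[OF r(2)] by simp
qed

lemma grid_in: "i \<le> n \<Longrightarrow> 0 < (real i + 1) / (real n + 2) \<and> (real i + 1) / (real n + 2) < 1"
  by (simp add: divide_less_eq)

lemma cbf_approx:
  assumes "h \<in> cbf"
  obtains w :: "nat \<Rightarrow> nat \<Rightarrow> real" where "\<And>n i. 0 \<le> w n i"
    "\<And>t. t < 0 \<Longrightarrow> (\<lambda>n. \<Sum>i\<le>n. w n i * cbf_kernel t ((real i + 1) / (real n + 2))) \<longlonglongrightarrow> h t"
proof -
  obtain \<sigma> where \<sigma>: "finite_measure \<sigma>" "sets \<sigma> = sets borel"
    and h: "\<And>t. t < 0 \<Longrightarrow> h t = (LINT v|\<sigma>. cbf_kernel t (unit_clip v))"
    using assms unfolding cbf_def by auto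
  obtain w :: "nat \<Rightarrow> nat \<Rightarrow> real" where w: "\<And>n i. 0 \<le> w n i"
    "\<And>\<phi>. continuous_on {0..1} \<phi> \<Longrightarrow>
      (\<lambda>n. \<Sum>i\<le>n. w n i * \<phi> ((real i + 1) / (real n + 2))) \<longlonglongrightarrow> (LINT v|\<sigma>. \<phi> (unit_clip v))"
    using discretise[OF \<sigma>] by blast
  show ?thesis using w h by (intro that[of w]) (auto intro: continuous_on_cbf_kernel)
qed

lemma cbf_grid_sum: "(\<And>i. 0 \<le> w i) \<Longrightarrow> (\<lambda>t. \<Sum>i\<le>n. w i * cbf_kernel t ((real i + 1) / (real n + 2))) \<in> cbf"
  using grid_in[of _ n] by (intro cbf_finite_sum) (auto simp: less_imp_le)

text \<open>Approximants of both functions use the same grid, so their weights can be added; no sum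
  of measures is formed.\<close>

lemma cbf_add:
  assumes "f \<in> cbf" "g \<in> cbf"
  shows "(\<lambda>t. f t + g t) \<in> cbf"
proof -
  obtain w :: "nat \<Rightarrow> nat \<Rightarrow> real" where w: "\<And>n i. 0 \<le> w n i"
    "\<And>t. t < 0 \<Longrightarrow> (\<lambda>n. \<Sum>i\<le>n. w n i * cbf_kernel t ((real i + 1) / (real n + 2))) \<longlonglongrightarrow> f t"
    using cbf_approx[OF assms(1)] by blast
  obtain u :: "nat \<Rightarrow> nat \<Rightarrow> real" where u: "\<And>n i. 0 \<le> u n i"
    "\<And>t. t < 0 \<Longrightarrow> (\<lambda>n. \<Sum>i\<le>n. u n i * cbf_kernel t ((real i + 1) / (real n + 2))) \<longlonglongrightarrow> g t"
    using cbf_approx[OF assms(2)] by blast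
  show ?thesis
  proof (rule cbf_limit)
    show "(\<lambda>t. \<Sum>i\<le>n. (w n i + u n i) * cbf_kernel t ((real i + 1) / (real n + 2))) \<in> cbf" for n
      using w u by (intro cbf_grid_sum) auto
    show "(\<lambda>n. \<Sum>i\<le>n. (w n i + u n i) * cbf_kernel t ((real i + 1) / (real n + 2))) \<longlonglongrightarrow> f t + g t" if "t < 0" for t
      using tendsto_add[OF w(2)[OF that] u(2)[OF that]] by (simp add: sum.distrib distrib_right)
  qed
qed

lemma cbf_cmul:
  assumes "f \<in> cbf" "c \<ge> 0"
  shows "(\<lambda>t. c * f t) \<in> cbf"
proof -
  obtain P where P: "real_distribution P" "\<And>t. t < 0 \<Longrightarrow> f t = - f (-1) * (LINT v|P. cbf_kernel t (unit_clip v))" "f (-1) \<le> 0"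
    using cbf_prob_repr[OF assms(1)] by blast
  have "(\<lambda>t. (c * - f (-1)) * (LINT v|P. cbf_kernel t (unit_clip v))) \<in> cbf"
    using P(1,3) assms(2) by (intro cbf_scaled_prob mult_nonneg_nonneg) auto
  then show ?thesis
  proof (rule cbf_cong)
    fix t :: real assume "t < 0"
    show "c * f t = (c * - f (-1)) * (LINT v|P. cbf_kernel t (unit_clip v))"
      by (subst P(2)[OF \<open>t < 0\<close>]) (simp only: mult.assoc)
  qed
qed

lemma cbf_zero: "(\<lambda>t. 0) \<in> cbf"
  using cbf_finite_sum[of "{}"] by simp

lemma cbf_sum: "finite I \<Longrightarrow> (\<And>i. i \<in> I \<Longrightarrow> f i \<in> cbf) \<Longrightarrow> (\<lambda>t. \<Sum>i\<in>I. f i t) \<in> cbf"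
  by (induction I rule: finite_induct) (auto intro: cbf_zero cbf_add)

text \<open>A mixture is a limit of finite nonnegative combinations of f at grid points. Continuity
  in the parameter for each fixed t is enough; the representing measures of the f(v) never have to
  be combined.\<close>

lemma cbf_mix:
  assumes \<sigma>: "finite_measure \<sigma>" "sets \<sigma> = sets borel"
    and f: "\<And>v. 0 \<le> v \<Longrightarrow> v \<le> 1 \<Longrightarrow> f v \<in> cbf"
    and cont: "\<And>t. t < 0 \<Longrightarrow> continuous_on {0..1} (\<lambda>v. f v t)"
  shows "(\<lambda>t. LINT v|\<sigma>. f (unit_clip v) t) \<in> cbf"
proof -
  obtain w :: "nat \<Rightarrow> nat \<Rightarrow> real" where w: "\<And>n i. 0 \<le> w n i"
    "\<And>\<phi>. continuous_on {0..1} \<phi> \<Longrightarrow>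
      (\<lambda>n. \<Sum>i\<le>n. w n i * \<phi> ((real i + 1) / (real n + 2))) \<longlonglongrightarrow> (LINT v|\<sigma>. \<phi> (unit_clip v))"
    using discretise[OF \<sigma>] by blast
  show ?thesis
  proof (rule cbf_limit)
    show "(\<lambda>t. \<Sum>i\<le>n. w n i * f ((real i + 1) / (real n + 2)) t) \<in> cbf" for n
      using w(1) grid_in[of _ n] by (intro cbf_sum cbf_cmul f) (auto simp: less_imp_le)
    show "(\<lambda>n. \<Sum>i\<le>n. w n i * f ((real i + 1) / (real n + 2)) t) \<longlonglongrightarrow> (LINT v|\<sigma>. f (unit_clip v) t)" if "t < 0" for t
      using w(2)[OF cont[OF that]] .
  qed
qed

section \<open>Sign, monotonicity and continuity\<close>

lemma cbf_nonpos:
  assumes "h \<in> cbf" "t < 0"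
  shows "h t \<le> 0"
proof -
  obtain \<sigma> where \<sigma>: "finite_measure \<sigma>" "h t = (LINT v|\<sigma>. cbf_kernel t (unit_clip v))"
    using assms unfolding cbf_def by auto
  have "(LINT v|\<sigma>. - cbf_kernel t (unit_clip v)) \<ge> 0"
    using cbf_kernel_neg[OF assms(2)] by (intro integral_nonneg_AE) (auto simp: less_imp_le)
  then show ?thesis using \<sigma> by simp
qed

text \<open>h(-1) is minus the total mass and the kernel is strictly negative. With
  \<open>cbf_eq_0\<close> this is a dichotomy: a member is negative everywhere or zero
  everywhere.\<close>

lemma cbf_neg:
  assumes "h \<in> cbf" "t < 0" "h (-1) < 0"
  shows "h t < 0"
proof -
  obtain P where P: "real_distribution P" "h t = - h (-1) * (LINT v|P. cbf_kernel t (unit_clip v))"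
    using cbf_prob_repr[OF assms(1)] assms(2) by blast
  interpret real_distribution P by fact
  have int: "integrable P (\<lambda>v. - cbf_kernel t (unit_clip v))"
    using integrable_cbf_kernel[of P t] assms(2) by (auto intro: finite_measure_axioms)
  have "AE v in P. 0 < - cbf_kernel t (unit_clip v)" using cbf_kernel_neg[OF assms(2)] by auto
  then have "(LINT v|P. 0) < (LINT v|P. - cbf_kernel t (unit_clip v))"
    using int emeasure_space_1 by (intro integral_less_AE_space) auto
  then show ?thesis using P(2) assms(3) by (simp add: mult_neg_neg)
qed

lemma cbf_eq_0:
  assumes "h \<in> cbf" "t < 0" "\<not> h (-1) < 0"
  shows "h t = 0"
proof -
  obtain P where "h t = - h (-1) * (LINT v|P. cbf_kernel t (unit_clip v))" "h (-1) \<le> 0"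
    using cbf_prob_repr[OF assms(1)] assms(2) by blast
  then show ?thesis using assms(3) by simp
qed

lemma cbf_kernel_mono: "s \<le> t \<Longrightarrow> t < 0 \<Longrightarrow> 0 \<le> v \<Longrightarrow> v \<le> 1 \<Longrightarrow> cbf_kernel s v \<le> cbf_kernel t v"
  using cbf_kernel_denom_pos[of s v] cbf_kernel_denom_pos[of t v]
proof -
  assume a: "s \<le> t" "t < 0" "0 \<le> v" "v \<le> 1"
  have p: "1 - (1 + s) * v > 0" "1 - (1 + t) * v > 0" using cbf_kernel_denom_pos a by auto
  have "s * (1 - (1 + t) * v) - t * (1 - (1 + s) * v) = (s - t) * (1 - v)" by (simp add: algebra_simps)
  also have "\<dots> \<le> 0" using a by (intro mult_nonpos_nonneg) auto
  finally show ?thesis unfolding cbf_kernel_def using p by (simp add: frac_le_eq divide_nonpos_pos)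
qed

lemma cbf_mono:
  assumes "h \<in> cbf" "s \<le> t" "t < 0"
  shows "h s \<le> h t"
proof -
  obtain \<sigma> where \<sigma>: "finite_measure \<sigma>" "sets \<sigma> = sets borel"
    and h: "\<And>t. t < 0 \<Longrightarrow> h t = (LINT v|\<sigma>. cbf_kernel t (unit_clip v))"
    using assms unfolding cbf_def by auto
  show ?thesis using assms h integrable_cbf_kernel[OF \<sigma>] cbf_kernel_mono by (auto intro!: integral_mono)
qed

text \<open>h(t) / t is the integral of 1 / (1 - (1 + t) v), which increases with t. Together with
  \<open>cbf_mono\<close> it bounds the value at one point from both sides by the value at another
  point; these bounds carry all later limit arguments.\<close>

lemma cbf_slope:
  assumes "h \<in> cbf" "s \<le> t" "t < 0"
  shows "h s / s \<le> h t / t"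
proof -
  obtain \<sigma> where \<sigma>: "finite_measure \<sigma>" "sets \<sigma> = sets borel"
    and h: "\<And>t. t < 0 \<Longrightarrow> h t = (LINT v|\<sigma>. cbf_kernel t (unit_clip v))"
    using assms unfolding cbf_def by auto
  have "cbf_kernel s v / s \<le> cbf_kernel t v / t" if "0 \<le> v" "v \<le> 1" for v
  proof -
    have "1 - (1 + t) * v \<le> 1 - (1 + s) * v" using assms that by (simp add: mult_right_mono)
    then show ?thesis using cbf_kernel_denom_pos[of t v] assms that
      by (simp add: cbf_kernel_def frac_le)
  qed
  then have "(LINT v|\<sigma>. cbf_kernel s (unit_clip v) / s) \<le> (LINT v|\<sigma>. cbf_kernel t (unit_clip v) / t)"
    using assms integrable_cbf_kernel[OF \<sigma>] by (intro integral_mono integrable_divide) auto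
  then show ?thesis using h assms by simp
qed

lemma cbf_continuous:
  assumes "h \<in> cbf"
  shows "continuous_on {..<0} h"
  unfolding continuous_on_sequentially
proof (intro allI ballI impI)
  fix x and a :: real assume a: "a \<in> {..<0}" and "(\<forall>n. x n \<in> {..<0}) \<and> x \<longlonglongrightarrow> a"
  then have x: "\<And>n. x n < 0" "x \<longlonglongrightarrow> a" by auto
  obtain \<sigma> where \<sigma>: "finite_measure \<sigma>" "sets \<sigma> = sets borel"
    and h: "\<And>t. t < 0 \<Longrightarrow> h t = (LINT v|\<sigma>. cbf_kernel t (unit_clip v))"
    using assms unfolding cbf_def by auto
  interpret finite_measure \<sigma> by fact
  have "Bseq x" using x(2) by (intro convergent_imp_Bseq convergentI)
  then obtain B where B: "\<And>n. \<bar>x n\<bar> \<le> B" unfolding Bseq_def by auto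
  have "(\<lambda>n. LINT v|\<sigma>. cbf_kernel (x n) (unit_clip v)) \<longlonglongrightarrow> (LINT v|\<sigma>. cbf_kernel a (unit_clip v))"
  proof (rule integral_dominated_convergence[where w="\<lambda>_. max 1 B"])
    show "AE v in \<sigma>. norm (cbf_kernel (x n) (unit_clip v)) \<le> max 1 B" for n
    proof (intro AE_I2)
      fix v
      have "\<bar>cbf_kernel (x n) (unit_clip v)\<bar> \<le> max 1 (- x n)" using x(1) by (intro cbf_kernel_bound) auto
      also have "\<dots> \<le> max 1 B" using B[of n] by auto
      finally show "norm (cbf_kernel (x n) (unit_clip v)) \<le> max 1 B" by simp
    qed
    show "AE v in \<sigma>. (\<lambda>n. cbf_kernel (x n) (unit_clip v)) \<longlonglongrightarrow> cbf_kernel a (unit_clip v)"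
    proof (intro AE_I2)
      fix v
      have "1 - (1 + a) * unit_clip v > 0" using a by (intro cbf_kernel_denom_pos) auto
      then show "(\<lambda>n. cbf_kernel (x n) (unit_clip v)) \<longlonglongrightarrow> cbf_kernel a (unit_clip v)"
        unfolding cbf_kernel_def using x(2) by (intro tendsto_intros) auto
    qed
  qed (use \<sigma>(2) in \<open>auto cong: measurable_cong_sets\<close>)
  then show "(h \<circ> x) \<longlonglongrightarrow> h a" using h x(1) a by (simp add: o_def)
qed

section \<open>Resolvents, duality and composition\<close>

lemma cbf_point: "0 \<le> y \<Longrightarrow> (\<lambda>t. t / (1 - t * y)) \<in> cbf"
proof -
  assume y: "0 \<le> y"
  have "(\<lambda>t. 1 / (1 + y) * cbf_kernel t (y / (1 + y))) \<in> cbf" using y by (intro cbf_cbf_kernel) auto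
  moreover have "1 / (1 + y) * cbf_kernel t (y / (1 + y)) = t / (1 - t * y)" for t
  proof -
    have "1 - (1 + t) * (y / (1 + y)) = (1 - t * y) / (1 + y)" using y by (simp add: field_simps)
    then show ?thesis using y by (simp add: cbf_kernel_def)
  qed
  ultimately show ?thesis by simp
qed

text \<open>The grid nodes are strictly between 0 and 1, so the corresponding u = v / (1 - v) are
  positive and finite, which is the form treated in \<open>rational_resolvent\<close>. The general
  case is a limit.\<close>

lemma cbf_resolvent:
  assumes "g \<in> cbf"
  shows "(\<lambda>t. t / (1 - g t)) \<in> cbf"
proof -
  obtain w :: "nat \<Rightarrow> nat \<Rightarrow> real" where w: "\<And>n i. 0 \<le> w n i"
    "\<And>t. t < 0 \<Longrightarrow> (\<lambda>n. \<Sum>i\<le>n. w n i * cbf_kernel t ((real i + 1) / (real n + 2))) \<longlonglongrightarrow> g t"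
    using cbf_approx[OF assms(1)] by blast
  define G where "G n t = (\<Sum>i\<le>n. w n i * cbf_kernel t ((real i + 1) / (real n + 2)))" for n t
  show ?thesis
  proof (rule cbf_limit)
    show "(\<lambda>n. t / (1 - G n t)) \<longlonglongrightarrow> t / (1 - g t)" if "t < 0" for t
      using w(2)[OF that] cbf_nonpos[OF assms that] unfolding G_def by (intro tendsto_intros) auto
    fix n
    \<comment> \<open>This is v / (1 - v) for the node v = (i + 1) / (n + 2).\<close>
    define x where "x i = (real i + 1) / (real n + 1 - real i)" for i
    \<comment> \<open>Zero weights are discarded since \<open>rational_resolvent\<close> asks for
      strictly positive coefficients.\<close>
    define I where "I = {i. i \<le> n \<and> w n i > 0}"
    have inj: "inj_on x I"
    proof (rule inj_onI)
      fix i j assume "i \<in> I" "j \<in> I" "x i = x j"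
      then have "(real i + 1) * (real n + 1 - real j) = (real j + 1) * (real n + 1 - real i)"
        by (simp add: x_def I_def frac_eq_eq)
      then have "(real n + 2) * (real i - real j) = 0" by (simp add: algebra_simps)
      then show "i = j" by simp
    qed
    \<comment> \<open>The factor (n + 2) / (n + 1 - i) is 1 + x i, from the kernel written as t (1 +
      u) / (1 - t u).\<close>
    define c where "c y = w n (inv_into I x y) * ((real n + 2) / (real n + 1 - real (inv_into I x y)))" for y
    have fin: "finite (x ` I)" by (simp add: I_def)
    have pos: "y > 0 \<and> c y > 0" if "y \<in> x ` I" for y
    proof -
      from that obtain i where i: "i \<in> I" "y = x i" by auto
      then show ?thesis using inv_into_f_f[OF inj i(1)]
        by (auto simp: c_def I_def x_def)
    qed
    obtain Y m where Y: "finite Y" "\<And>y. y \<in> Y \<Longrightarrow> 0 \<le> y \<and> 0 \<le> m y"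
      and eq: "\<And>t. t < 0 \<Longrightarrow> 1 / (1 - (\<Sum>y\<in>x ` I. c y * (t / (1 - t * y)))) = (\<Sum>y\<in>Y. m y / (1 - t * y))"
      using rational_resolvent[OF fin, of c] pos by blast
    have G: "G n t = (\<Sum>y\<in>x ` I. c y * (t / (1 - t * y)))" for t
    proof -
      have "(\<Sum>y\<in>x ` I. c y * (t / (1 - t * y))) = (\<Sum>i\<in>I. c (x i) * (t / (1 - t * x i)))"
        using inj by (simp add: sum.reindex)
      also have "\<dots> = (\<Sum>i\<in>I. w n i * cbf_kernel t ((real i + 1) / (real n + 2)))"
      proof (intro sum.cong refl)
        fix i assume i: "i \<in> I"
        then have p: "real n + 1 - real i > 0" by (auto simp: I_def)
        have 1: "1 - t * x i = (real n + 1 - real i - t * (real i + 1)) / (real n + 1 - real i)"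
          using p by (simp add: x_def field_simps)
        have 2: "1 - (1 + t) * ((real i + 1) / (real n + 2)) = (real n + 1 - real i - t * (real i + 1)) / (real n + 2)"
          by (simp add: field_simps)
        show "c (x i) * (t / (1 - t * x i)) = w n i * cbf_kernel t ((real i + 1) / (real n + 2))"
          unfolding cbf_kernel_def 1 2 c_def inv_into_f_f[OF inj i] using p by simp
      qed
      also have "\<dots> = G n t" unfolding G_def
        using w(1)[of n] by (intro sum.mono_neutral_left) (auto simp: I_def not_less intro: antisym)
      finally show ?thesis by simp
    qed
    have "(\<lambda>t. \<Sum>y\<in>Y. m y * (t / (1 - t * y))) \<in> cbf"
      using Y by (intro cbf_sum cbf_cmul cbf_point) auto
    then show "(\<lambda>t. t / (1 - G n t)) \<in> cbf"
    proof (rule cbf_cong)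
      fix t :: real assume "t < 0"
      have "t / (1 - G n t) = t * (1 / (1 - G n t))" by simp
      also have "\<dots> = (\<Sum>y\<in>Y. m y * (t / (1 - t * y)))"
        unfolding G eq[OF \<open>t < 0\<close>] by (simp add: sum_distrib_left mult_ac)
      finally show "t / (1 - G n t) = (\<Sum>y\<in>Y. m y * (t / (1 - t * y)))" .
    qed
  qed
qed

text \<open>Apply the resolvent to N g and multiply by N: the result t / (1 / N - g) tends to - t /
  g.\<close>

lemma cbf_dual:
  assumes g: "g \<in> cbf" "g (-1) < 0"
  shows "(\<lambda>t. - t / g t) \<in> cbf"
proof (rule cbf_limit)
  show "(\<lambda>t. real (Suc n) * (t / (1 - real (Suc n) * g t))) \<in> cbf" for n
    using g by (intro cbf_cmul cbf_resolvent) auto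
  fix t :: real assume t: "t < 0"
  have neg: "g t < 0" by (rule cbf_neg[OF g(1) t g(2)])
  have eq: "real (Suc n) * (t / (1 - real (Suc n) * g t)) = t / (inverse (real (Suc n)) - g t)" for n
  proof -
    define N where "N = real (Suc n)"
    have "N > 0" by (simp add: N_def)
    then have "1 - N * g t = N * (inverse N - g t)" by (simp add: right_diff_distrib)
    then have "N * (t / (1 - N * g t)) = t / (inverse N - g t)" using \<open>N > 0\<close> by simp
    then show ?thesis by (simp only: N_def)
  qed
  have "(\<lambda>n. t / (inverse (real (Suc n)) - g t)) \<longlonglongrightarrow> t / (0 - g t)"
    using neg by (intro tendsto_intros LIMSEQ_inverse_real_of_nat) auto
  then show "(\<lambda>n. real (Suc n) * (t / (1 - real (Suc n) * g t))) \<longlonglongrightarrow> - t / g t"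
    unfolding eq by simp
qed

lemma cbf_id: "(\<lambda>t. t) \<in> cbf"
  using cbf_point[of 0] by simp

text \<open>Dualise, add c t, dualise again: the dual of - t / g + c t is g / (1 - c g).\<close>

lemma cbf_linfrac:
  assumes g: "g \<in> cbf" "g (-1) < 0" "c \<ge> 0"
  shows "(\<lambda>t. g t / (1 - c * g t)) \<in> cbf"
proof -
  define k where "k t = - t / g t + c * t" for t
  have k: "k \<in> cbf" unfolding k_def using g by (intro cbf_add cbf_dual cbf_cmul cbf_id)
  have kneg: "k t < 0" if "t < 0" for t
  proof -
    have "- t / g t < 0" using cbf_neg[OF g(1) that g(2)] that by (intro divide_pos_neg) auto
    moreover have "c * t \<le> 0" using that g(3) by (intro mult_nonneg_nonpos) auto
    ultimately show ?thesis by (simp add: k_def)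
  qed
  have "(\<lambda>t. - t / k t) \<in> cbf" using k kneg by (intro cbf_dual) auto
  then show ?thesis
  proof (rule cbf_cong)
    fix t :: real assume t: "t < 0"
    have gn: "g t < 0" by (rule cbf_neg[OF g(1) t g(2)])
    have "k t = - t * (1 - c * g t) / g t" using gn by (simp add: k_def field_simps)
    then show "g t / (1 - c * g t) = - t / k t" using t gn by simp
  qed
qed

text \<open>By \<open>cbf_mix\<close> it suffices to insert g into one kernel. For v < 1 this is a
  multiple of the linear fractional transform with c = v / (1 - v); for v = 1 it is the constant
  -1.\<close>

lemma cbf_comp:
  assumes h: "h \<in> cbf" and g: "g \<in> cbf" "g (-1) < 0"
  shows "(\<lambda>t. h (g t)) \<in> cbf"
proof -
  obtain \<sigma> where \<sigma>: "finite_measure \<sigma>" "sets \<sigma> = sets borel"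
    and hr: "\<And>t. t < 0 \<Longrightarrow> h t = (LINT v|\<sigma>. cbf_kernel t (unit_clip v))"
    using h unfolding cbf_def by auto
  have neg: "g t < 0" if "t < 0" for t by (rule cbf_neg[OF g(1) that g(2)])
  have "(\<lambda>t. LINT v|\<sigma>. cbf_kernel (g t) (unit_clip v)) \<in> cbf"
  proof (rule cbf_mix[OF \<sigma>])
    show "continuous_on {0..1} (cbf_kernel (g t))" if "t < 0" for t using neg[OF that] by (rule continuous_on_cbf_kernel)
    fix v :: real assume v: "0 \<le> v" "v \<le> 1"
    show "(\<lambda>t. cbf_kernel (g t) v) \<in> cbf"
    proof (cases "v = 1")
      case True
      show ?thesis by (rule cbf_cong[OF cbf_cbf_kernel[of 1 1]]) (use True neg less_imp_neq in \<open>fastforce simp: cbf_kernel_def\<close>)+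
    next
      case False
      have "(\<lambda>t. 1 / (1 - v) * (g t / (1 - v / (1 - v) * g t))) \<in> cbf"
        using v g by (intro cbf_cmul cbf_linfrac) auto
      moreover have "1 / (1 - v) * (g t / (1 - v / (1 - v) * g t)) = cbf_kernel (g t) v" for t
      proof -
        have "1 - (1 + g t) * v = (1 - v) * (1 - v / (1 - v) * g t)" using False v by (simp add: field_simps)
        then show ?thesis by (simp add: cbf_kernel_def)
      qed
      ultimately show ?thesis by simp
    qed
  qed
  then show ?thesis by (rule cbf_cong) (simp add: hr neg)
qed

text \<open>Dividing the kernel at g by g leaves the resolvents t / (1 - c g), and - t / g for v =
  1. This is the closure property behind the fixed-point iteration in
  \<open>isR_exists\<close>.\<close>

lemma cbf_comp_div:
  assumes h: "h \<in> cbf" and g: "g \<in> cbf" "g (-1) < 0"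
  shows "(\<lambda>t. t * h (g t) / g t) \<in> cbf"
proof -
  obtain \<sigma> where \<sigma>: "finite_measure \<sigma>" "sets \<sigma> = sets borel"
    and hr: "\<And>t. t < 0 \<Longrightarrow> h t = (LINT v|\<sigma>. cbf_kernel t (unit_clip v))"
    using h unfolding cbf_def by auto
  have neg: "g t < 0" if "t < 0" for t by (rule cbf_neg[OF g(1) that g(2)])
  have "(\<lambda>t. LINT v|\<sigma>. t / g t * cbf_kernel (g t) (unit_clip v)) \<in> cbf"
  proof (rule cbf_mix[OF \<sigma>])
    show "continuous_on {0..1} (\<lambda>v. t / g t * cbf_kernel (g t) v)" if "t < 0" for t
      using neg[OF that] by (intro continuous_intros)
    fix v :: real assume v: "0 \<le> v" "v \<le> 1"
    show "(\<lambda>t. t / g t * cbf_kernel (g t) v) \<in> cbf"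
    proof (cases "v = 1")
      case True
      show ?thesis by (rule cbf_cong[OF cbf_dual[OF g]]) (use True neg in \<open>auto simp: cbf_kernel_def\<close>)
    next
      case False
      have "(\<lambda>t. 1 / (1 - v) * (t / (1 - v / (1 - v) * g t))) \<in> cbf"
        using v g by (intro cbf_cmul cbf_resolvent) auto
      then show ?thesis
      proof (rule cbf_cong)
        fix t :: real assume "t < 0"
        have "1 - (1 + g t) * v = (1 - v) * (1 - v / (1 - v) * g t)" using False v by (simp add: field_simps)
        then show "t / g t * cbf_kernel (g t) v = 1 / (1 - v) * (t / (1 - v / (1 - v) * g t))"
          using neg[OF \<open>t < 0\<close>] by (simp add: cbf_kernel_def)
      qed
    qed
  qed
  then show ?thesis by (rule cbf_cong) (simp add: hr neg)
qed


section \<open>The transforms \<open>\<psi>\<close> and \<open>\<eta>\<close>\<close>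

definition M_tr :: "real measure \<Rightarrow> real \<Rightarrow> real" where
  "M_tr \<mu> t = (LINT u|\<mu>. 1 / (1 - t * u))"

definition cbf0 :: "(real \<Rightarrow> real) set" where
  "cbf0 = {h \<in> cbf. (h \<longlongrightarrow> 0) (at_left 0)}"

section \<open>Measures on the half-line and the transform M\<close>

lemma PplusI:
  assumes "real_distribution \<mu>" "AE u in \<mu>. 0 \<le> u"
  shows "\<mu> \<in> Pplus"
proof -
  interpret real_distribution \<mu> by fact
  have "prob {0..} = 1" using assms(2) by (subst prob_eq_1) auto
  then show ?thesis using assms(1) by (simp add: Pplus_def)
qed

lemma Pplus_real_distribution: "\<mu> \<in> Pplus \<Longrightarrow> real_distribution \<mu>"
  by (simp add: Pplus_def)

lemma Pplus_AE: assumes "\<mu> \<in> Pplus" shows "AE u in \<mu>. 0 \<le> u"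
proof -
  interpret real_distribution \<mu> using assms by (simp add: Pplus_def)
  have "prob {0..} = 1" using assms by (simp add: Pplus_def)
  then show ?thesis by (subst (asm) prob_eq_1) auto
qed

lemma Pplus_sets: "\<mu> \<in> Pplus \<Longrightarrow> sets \<mu> = sets borel"
  by (simp add: Pplus_def real_distribution_def real_distribution_axioms_def)

lemma Pplus_space: "\<mu> \<in> Pplus \<Longrightarrow> space \<mu> = UNIV"
  using sets_eq_imp_space_eq[OF Pplus_sets] by simp

lemma Pplus_prob: "\<mu> \<in> Pplus \<Longrightarrow> prob_space \<mu>"
  by (simp add: Pplus_def real_distribution_def)

lemma Pplus_distr:
  assumes "\<mu> \<in> Pplus" and [measurable]: "f \<in> borel_measurable borel" and "\<And>u. 0 \<le> u \<Longrightarrow> 0 \<le> f u"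
  shows "distr \<mu> borel f \<in> Pplus"
proof (rule PplusI)
  interpret real_distribution \<mu> using assms by (simp add: Pplus_def)
  show "real_distribution (distr \<mu> borel f)" by (rule real_distribution_distr) simp
  have "AE u in \<mu>. 0 \<le> f u" using Pplus_AE[OF assms(1)] assms(3) by auto
  then show "AE u in distr \<mu> borel f. 0 \<le> u" by (subst AE_distr_iff) auto
qed

lemma one_minus_ge_1: "t \<le> 0 \<Longrightarrow> 0 \<le> u \<Longrightarrow> 1 \<le> 1 - t * (u::real)"
  by (simp add: mult_nonpos_nonneg)

lemma inverse_one_minus_le_1: "t \<le> 0 \<Longrightarrow> 0 \<le> u \<Longrightarrow> \<bar>1 / (1 - t * (u::real))\<bar> \<le> 1"
  using one_minus_ge_1[of t u] by simp

lemma cbf_kernel_minus_inverse: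
  assumes "N > 0"
  shows "cbf_kernel (- 1 / N) v = (- 1 / N) * (1 / (1 - v + v / N))"
proof -
  have "1 - (1 + - 1 / N) * v = 1 - v + v / N" using assms by (simp add: field_simps)
  then show ?thesis unfolding cbf_kernel_def by (simp only: times_divide_eq_right mult_1_right)
qed

lemma integrable_M:
  assumes "\<mu> \<in> Pplus" "t \<le> 0"
  shows "integrable \<mu> (\<lambda>u. 1 / (1 - t * u))"
proof -
  interpret real_distribution \<mu> using assms by (simp add: Pplus_def)
  show ?thesis
  proof (rule integrable_const_bound[where B=1])
    show "AE u in \<mu>. norm (1 / (1 - t * u)) \<le> 1"
      using Pplus_AE[OF assms(1)]
    proof eventually_elim
      case (elim u)
      then show ?case using one_minus_ge_1[OF assms(2) elim] by simp
    qed
  qed measurable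
qed

lemma psi_eq:
  assumes "\<mu> \<in> Pplus" "t \<le> 0"
  shows "psi_tr \<mu> t = M_tr \<mu> t - 1"
proof -
  interpret real_distribution \<mu> using assms by (simp add: Pplus_def)
  have "psi_tr \<mu> t = (LINT u|\<mu>. 1 / (1 - t * u) - 1)" unfolding psi_tr_def
  proof (rule integral_cong_AE)
    show "AE u in \<mu>. t * u / (1 - t * u) = 1 / (1 - t * u) - 1"
      using Pplus_AE[OF assms(1)]
    proof eventually_elim
      case (elim u)
      then have "1 - t * u \<noteq> 0" using one_minus_ge_1[OF assms(2) elim] by simp
      then show ?case by (simp add: field_simps)
    qed
  qed measurable
  also have "\<dots> = M_tr \<mu> t - 1"
    unfolding M_tr_def using integrable_M[OF assms] by (subst Bochner_Integration.integral_diff) (auto simp: prob_space[simplified])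
  finally show ?thesis .
qed

lemma M_le_1:
  assumes "\<mu> \<in> Pplus" "t \<le> 0"
  shows "M_tr \<mu> t \<le> 1"
proof -
  interpret real_distribution \<mu> using assms by (simp add: Pplus_def)
  have "M_tr \<mu> t \<le> (LINT u|\<mu>. 1)" unfolding M_tr_def
  proof (rule integral_mono_AE)
    show "AE u in \<mu>. 1 / (1 - t * u) \<le> 1"
      using Pplus_AE[OF assms(1)] by eventually_elim (use inverse_one_minus_le_1[OF assms(2)] abs_le_D1 in blast)
  qed (use integrable_M[OF assms] in auto)
  then show ?thesis by (simp add: prob_space[simplified])
qed

lemma M_pos:
  assumes "\<mu> \<in> Pplus" "t \<le> 0"
  shows "M_tr \<mu> t > 0"
proof -
  interpret real_distribution \<mu> using assms by (simp add: Pplus_def)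
  have "AE u in \<mu>. 0 < 1 / (1 - t * u)"
    using Pplus_AE[OF assms(1)] by eventually_elim (use one_minus_ge_1[OF assms(2)] in force)
  then have "(LINT u|\<mu>. 0) < M_tr \<mu> t" unfolding M_tr_def
    using integrable_M[OF assms] emeasure_space_1 by (intro integral_less_AE_space) auto
  then show ?thesis by simp
qed

lemma eta_eq:
  assumes "\<mu> \<in> Pplus" "t \<le> 0"
  shows "eta_tr \<mu> t = 1 - 1 / M_tr \<mu> t"
  using M_pos[OF assms] by (simp add: eta_tr_def psi_eq[OF assms] field_simps)

lemma M_lim:
  assumes "\<mu> \<in> Pplus"
  shows "(M_tr \<mu> \<longlongrightarrow> 1) (at_left 0)"
proof (rule tendsto_at_left_sequentially[of "-1"])
  interpret real_distribution \<mu> using assms by (simp add: Pplus_def)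
  fix S :: "nat \<Rightarrow> real" assume S: "\<And>n. S n < 0" "S \<longlonglongrightarrow> 0"
  have "(\<lambda>n. LINT u|\<mu>. 1 / (1 - S n * u)) \<longlonglongrightarrow> (LINT u|\<mu>. 1)"
  proof (rule integral_dominated_convergence[where w="\<lambda>_. 1"])
    show "AE u in \<mu>. (\<lambda>n. 1 / (1 - S n * u)) \<longlonglongrightarrow> 1"
    proof (intro AE_I2)
      fix u
      have "(\<lambda>n. 1 / (1 - S n * u)) \<longlonglongrightarrow> 1 / (1 - 0 * u)" using S by (intro tendsto_intros) auto
      then show "(\<lambda>n. 1 / (1 - S n * u)) \<longlonglongrightarrow> 1" by simp
    qed
    show "AE u in \<mu>. norm (1 / (1 - S n * u)) \<le> 1" for n
      using Pplus_AE[OF assms(1)] by eventually_elim (use inverse_one_minus_le_1[of "S n"] S(1)[of n] in auto)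
  qed auto
  then show "(\<lambda>n. M_tr \<mu> (S n)) \<longlonglongrightarrow> 1" by (simp add: M_tr_def prob_space[simplified])
qed simp

text \<open>\<mu> is transported to [0, 1) by v = u / (1 + u). The weight a(v) = 1 - v produces t
  M(t) and a(v) = v produces \<psi>.\<close>

lemma Pplus_cbf_mix:
  assumes \<mu>: "\<mu> \<in> Pplus"
    and a: "continuous_on {0..1} a" "\<And>v. 0 \<le> v \<Longrightarrow> v \<le> 1 \<Longrightarrow> 0 \<le> a v"
    and [measurable]: "a \<in> borel_measurable borel"
  shows "(\<lambda>t. LINT u|\<mu>. a (u / (1 + u)) * cbf_kernel t (u / (1 + u))) \<in> cbf"
proof -
  interpret real_distribution \<mu> using \<mu> by (simp add: Pplus_def)
  let ?\<sigma> = "distr \<mu> borel (\<lambda>u. u / (1 + u))"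
  have fin: "finite_measure ?\<sigma>" by (rule finite_measure_distr) measurable
  have "(\<lambda>t. LINT v|?\<sigma>. a (unit_clip v) * cbf_kernel t (unit_clip v)) \<in> cbf"
  proof (rule cbf_mix[OF fin])
    show "(\<lambda>t. a v * cbf_kernel t v) \<in> cbf" if "0 \<le> v" "v \<le> 1" for v using a that by (intro cbf_cbf_kernel)
    show "continuous_on {0..1} (\<lambda>v. a v * cbf_kernel t v)" if "t < 0" for t
      using that a by (intro continuous_intros)
  qed simp
  then show ?thesis
  proof (rule cbf_cong)
    fix t :: real assume t: "t < 0"
    have c: "continuous_on {0..1} (\<lambda>v. a v * cbf_kernel t v)" using t a by (intro continuous_intros)
    have m: "(\<lambda>v. a (unit_clip v) * cbf_kernel t (unit_clip v)) \<in> borel_measurable borel"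
      using integrable_continuous_clip(2)[OF _ _ c, of borel]
        integrable_continuous_clip(2)[OF fin _ c] by simp
    have "(LINT v|?\<sigma>. a (unit_clip v) * cbf_kernel t (unit_clip v)) = (LINT u|\<mu>. a (unit_clip (u / (1 + u))) * cbf_kernel t (unit_clip (u / (1 + u))))"
      using m by (intro integral_distr) auto
    also have "\<dots> = (LINT u|\<mu>. a (u / (1 + u)) * cbf_kernel t (u / (1 + u)))"
    proof -
      have eq: "AE u in \<mu>. a (unit_clip (u / (1 + u))) * cbf_kernel t (unit_clip (u / (1 + u))) = a (u / (1 + u)) * cbf_kernel t (u / (1 + u))"
        using Pplus_AE[OF \<mu>] by eventually_elim simp
      show ?thesis
        using eq by (intro integral_cong_AE) measurable
    qed
    finally show "(LINT u|\<mu>. a (u / (1 + u)) * cbf_kernel t (u / (1 + u))) = (LINT v|?\<sigma>. a (unit_clip v) * cbf_kernel t (unit_clip v))" ..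
  qed
qed

lemma cbf_kernel_moebius: "0 \<le> u \<Longrightarrow> t < 0 \<Longrightarrow> cbf_kernel t (u / (1 + u)) = t * (1 + u) / (1 - t * u)"
proof -
  assume "0 \<le> u" "t < 0"
  have "1 - (1 + t) * (u / (1 + u)) = (1 - t * u) / (1 + u)" using \<open>0 \<le> u\<close> by (simp add: field_simps)
  then show ?thesis using \<open>0 \<le> u\<close> by (simp add: cbf_kernel_def)
qed

lemma tM_cbf:
  assumes \<mu>: "\<mu> \<in> Pplus"
  shows "(\<lambda>t. t * M_tr \<mu> t) \<in> cbf"
proof -
  have "(\<lambda>t. LINT u|\<mu>. (1 - u / (1 + u)) * cbf_kernel t (u / (1 + u))) \<in> cbf"
    by (rule Pplus_cbf_mix[OF \<mu>]) (auto intro!: continuous_intros)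
  then show ?thesis
  proof (rule cbf_cong)
    fix t :: real assume t: "t < 0"
    have "(LINT u|\<mu>. (1 - u / (1 + u)) * cbf_kernel t (u / (1 + u))) = (LINT u|\<mu>. t * (1 / (1 - t * u)))"
    proof (rule integral_cong_AE)
      show "AE u in \<mu>. (1 - u / (1 + u)) * cbf_kernel t (u / (1 + u)) = t * (1 / (1 - t * u))"
        using Pplus_AE[OF \<mu>]
      proof eventually_elim
        case (elim u)
        then have "1 - u / (1 + u) = 1 / (1 + u)" by (simp add: field_simps)
        then show ?case using elim t by (simp add: cbf_kernel_moebius)
      qed
    qed (use Pplus_sets[OF \<mu>] in \<open>auto cong: measurable_cong_sets\<close>)
    then show "t * M_tr \<mu> t = (LINT u|\<mu>. (1 - u / (1 + u)) * cbf_kernel t (u / (1 + u)))"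
      unfolding M_tr_def by (simp only: integral_mult_right_zero)
  qed
qed

lemma psi_cbf:
  assumes \<mu>: "\<mu> \<in> Pplus"
  shows "psi_tr \<mu> \<in> cbf"
proof -
  have "(\<lambda>t. LINT u|\<mu>. (u / (1 + u)) * cbf_kernel t (u / (1 + u))) \<in> cbf"
    by (rule Pplus_cbf_mix[OF \<mu>]) (auto intro!: continuous_intros)
  then show ?thesis
  proof (rule cbf_cong)
    fix t :: real assume t: "t < 0"
    show "psi_tr \<mu> t = (LINT u|\<mu>. (u / (1 + u)) * cbf_kernel t (u / (1 + u)))"
      unfolding psi_tr_def
    proof (rule integral_cong_AE)
      show "AE u in \<mu>. t * u / (1 - t * u) = (u / (1 + u)) * cbf_kernel t (u / (1 + u))"
        using Pplus_AE[OF \<mu>] by eventually_elim (use t in \<open>simp add: cbf_kernel_moebius mult.commute\<close>)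
    qed (use Pplus_sets[OF \<mu>] in \<open>auto cong: measurable_cong_sets\<close>)
  qed
qed

text \<open>Converse of \<open>tM_cbf\<close>: the density m / (1 - v) undoes the weight 1 - v, and
  v / (1 - v) undoes the change of variable. By monotone convergence the limit 1 of f(t) / t says
  that the resulting measure has mass 1 and that v = 1 carries nothing.\<close>

lemma cbf_prob:
  assumes f: "f \<in> cbf" and lim: "((\<lambda>t. f t / t) \<longlongrightarrow> 1) (at_left 0)"
  obtains \<mu> where "\<mu> \<in> Pplus" "\<And>t. t < 0 \<Longrightarrow> M_tr \<mu> t = f t / t"
proof -
  obtain P where P: "real_distribution P" "\<And>t. t < 0 \<Longrightarrow> f t = - f (-1) * (LINT v|P. cbf_kernel t (unit_clip v))" "f (-1) \<le> 0"
    using cbf_prob_repr[OF f] by blast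
  interpret real_distribution P by fact
  define m where "m = - f (-1)"
  have m: "m \<ge> 0" using P(3) by (simp add: m_def)
  have fm: "f t = m * (LINT v|P. cbf_kernel t (unit_clip v))" if "t < 0" for t using P(2)[OF that] by (simp add: m_def)
  \<comment> \<open>The kernel divided by t at t = - 1 / (n + 1); it increases with n to 1 / (1 -
    v), with value infinity at v = 1.\<close>
  define g where "g n v = ennreal (1 / (1 - unit_clip v + unit_clip v / real (Suc n)))" for n v
  have den: "1 - unit_clip v + unit_clip v / real (Suc n) > 0" for n v
    using cbf_kernel_denom_pos[of "- 1 / real (Suc n)" "unit_clip v"] by (simp add: algebra_simps del: of_nat_Suc)
  have intg: "(\<integral>\<^sup>+ v. g n v \<partial>P) = ennreal (LINT v|P. 1 / (1 - unit_clip v + unit_clip v / real (Suc n)))" for n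
    unfolding g_def
  proof (rule nn_integral_eq_integral)
    have "1 / (1 - unit_clip v + unit_clip v / real (Suc n)) = - real (Suc n) * cbf_kernel (- 1 / real (Suc n)) (unit_clip v)" for v
      by (subst cbf_kernel_minus_inverse) (simp_all del: of_nat_Suc)
    then show "integrable P (\<lambda>v. 1 / (1 - unit_clip v + unit_clip v / real (Suc n)))"
      using integrable_cbf_kernel[of P "- 1 / real (Suc n)"] by (auto intro: finite_measure_axioms simp del: of_nat_Suc)
    show "AE v in P. 0 \<le> 1 / (1 - unit_clip v + unit_clip v / real (Suc n))"
      using den by (auto simp: less_imp_le simp del: of_nat_Suc)
  qed
  have fn: "m * (LINT v|P. 1 / (1 - unit_clip v + unit_clip v / real (Suc n))) = f (- 1 / real (Suc n)) / (- 1 / real (Suc n))" for n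
  proof -
    have "cbf_kernel (- 1 / real (Suc n)) (unit_clip v) = (- 1 / real (Suc n)) * (1 / (1 - unit_clip v + unit_clip v / real (Suc n)))" for v
      by (rule cbf_kernel_minus_inverse) simp
    then have "f (- 1 / real (Suc n)) = m * ((- 1 / real (Suc n)) * (LINT v|P. 1 / (1 - unit_clip v + unit_clip v / real (Suc n))))"
      by (subst fm) (simp_all only: integral_mult_right_zero, simp)
    then show ?thesis by (simp del: of_nat_Suc)
  qed
  have "filterlim (\<lambda>n. - 1 / real (Suc n)) (at_left 0) sequentially" by real_asymp
  from filterlim_compose[OF lim this]
  have lim1: "(\<lambda>n. m * (LINT v|P. 1 / (1 - unit_clip v + unit_clip v / real (Suc n)))) \<longlonglongrightarrow> 1"
    unfolding fn .
  have "(\<lambda>n. \<integral>\<^sup>+ v. g n v \<partial>P) \<longlonglongrightarrow> (\<integral>\<^sup>+ v. inverse (ennreal (1 - unit_clip v)) \<partial>P)"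
  proof (rule nn_integral_LIMSEQ)
    show "(\<lambda>n. g n v) \<longlonglongrightarrow> inverse (ennreal (1 - unit_clip v))" for v
    proof (cases "unit_clip v = 1")
      case True
      then have "g n v = of_nat (Suc n)" for n
        by (simp add: g_def ennreal_of_nat_eq_real_of_nat del: of_nat_Suc)
      then show ?thesis using True LIMSEQ_Suc[OF of_nat_tendsto_top_ennreal] by simp
    next
      case False
      then have lt: "unit_clip v < 1" using unit_clip_in(2)[of v] by linarith
      have "(\<lambda>n. unit_clip v / real (Suc n)) \<longlonglongrightarrow> 0" by real_asymp
      then have "(\<lambda>n. 1 / (1 - unit_clip v + unit_clip v / real (Suc n))) \<longlonglongrightarrow> 1 / (1 - unit_clip v + 0)"
        using lt by (intro tendsto_intros) auto
      then have "(\<lambda>n. g n v) \<longlonglongrightarrow> ennreal (1 / (1 - unit_clip v))"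
        unfolding g_def by (intro tendsto_ennrealI) simp
      then show ?thesis using lt by (simp add: inverse_ennreal inverse_eq_divide)
    qed
    show "incseq g"
      unfolding g_def incseq_def le_fun_def
    proof (intro allI impI ennreal_leI)
      fix a b :: nat and v assume "a \<le> b"
      then show "1 / (1 - unit_clip v + unit_clip v / real (Suc a)) \<le> 1 / (1 - unit_clip v + unit_clip v / real (Suc b))"
        using den by (intro frac_le add_left_mono divide_left_mono) auto
    qed
  qed (simp add: g_def)
  then have "(\<lambda>n. ennreal m * (\<integral>\<^sup>+ v. g n v \<partial>P)) \<longlonglongrightarrow> ennreal m * (\<integral>\<^sup>+ v. inverse (ennreal (1 - unit_clip v)) \<partial>P)"
    by (intro ennreal_tendsto_cmult) auto
  moreover have "ennreal m * (\<integral>\<^sup>+ v. g n v \<partial>P) = ennreal (m * (LINT v|P. 1 / (1 - unit_clip v + unit_clip v / real (Suc n))))" for n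
    unfolding intg using m by (simp add: ennreal_mult')
  ultimately have "(\<lambda>n. ennreal (m * (LINT v|P. 1 / (1 - unit_clip v + unit_clip v / real (Suc n))))) \<longlonglongrightarrow> ennreal m * (\<integral>\<^sup>+ v. inverse (ennreal (1 - unit_clip v)) \<partial>P)"
    by simp
  moreover have "(\<lambda>n. ennreal (m * (LINT v|P. 1 / (1 - unit_clip v + unit_clip v / real (Suc n))))) \<longlonglongrightarrow> ennreal 1"
    using lim1 by (rule tendsto_ennrealI)
  \<comment> \<open>This equation yields m > 0, finiteness of the integral (so v < 1 almost
    everywhere) and total mass 1 for the measure \<open>D\<close>.\<close>
  ultimately have tot: "ennreal m * (\<integral>\<^sup>+ v. inverse (ennreal (1 - unit_clip v)) \<partial>P) = 1"
    using LIMSEQ_unique by fastforce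
  then have "m \<noteq> 0" by auto
  with m have mpos: "m > 0" by simp
  have "(\<integral>\<^sup>+ v. inverse (ennreal (1 - unit_clip v)) \<partial>P) \<noteq> \<infinity>"
    using tot mpos by (auto simp: ennreal_mult_top)
  then have "AE v in P. inverse (ennreal (1 - unit_clip v)) \<noteq> \<infinity>"
    by (intro nn_integral_noteq_infinite) auto
  then have AE1: "AE v in P. unit_clip v < 1"
  proof eventually_elim
    case (elim v)
    then have "unit_clip v \<noteq> 1" by auto
    then show ?case using unit_clip_in(2)[of v] by linarith
  qed
  define D where "D = density P (\<lambda>v. ennreal (m / (1 - unit_clip v)))"
  define \<mu> where "\<mu> = distr D borel (\<lambda>v. unit_clip v / (1 - unit_clip v))"
  have "emeasure D (space D) = (\<integral>\<^sup>+ v. ennreal (m / (1 - unit_clip v)) \<partial>P)"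
    unfolding D_def by (simp add: emeasure_density)
  also have "\<dots> = (\<integral>\<^sup>+ v. ennreal m * inverse (ennreal (1 - unit_clip v)) \<partial>P)"
  proof (rule nn_integral_cong_AE)
    show "AE v in P. ennreal (m / (1 - unit_clip v)) = ennreal m * inverse (ennreal (1 - unit_clip v))"
      using AE1 by eventually_elim (use m in \<open>simp add: inverse_ennreal ennreal_mult'[symmetric] inverse_eq_divide\<close>)
  qed
  also have "\<dots> = 1" using tot by (simp add: nn_integral_cmult)
  finally have "prob_space D" by (rule prob_spaceI)
  then interpret D: prob_space D .
  have Dm: "(\<lambda>v. unit_clip v / (1 - unit_clip v)) \<in> borel_measurable D" unfolding D_def by measurable
  have \<mu>: "\<mu> \<in> Pplus"
  proof (rule PplusI)
    show "real_distribution \<mu>" unfolding \<mu>_def using Dm by (rule D.real_distribution_distr)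
    show "AE u in \<mu>. 0 \<le> u" unfolding \<mu>_def using Dm by (subst AE_distr_iff) auto
  qed
  show ?thesis
  proof (rule that[OF \<mu>])
    fix t :: real assume t: "t < 0"
    have "M_tr \<mu> t = (LINT v|D. 1 / (1 - t * (unit_clip v / (1 - unit_clip v))))"
      unfolding M_tr_def \<mu>_def using Dm by (subst integral_distr) auto
    also have "\<dots> = (LINT v|P. (m / (1 - unit_clip v)) *\<^sub>R (1 / (1 - t * (unit_clip v / (1 - unit_clip v)))))"
      unfolding D_def using m by (subst integral_density) auto
    also have "\<dots> = (LINT v|P. m / t * cbf_kernel t (unit_clip v))"
    proof (rule integral_cong_AE)
      show "AE v in P. (m / (1 - unit_clip v)) *\<^sub>R (1 / (1 - t * (unit_clip v / (1 - unit_clip v)))) = m / t * cbf_kernel t (unit_clip v)"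
        using AE1
      proof eventually_elim
        case (elim v)
        have "1 - t * (unit_clip v / (1 - unit_clip v)) = (1 - (1 + t) * unit_clip v) / (1 - unit_clip v)"
          using elim by (simp add: field_simps)
        then show ?case using elim t by (simp add: cbf_kernel_def)
      qed
    qed measurable
    also have "\<dots> = f t / t" using fm[OF t] by simp
    finally show "M_tr \<mu> t = f t / t" .
  qed
qed

text \<open>The mass b at v = 1 contributes the constant - b, and the rest tends to 0 at 0 by
  dominated convergence. So the limit identifies a = b, and restricting the measure to v < 1 removes
  the constant.\<close>

lemma cbf_split:
  assumes h: "h \<in> cbf" and lim: "(h \<longlongrightarrow> - a) (at_left 0)"
  shows "(\<lambda>t. h t + a) \<in> cbf"
proof -
  obtain \<sigma> where \<sigma>: "finite_measure \<sigma>" and S[measurable_cong]: "sets \<sigma> = sets borel"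
    and hr: "\<And>t. t < 0 \<Longrightarrow> h t = (LINT v|\<sigma>. cbf_kernel t (unit_clip v))"
    using h unfolding cbf_def by auto
  interpret finite_measure \<sigma> by fact
  define A where "A = {v \<in> space \<sigma>. unit_clip v < 1}"
  have [measurable]: "A \<in> sets \<sigma>" unfolding A_def by measurable
  define \<sigma>' where "\<sigma>' = density \<sigma> (\<lambda>v. ennreal (indicator A v))"
  define h0 where "h0 t = (LINT v|\<sigma>. indicator A v * cbf_kernel t (unit_clip v))" for t
  define b where "b = measure \<sigma> (space \<sigma> - A)"
  have int: "integrable \<sigma> (\<lambda>v. cbf_kernel t (unit_clip v))" if "t < 0" for t by (rule integrable_cbf_kernel[OF \<sigma> S that])
  have intA: "integrable \<sigma> (\<lambda>v. indicator A v * cbf_kernel t (unit_clip v))" if "t < 0" for t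
    using integrable_mult_indicator[OF _ int[OF that], of A] by simp
  have eq: "h t = h0 t - b" if "t < 0" for t
  proof -
    have "h t = (LINT v|\<sigma>. indicator A v * cbf_kernel t (unit_clip v) - indicator (space \<sigma> - A) v)"
      unfolding hr[OF that]
    proof (intro Bochner_Integration.integral_cong refl)
      fix v assume "v \<in> space \<sigma>"
      show "cbf_kernel t (unit_clip v) = indicator A v * cbf_kernel t (unit_clip v) - indicator (space \<sigma> - A) v"
      proof (cases "v \<in> A")
        case False
        then have "unit_clip v = 1" using \<open>v \<in> space \<sigma>\<close> unit_clip_in(2)[of v] by (auto simp: A_def)
        then show ?thesis using False \<open>v \<in> space \<sigma>\<close> that by (simp add: cbf_kernel_def)
      qed simp
    qed
    also have "\<dots> = h0 t - b" unfolding h0_def b_def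
      using intA[OF that] by (subst Bochner_Integration.integral_diff) (auto simp: less_top[symmetric])
    finally show ?thesis .
  qed
  have t_lim: "filterlim (\<lambda>n. - 1 / real (Suc n)) (at_left 0) sequentially" by real_asymp
  have "(\<lambda>n. h0 (- 1 / real (Suc n))) \<longlonglongrightarrow> (LINT v|\<sigma>. 0)"
    unfolding h0_def
  proof (rule integral_dominated_convergence[where w="\<lambda>_. 1"])
    show "AE v in \<sigma>. (\<lambda>n. indicator A v * cbf_kernel (- 1 / real (Suc n)) (unit_clip v)) \<longlonglongrightarrow> 0"
    proof (intro AE_I2)
      fix v
      show "(\<lambda>n. indicator A v * cbf_kernel (- 1 / real (Suc n)) (unit_clip v)) \<longlonglongrightarrow> 0"
      proof (cases "v \<in> A")
        case True
        have "(\<lambda>n. - 1 / real (Suc n)) \<longlonglongrightarrow> 0" by real_asymp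
        then have "(\<lambda>n. cbf_kernel (- 1 / real (Suc n)) (unit_clip v)) \<longlonglongrightarrow> 0 / (1 - (1 + 0) * unit_clip v)"
          unfolding cbf_kernel_def using True by (intro tendsto_intros) (auto simp: A_def)
        then show ?thesis using True by simp
      qed simp
    qed
    show "AE v in \<sigma>. norm (indicator A v * cbf_kernel (- 1 / real (Suc n)) (unit_clip v)) \<le> 1" for n
    proof (intro AE_I2)
      fix v
      have "\<bar>cbf_kernel (- 1 / real (Suc n)) (unit_clip v)\<bar> \<le> max 1 (- (- 1 / real (Suc n)))"
        by (intro cbf_kernel_bound) auto
      also have "\<dots> = 1" by simp
      finally show "norm (indicator A v * cbf_kernel (- 1 / real (Suc n)) (unit_clip v)) \<le> 1"
        by (auto simp: indicator_def)
    qed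
  qed auto
  then have "(\<lambda>n. h0 (- 1 / real (Suc n)) - b) \<longlonglongrightarrow> 0 - b" by (intro tendsto_intros) simp
  moreover have "(\<lambda>n. h (- 1 / real (Suc n))) \<longlonglongrightarrow> - a" using filterlim_compose[OF lim t_lim] .
  moreover have "h (- 1 / real (Suc n)) = h0 (- 1 / real (Suc n)) - b" for n by (rule eq) simp
  ultimately have ab: "a = b" using LIMSEQ_unique by fastforce
  have "finite_measure \<sigma>'"
  proof (rule finite_measureI)
    have "emeasure \<sigma>' (space \<sigma>') = emeasure \<sigma> A" by (simp add: \<sigma>'_def emeasure_density ennreal_indicator)
    then show "emeasure \<sigma>' (space \<sigma>') \<noteq> \<infinity>" by simp
  qed
  moreover have "h t + a = (LINT v|\<sigma>'. cbf_kernel t (unit_clip v))" if "t < 0" for t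
    unfolding \<sigma>'_def by (subst integral_density) (auto simp: eq[OF that] ab h0_def)
  ultimately show ?thesis unfolding cbf_def using S by (intro CollectI exI[of _ \<sigma>']) (auto simp: \<sigma>'_def)
qed

section \<open>Members vanishing at 0 and the transform \<eta>\<close>

lemma cbf0_cbf: "h \<in> cbf0 \<Longrightarrow> h \<in> cbf" by (simp add: cbf0_def)
lemma cbf0_lim: "h \<in> cbf0 \<Longrightarrow> (h \<longlongrightarrow> 0) (at_left 0)" by (simp add: cbf0_def)

lemma cbf0_cong:
  assumes "h \<in> cbf0" "\<And>t. t < 0 \<Longrightarrow> h' t = h t"
  shows "h' \<in> cbf0"
proof -
  have "(h' \<longlongrightarrow> 0) (at_left 0) \<longleftrightarrow> (h \<longlongrightarrow> 0) (at_left 0)"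
    by (rule tendsto_cong) (auto simp: eventually_at_filter assms(2))
  then show ?thesis using assms cbf_cong[of h h'] by (auto simp: cbf0_def)
qed

lemma cbf0_add: "f \<in> cbf0 \<Longrightarrow> g \<in> cbf0 \<Longrightarrow> (\<lambda>t. f t + g t) \<in> cbf0"
  unfolding cbf0_def using tendsto_add[of f 0 "at_left 0" g 0] by (auto intro: cbf_add)

lemma cbf0_cmul: "f \<in> cbf0 \<Longrightarrow> c \<ge> 0 \<Longrightarrow> (\<lambda>t. c * f t) \<in> cbf0"
  unfolding cbf0_def using tendsto_mult_left[of f 0 "at_left 0" c] by (auto intro: cbf_cmul)

lemma cbf0_id: "(\<lambda>t. t) \<in> cbf0"
  unfolding cbf0_def using cbf_id by (auto intro: tendsto_ident_at)

lemma psi_cbf0: "\<mu> \<in> Pplus \<Longrightarrow> psi_tr \<mu> \<in> cbf0"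
proof -
  assume \<mu>: "\<mu> \<in> Pplus"
  have "((\<lambda>t. M_tr \<mu> t - 1) \<longlongrightarrow> 1 - 1) (at_left 0)" using M_lim[OF \<mu>] by (intro tendsto_intros)
  moreover have "eventually (\<lambda>t. M_tr \<mu> t - 1 = psi_tr \<mu> t) (at_left 0)"
    by (auto simp: eventually_at_filter psi_eq[OF \<mu>])
  ultimately have "(psi_tr \<mu> \<longlongrightarrow> 0) (at_left 0)" using Lim_transform_eventually by fastforce
  then show ?thesis using psi_cbf[OF \<mu>] by (simp add: cbf0_def)
qed

text \<open>- 1 / M is the dual of t M; its limit at 0 is -1, and splitting off this constant leaves
  \<eta> = 1 - 1 / M.\<close>

lemma eta_cbf0:
  assumes \<mu>: "\<mu> \<in> Pplus"
  shows "eta_tr \<mu> \<in> cbf0"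
proof -
  have "(\<lambda>t. - t / (t * M_tr \<mu> t)) \<in> cbf"
    using M_pos[OF \<mu>, of "-1"] by (intro cbf_dual tM_cbf[OF \<mu>]) auto
  then have c: "(\<lambda>t. - (1 / M_tr \<mu> t)) \<in> cbf" by (rule cbf_cong) simp
  have l: "((\<lambda>t. - (1 / M_tr \<mu> t)) \<longlongrightarrow> - (1 / 1)) (at_left 0)"
    using M_lim[OF \<mu>] by (intro tendsto_intros) auto
  have "(\<lambda>t. - (1 / M_tr \<mu> t) + 1) \<in> cbf" using c l by (intro cbf_split) auto
  moreover have "((\<lambda>t. - (1 / M_tr \<mu> t) + 1) \<longlongrightarrow> - (1 / 1) + 1) (at_left 0)"
    by (rule tendsto_add[OF l tendsto_const])
  ultimately have "(\<lambda>t. - (1 / M_tr \<mu> t) + 1) \<in> cbf0" by (simp add: cbf0_def)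
  then show ?thesis by (rule cbf0_cong) (simp add: eta_eq[OF \<mu>])
qed

text \<open>The prescription M = 1 / (1 - h) makes t M the resolvent of h, and h \<rightarrow> 0 is
  the normalisation required by \<open>cbf_prob\<close>.\<close>

lemma cbf0_eta:
  assumes "h \<in> cbf0"
  obtains \<mu> where "\<mu> \<in> Pplus" "\<And>t. t < 0 \<Longrightarrow> M_tr \<mu> t = 1 / (1 - h t)" "\<And>t. t < 0 \<Longrightarrow> eta_tr \<mu> t = h t"
proof -
  have "((\<lambda>t. 1 / (1 - h t)) \<longlongrightarrow> 1 / (1 - 0)) (at_left 0)"
    using cbf0_lim[OF assms] by (intro tendsto_intros) auto
  moreover have "eventually (\<lambda>t. 1 / (1 - h t) = t / (1 - h t) / t) (at_left 0)"
    by (auto simp: eventually_at_filter)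
  ultimately have "((\<lambda>t. t / (1 - h t) / t) \<longlongrightarrow> 1) (at_left 0)"
    using Lim_transform_eventually by fastforce
  then obtain \<mu> where \<mu>: "\<mu> \<in> Pplus" "\<And>t. t < 0 \<Longrightarrow> M_tr \<mu> t = t / (1 - h t) / t"
    using cbf_prob[OF cbf_resolvent[OF cbf0_cbf[OF assms]]] by blast
  show ?thesis
  proof (rule that[OF \<mu>(1)])
    fix t :: real assume t: "t < 0"
    show 1: "M_tr \<mu> t = 1 / (1 - h t)" using \<mu>(2)[OF t] t by simp
    show "eta_tr \<mu> t = h t" using 1 t eta_eq[OF \<mu>(1), of t] by simp
  qed
qed


section \<open>Laplace transforms and uniqueness\<close>

text \<open>Hausdorff moment argument: Bernstein polynomials approximate \<phi> uniformly, and their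
  integrals are determined by the moments. Signed weights and two base spaces cover both
  applications: two measures with weight 1, and one measure with the weights f - g and 0.\<close>

lemma moments_determine:
  fixes f :: "'a \<Rightarrow> real" and g :: "'b \<Rightarrow> real" and \<phi> :: "real \<Rightarrow> real"
  assumes f: "integrable M f" and g: "integrable N g"
    and [measurable]: "X \<in> borel_measurable M" "Y \<in> borel_measurable N"
    and X: "AE x in M. 0 \<le> X x \<and> X x \<le> 1" and Y: "AE y in N. 0 \<le> Y y \<and> Y y \<le> 1"
    and mom: "\<And>n::nat. (LINT x|M. X x ^ n * f x) = (LINT y|N. Y y ^ n * g y)"
    and \<phi>: "continuous_on {0..1} \<phi>"
  shows "(LINT x|M. \<phi> (unit_clip (X x)) * f x) = (LINT y|N. \<phi> (unit_clip (Y y)) * g y)"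
proof -
  have [measurable]: "f \<in> borel_measurable M" "g \<in> borel_measurable N" using f g by auto
  have poly_int: "integrable M (\<lambda>x. X x ^ j * (1 - X x) ^ k * f x)" for j k
  proof (rule Bochner_Integration.integrable_bound[OF f])
    show "AE x in M. norm (X x ^ j * (1 - X x) ^ k * f x) \<le> norm (f x)"
      using X by eventually_elim (auto simp: abs_mult intro!: mult_left_le_one_le mult_le_one power_le_one)
  qed measurable
  have poly_int': "integrable N (\<lambda>x. Y x ^ j * (1 - Y x) ^ k * g x)" for j k
  proof (rule Bochner_Integration.integrable_bound[OF g])
    show "AE x in N. norm (Y x ^ j * (1 - Y x) ^ k * g x) \<le> norm (g x)"
      using Y by eventually_elim (auto simp: abs_mult intro!: mult_left_le_one_le mult_le_one power_le_one)
  qed measurable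
  \<comment> \<open>Induction on the power of 1 - X brings the moments into the form of the
    Bernstein basis.\<close>
  have mom2: "(LINT x|M. X x ^ j * (1 - X x) ^ k * f x) = (LINT y|N. Y y ^ j * (1 - Y y) ^ k * g y)" for j k
  proof (induction k arbitrary: j)
    case 0
    show ?case using mom by simp
  next
    case (Suc k)
    have "(LINT x|M. X x ^ j * (1 - X x) ^ Suc k * f x)
      = (LINT x|M. X x ^ j * (1 - X x) ^ k * f x - X x ^ Suc j * (1 - X x) ^ k * f x)"
      by (intro Bochner_Integration.integral_cong refl) (simp add: algebra_simps)
    also have "\<dots> = (LINT x|M. X x ^ j * (1 - X x) ^ k * f x) - (LINT x|M. X x ^ Suc j * (1 - X x) ^ k * f x)"
      by (intro Bochner_Integration.integral_diff poly_int)
    also have "\<dots> = (LINT y|N. Y y ^ j * (1 - Y y) ^ k * g y) - (LINT y|N. Y y ^ Suc j * (1 - Y y) ^ k * g y)"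
      by (simp only: Suc)
    also have "\<dots> = (LINT y|N. Y y ^ j * (1 - Y y) ^ k * g y - Y y ^ Suc j * (1 - Y y) ^ k * g y)"
      by (intro Bochner_Integration.integral_diff[symmetric] poly_int')
    also have "\<dots> = (LINT y|N. Y y ^ j * (1 - Y y) ^ Suc k * g y)"
      by (intro Bochner_Integration.integral_cong refl) (simp add: algebra_simps)
    finally show ?case .
  qed
  define I where "I = (LINT x|M. \<bar>f x\<bar>) + (LINT y|N. \<bar>g y\<bar>)"
  have I0: "I \<ge> 0" by (simp add: I_def)
  obtain B where B: "\<And>v. \<bar>\<phi> (unit_clip v)\<bar> \<le> B"
    using integrable_continuous_clip(3)[of "return borel 0", OF _ _ \<phi>]
    by (auto simp: prob_space_return prob_space_imp_sigma_finite prob_space.finite_measure)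
  have \<phi>m: "(\<lambda>v. \<phi> (unit_clip v)) \<in> borel_measurable borel"
    by (intro borel_measurable_continuous_onI continuous_on_compose2[OF \<phi> continuous_unit_clip]) auto
  have [measurable]: "(\<lambda>x. \<phi> (unit_clip (X x))) \<in> borel_measurable M" "(\<lambda>y. \<phi> (unit_clip (Y y))) \<in> borel_measurable N"
    using \<phi>m by (auto intro: measurable_compose[OF _ \<phi>m])
  have \<phi>f: "integrable M (\<lambda>x. \<phi> (unit_clip (X x)) * f x)"
  proof (rule Bochner_Integration.integrable_bound[OF integrable_mult_right[OF f, of B]])
    show "AE x in M. norm (\<phi> (unit_clip (X x)) * f x) \<le> norm (B * f x)"
      using B by (intro AE_I2) (auto simp: abs_mult intro!: mult_right_mono order_trans[OF B abs_ge_self])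
  qed measurable
  have \<phi>g: "integrable N (\<lambda>x. \<phi> (unit_clip (Y x)) * g x)"
  proof (rule Bochner_Integration.integrable_bound[OF integrable_mult_right[OF g, of B]])
    show "AE x in N. norm (\<phi> (unit_clip (Y x)) * g x) \<le> norm (B * g x)"
      using B by (intro AE_I2) (auto simp: abs_mult intro!: mult_right_mono order_trans[OF B abs_ge_self])
  qed measurable
  have close: "\<bar>(LINT x|M. \<phi> (unit_clip (X x)) * f x) - (LINT y|N. \<phi> (unit_clip (Y y)) * g y)\<bar> \<le> e * I" if e: "e > 0" for e
  proof -
    obtain n where n: "\<And>x. x \<in> {0..1} \<Longrightarrow> \<bar>\<phi> x - (\<Sum>k\<le>n. \<phi> (real k / real n) * Bernstein n k x)\<bar> < e"
      using Bernstein_Weierstrass[OF \<phi> e] by blast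
    define p where "p x = (\<Sum>k\<le>n. \<phi> (real k / real n) * Bernstein n k x)" for x
    have pf: "p x * c = (\<Sum>k\<le>n. (\<phi> (real k / real n) * real (n choose k)) * (x ^ k * (1 - x) ^ (n - k) * c))" for x c
      by (simp add: p_def Bernstein_def sum_distrib_left mult_ac)
    have pint: "integrable M (\<lambda>x. p (X x) * f x)" "integrable N (\<lambda>y. p (Y y) * g y)"
      unfolding pf by (intro Bochner_Integration.integrable_sum integrable_mult_right poly_int poly_int')+
    have peq: "(LINT x|M. p (X x) * f x) = (LINT y|N. p (Y y) * g y)"
      unfolding pf by (subst Bochner_Integration.integral_sum, intro integrable_mult_right poly_int,
        subst Bochner_Integration.integral_sum, intro integrable_mult_right poly_int') (simp add: mom2)
    have d1: "\<bar>(LINT x|M. \<phi> (unit_clip (X x)) * f x) - (LINT x|M. p (X x) * f x)\<bar> \<le> e * (LINT x|M. \<bar>f x\<bar>)"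
    proof -
      have "\<bar>(LINT x|M. \<phi> (unit_clip (X x)) * f x) - (LINT x|M. p (X x) * f x)\<bar> = norm (LINT x|M. \<phi> (unit_clip (X x)) * f x - p (X x) * f x)"
        using \<phi>f pint by simp
      also have "\<dots> \<le> (LINT x|M. \<bar>\<phi> (unit_clip (X x)) * f x - p (X x) * f x\<bar>)"
        using integral_norm_bound by fastforce
      also have "\<dots> \<le> (LINT x|M. e * \<bar>f x\<bar>)"
      proof (rule integral_mono_AE)
        show "AE x in M. \<bar>\<phi> (unit_clip (X x)) * f x - p (X x) * f x\<bar> \<le> e * \<bar>f x\<bar>"
          using X
        proof eventually_elim
          case (elim x)
          then have "\<bar>\<phi> (X x) - p (X x)\<bar> \<le> e" using n[of "X x"] by (simp add: p_def)
          then show ?case using elim by (simp add: left_diff_distrib[symmetric] abs_mult mult_right_mono)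
        qed
      qed (use \<phi>f pint f in auto)
      finally show ?thesis by simp
    qed
    have d2: "\<bar>(LINT x|N. \<phi> (unit_clip (Y x)) * g x) - (LINT x|N. p (Y x) * g x)\<bar> \<le> e * (LINT x|N. \<bar>g x\<bar>)"
    proof -
      have "\<bar>(LINT x|N. \<phi> (unit_clip (Y x)) * g x) - (LINT x|N. p (Y x) * g x)\<bar> = norm (LINT x|N. \<phi> (unit_clip (Y x)) * g x - p (Y x) * g x)"
        using \<phi>g pint by simp
      also have "\<dots> \<le> (LINT x|N. \<bar>\<phi> (unit_clip (Y x)) * g x - p (Y x) * g x\<bar>)"
        using integral_norm_bound by fastforce
      also have "\<dots> \<le> (LINT x|N. e * \<bar>g x\<bar>)"
      proof (rule integral_mono_AE)
        show "AE x in N. \<bar>\<phi> (unit_clip (Y x)) * g x - p (Y x) * g x\<bar> \<le> e * \<bar>g x\<bar>"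
          using Y
        proof eventually_elim
          case (elim x)
          then have "\<bar>\<phi> (Y x) - p (Y x)\<bar> \<le> e" using n[of "Y x"] by (simp add: p_def)
          then show ?case using elim by (simp add: left_diff_distrib[symmetric] abs_mult mult_right_mono)
        qed
      qed (use \<phi>g pint g in auto)
      finally show ?thesis by simp
    qed
    show ?thesis using d1 d2 peq by (simp add: I_def distrib_left abs_le_iff)
  qed
  have "\<bar>(LINT x|M. \<phi> (unit_clip (X x)) * f x) - (LINT y|N. \<phi> (unit_clip (Y y)) * g y)\<bar> \<le> 0"
  proof (rule field_le_epsilon)
    fix e :: real assume "e > 0"
    \<comment> \<open>The denominator is I + 1 because I may be 0.\<close>
    have "e / (I + 1) * I \<le> e" using \<open>e > 0\<close> I0 by (simp add: divide_le_eq mult_left_mono)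
    then show "\<bar>(LINT x|M. \<phi> (unit_clip (X x)) * f x) - (LINT y|N. \<phi> (unit_clip (Y y)) * g y)\<bar> \<le> 0 + e"
      using close[of "e / (I + 1)"] \<open>e > 0\<close> I0 by simp
  qed
  then show ?thesis by simp
qed

section \<open>Injectivity of the Laplace transform and of exponential averages\<close>

definition L_tr :: "real measure \<Rightarrow> real \<Rightarrow> real" where
  "L_tr \<mu> t = (LINT u|\<mu>. exp (t * u))"

lemma integrable_L:
  assumes "\<mu> \<in> Pplus" "t \<le> 0"
  shows "integrable \<mu> (\<lambda>u. exp (t * u))"
proof -
  interpret real_distribution \<mu> using assms by (simp add: Pplus_def)
  show ?thesis
  proof (rule integrable_const_bound[where B=1])
    show "AE u in \<mu>. norm (exp (t * u)) \<le> 1"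
      using Pplus_AE[OF assms(1)] by eventually_elim (use assms(2) in \<open>simp add: mult_nonpos_nonneg\<close>)
  qed measurable
qed

text \<open>The values at negative integers are the moments of exp(- u), so all integrals of
  continuous functions of exp(- u) agree. Clipped ramps in exp(- u) of growing steepness converge to
  the indicator of u \<le> a and yield the distribution function.\<close>

lemma laplace_unique:
  assumes \<mu>: "\<mu> \<in> Pplus" and \<nu>: "\<nu> \<in> Pplus" and L: "\<And>t. t < 0 \<Longrightarrow> L_tr \<mu> t = L_tr \<nu> t"
  shows "\<mu> = \<nu>"
proof (rule cdf_unique)
  show rd: "real_distribution \<mu>" "real_distribution \<nu>" using \<mu> \<nu> by (auto simp: Pplus_def)
  have cdf_lim: "(\<lambda>k. LINT u|\<rho>. unit_clip (1 + real k * (unit_clip (exp (- u)) - exp (- a))) * 1) \<longlonglongrightarrow> cdf \<rho> a"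
    if \<rho>: "\<rho> \<in> Pplus" and a: "a \<ge> 0" for \<rho> and a
  proof -
    interpret real_distribution \<rho> using \<rho> by (simp add: Pplus_def)
    have "(\<lambda>k. LINT u|\<rho>. unit_clip (1 + real k * (unit_clip (exp (- u)) - exp (- a)))) \<longlonglongrightarrow> (LINT u|\<rho>. indicator {..a} u)"
    proof (rule integral_dominated_convergence[where w="\<lambda>_. 1"])
      show "AE u in \<rho>. (\<lambda>k. unit_clip (1 + real k * (unit_clip (exp (- u)) - exp (- a)))) \<longlonglongrightarrow> indicator {..a} u"
        using Pplus_AE[OF \<rho>]
      proof eventually_elim
        case (elim u)
        show ?case
        proof (cases "u \<le> a")
          case True
          then have "unit_clip (1 + real k * (unit_clip (exp (- u)) - exp (- a))) = 1" for k
            using elim by (auto simp: unit_clip_def[of "1 + _"])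
          then show ?thesis using True by simp
        next
          case False
          define d where "d = exp (- a) - exp (- u)"
          have d: "d > 0" using False by (simp add: d_def)
          have "eventually (\<lambda>k. real k \<ge> 1 / d) sequentially"
            by (rule eventually_compose_filterlim[OF eventually_ge_at_top filterlim_real_sequentially])
          then have "eventually (\<lambda>k. unit_clip (1 + real k * (unit_clip (exp (- u)) - exp (- a))) = 0) sequentially"
          proof eventually_elim
            case (elim k)
            then have "1 - real k * d \<le> 0" using d by (simp add: divide_le_eq)
            moreover have "1 + real k * (unit_clip (exp (- u)) - exp (- a)) = 1 - real k * d"
              using \<open>0 \<le> u\<close> by (simp add: d_def algebra_simps)
            ultimately show ?case by (simp add: unit_clip_def)
          qed
          then have "(\<lambda>k. unit_clip (1 + real k * (unit_clip (exp (- u)) - exp (- a)))) \<longlonglongrightarrow> 0"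
            by (rule tendsto_eventually)
          then show ?thesis using False by simp
        qed
      qed
    qed auto
    then show ?thesis by (simp add: cdf_def)
  qed
  have neg: "cdf \<rho> a = 0" if \<rho>: "\<rho> \<in> Pplus" and a: "a < 0" for \<rho> a
  proof -
    interpret real_distribution \<rho> using \<rho> by (simp add: Pplus_def)
    have "AE u in \<rho>. u \<notin> {..a}" using Pplus_AE[OF \<rho>] by eventually_elim (use a in auto)
    then show ?thesis unfolding cdf_def by (subst (asm) prob_eq_0[symmetric]) auto
  qed
  show "cdf \<mu> = cdf \<nu>"
  proof
    fix a :: real
    interpret \<mu>: real_distribution \<mu> by fact
    interpret \<nu>: real_distribution \<nu> by fact
    show "cdf \<mu> a = cdf \<nu> a"
    proof (cases "a < 0")
      case False
      have "(LINT u|\<mu>. unit_clip (1 + real k * (unit_clip (exp (- u)) - exp (- a))) * 1) = (LINT u|\<nu>. unit_clip (1 + real k * (unit_clip (exp (- u)) - exp (- a))) * 1)" for k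
      proof (rule moments_determine[where X="\<lambda>u. exp (- u)" and Y="\<lambda>u. exp (- u)" and f="\<lambda>_. 1" and g="\<lambda>_. 1" and \<phi>="\<lambda>v. unit_clip (1 + real k * (v - exp (- a)))"])
        show "AE x in \<mu>. 0 \<le> exp (- x) \<and> exp (- x) \<le> 1" using Pplus_AE[OF \<mu>] by eventually_elim simp
        show "AE x in \<nu>. 0 \<le> exp (- x) \<and> exp (- x) \<le> 1" using Pplus_AE[OF \<nu>] by eventually_elim simp
        show "(LINT x|\<mu>. exp (- x) ^ n * 1) = (LINT x|\<nu>. exp (- x) ^ n * 1)" for n
        \<comment> \<open>The moment of order 0 is the total mass and is not covered by the values
          at t < 0.\<close>
        proof (cases "n = 0")
          case False
          have "exp (- x) ^ n = exp (- real n * x)" for x by (simp add: exp_of_nat_mult[symmetric])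
          then show ?thesis using L[of "- real n"] False by (simp add: L_tr_def)
        qed (simp add: \<mu>.prob_space[simplified] \<nu>.prob_space[simplified])
        show "continuous_on {0..1} (\<lambda>x. unit_clip (1 + real k * (x - exp (- a))))"
          by (rule continuous_on_compose2[OF continuous_unit_clip[of UNIV]]) (auto intro!: continuous_intros)
      qed auto
      then show ?thesis using LIMSEQ_unique[OF cdf_lim[OF \<mu>] ] cdf_lim[OF \<nu>] False by simp
    qed (simp add: neg \<mu> \<nu>)
  qed
qed

text \<open>The exponential law of rate 1. Averaging over it turns L into M
  (\<open>M_eq_expm_L\<close>) and C into LC (\<open>LC_expm\<close>).\<close>

definition expm :: "real measure" where
  "expm = density lborel (\<lambda>x. ennreal (indicator {0<..} x * exp (- x)))"

lemma sets_expm [measurable_cong, simp]: "sets expm = sets borel" by (simp add: expm_def)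
lemma prob_space_expm: "prob_space expm"
proof (rule prob_spaceI)
  have "emeasure expm (space expm) = (\<integral>\<^sup>+ x. ennreal (x ^ 0 * exp (- x)) * indicator {0..} x \<partial>lborel)"
  proof -
    have "emeasure expm (space expm) = (\<integral>\<^sup>+ x. ennreal (indicator {0<..} x * exp (- x)) \<partial>lborel)"
      unfolding expm_def by (subst emeasure_density) (auto simp: indicator_def)
    also have "\<dots> = (\<integral>\<^sup>+ x. ennreal (x ^ 0 * exp (- x)) * indicator {0..} x \<partial>lborel)"
    proof (rule nn_integral_cong_AE)
      show "AE x in lborel. ennreal (indicator {0<..} x * exp (- x)) = ennreal (x ^ 0 * exp (- x)) * indicator {0..} x"
        using AE_lborel_singleton[of 0] by eventually_elim (auto simp: indicator_def)
    qed
    finally show ?thesis .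
  qed
  then show "emeasure expm (space expm) = 1" using nn_intergal_power_times_exp_Ici[of 0] by simp
qed

interpretation expm: prob_space expm by (rule prob_space_expm)

lemma AE_expm: "AE x in expm. x > 0"
  unfolding expm_def by (subst AE_density) (auto simp: indicator_def)

lemma integral_expm:
  fixes f :: "real \<Rightarrow> real"
  shows "f \<in> borel_measurable borel \<Longrightarrow> (LINT x|expm. f x) = (LINT x:{0<..}|lborel. f x * exp (- x))"
  unfolding expm_def set_lebesgue_integral_def by (subst integral_density) (auto simp: mult_ac)

lemma integrable_expm_linear: "integrable expm (\<lambda>x. A * (1 + x))"
proof -
  have "integrable expm (\<lambda>x. 1 + x)"
    unfolding expm_def
  proof (subst integrable_real_density)
    have "integrable lborel (\<lambda>x::real. x ^ 0 * exp (- x) * indicator {0<..} x + x ^ 1 * exp (- x) * indicator {0<..} x)"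
      by (intro Bochner_Integration.integrable_add has_bochner_integral_I0i_power_exp_m[THEN integrable.intros])
    then show "integrable lborel (\<lambda>x::real. indicator {0<..} x * exp (- x) * (1 + x))"
      by (rule Bochner_Integration.integrable_cong[THEN iffD1, rotated -1]) (auto simp: algebra_simps)
  qed auto
  then show ?thesis by simp
qed

lemma integrable_expm:
  assumes "f \<in> borel_measurable borel" "\<And>x. x > 0 \<Longrightarrow> \<bar>f x\<bar> \<le> A * (1 + x)"
  shows "integrable expm f"
proof (rule Bochner_Integration.integrable_bound[OF integrable_expm_linear[of A]])
  show "f \<in> borel_measurable expm" using assms by simp
  show "AE x in expm. norm (f x) \<le> norm (A * (1 + x))"
    using AE_expm by eventually_elim (use assms(2) in \<open>force intro: order_trans\<close>)
qed

text \<open>Substitution x \<rightarrow> x / N: the density exp(- x) becomes exp(- N x), of which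
  one factor is the density again and N - 1 = n factors remain. Thus averages of f at the scales 1 /
  N are moments of exp(- x) with weight f.\<close>

lemma integral_expm_scale:
  fixes f :: "real \<Rightarrow> real"
  assumes [measurable]: "f \<in> borel_measurable borel"
  shows "(LINT x|expm. f (x / real (Suc n))) = real (Suc n) * (LINT x|expm. exp (- x) ^ n * f x)"
proof -
  let ?N = "real (Suc n)"
  have "(LINT x|expm. exp (- x) ^ n * f x) = (LINT x|lborel. indicator {0<..} x * (exp (- x) ^ n * f x * exp (- x)))"
    by (subst integral_expm) (auto simp: set_lebesgue_integral_def)
  also have "\<dots> = \<bar>1 / ?N\<bar> *\<^sub>R (LINT x|lborel. indicator {0<..} (0 + 1 / ?N * x) * (exp (- (0 + 1 / ?N * x)) ^ n * f (0 + 1 / ?N * x) * exp (- (0 + 1 / ?N * x))))"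
    by (rule lborel_integral_real_affine) simp
  also have "(\<lambda>x. indicator {0<..} (0 + 1 / ?N * x) * (exp (- (0 + 1 / ?N * x)) ^ n * f (0 + 1 / ?N * x) * exp (- (0 + 1 / ?N * x))))
     = (\<lambda>x. indicator {0<..} x *\<^sub>R (f (x / ?N) * exp (- x)))"
  proof
    fix x :: real
    have "exp (- (0 + 1 / ?N * x)) ^ n * exp (- (0 + 1 / ?N * x)) = exp (- (x / ?N)) ^ Suc n" by simp
    also have "\<dots> = exp (?N * - (x / ?N))" by (simp only: exp_of_nat_mult)
    also have "\<dots> = exp (- x)" by simp
    finally have "exp (- (0 + 1 / ?N * x)) ^ n * exp (- (0 + 1 / ?N * x)) = exp (- x)" .
    moreover have "indicator {0<..} (0 + 1 / ?N * x) = (indicator {0<..} x :: real)"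
      by (auto simp: indicator_def zero_less_divide_iff)
    ultimately have "indicator {0<..} (0 + 1 / ?N * x) * (f (0 + 1 / ?N * x) * (exp (- (0 + 1 / ?N * x)) ^ n * exp (- (0 + 1 / ?N * x))))
       = indicator {0<..} x *\<^sub>R (f (x / ?N) * exp (- x))"
      by (simp only:) simp
    then show "indicator {0<..} (0 + 1 / ?N * x) * (exp (- (0 + 1 / ?N * x)) ^ n * f (0 + 1 / ?N * x) * exp (- (0 + 1 / ?N * x)))
       = indicator {0<..} x *\<^sub>R (f (x / ?N) * exp (- x))"
      by (simp only: mult_ac)
  qed
  finally show ?thesis by (subst integral_expm) (auto simp: set_lebesgue_integral_def)
qed

text \<open>The scales 1 / N give all moments of exp(- x) against d = f - g. Testing with exp(- x)
  d(x), viewed as a function of exp(- x), yields a vanishing integral of exp(- x) d(x)^2; so d = 0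
  almost everywhere, and everywhere on x > 0 by continuity.\<close>

lemma expm_fun_unique:
  fixes f g :: "real \<Rightarrow> real"
  assumes cont: "continuous_on {0..} f" "continuous_on {0..} g"
    and [measurable]: "f \<in> borel_measurable borel" "g \<in> borel_measurable borel"
    and bnd: "\<And>x. x > 0 \<Longrightarrow> \<bar>f x\<bar> \<le> A * (1 + x)" "\<And>x. x > 0 \<Longrightarrow> \<bar>g x\<bar> \<le> B * (1 + x)"
    and eq: "\<And>s. s > 0 \<Longrightarrow> (LINT x|expm. f (s * x)) = (LINT x|expm. g (s * x))"
    and y: "y > 0"
  shows "f y = g y"
proof -
  define d where "d x = f x - g x" for x
  have [measurable]: "d \<in> borel_measurable borel" unfolding d_def by measurable
  define C where "C = A + B"
  have dbnd: "\<bar>d x\<bar> \<le> C * (1 + x)" if "x > 0" for x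
    using bnd[OF that] unfolding d_def C_def by (simp add: distrib_right)
  have int: "integrable expm f" "integrable expm g" "integrable expm d"
    by (rule integrable_expm[OF _ bnd(1)], measurable, rule integrable_expm[OF _ bnd(2)], measurable,
      rule integrable_expm[OF _ dbnd], measurable)
  have C0: "C \<ge> 0" using dbnd[of 1] by simp
  \<comment> \<open>Chosen such that \<phi>(exp(- x)) = exp(- x) d(x). The factor x gives continuity
    at 0, where d(- ln x) may grow like - ln x.\<close>
  define \<phi> where "\<phi> x = x * d (- ln x)" for x
  have mom: "(LINT x|expm. exp (- x) ^ n * d x) = (LINT x|expm. exp (- x) ^ n * 0)" for n :: nat
  proof -
    have i: "integrable expm (\<lambda>x. exp (- x) ^ n * h x)" if "integrable expm h" for h
    proof (rule Bochner_Integration.integrable_bound[OF that])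
      show "AE x in expm. norm (exp (- x) ^ n * h x) \<le> norm (h x)"
        using AE_expm by eventually_elim (auto simp: abs_mult intro!: mult_left_le_one_le power_le_one)
    qed (use that in measurable)
    have "(LINT x|expm. exp (- x) ^ n * f x) = (LINT x|expm. exp (- x) ^ n * g x)"
      using eq[of "1 / real (Suc n)"] integral_expm_scale[of f n] integral_expm_scale[of g n] by simp
    then show ?thesis unfolding d_def using i[OF int(1)] i[OF int(2)] by (simp add: right_diff_distrib)
  qed
  have cd: "continuous_on {0..} d" unfolding d_def by (intro continuous_intros cont)
  have "continuous_on {0..1} \<phi>"
    unfolding continuous_on_def
  proof
    fix x :: real assume x: "x \<in> {0..1}"
    show "(\<phi> \<longlongrightarrow> \<phi> x) (at x within {0..1})"
    proof (cases "x = 0")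
      case True
      have "((\<lambda>x. x * (C * (1 + - ln x))) \<longlongrightarrow> 0) (at_right (0::real))" by real_asymp
      moreover have "\<forall>\<^sub>F x in at_right 0. norm (\<phi> x) \<le> x * (C * (1 + - ln x))"
        using eventually_at_right_real[OF zero_less_one]
      proof eventually_elim
        case (elim x)
        then show ?case using dbnd[of "- ln x"] by (auto simp: \<phi>_def abs_mult)
      qed
      ultimately have "(\<phi> \<longlongrightarrow> 0) (at_right 0)" by (rule Lim_null_comparison[rotated])
      then show ?thesis using True by (simp add: at_within_Icc_at_right \<phi>_def)
    next
      case False
      have "continuous_on {0<..1} \<phi>" unfolding \<phi>_def
        by (intro continuous_intros continuous_on_compose2[OF cd]) auto
      then have "(\<phi> \<longlongrightarrow> \<phi> x) (at x within {0<..1})" using x False by (auto simp: continuous_on_def)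
      moreover have "at x within {0<..1} = at x within {0..1}"
        by (rule at_within_nhd[of x "{0<..}"]) (use x False in auto)
      ultimately show ?thesis by simp
    qed
  qed
  then have "(LINT x|expm. \<phi> (unit_clip (exp (- x))) * d x) = (LINT x|expm. \<phi> (unit_clip (exp (- x))) * 0)"
    by (intro moments_determine[where X="\<lambda>x. exp (- x)" and Y="\<lambda>x. exp (- x)"] mom int(3)) (use AE_expm in auto)
  then have 0: "(LINT x|expm. \<phi> (unit_clip (exp (- x))) * d x) = 0" by simp
  have eqd: "AE x in expm. \<phi> (unit_clip (exp (- x))) * d x = exp (- x) * (d x * d x)"
    using AE_expm by eventually_elim (simp add: \<phi>_def)
  have "(LINT x|expm. \<phi> (unit_clip (exp (- x))) * d x) = (LINT x|expm. exp (- x) * (d x * d x))"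
    by (rule integral_cong_AE[OF _ _ eqd]) (unfold \<phi>_def, measurable)
  with 0 have 1: "(LINT x|expm. exp (- x) * (d x * d x)) = 0" by simp
  have "integrable expm (\<lambda>x. exp (- x) * (d x * d x))"
  proof (rule integrable_expm[where A="C * C"])
    fix x :: real assume x: "x > 0"
    \<comment> \<open>This reduces the quadratic growth of d^2 to the linear growth that
      \<open>integrable_expm\<close> accepts.\<close>
    have "exp (- x) * (1 + x) \<le> 1" using exp_ge_add_one_self[of x] by (simp add: exp_minus field_simps)
    then have 2: "C * C * (1 + x) * (exp (- x) * (1 + x)) \<le> C * C * (1 + x) * 1"
      using C0 x by (intro mult_left_mono) auto
    have "\<bar>d x\<bar> * \<bar>d x\<bar> \<le> (C * (1 + x)) * (C * (1 + x))"
      using dbnd[OF x] C0 x by (intro mult_mono) auto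
    then have "exp (- x) * (\<bar>d x\<bar> * \<bar>d x\<bar>) \<le> exp (- x) * ((C * (1 + x)) * (C * (1 + x)))"
      by (intro mult_left_mono) auto
    also have "\<dots> = C * C * (1 + x) * (exp (- x) * (1 + x))" by (simp only: mult_ac)
    also have "\<dots> \<le> C * C * (1 + x)" using 2 by simp
    finally show "\<bar>exp (- x) * (d x * d x)\<bar> \<le> C * C * (1 + x)" by (simp only: abs_mult abs_exp_cancel)
  qed measurable
  then have "AE x in expm. exp (- x) * (d x * d x) = 0"
    using 1 by (subst (asm) integral_nonneg_eq_0_iff_AE) auto
  then have AE0: "AE x in lborel. x > 0 \<longrightarrow> d x = 0"
    unfolding expm_def by (subst (asm) AE_density) (auto simp: indicator_def)
  have "d y = 0"
  proof (rule ccontr)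
    assume "d y \<noteq> 0"
    moreover have "isCont d y"
    proof -
      have "continuous_on {0<..} d" by (rule continuous_on_subset[OF cd]) auto
      then show ?thesis using y by (auto simp: continuous_on_eq_continuous_at)
    qed
    ultimately obtain e where e: "e > 0" "\<And>x. dist y x < e \<Longrightarrow> d x \<noteq> 0"
      using continuous_at_avoid by blast
    define e' where "e' = min e y"
    have e': "e' > 0" "e' \<le> e" "e' \<le> y" using e y by (auto simp: e'_def)
    have "AE x in lborel. x \<notin> {y - e'<..<y + e'}"
      using AE0
    proof eventually_elim
      case (elim x)
      show ?case
      proof
        assume x: "x \<in> {y - e'<..<y + e'}"
        then have "dist y x < e" "x > 0" using e' by (auto simp: dist_real_def abs_less_iff)
        then show False using elim e(2) by auto
      qed
    qed
    then have "emeasure lborel {y - e'<..<y + e'} = 0" by (subst (asm) AE_iff_null_sets[symmetric]) auto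
    then show False using e' by simp
  qed
  then show ?thesis by (simp add: d_def)
qed


section \<open>Bounds, continuity and uniqueness for L, C, LC and M\<close>

lemma L_le_1:
  assumes "\<mu> \<in> Pplus" "t \<le> 0"
  shows "L_tr \<mu> t \<le> 1"
proof -
  interpret real_distribution \<mu> using assms by (simp add: Pplus_def)
  have "L_tr \<mu> t \<le> (LINT u|\<mu>. 1)" unfolding L_tr_def
  proof (rule integral_mono_AE)
    show "AE u in \<mu>. exp (t * u) \<le> 1"
      using Pplus_AE[OF assms(1)] by eventually_elim (use assms(2) in \<open>simp add: mult_nonpos_nonneg\<close>)
  qed (use integrable_L[OF assms] in auto)
  then show ?thesis by (simp add: prob_space[simplified])
qed

text \<open>More than half of the mass lies below some K. The resulting exponential lower bound
  makes C grow at most linearly, so the integral LC converges.\<close>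

lemma L_ge:
  assumes \<mu>: "\<mu> \<in> Pplus"
  obtains K where "K \<ge> 0" "\<And>t. t \<le> 0 \<Longrightarrow> L_tr \<mu> t \<ge> exp (t * K) / 2"
proof -
  interpret real_distribution \<mu> using \<mu> by (simp add: Pplus_def)
  have "eventually (\<lambda>x. cdf \<mu> x > 1 / 2) at_top"
    using cdf_lim_at_top_prob by (rule order_tendstoD) simp
  then obtain K where K: "K \<ge> 0" "cdf \<mu> K > 1 / 2"
    by (metis (mono_tags, lifting) eventually_at_top_linorder linorder_linear order_refl)
  show ?thesis
  proof (rule that[OF K(1)])
    fix t :: real assume t: "t \<le> 0"
    have "exp (t * K) / 2 \<le> exp (t * K) * cdf \<mu> K" using K(2) by simp
    also have "\<dots> = (LINT u|\<mu>. exp (t * K) * indicator {..K} u)" by (simp add: cdf_def)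
    also have "\<dots> \<le> L_tr \<mu> t" unfolding L_tr_def
    proof (rule integral_mono)
      show "exp (t * K) * indicator {..K} u \<le> exp (t * u)" for u
        using t by (auto simp: indicator_def mult_left_mono_neg)
    qed (use integrable_L[OF \<mu> t] in \<open>auto simp: less_top[symmetric]\<close>)
    finally show "L_tr \<mu> t \<ge> exp (t * K) / 2" .
  qed
qed

lemma L_pos: "\<mu> \<in> Pplus \<Longrightarrow> t \<le> 0 \<Longrightarrow> L_tr \<mu> t > 0"
  using L_ge[of \<mu>] by (metis exp_gt_zero half_gt_zero less_le_trans)

lemma L_0: "\<mu> \<in> Pplus \<Longrightarrow> L_tr \<mu> 0 = 1"
  using prob_space.prob_space[OF Pplus_prob] by (simp add: L_tr_def)

lemma L_continuous:
  assumes \<mu>: "\<mu> \<in> Pplus"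
  shows "continuous_on {..0} (L_tr \<mu>)"
  unfolding continuous_on_sequentially
proof (intro allI ballI impI)
  interpret real_distribution \<mu> using \<mu> by (simp add: Pplus_def)
  fix x and a :: real assume "a \<in> {..0}" and "(\<forall>n. x n \<in> {..0}) \<and> x \<longlonglongrightarrow> a"
  then have x: "\<And>n. x n \<le> 0" "x \<longlonglongrightarrow> a" by auto
  show "(L_tr \<mu> \<circ> x) \<longlonglongrightarrow> L_tr \<mu> a"
    unfolding o_def L_tr_def
  proof (rule integral_dominated_convergence[where w="\<lambda>_. 1"])
    show "AE u in \<mu>. norm (exp (x n * u)) \<le> 1" for n
      using Pplus_AE[OF \<mu>] by eventually_elim (use x(1)[of n] in \<open>simp add: mult_nonpos_nonneg\<close>)
    show "AE u in \<mu>. (\<lambda>n. exp (x n * u)) \<longlonglongrightarrow> exp (a * u)"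
      by (intro AE_I2 tendsto_intros x)
  qed auto
qed

lemma C_eq: "C_tr \<mu> t = ln (L_tr \<mu> t)"
  by (simp add: C_tr_def L_tr_def)

lemma C_nonpos: "\<mu> \<in> Pplus \<Longrightarrow> t \<le> 0 \<Longrightarrow> C_tr \<mu> t \<le> 0"
  using L_le_1[of \<mu> t] L_pos[of \<mu> t] by (simp add: C_eq)

lemma C_0: "\<mu> \<in> Pplus \<Longrightarrow> C_tr \<mu> 0 = 0"
  by (simp add: C_eq L_0)

lemma C_continuous: "\<mu> \<in> Pplus \<Longrightarrow> continuous_on {..0} (C_tr \<mu>)"
  unfolding C_eq[abs_def] using L_pos[of \<mu>]
  by (intro continuous_on_ln L_continuous) (auto simp: less_imp_neq[symmetric])

lemma C_bound:
  assumes \<mu>: "\<mu> \<in> Pplus"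
  obtains A where "A \<ge> 0" "\<And>t. t \<le> 0 \<Longrightarrow> \<bar>C_tr \<mu> t\<bar> \<le> A * (1 - t)"
proof -
  obtain K where K: "K \<ge> 0" "\<And>t. t \<le> 0 \<Longrightarrow> L_tr \<mu> t \<ge> exp (t * K) / 2"
    using L_ge[OF \<mu>] by blast
  show ?thesis
  proof (rule that[of "max (ln 2) K"])
    fix t :: real assume t: "t \<le> 0"
    have "ln (exp (t * K) / 2) \<le> C_tr \<mu> t"
      unfolding C_eq using K(2)[OF t] L_pos[OF \<mu> t] by (intro ln_mono) auto
    then have "- C_tr \<mu> t \<le> ln 2 + (- t) * K" by (simp add: ln_div)
    also have "\<dots> \<le> max (ln 2) K * 1 + (- t) * max (ln 2) K"
      using t by (intro add_mono mult_left_mono) auto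
    finally show "\<bar>C_tr \<mu> t\<bar> \<le> max (ln 2) K * (1 - t)"
      using C_nonpos[OF \<mu> t] by (simp add: algebra_simps)
  qed (use K in auto)
qed

lemma L_measurable: "\<mu> \<in> Pplus \<Longrightarrow> L_tr \<mu> \<in> borel_measurable borel"
proof -
  assume \<mu>: "\<mu> \<in> Pplus"
  interpret real_distribution \<mu> using \<mu> by (simp add: Pplus_def)
  show ?thesis unfolding L_tr_def by measurable
qed

lemma C_measurable: "\<mu> \<in> Pplus \<Longrightarrow> C_tr \<mu> \<in> borel_measurable borel"
  unfolding C_eq[abs_def] using L_measurable by measurable

lemma LC_expm:
  assumes "\<mu> \<in> Pplus"
  shows "LC \<mu> t = (LINT x|expm. C_tr \<mu> (t * x))"
proof -
  have [measurable]: "C_tr \<mu> \<in> borel_measurable borel" by (rule C_measurable[OF assms])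
  show ?thesis unfolding LC_def by (subst integral_expm) simp_all
qed

lemma LC_unique:
  assumes \<mu>: "\<mu> \<in> Pplus" and \<nu>: "\<nu> \<in> Pplus" and eq: "\<And>t. t < 0 \<Longrightarrow> LC \<mu> t = LC \<nu> t"
  shows "\<mu> = \<nu>"
proof (rule laplace_unique[OF \<mu> \<nu>])
  fix t :: real assume t: "t < 0"
  obtain A where A: "A \<ge> 0" "\<And>t. t \<le> 0 \<Longrightarrow> \<bar>C_tr \<mu> t\<bar> \<le> A * (1 - t)" using C_bound[OF \<mu>] by blast
  obtain B where B: "B \<ge> 0" "\<And>t. t \<le> 0 \<Longrightarrow> \<bar>C_tr \<nu> t\<bar> \<le> B * (1 - t)" using C_bound[OF \<nu>] by blast
  have [measurable]: "C_tr \<mu> \<in> borel_measurable borel" "C_tr \<nu> \<in> borel_measurable borel"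
    using \<mu> \<nu> by (auto intro: C_measurable)
  have "C_tr \<mu> (- (- t)) = C_tr \<nu> (- (- t))"
  proof (rule expm_fun_unique[where f="\<lambda>y. C_tr \<mu> (- y)" and g="\<lambda>y. C_tr \<nu> (- y)"])
    show "continuous_on {0..} (\<lambda>y. C_tr \<mu> (- y))"
      by (rule continuous_on_compose2[OF C_continuous[OF \<mu>]]) (auto intro!: continuous_intros)
    show "continuous_on {0..} (\<lambda>y. C_tr \<nu> (- y))"
      by (rule continuous_on_compose2[OF C_continuous[OF \<nu>]]) (auto intro!: continuous_intros)
    show "\<bar>C_tr \<mu> (- x)\<bar> \<le> A * (1 + x)" if "x > 0" for x using A(2)[of "- x"] that by simp
    show "\<bar>C_tr \<nu> (- x)\<bar> \<le> B * (1 + x)" if "x > 0" for x using B(2)[of "- x"] that by simp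
    show "(LINT x|expm. C_tr \<mu> (- (s * x))) = (LINT x|expm. C_tr \<nu> (- (s * x)))" if "s > 0" for s
      using eq[of "- s"] that by (simp add: LC_expm \<mu> \<nu>)
  qed (measurable, measurable, use t in simp)
  then show "L_tr \<mu> t = L_tr \<nu> t"
    using t L_pos[OF \<mu>, of t] L_pos[OF \<nu>, of t] by (simp add: C_eq)
qed

lemma integral_expm_exp:
  assumes "c \<ge> 0"
  shows "(LINT x|expm. exp (- c * x)) = 1 / (1 + c)"
proof -
  have "(LINT x|expm. exp (- c * x)) = (LINT x:{0<..}|lborel. exp (- c * x) * exp (- x))"
    by (rule integral_expm) simp
  also have "(\<lambda>x. exp (- c * x) * exp (- x)) = (\<lambda>x. exp (- (x * (1 + c))))"
    by (auto simp: exp_add[symmetric] algebra_simps)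
  also have "(LINT x:{0<..}|lborel. exp (- (x * (1 + c)))) = (LBINT x=ereal 0..\<infinity>. exp (- (x * (1 + c))))"
    by (simp only: interval_integral_to_infinity_eq)
  also have "\<dots> = 1 / (1 + c)" using LBINT_I0i_exp_mscale[of "1 + c"] assms by (simp add: zero_ereal_def)
  finally show ?thesis .
qed

text \<open>Fubini, with the exponential average of exp(t u x) equal to 1 / (1 - t u).\<close>

lemma M_eq_expm_L:
  assumes \<mu>: "\<mu> \<in> Pplus" and t: "t \<le> 0"
  shows "M_tr \<mu> t = (LINT x|expm. L_tr \<mu> (t * x))"
proof -
  interpret real_distribution \<mu> using \<mu> by (simp add: Pplus_def)
  interpret P: pair_prob_space expm \<mu> ..
  \<comment> \<open>Truncation at 0 makes the integrand bounded by 1 everywhere on the product space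
    and changes it only on null sets.\<close>
  define F where "F x u = exp (t * max 0 x * max 0 u)" for x u :: real
  have "integrable (expm \<Otimes>\<^sub>M \<mu>) (\<lambda>(x, u). F x u)"
  proof (rule P.integrable_const_bound[where B=1])
    show "AE x in expm \<Otimes>\<^sub>M \<mu>. norm (case x of (x, u) \<Rightarrow> F x u) \<le> 1"
      using t by (auto simp: F_def mult_nonpos_nonneg)
    show "(\<lambda>(x, u). F x u) \<in> borel_measurable (expm \<Otimes>\<^sub>M \<mu>)"
      unfolding F_def by measurable
  qed
  from P.Fubini_integral[OF this]
  have "(LINT u|\<mu>. LINT x|expm. F x u) = (LINT x|expm. LINT u|\<mu>. F x u)" .
  also have "(LINT x|expm. LINT u|\<mu>. F x u) = (LINT x|expm. L_tr \<mu> (t * x))"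
  proof (rule integral_cong_AE)
    show "AE x in expm. (LINT u|\<mu>. F x u) = L_tr \<mu> (t * x)" using AE_expm
    proof eventually_elim
      case (elim x)
      show ?case unfolding L_tr_def F_def
      proof (rule integral_cong_AE)
        show "AE u in \<mu>. exp (t * max 0 x * max 0 u) = exp (t * x * u)"
          using Pplus_AE[OF \<mu>] by eventually_elim (use elim in simp)
      qed measurable
    qed
    show "(\<lambda>x. LINT u|\<mu>. F x u) \<in> borel_measurable expm" unfolding F_def by measurable
    show "(\<lambda>x. L_tr \<mu> (t * x)) \<in> borel_measurable expm" using L_measurable[OF \<mu>] by measurable
  qed
  also have "(LINT u|\<mu>. LINT x|expm. F x u) = M_tr \<mu> t"
    unfolding M_tr_def
  proof (rule integral_cong_AE)
    show "AE u in \<mu>. (LINT x|expm. F x u) = 1 / (1 - t * u)"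
      using Pplus_AE[OF \<mu>]
    proof eventually_elim
      case (elim u)
      have "(LINT x|expm. F x u) = (LINT x|expm. exp (- (- t * u) * x))"
      proof (rule integral_cong_AE)
        show "AE x in expm. F x u = exp (- (- t * u) * x)"
          using AE_expm by eventually_elim (use elim in \<open>simp add: F_def mult_ac\<close>)
      qed (unfold F_def, measurable)
      also have "\<dots> = 1 / (1 + (- t * u))"
        using t elim by (intro integral_expm_exp) (simp add: mult_nonpos_nonneg)
      finally show ?case by simp
    qed
    show "(\<lambda>u. LINT x|expm. F x u) \<in> borel_measurable \<mu>" unfolding F_def by measurable
  qed measurable
  finally show ?thesis .
qed

lemma M_unique:
  assumes \<mu>: "\<mu> \<in> Pplus" and \<nu>: "\<nu> \<in> Pplus" and eq: "\<And>t. t < 0 \<Longrightarrow> M_tr \<mu> t = M_tr \<nu> t"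
  shows "\<mu> = \<nu>"
proof (rule laplace_unique[OF \<mu> \<nu>])
  fix t :: real assume t: "t < 0"
  have [measurable]: "L_tr \<mu> \<in> borel_measurable borel" "L_tr \<nu> \<in> borel_measurable borel"
    using \<mu> \<nu> by (auto intro: L_measurable)
  have bnd: "\<bar>L_tr \<rho> (- x)\<bar> \<le> 1 * (1 + x)" if "\<rho> \<in> Pplus" "x > 0" for \<rho> x
    using L_le_1[OF that(1), of "- x"] L_pos[OF that(1), of "- x"] that(2) by simp
  have "L_tr \<mu> (- (- t)) = L_tr \<nu> (- (- t))"
  proof (rule expm_fun_unique[where f="\<lambda>y. L_tr \<mu> (- y)" and g="\<lambda>y. L_tr \<nu> (- y)"])
    show "continuous_on {0..} (\<lambda>y. L_tr \<mu> (- y))"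
      by (rule continuous_on_compose2[OF L_continuous[OF \<mu>]]) (auto intro!: continuous_intros)
    show "continuous_on {0..} (\<lambda>y. L_tr \<nu> (- y))"
      by (rule continuous_on_compose2[OF L_continuous[OF \<nu>]]) (auto intro!: continuous_intros)
    show "\<bar>L_tr \<mu> (- x)\<bar> \<le> 1 * (1 + x)" if "x > 0" for x by (rule bnd[OF \<mu> that])
    show "\<bar>L_tr \<nu> (- x)\<bar> \<le> 1 * (1 + x)" if "x > 0" for x by (rule bnd[OF \<nu> that])
    show "(LINT x|expm. L_tr \<mu> (- (s * x))) = (LINT x|expm. L_tr \<nu> (- (s * x)))" if "s > 0" for s
      using eq[of "- s"] that M_eq_expm_L[OF \<mu>, of "- s"] M_eq_expm_L[OF \<nu>, of "- s"] by simp
  qed (measurable, measurable, use t in simp)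
  then show "L_tr \<mu> t = L_tr \<nu> t" by simp
qed


section \<open>R-transforms\<close>

text \<open>The Cauchy transform in the variable t = 1 / s, see \<open>G_eq\<close>; it maps the
  negative half-line into itself.\<close>

definition g_tr :: "real measure \<Rightarrow> real \<Rightarrow> real" where
  "g_tr \<mu> t = t * M_tr \<mu> t"

lemma g_neg: "\<mu> \<in> Pplus \<Longrightarrow> t < 0 \<Longrightarrow> g_tr \<mu> t < 0"
  using M_pos[of \<mu> t] by (simp add: g_tr_def mult_neg_pos)

lemma g_cbf: "\<mu> \<in> Pplus \<Longrightarrow> g_tr \<mu> \<in> cbf"
  unfolding g_tr_def[abs_def] by (rule tM_cbf)

lemma g_lim:
  assumes "\<mu> \<in> Pplus"
  shows "(g_tr \<mu> \<longlongrightarrow> 0) (at_left 0)"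
proof -
  have "((\<lambda>t. t * M_tr \<mu> t) \<longlongrightarrow> 0 * 1) (at_left 0)"
    using M_lim[OF assms] by (intro tendsto_intros)
  then show ?thesis by (simp add: g_tr_def[abs_def])
qed

lemma filterlim_at_leftI:
  fixes f :: "real \<Rightarrow> real"
  assumes "(f \<longlongrightarrow> 0) (at_left 0)" "\<And>t. t < 0 \<Longrightarrow> f t < 0"
  shows "filterlim f (at_left 0) (at_left 0)"
proof -
  have "\<forall>\<^sub>F t in at_left 0. f t \<in> {..<0} \<and> f t \<noteq> 0"
    unfolding eventually_at_filter using assms(2) by (intro always_eventually allI impI) force
  then show ?thesis unfolding filterlim_at using assms(1) by simp
qed

lemma g_filterlim: "\<mu> \<in> Pplus \<Longrightarrow> filterlim (g_tr \<mu>) (at_left 0) (at_left 0)"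
  by (intro filterlim_at_leftI g_lim g_neg)

section \<open>The Cauchy transform and the domain of R\<close>

lemma G_eq:
  assumes "s \<noteq> 0"
  shows "G_tr \<mu> s = g_tr \<mu> (1 / s)"
proof -
  have "1 / (s - x) = 1 / s * (1 / (1 - 1 / s * x))" for x
  proof -
    have "1 - 1 / s * x = (s - x) / s" using assms by (simp add: field_simps)
    then show ?thesis using assms by simp
  qed
  then show ?thesis unfolding G_tr_def g_tr_def M_tr_def by (simp only: integral_mult_right_zero)
qed

lemma g_strict_mono:
  assumes \<mu>: "\<mu> \<in> Pplus" and "s < t" "t < 0"
  shows "g_tr \<mu> s < g_tr \<mu> t"
proof -
  interpret real_distribution \<mu> using \<mu> by (simp add: Pplus_def)
  have "(LINT u|\<mu>. s * (1 / (1 - s * u))) < (LINT u|\<mu>. t * (1 / (1 - t * u)))"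
  proof (rule integral_less_AE_space)
    show "AE u in \<mu>. s * (1 / (1 - s * u)) < t * (1 / (1 - t * u))"
      using Pplus_AE[OF \<mu>]
    proof eventually_elim
      case (elim u)
      have "1 - s * u > 0" "1 - t * u > 0" using one_minus_ge_1[of s u] one_minus_ge_1[of t u] elim assms by auto
      moreover have "s * (1 - t * u) < t * (1 - s * u)" using assms by (simp add: algebra_simps)
      ultimately show ?case by (simp add: divide_less_eq mult.commute pos_divide_less_eq pos_less_divide_eq)
    qed
  qed (use integrable_mult_right[OF integrable_M[OF \<mu>, of s], of s] integrable_mult_right[OF integrable_M[OF \<mu>, of t], of t] assms emeasure_space_1 in auto)
  then show ?thesis unfolding g_tr_def M_tr_def by (simp only: integral_mult_right_zero)
qed

lemma g_inj: "\<mu> \<in> Pplus \<Longrightarrow> inj_on (g_tr \<mu>) {..<0}"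
  using g_strict_mono[of \<mu>] by (intro linorder_inj_onI') (auto dest: less_imp_neq)

lemma minus_g_integral: "- g_tr \<mu> t = (LINT u|\<mu>. - t * (1 / (1 - t * u)))"
  unfolding g_tr_def M_tr_def by (subst integral_mult_right_zero) simp

lemma minus_g_kernel_nonneg: "t < 0 \<Longrightarrow> 0 \<le> u \<Longrightarrow> 0 \<le> - t * (1 / (1 - t * (u::real)))"
  using one_minus_ge_1[of t u] by (intro mult_nonneg_nonneg) auto

lemma g_le_kappa:
  assumes \<mu>: "\<mu> \<in> Pplus" and t: "t < 0"
  shows "ennreal (- g_tr \<mu> t) \<le> kappa \<mu>"
proof -
  interpret real_distribution \<mu> using \<mu> by (simp add: Pplus_def)
  have "- g_tr \<mu> t = (LINT u|\<mu>. - t * (1 / (1 - t * u)))"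
    by (rule minus_g_integral)
  also have "ennreal \<dots> = (\<integral>\<^sup>+ u. ennreal (- t * (1 / (1 - t * u))) \<partial>\<mu>)"
  proof (rule nn_integral_eq_integral[symmetric])
    show "AE u in \<mu>. 0 \<le> - t * (1 / (1 - t * u))"
      using Pplus_AE[OF \<mu>] by eventually_elim (rule minus_g_kernel_nonneg[OF t])
  qed (use integrable_mult_right[OF integrable_M[OF \<mu>, of t], of "- t"] t in auto)
  also have "\<dots> \<le> kappa \<mu>" unfolding kappa_def
  proof (rule nn_integral_mono_AE)
    show "AE u in \<mu>. ennreal (- t * (1 / (1 - t * u))) \<le> inverse (ennreal u)"
      using Pplus_AE[OF \<mu>]
    proof eventually_elim
      case (elim u)
      show ?case
      proof (cases "u = 0")
        case False
        then have u: "u > 0" using elim by simp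
        then have "- t * (1 / (1 - t * u)) \<le> 1 / u"
          using t one_minus_ge_1[of t u] by (simp add: divide_simps)
        then show ?thesis using u by (simp add: inverse_ennreal inverse_eq_divide ennreal_leI)
      qed simp
    qed
  qed
  finally show ?thesis .
qed

text \<open>- g(- N) is the integral of 1 / (1 / N + u), which increases to the integral of 1 /
  u.\<close>

lemma g_tendsto_kappa:
  assumes \<mu>: "\<mu> \<in> Pplus"
  shows "(\<lambda>n. ennreal (- g_tr \<mu> (- real (Suc n)))) \<longlonglongrightarrow> kappa \<mu>"
proof -
  interpret real_distribution \<mu> using \<mu> by (simp add: Pplus_def)
  define f where "f n u = ennreal (1 / (1 / real (Suc n) + max 0 u))" for n u
  have pos: "1 / real (Suc n) + max 0 u > 0" for n u by (intro add_pos_nonneg) auto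
  have "(\<lambda>n. \<integral>\<^sup>+ u. f n u \<partial>\<mu>) \<longlonglongrightarrow> (\<integral>\<^sup>+ u. inverse (ennreal u) \<partial>\<mu>)"
  proof (rule nn_integral_LIMSEQ)
    show "incseq f" unfolding f_def incseq_def le_fun_def
      using pos by (intro allI impI ennreal_leI frac_le add_right_mono) auto
    show "f n \<in> borel_measurable \<mu>" for n unfolding f_def by measurable
    show "(\<lambda>n. f n u) \<longlonglongrightarrow> inverse (ennreal u)" for u
    proof (cases "u > 0")
      case False
      then have "f n u = of_nat (Suc n)" for n
        by (simp add: f_def ennreal_of_nat_eq_real_of_nat max_def del: of_nat_Suc)
      then show ?thesis using False LIMSEQ_Suc[OF of_nat_tendsto_top_ennreal] by (simp add: ennreal_neg)
    next
      case True
      have "(\<lambda>n. 1 / real (Suc n)) \<longlonglongrightarrow> 0" by real_asymp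
      then have "(\<lambda>n. 1 / (1 / real (Suc n) + max 0 u)) \<longlonglongrightarrow> 1 / (0 + max 0 u)"
        using True by (intro tendsto_intros) auto
      then have "(\<lambda>n. f n u) \<longlonglongrightarrow> ennreal (1 / u)"
        unfolding f_def using True by (intro tendsto_ennrealI) simp
      then show ?thesis using True by (simp add: inverse_ennreal inverse_eq_divide)
    qed
  qed
  moreover have "(\<integral>\<^sup>+ u. f n u \<partial>\<mu>) = ennreal (- g_tr \<mu> (- real (Suc n)))" for n
  proof -
    let ?t = "- real (Suc n)"
    have "- g_tr \<mu> ?t = (LINT u|\<mu>. - ?t * (1 / (1 - ?t * u)))"
      by (rule minus_g_integral)
    also have "ennreal \<dots> = (\<integral>\<^sup>+ u. ennreal (- ?t * (1 / (1 - ?t * u))) \<partial>\<mu>)"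
    proof (rule nn_integral_eq_integral[symmetric])
      show "AE u in \<mu>. 0 \<le> - ?t * (1 / (1 - ?t * u))"
        using Pplus_AE[OF \<mu>] by eventually_elim (rule minus_g_kernel_nonneg, simp)
    qed (use integrable_mult_right[OF integrable_M[OF \<mu>, of ?t], of "- ?t"] in auto)
    also have "\<dots> = (\<integral>\<^sup>+ u. f n u \<partial>\<mu>)"
    proof (rule nn_integral_cong_AE)
      show "AE u in \<mu>. ennreal (- ?t * (1 / (1 - ?t * u))) = f n u"
        using Pplus_AE[OF \<mu>]
      proof eventually_elim
        case (elim u)
        have "1 / real (Suc n) + u = (1 - ?t * u) / real (Suc n)" by (simp add: field_simps)
        then have "1 / (1 / real (Suc n) + u) = - ?t * (1 / (1 - ?t * u))" by simp
        then show ?case using elim by (simp add: f_def del: of_nat_Suc)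
      qed
    qed
    finally show ?thesis by simp
  qed
  ultimately show ?thesis by (simp add: kappa_def)
qed

text \<open>g is continuous, tends to 0 at 0 and approaches - \<kappa> at - \<infinity>;
  intermediate values give one inclusion and strict monotonicity the other.\<close>

lemma R_dom_eq:
  assumes \<mu>: "\<mu> \<in> Pplus"
  shows "R_dom \<mu> = g_tr \<mu> ` {..<0}"
proof safe
  fix t assume "t \<in> R_dom \<mu>"
  then have t: "t < 0" "ennreal (- t) < kappa \<mu>" by (auto simp: R_dom_def)
  have "eventually (\<lambda>n. ennreal (- t) < ennreal (- g_tr \<mu> (- real (Suc n)))) sequentially"
    by (rule order_tendstoD(1)[OF g_tendsto_kappa[OF \<mu>] t(2)])
  then obtain n where "ennreal (- t) < ennreal (- g_tr \<mu> (- real (Suc n)))"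
    by (auto simp: eventually_sequentially)
  then have n: "g_tr \<mu> (- real (Suc n)) < t" using t by (simp add: ennreal_less_iff del: of_nat_Suc)
  have "eventually (\<lambda>x. g_tr \<mu> x > t) (at_left 0)" using order_tendstoD(1)[OF g_lim[OF \<mu>] t(1)] .
  moreover have "eventually (\<lambda>x. x \<in> {- real (Suc n)<..<0}) (at_left 0)"
    by (rule eventually_at_left_real) simp
  ultimately have "eventually (\<lambda>x. g_tr \<mu> x > t \<and> x \<in> {- real (Suc n)<..<0}) (at_left 0)"
    by (rule eventually_conj)
  then obtain x where x: "g_tr \<mu> x > t" "x < 0" "- real (Suc n) < x"
    using eventually_happens by (force simp: trivial_limit_at_left_real)
  have "\<exists>y\<ge>- real (Suc n). y \<le> x \<and> g_tr \<mu> y = t"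
  proof (rule IVT')
    show "continuous_on {- real (Suc n)..x} (g_tr \<mu>)"
      by (rule continuous_on_subset[OF cbf_continuous[OF g_cbf[OF \<mu>]]]) (use x in auto)
  qed (use n x in auto)
  then show "t \<in> g_tr \<mu> ` {..<0}" using x by force
next
  fix x :: real assume x: "x < 0"
  \<comment> \<open>2 x is just some point to the left of x; it makes the inequality with \<kappa>
    strict.\<close>
  have "- g_tr \<mu> x < - g_tr \<mu> (2 * x)" using g_strict_mono[OF \<mu>, of "2 * x" x] x by simp
  then have "ennreal (- g_tr \<mu> x) < ennreal (- g_tr \<mu> (2 * x))"
    using g_neg[OF \<mu> x] by (simp add: ennreal_less_iff)
  also have "\<dots> \<le> kappa \<mu>" using x by (intro g_le_kappa[OF \<mu>]) simp
  finally show "g_tr \<mu> x \<in> R_dom \<mu>" using g_neg[OF \<mu> x] by (simp add: R_dom_def)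
qed

lemma R_dom_neg: "t \<in> R_dom \<mu> \<Longrightarrow> t < 0"
  by (simp add: R_dom_def)

lemma R_dom_linear: "R_dom \<mu> \<subseteq> R_dom \<nu> \<or> R_dom \<nu> \<subseteq> R_dom \<mu>"
  unfolding R_dom_def using linear[of "kappa \<mu>" "kappa \<nu>"] by (auto intro: less_le_trans)

text \<open>The inverse of G sends g(t) to 1 / t, so R at g(t) is g(t) / t - 1.\<close>

lemma R_tr_g:
  assumes \<mu>: "\<mu> \<in> Pplus" and t: "t < 0"
  shows "R_tr \<mu> (g_tr \<mu> t) = M_tr \<mu> t - 1"
proof -
  have inj: "inj_on (G_tr \<mu>) {..<0}"
  proof (rule inj_onI)
    fix x y assume "x \<in> {..<0}" "y \<in> {..<0}" "G_tr \<mu> x = G_tr \<mu> y"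
    then have "1 / x = 1 / y" using inj_onD[OF g_inj[OF \<mu>], of "1 / x" "1 / y"] by (auto simp: G_eq)
    then show "x = y" by simp
  qed
  have "inv_into {..<0} (G_tr \<mu>) (G_tr \<mu> (1 / t)) = 1 / t"
    by (rule inv_into_f_f[OF inj]) (use t in auto)
  moreover have "G_tr \<mu> (1 / t) = g_tr \<mu> t" using t by (simp add: G_eq)
  ultimately have "inv_into {..<0} (G_tr \<mu>) (g_tr \<mu> t) = 1 / t" by simp
  then show ?thesis using t by (simp add: R_tr_def g_tr_def)
qed

text \<open>Domains of R-transforms are nested intervals ending at 0. On the smaller one each value
  g(x) of one measure is a value g(y) of the other; equal R there means equal M, and then x = y
  because t = g / M.\<close>

lemma R_unique:
  assumes "\<mu> \<in> Pplus" "\<nu> \<in> Pplus"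
    and "\<And>t. t \<in> R_dom \<mu> \<Longrightarrow> R_tr \<mu> t = f t" "\<And>t. t \<in> R_dom \<nu> \<Longrightarrow> R_tr \<nu> t = f t"
  shows "\<mu> = \<nu>"
proof -
  have main: "\<mu> = \<nu>" if \<mu>: "\<mu> \<in> Pplus" and \<nu>: "\<nu> \<in> Pplus" and sub: "R_dom \<mu> \<subseteq> R_dom \<nu>"
    and eq: "\<And>t. t \<in> R_dom \<mu> \<Longrightarrow> R_tr \<mu> t = f t" "\<And>t. t \<in> R_dom \<nu> \<Longrightarrow> R_tr \<nu> t = f t" for \<mu> \<nu>
  proof (rule M_unique[OF \<mu> \<nu>])
    fix x :: real assume x: "x < 0"
    have d: "g_tr \<mu> x \<in> R_dom \<mu>" using R_dom_eq[OF \<mu>] x by auto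
    then have "g_tr \<mu> x \<in> g_tr \<nu> ` {..<0}" using sub R_dom_eq[OF \<nu>] by auto
    then obtain y where y: "y < 0" "g_tr \<mu> x = g_tr \<nu> y" by auto
    have "M_tr \<mu> x - 1 = M_tr \<nu> y - 1"
      using R_tr_g[OF \<mu> x] R_tr_g[OF \<nu> y(1)] eq(1)[OF d] eq(2)[of "g_tr \<mu> x"] sub d y(2) by auto
    moreover from this have "x = y" using y(2) M_pos[OF \<mu>, of x] x by (simp add: g_tr_def)
    ultimately show "M_tr \<mu> x = M_tr \<nu> x" by simp
  qed
  show ?thesis using R_dom_linear[of \<mu> \<nu>]
  proof
    assume "R_dom \<mu> \<subseteq> R_dom \<nu>"
    then show ?thesis using assms by (intro main)
  next
    assume "R_dom \<nu> \<subseteq> R_dom \<mu>"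
    then show ?thesis using assms by (intro main[symmetric])
  qed
qed

section \<open>Measures with a prescribed R-transform\<close>

lemma boxplus_eq:
  assumes "\<rho> \<in> Pplus" "\<And>t. t \<in> R_dom \<rho> \<Longrightarrow> R_tr \<rho> t = R_tr \<mu> t + R_tr \<nu> t"
  shows "boxplus \<mu> \<nu> = \<rho>"
  unfolding boxplus_def
proof (rule the_equality)
  show "\<rho>' = \<rho>" if "\<rho>' \<in> Pplus \<and> (\<forall>t\<in>R_dom \<rho>'. R_tr \<rho>' t = R_tr \<mu> t + R_tr \<nu> t)" for \<rho>'
    using that assms by (intro R_unique[where f="\<lambda>t. R_tr \<mu> t + R_tr \<nu> t"]) auto
qed (use assms in auto)

text \<open>h continues the R-transform to all t < 0; the domain of R itself is the part where 1 + h
  > 0 (\<open>isR_dom\<close>).\<close>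

definition isR :: "real measure \<Rightarrow> (real \<Rightarrow> real) \<Rightarrow> bool" where
  "isR \<mu> h \<longleftrightarrow> \<mu> \<in> Pplus \<and> h \<in> cbf0 \<and> (\<forall>t<0. M_tr \<mu> t = 1 + h (g_tr \<mu> t))"

text \<open>Since x < 0 and h is nondecreasing, m \<mapsto> 1 + h(x m) is nonincreasing and has at
  most one fixed point.\<close>

lemma fix_unique:
  assumes "h \<in> cbf" "x < 0" "0 < m" "0 < m'" "m = 1 + h (x * m)" "m' = 1 + h (x * m')"
  shows "m = m'"
proof -
  have *: "\<not> a < b" if "0 < a" "0 < b" "a = 1 + h (x * a)" "b = 1 + h (x * b)" for a b
  proof
    assume "a < b"
    then have "x * b \<le> x * a" "x * a < 0" using assms(2) that by (auto simp: mult_left_mono_neg mult_neg_pos)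
    then have "h (x * b) \<le> h (x * a)" by (rule cbf_mono[OF assms(1)])
    then show False using that \<open>a < b\<close> by linarith
  qed
  show ?thesis using *[of m m'] *[of m' m] assms by linarith
qed

text \<open>If 1 + h(t) > 0, put x = t / (1 + h(t)). Then m = 1 + h(t) solves m = 1 + h(x m), so
  uniqueness gives M(x) = m and g(x) = t.\<close>

lemma isR_dom:
  assumes "isR \<mu> h"
  shows "R_dom \<mu> = {t. t < 0 \<and> 1 + h t > 0}"
proof -
  have \<mu>: "\<mu> \<in> Pplus" and h: "h \<in> cbf" and eq: "\<And>t. t < 0 \<Longrightarrow> M_tr \<mu> t = 1 + h (g_tr \<mu> t)"
    using assms by (auto simp: isR_def cbf0_def)
  show ?thesis unfolding R_dom_eq[OF \<mu>]
  proof safe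
    fix x :: real assume x: "x < 0"
    show "g_tr \<mu> x < 0" by (rule g_neg[OF \<mu> x])
    show "1 + h (g_tr \<mu> x) > 0" using eq[OF x] M_pos[OF \<mu>, of x] x by simp
  next
    fix t assume t: "t < 0" "1 + h t > 0"
    define x where "x = t / (1 + h t)"
    have x: "x < 0" using t by (simp add: x_def divide_neg_pos)
    have "M_tr \<mu> x = 1 + h t"
    proof (rule fix_unique[OF h x])
      show "M_tr \<mu> x > 0" using M_pos[OF \<mu>] x by simp
      show "M_tr \<mu> x = 1 + h (x * M_tr \<mu> x)" using eq[OF x] by (simp add: g_tr_def)
      show "1 + h t = 1 + h (x * (1 + h t))" using t by (simp add: x_def)
    qed (use t in auto)
    then have "g_tr \<mu> x = t" using t by (simp add: g_tr_def x_def)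
    then show "t \<in> g_tr \<mu> ` {..<0}" using x by auto
  qed
qed

lemma isR_R:
  assumes "isR \<mu> h" "t \<in> R_dom \<mu>"
  shows "R_tr \<mu> t = h t"
proof -
  have \<mu>: "\<mu> \<in> Pplus" and eq: "\<And>t. t < 0 \<Longrightarrow> M_tr \<mu> t = 1 + h (g_tr \<mu> t)"
    using assms by (auto simp: isR_def)
  obtain x where "x < 0" "t = g_tr \<mu> x" using assms(2) R_dom_eq[OF \<mu>] by auto
  then show ?thesis using R_tr_g[OF \<mu>] eq by simp
qed

lemma isR_I:
  assumes "\<mu> \<in> Pplus" "h \<in> cbf0" "\<And>t. t \<in> R_dom \<mu> \<Longrightarrow> R_tr \<mu> t = h t"
  shows "isR \<mu> h"
  unfolding isR_def
proof (intro conjI assms(1,2) allI impI)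
  fix t :: real assume t: "t < 0"
  then have "g_tr \<mu> t \<in> R_dom \<mu>" using R_dom_eq[OF assms(1)] by auto
  then show "M_tr \<mu> t = 1 + h (g_tr \<mu> t)" using R_tr_g[OF assms(1) t] assms(3) by simp
qed

lemma isR_unique:
  assumes "isR \<mu> h" "isR \<nu> h'" "\<And>t. t < 0 \<Longrightarrow> h t = h' t"
  shows "\<mu> = \<nu>"
proof (rule R_unique[where f=h])
  show "R_tr \<nu> t = h t" if "t \<in> R_dom \<nu>" for t
    using isR_R[OF assms(2) that] assms(3) R_dom_neg[OF that] by simp
qed (use assms isR_R in \<open>auto simp: isR_def\<close>)

text \<open>The equation M = 1 + h(t M) is solved by a monotone iteration on functions M with t M in
  the class. Iterating 1 + h(t M) directly could produce negative values; the recursion M / (M - h(t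
  M)) has the same positive fixed points and stays in (0, 1].\<close>

lemma isR_exists:
  assumes h0: "h \<in> cbf0"
  obtains \<mu> where "isR \<mu> h"
proof -
  have h: "h \<in> cbf" using h0 by (rule cbf0_cbf)
  \<comment> \<open>The recursion M / (M - h(t M)), compare \<open>rel\<close>, written as a
    resolvent so that \<open>cbf_comp_div\<close> and \<open>cbf_resolvent\<close> apply.\<close>
  define M where "M = rec_nat (\<lambda>t. 1) (\<lambda>k F t. 1 / (1 - t * h (t * F t) / (t * F t)))"
  have M0: "M 0 = (\<lambda>t. 1)" and MS: "M (Suc k) = (\<lambda>t. 1 / (1 - t * h (t * M k t) / (t * M k t)))" for k
    by (simp_all add: M_def)
  have cb: "(\<lambda>t. t * M k t) \<in> cbf \<and> (\<forall>t<0. 0 < M k t \<and> M k t \<le> 1)" for k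
  proof (induction k)
    case 0
    show ?case by (simp add: M0 cbf_id)
  next
    case (Suc k)
    have p: "(\<lambda>t. t * h (t * M k t) / (t * M k t)) \<in> cbf"
      using Suc by (intro cbf_comp_div[OF h]) auto
    have "(\<lambda>t. t * M (Suc k) t) \<in> cbf" using cbf_resolvent[OF p] unfolding MS by simp
    moreover have "0 < M (Suc k) t \<and> M (Suc k) t \<le> 1" if "t < 0" for t
      using cbf_nonpos[OF p that] unfolding MS by simp
    ultimately show ?case by blast
  qed
  \<comment> \<open>A smaller M gives a larger s = t M, hence a larger slope h(s) / s, a more
    negative t h(s) / s and a smaller next iterate.\<close>
  have dec: "M (Suc k) t \<le> M k t" if t: "t < 0" for k t
  proof (induction k)
    case 0
    show ?case using cb[of 1] t by (simp add: M0)
  next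
    case (Suc k)
    have pos: "0 < M (Suc k) t" "0 < M k t" using cb t by auto
    have le: "t * M k t \<le> t * M (Suc k) t" "t * M (Suc k) t < 0"
      using Suc t pos by (auto simp: mult_left_mono_neg mult_neg_pos)
    have "h (t * M k t) / (t * M k t) \<le> h (t * M (Suc k) t) / (t * M (Suc k) t)"
      by (rule cbf_slope[OF h le])
    then have "t * h (t * M (Suc k) t) / (t * M (Suc k) t) \<le> t * h (t * M k t) / (t * M k t)"
      using t mult_left_mono_neg by (metis less_imp_le times_divide_eq_right)
    moreover have "t * h (t * M k t) / (t * M k t) \<le> 0"
    proof -
      have "t * M k t < 0" using pos t by (simp add: mult_neg_pos)
      from divide_nonpos_neg[OF cbf_nonpos[OF h this] this] mult_nonpos_nonneg[of t "h (t * M k t) / (t * M k t)"]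
      show ?thesis using t \<open>t * M k t < 0\<close> cbf_nonpos[OF h \<open>t * M k t < 0\<close>]
        by (metis divide_nonpos_neg less_imp_le mult_nonpos_nonneg times_divide_eq_right)
    qed
    ultimately show ?case unfolding MS[of "Suc k"] MS[of k]
      by (intro divide_left_mono mult_pos_pos) (auto simp: MS[symmetric])
  qed
  have rel: "M (Suc k) t * (M k t - h (t * M k t)) = M k t" if t: "t < 0" for k t
  proof -
    have pos: "0 < M k t" "t * M k t < 0" using cb t by (auto simp: mult_neg_pos)
    have "M (Suc k) t = M k t / (M k t - h (t * M k t))"
      unfolding MS using t pos by (simp add: field_simps)
    moreover have "M k t - h (t * M k t) > 0" using cbf_nonpos[OF h pos(2)] pos by simp
    ultimately show ?thesis by simp
  qed
  define m where "m t = lim (\<lambda>k. M k t)" for t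
  have lim: "(\<lambda>k. M k t) \<longlonglongrightarrow> m t" if t: "t < 0" for t
  proof -
    have "decseq (\<lambda>k. M k t)" using dec[OF t] by (intro decseq_SucI) simp
    moreover have "0 \<le> M k t" for k using cb[of k] t by (simp add: less_imp_le)
    ultimately obtain L where "(\<lambda>k. M k t) \<longlonglongrightarrow> L" using decseq_convergent[of "\<lambda>k. M k t" 0] by blast
    then show ?thesis unfolding m_def by (simp add: limI)
  qed
  have pos: "0 < m t \<and> m t \<le> 1" if t: "t < 0" for t
  proof -
    have "m t \<le> 1" using cb t by (intro LIMSEQ_le_const2[OF lim[OF t]]) auto
    moreover have "0 \<le> m t" using cb t by (intro LIMSEQ_le_const[OF lim[OF t]]) (auto simp: less_imp_le)
    \<comment> \<open>If the iterates tended to 0, then so would h at t M, because h vanishes at 0.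
      Then M - h(t M) < 1 for some k, and \<open>rel\<close> would force the next iterate to be
      larger.\<close>
    moreover have "m t \<noteq> 0"
    proof
      assume "m t = 0"
      then have M_0: "(\<lambda>k. M k t) \<longlonglongrightarrow> 0" using lim[OF t] by simp
      have "(\<lambda>k. t * M k t) \<longlonglongrightarrow> t * 0" using M_0 by (intro tendsto_intros)
      moreover have "t * M k t < 0" for k using cb t by (simp add: mult_neg_pos)
      then have "\<forall>\<^sub>F k in sequentially. t * M k t \<in> {..<0} \<and> t * M k t \<noteq> 0"
        by (intro always_eventually allI) (metis lessThan_iff less_irrefl)
      ultimately have "filterlim (\<lambda>k. t * M k t) (at_left 0) sequentially"
        unfolding filterlim_at by simp
      from filterlim_compose[OF cbf0_lim[OF h0] this]
      have "(\<lambda>k. M k t - h (t * M k t)) \<longlonglongrightarrow> 0 - 0" using M_0 by (intro tendsto_intros)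
      then have "eventually (\<lambda>k. M k t - h (t * M k t) < 1) sequentially"
        by (rule order_tendstoD) simp
      then obtain k where k: "M k t - h (t * M k t) < 1" by (auto simp: eventually_sequentially)
      have "0 < M (Suc k) t" using cb t by auto
      then have "M (Suc k) t * (M k t - h (t * M k t)) < M (Suc k) t * 1"
        using k by (intro mult_strict_left_mono)
      then show False using rel[OF t] dec[OF t, of k] by simp
    qed
    ultimately show ?thesis by simp
  qed
  have fixm: "m t = 1 + h (t * m t)" if t: "t < 0" for t
  proof -
    have neg: "t * m t < 0" using pos[OF t] t by (simp add: mult_neg_pos)
    have "isCont h (t * m t)"
      using cbf_continuous[OF h] neg by (simp add: continuous_on_eq_continuous_at)
    then have "(\<lambda>k. h (t * M k t)) \<longlonglongrightarrow> h (t * m t)"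
      using lim[OF t] by (intro isCont_tendsto_compose[where g=h] tendsto_intros)
    then have "(\<lambda>k. M (Suc k) t * (M k t - h (t * M k t))) \<longlonglongrightarrow> m t * (m t - h (t * m t))"
      using lim[OF t] LIMSEQ_Suc[OF lim[OF t]] by (intro tendsto_intros)
    then have "(\<lambda>k. M k t) \<longlonglongrightarrow> m t * (m t - h (t * m t))" by (simp only: rel[OF t])
    then have "m t * (m t - h (t * m t)) = m t" using lim[OF t] by (rule LIMSEQ_unique)
    then show ?thesis using pos[OF t] by simp
  qed
  have mc: "(\<lambda>t. t * m t) \<in> cbf"
  proof (rule cbf_limit)
    show "(\<lambda>t. t * M k t) \<in> cbf" for k using cb by blast
    show "(\<lambda>k. t * M k t) \<longlonglongrightarrow> t * m t" if "t < 0" for t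
      by (intro tendsto_mult tendsto_const lim that)
  qed
  have "(m \<longlongrightarrow> 1) (at_left 0)"
  proof (rule tendsto_sandwich)
    show "((\<lambda>t. 1 + h t) \<longlongrightarrow> 1) (at_left 0)"
      using tendsto_add[OF tendsto_const[of 1] cbf0_lim[OF h0]] by simp
    \<comment> \<open>m \<le> 1 gives t \<le> t m(t), and h is monotone.\<close>
    show "\<forall>\<^sub>F t in at_left 0. 1 + h t \<le> m t"
    proof (clarsimp simp: eventually_at_filter, intro always_eventually allI impI)
      fix t :: real assume t: "t < 0"
      have "t \<le> t * m t" "t * m t < 0" using pos[OF t] t
        by (auto simp: mult_neg_pos intro: mult_left_mono_neg[of "m t" 1 t, simplified])
      from cbf_mono[OF h this] show "1 + h t \<le> m t" using fixm[OF t] by simp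
    qed
    show "\<forall>\<^sub>F t in at_left 0. m t \<le> 1" using pos by (auto simp: eventually_at_filter)
  qed auto
  moreover have "\<forall>\<^sub>F t in at_left 0. m t = t * m t / t" by (auto simp: eventually_at_filter)
  ultimately have "((\<lambda>t. t * m t / t) \<longlongrightarrow> 1) (at_left 0)" by (rule Lim_transform_eventually)
  then obtain \<mu> where \<mu>: "\<mu> \<in> Pplus" "\<And>t. t < 0 \<Longrightarrow> M_tr \<mu> t = t * m t / t"
    using cbf_prob[OF mc] by blast
  then have "isR \<mu> h" unfolding isR_def using h0 fixm by (auto simp: g_tr_def)
  then show ?thesis by (rule that)
qed


section \<open>Free additive powers\<close>

lemma R_bounds:
  assumes "\<mu> \<in> Pplus" "t \<in> R_dom \<mu>"
  shows "-1 < R_tr \<mu> t" "R_tr \<mu> t \<le> 0"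
proof -
  obtain x where "x < 0" "t = g_tr \<mu> x" using assms R_dom_eq by auto
  then show "-1 < R_tr \<mu> t" "R_tr \<mu> t \<le> 0"
    using R_tr_g[OF assms(1)] M_pos[OF assms(1), of x] M_le_1[OF assms(1), of x] by auto
qed

text \<open>If \<open>F = 1/G\<close> and \<open>\<xi>\<close> has R-transform \<open>(c - 1) \<eta>\<^bsub>\<nu>\<^esub>\<close>, then the free power satisfies
  \<open>F\<^bsub>\<rho>\<^esub> = F\<^bsub>\<nu>\<^esub> \<circ> F\<^bsub>\<xi>\<^esub>\<close>: subordination turns into an explicit composition.\<close>

lemma free_power:
  assumes \<nu>: "\<nu> \<in> Pplus" and c: "c \<ge> 1"
  obtains \<rho> where "\<rho> \<in> Pplus" "R_dom \<rho> = {t \<in> R_dom \<nu>. 1 + c * R_tr \<nu> t > 0}"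
    "\<And>t. t \<in> R_dom \<rho> \<Longrightarrow> R_tr \<rho> t = c * R_tr \<nu> t"
proof -
  define k where "k t = (c - 1) * eta_tr \<nu> t" for t
  have k: "k \<in> cbf0" unfolding k_def using c by (intro cbf0_cmul eta_cbf0[OF \<nu>]) auto
  obtain \<xi> where \<xi>: "isR \<xi> k" using isR_exists[OF k] by blast
  then have \<xi>P: "\<xi> \<in> Pplus" and M\<xi>: "\<And>t. t < 0 \<Longrightarrow> M_tr \<xi> t = 1 + k (g_tr \<xi> t)"
    by (auto simp: isR_def)
  have f: "(\<lambda>t. g_tr \<nu> (g_tr \<xi> t)) \<in> cbf"
    by (rule cbf_comp[OF g_cbf[OF \<nu>] g_cbf[OF \<xi>P]]) (simp add: g_neg[OF \<xi>P])
  have "((\<lambda>t. M_tr \<nu> (g_tr \<xi> t) * M_tr \<xi> t) \<longlongrightarrow> 1 * 1) (at_left 0)"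
    by (intro tendsto_mult M_lim[OF \<xi>P] filterlim_compose[OF M_lim[OF \<nu>] g_filterlim[OF \<xi>P]])
  moreover have "\<forall>\<^sub>F t in at_left 0. M_tr \<nu> (g_tr \<xi> t) * M_tr \<xi> t = g_tr \<nu> (g_tr \<xi> t) / t"
    by (auto simp: eventually_at_filter g_tr_def)
  ultimately have "((\<lambda>t. g_tr \<nu> (g_tr \<xi> t) / t) \<longlongrightarrow> 1) (at_left 0)"
    using Lim_transform_eventually by fastforce
  then obtain \<rho> where \<rho>: "\<rho> \<in> Pplus" and M\<rho>: "\<And>t. t < 0 \<Longrightarrow> M_tr \<rho> t = g_tr \<nu> (g_tr \<xi> t) / t"
    using cbf_prob[OF f] by blast
  have g\<rho>: "g_tr \<rho> t = g_tr \<nu> (g_tr \<xi> t)" if "t < 0" for t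
    using M\<rho>[OF that] that by (simp add: g_tr_def[of \<rho>])
  have key: "M_tr \<nu> x * (1 + k x) = 1 + c * (M_tr \<nu> x - 1)" if "x < 0" for x
  proof -
    have "M_tr \<nu> x > 0" using M_pos[OF \<nu>, of x] that by simp
    then show ?thesis using that by (simp add: k_def eta_eq[OF \<nu>] field_simps)
  qed
  have in_dom: "g_tr \<rho> t \<in> R_dom \<nu> \<and> R_tr \<rho> (g_tr \<rho> t) = c * R_tr \<nu> (g_tr \<rho> t)" if t: "t < 0" for t
  proof
    have x: "g_tr \<xi> t < 0" by (rule g_neg[OF \<xi>P t])
    show "g_tr \<rho> t \<in> R_dom \<nu>" using x g\<rho>[OF t] R_dom_eq[OF \<nu>] by auto
    have "M_tr \<rho> t = M_tr \<nu> (g_tr \<xi> t) * M_tr \<xi> t"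
      using M\<rho>[OF t] t by (simp add: g_tr_def)
    also have "\<dots> = 1 + c * (M_tr \<nu> (g_tr \<xi> t) - 1)" using key[OF x] M\<xi>[OF t] by simp
    finally show "R_tr \<rho> (g_tr \<rho> t) = c * R_tr \<nu> (g_tr \<rho> t)"
      using R_tr_g[OF \<rho> t] R_tr_g[OF \<nu> x] g\<rho>[OF t] by simp
  qed
  show ?thesis
  proof (rule that[OF \<rho>])
    show "R_tr \<rho> t = c * R_tr \<nu> t" if "t \<in> R_dom \<rho>" for t
      using that in_dom R_dom_eq[OF \<rho>] by auto
    show "R_dom \<rho> = {t \<in> R_dom \<nu>. 1 + c * R_tr \<nu> t > 0}"
    proof safe
      fix t assume t: "t \<in> R_dom \<rho>"
      then obtain y where y: "y < 0" "t = g_tr \<rho> y" using R_dom_eq[OF \<rho>] by auto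
      then show "t \<in> R_dom \<nu>" using in_dom by auto
      show "1 + c * R_tr \<nu> t > 0" using in_dom[OF y(1)] y(2) R_bounds[OF \<rho> t] by auto
    next
      fix t assume t: "t \<in> R_dom \<nu>" "1 + c * R_tr \<nu> t > 0"
      then obtain x where x: "x < 0" "t = g_tr \<nu> x" using R_dom_eq[OF \<nu>] by auto
      have "M_tr \<nu> x * (1 + k x) > 0" using key[OF x(1)] t x R_tr_g[OF \<nu> x(1)] by simp
      then have "1 + k x > 0" using M_pos[OF \<nu>, of x] x(1) by (simp add: zero_less_mult_iff)
      then have "x \<in> R_dom \<xi>" using isR_dom[OF \<xi>] x(1) by simp
      then obtain y where "y < 0" "x = g_tr \<xi> y" using R_dom_eq[OF \<xi>P] by auto
      then show "t \<in> R_dom \<rho>" using g\<rho> x R_dom_eq[OF \<rho>] by auto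
    qed
  qed
qed

section \<open>Free infinite divisibility\<close>

lemma nfold_Suc: "n \<ge> 1 \<Longrightarrow> nfold f (Suc n) \<nu> = f \<nu> (nfold f n \<nu>)"
  by (cases n) (simp_all add: nfold_def)

text \<open>\<open>free_power\<close> supplies the candidate for every n. The domain is carried
  along because R \<le> 0 makes the domains decrease with n, so the sum formula applies on the
  domain of the next power.\<close>

lemma nfold_boxplus:
  assumes \<nu>: "\<nu> \<in> Pplus" and n: "n \<ge> 1"
  shows "nfold boxplus n \<nu> \<in> Pplus \<and> R_dom (nfold boxplus n \<nu>) = {t \<in> R_dom \<nu>. 1 + real n * R_tr \<nu> t > 0} \<and>
    (\<forall>t\<in>R_dom (nfold boxplus n \<nu>). R_tr (nfold boxplus n \<nu>) t = real n * R_tr \<nu> t)"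
  using n
proof (induction n rule: dec_induct)
  case base
  have "1 + R_tr \<nu> t > 0" if "t \<in> R_dom \<nu>" for t using R_bounds[OF \<nu> that] by simp
  then show ?case using \<nu> by (auto simp: nfold_def)
next
  case (step n)
  obtain \<rho> where \<rho>: "\<rho> \<in> Pplus" "R_dom \<rho> = {t \<in> R_dom \<nu>. 1 + real (Suc n) * R_tr \<nu> t > 0}"
    "\<And>t. t \<in> R_dom \<rho> \<Longrightarrow> R_tr \<rho> t = real (Suc n) * R_tr \<nu> t"
    using free_power[OF \<nu>, of "real (Suc n)"] by auto
  have "boxplus \<nu> (nfold boxplus n \<nu>) = \<rho>"
  proof (rule boxplus_eq[OF \<rho>(1)])
    fix t assume t: "t \<in> R_dom \<rho>"
    then have t': "t \<in> R_dom \<nu>" "1 + real (Suc n) * R_tr \<nu> t > 0" using \<rho>(2) by auto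
    then have "t \<in> R_dom (nfold boxplus n \<nu>)" using step R_bounds[OF \<nu> t'(1)] by (auto simp: algebra_simps)
    then show "R_tr \<rho> t = R_tr \<nu> t + R_tr (nfold boxplus n \<nu>) t"
      using step \<rho>(3)[OF t] by (simp add: algebra_simps)
  qed
  then have "nfold boxplus (Suc n) \<nu> = \<rho>" using nfold_Suc[of n boxplus \<nu>] step by simp
  then show ?case using \<rho> by simp
qed

text \<open>h / n is again in the class; the measure it belongs to is an n-th root.\<close>

lemma isR_ID:
  assumes "isR \<mu> h"
  shows "\<mu> \<in> ID boxplus"
proof -
  have \<mu>: "\<mu> \<in> Pplus" and h: "h \<in> cbf0" using assms by (auto simp: isR_def)
  have "\<exists>\<nu>\<in>Pplus. \<mu> = nfold boxplus n \<nu>" if n: "n \<ge> 1" for n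
  proof -
    have "(\<lambda>t. 1 / real n * h t) \<in> cbf0" by (intro cbf0_cmul h) simp
    then obtain \<nu> where \<nu>: "isR \<nu> (\<lambda>t. 1 / real n * h t)" using isR_exists by blast
    then have \<nu>P: "\<nu> \<in> Pplus" by (simp add: isR_def)
    note nf = nfold_boxplus[OF \<nu>P n]
    have "isR (nfold boxplus n \<nu>) h"
    proof (rule isR_I)
      fix t assume t: "t \<in> R_dom (nfold boxplus n \<nu>)"
      then have "t \<in> R_dom \<nu>" using nf by auto
      then show "R_tr (nfold boxplus n \<nu>) t = h t" using nf t isR_R[OF \<nu>] n by simp
    qed (use nf h in auto)
    then have "\<mu> = nfold boxplus n \<nu>" using isR_unique[OF assms] by simp
    then show ?thesis using \<nu>P by blast
  qed
  then show ?thesis using \<mu> by (simp add: ID_def)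
qed

text \<open>For roots \<nu> of order n the function n \<psi> of \<nu> is in the class and takes the
  value R(t) at the nearby point t / (1 + R(t) / n). Monotonicity and the slope bound trap its value
  at t between R(t) and R(t) (1 + R(t) / n), and compactness provides the limit on all t <
  0.\<close>

lemma ID_isR:
  assumes "\<mu> \<in> ID boxplus"
  obtains h where "isR \<mu> h"
proof -
  have \<mu>: "\<mu> \<in> Pplus" using assms by (simp add: ID_def)
  have "\<forall>n. \<exists>\<nu>\<in>Pplus. \<mu> = nfold boxplus (Suc n) \<nu>" using assms by (auto simp: ID_def)
  then obtain \<nu> where \<nu>: "\<And>n. \<nu> n \<in> Pplus" and \<mu>_eq: "\<And>n. \<mu> = nfold boxplus (Suc n) (\<nu> n)" by metis
  define h where "h n t = real (Suc n) * psi_tr (\<nu> n) t" for n t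
  have hc: "h n \<in> cbf" for n unfolding h_def using \<nu> by (intro cbf_cmul psi_cbf) auto
  \<comment> \<open>t = g(x) for the root, and M(x) = 1 + R(t) / n there; so x = t / M(x) is
    explicit.\<close>
  have hx: "h n (t / (1 + R_tr \<mu> t / real (Suc n))) = R_tr \<mu> t \<and> t / (1 + R_tr \<mu> t / real (Suc n)) \<le> t \<and> 1 + R_tr \<mu> t / real (Suc n) > 0"
    if t: "t \<in> R_dom \<mu>" for n t
  proof -
    note nf = nfold_boxplus[OF \<nu>[of n], of "Suc n", folded \<mu>_eq[of n]]
    have t\<nu>: "t \<in> R_dom (\<nu> n)" and R: "R_tr \<mu> t = real (Suc n) * R_tr (\<nu> n) t"
      using nf t by auto
    obtain x where x: "x < 0" "t = g_tr (\<nu> n) x" using t\<nu> R_dom_eq[OF \<nu>[of n]] by auto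
    have M: "M_tr (\<nu> n) x = 1 + R_tr \<mu> t / real (Suc n)"
      using R_tr_g[OF \<nu>[of n] x(1)] x(2) R by simp
    have pos: "M_tr (\<nu> n) x > 0" "M_tr (\<nu> n) x \<le> 1" using M_pos[OF \<nu>] M_le_1[OF \<nu>] x by auto
    have xe: "x = t / (1 + R_tr \<mu> t / real (Suc n))"
      unfolding M[symmetric] using x(2) pos by (simp add: g_tr_def)
    have "h n x = R_tr \<mu> t" unfolding h_def using psi_eq[OF \<nu>[of n], of x] x(1) M by simp
    moreover have "x \<le> t" using x pos mult_left_mono_neg[of "M_tr (\<nu> n) x" 1 x] by (simp add: g_tr_def)
    ultimately show ?thesis using xe M pos by simp
  qed
  have lower: "R_tr \<mu> t \<le> h n t" if t: "t \<in> R_dom \<mu>" for n t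
    using cbf_mono[OF hc[of n], of "t / (1 + R_tr \<mu> t / real (Suc n))" t] hx[OF t, of n] R_dom_neg[OF t] by simp
  have upper: "h n t \<le> R_tr \<mu> t * (1 + R_tr \<mu> t / real (Suc n))" if t: "t \<in> R_dom \<mu>" for n t
  proof -
    let ?m = "1 + R_tr \<mu> t / real (Suc n)"
    have m: "?m > 0" using hx[OF t, of n] by simp
    have "R_tr \<mu> t / (t / ?m) \<le> h n t / t"
      using cbf_slope[OF hc[of n], of "t / ?m" t] hx[OF t, of n] R_dom_neg[OF t] by simp
    then have "R_tr \<mu> t * ?m / t \<le> h n t / t" by simp
    then show ?thesis using R_dom_neg[OF t] by (simp add: divide_le_cancel)
  qed
  define t0 where "t0 = g_tr \<mu> (-1)"
  have t0: "t0 \<in> R_dom \<mu>" using R_dom_eq[OF \<mu>] by (auto simp: t0_def)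
  \<comment> \<open>Compactness needs a bound at -1, which may lie outside the domain of R. It is
    transferred from one point t0 of the domain, by monotonicity if t0 \<le> -1 and by the slope
    otherwise.\<close>
  have "- h n (-1) \<le> max (- R_tr \<mu> t0) (R_tr \<mu> t0 / t0)" for n
  proof (cases "t0 \<le> -1")
    case True
    then have "h n t0 \<le> h n (-1)" by (intro cbf_mono[OF hc[of n]]) auto
    then show ?thesis using lower[OF t0, of n] by simp
  next
    case False
    have "h n (-1) / (-1) \<le> h n t0 / t0"
      by (rule cbf_slope[OF hc[of n]]) (use False R_dom_neg[OF t0] in auto)
    also have "\<dots> \<le> R_tr \<mu> t0 / t0"
      using lower[OF t0, of n] R_dom_neg[OF t0] by (intro divide_right_mono_neg) auto
    finally show ?thesis by simp
  qed
  then obtain r H where r: "strict_mono (r :: nat \<Rightarrow> nat)" and Hc: "H \<in> cbf"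
    and H: "\<And>t. t < 0 \<Longrightarrow> (\<lambda>n. h (r n) t) \<longlonglongrightarrow> H t"
    using cbf_compact[of h "max (- R_tr \<mu> t0) (R_tr \<mu> t0 / t0)"] hc by blast
  have HR: "R_tr \<mu> t = H t" if t: "t \<in> R_dom \<mu>" for t
  proof -
    have "(\<lambda>n. R_tr \<mu> t * (1 + R_tr \<mu> t / real (Suc n))) \<longlonglongrightarrow> R_tr \<mu> t" by real_asymp
    then have lim: "(\<lambda>n. h n t) \<longlonglongrightarrow> R_tr \<mu> t"
    proof (rule tendsto_sandwich[OF _ _ tendsto_const[of "R_tr \<mu> t"], rotated 2])
      show "\<forall>\<^sub>F n in sequentially. R_tr \<mu> t \<le> h n t"
        by (intro always_eventually allI lower[OF t])
      show "\<forall>\<^sub>F n in sequentially. h n t \<le> R_tr \<mu> t * (1 + R_tr \<mu> t / real (Suc n))"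
        by (intro always_eventually allI upper[OF t])
    qed
    from LIMSEQ_subseq_LIMSEQ[OF lim r] have "(\<lambda>n. h (r n) t) \<longlonglongrightarrow> R_tr \<mu> t" by (simp add: o_def)
    then show ?thesis using H[OF R_dom_neg[OF t]] by (rule LIMSEQ_unique)
  qed
  \<comment> \<open>H agrees with M(x) - 1 at the points g(x), which tends to 0; monotonicity does
    the rest.\<close>
  have "(H \<longlongrightarrow> 0) (at_left 0)"
  proof (rule order_tendstoI)
    fix a :: real assume "a < 0"
    have "((\<lambda>t. M_tr \<mu> t - 1) \<longlongrightarrow> 1 - 1) (at_left 0)" using M_lim[OF \<mu>] by (intro tendsto_intros)
    then have "eventually (\<lambda>t. M_tr \<mu> t - 1 > a) (at_left 0)" using \<open>a < 0\<close> by (intro order_tendstoD(1)) auto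
    moreover have "eventually (\<lambda>t. t < 0) (at_left (0::real))" by (auto simp: eventually_at_filter)
    ultimately obtain x where x: "M_tr \<mu> x - 1 > a" "x < 0"
      using eventually_happens[OF eventually_conj] by (force simp: trivial_limit_at_left_real)
    have gx: "g_tr \<mu> x \<in> R_dom \<mu>" using x R_dom_eq[OF \<mu>] by auto
    have "eventually (\<lambda>t. t \<in> {g_tr \<mu> x<..<0}) (at_left 0)"
      using g_neg[OF \<mu> x(2)] by (rule eventually_at_left_real)
    then show "eventually (\<lambda>t. H t > a) (at_left 0)"
    proof eventually_elim
      case (elim t)
      then have "H (g_tr \<mu> x) \<le> H t" by (intro cbf_mono[OF Hc]) auto
      moreover have "H (g_tr \<mu> x) = M_tr \<mu> x - 1" using HR[OF gx] R_tr_g[OF \<mu> x(2)] by simp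
      ultimately show ?case using x by simp
    qed
  next
    fix a :: real assume "0 < a"
    then show "eventually (\<lambda>t. H t < a) (at_left 0)"
      using cbf_nonpos[OF Hc] by (auto simp: eventually_at_filter intro!: always_eventually intro: le_less_trans)
  qed
  then have "H \<in> cbf0" using Hc by (simp add: cbf0_def)
  then show ?thesis using that isR_I[OF \<mu> _ HR] by blast
qed

text \<open>h and k are nonpositive, so 1 + h + k > 0 forces 1 + h > 0 and 1 + k > 0: the domain of
  the sum lies in both domains.\<close>

lemma boxplus_isR:
  assumes "isR \<mu> h" "isR \<nu> k"
  shows "isR (boxplus \<mu> \<nu>) (\<lambda>t. h t + k t)"
proof -
  have hk: "h \<in> cbf0" "k \<in> cbf0" using assms by (auto simp: isR_def)
  obtain \<rho> where \<rho>: "isR \<rho> (\<lambda>t. h t + k t)" using isR_exists[OF cbf0_add[OF hk]] by blast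
  have "boxplus \<mu> \<nu> = \<rho>"
  proof (rule boxplus_eq)
    show "\<rho> \<in> Pplus" using \<rho> by (simp add: isR_def)
    fix t assume t: "t \<in> R_dom \<rho>"
    then have "t < 0" "1 + (h t + k t) > 0" using isR_dom[OF \<rho>] by auto
    moreover have "h t \<le> 0" "k t \<le> 0" using hk \<open>t < 0\<close> by (auto intro: cbf_nonpos cbf0_cbf)
    ultimately have "t \<in> R_dom \<mu>" "t \<in> R_dom \<nu>" using isR_dom assms by auto
    then show "R_tr \<rho> t = R_tr \<mu> t + R_tr \<nu> t"
      using isR_R[OF \<rho> t] isR_R[OF assms(1)] isR_R[OF assms(2)] by simp
  qed
  then show ?thesis using \<rho> by simp
qed

lemma semigroup_ID_boxplus: "semigroup_on (ID boxplus) boxplus"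
  unfolding semigroup_on_def
proof (intro conjI ballI)
  fix x y assume "x \<in> ID boxplus" "y \<in> ID boxplus"
  then obtain h k where "isR x h" "isR y k" by (meson ID_isR)
  then show "boxplus x y \<in> ID boxplus" using boxplus_isR isR_ID by blast
  fix z assume "z \<in> ID boxplus"
  then obtain l where "isR z l" by (meson ID_isR)
  have "isR (boxplus (boxplus x y) z) (\<lambda>t. (h t + k t) + l t)"
    by (intro boxplus_isR \<open>isR x h\<close> \<open>isR y k\<close> \<open>isR z l\<close>)
  moreover have "isR (boxplus x (boxplus y z)) (\<lambda>t. h t + (k t + l t))"
    by (intro boxplus_isR \<open>isR x h\<close> \<open>isR y k\<close> \<open>isR z l\<close>)
  ultimately show "boxplus (boxplus x y) z = boxplus x (boxplus y z)"
    by (rule isR_unique) simp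
qed


section \<open>S-transforms\<close>

lemma M_mono:
  assumes \<mu>: "\<mu> \<in> Pplus" and "s \<le> t" "t < 0"
  shows "M_tr \<mu> s \<le> M_tr \<mu> t"
  using cbf_mono[OF psi_cbf[OF \<mu>] assms(2,3)] psi_eq[OF \<mu>] assms by simp

lemma M_continuous:
  assumes \<mu>: "\<mu> \<in> Pplus"
  shows "continuous_on {..<0} (M_tr \<mu>)"
proof -
  have "continuous_on {..<0} (\<lambda>t. psi_tr \<mu> t + 1)"
    by (intro continuous_intros cbf_continuous psi_cbf \<mu>)
  then show ?thesis by (rule continuous_on_eq) (simp add: psi_eq[OF \<mu>])
qed

lemma delta0_Pplus: "delta0 \<in> Pplus"
proof (rule PplusI)
  show "real_distribution delta0"
    by (simp add: real_distribution_def real_distribution_axioms_def prob_space_return)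
  show "AE u in delta0. 0 \<le> u" by (subst AE_return) auto
qed

lemma M_delta0: "M_tr delta0 t = 1"
  unfolding M_tr_def by (subst integral_return) auto

text \<open>The difference of the two integrands is nonnegative and vanishes only at u = 0, so
  equality would concentrate \<mu> at 0.\<close>

lemma M_strict_mono:
  assumes \<mu>: "\<mu> \<in> Pplus" "\<mu> \<noteq> delta0" and st: "s < t" "t < 0"
  shows "M_tr \<mu> s < M_tr \<mu> t"
proof (rule ccontr)
  interpret real_distribution \<mu> using \<mu> by (simp add: Pplus_def)
  assume "\<not> M_tr \<mu> s < M_tr \<mu> t"
  then have eq: "M_tr \<mu> s = M_tr \<mu> t" using M_mono[OF \<mu>(1), of s t] st by simp
  have int: "integrable \<mu> (\<lambda>u. 1 / (1 - t * u) - 1 / (1 - s * u))"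
    using integrable_M[OF \<mu>(1), of t] integrable_M[OF \<mu>(1), of s] st by simp
  have diff: "1 / (1 - t * u) - 1 / (1 - s * u) = (t - s) * u / ((1 - t * u) * (1 - s * u))"
    and pos: "(1 - t * u) * (1 - s * u) > 0" if "0 \<le> u" for u
  proof -
    have "1 - t * u > 0" "1 - s * u > 0" using one_minus_ge_1[of t u] one_minus_ge_1[of s u] st that by auto
    then show "(1 - t * u) * (1 - s * u) > 0" by (rule mult_pos_pos)
    show "1 / (1 - t * u) - 1 / (1 - s * u) = (t - s) * u / ((1 - t * u) * (1 - s * u))"
      using \<open>1 - t * u > 0\<close> \<open>1 - s * u > 0\<close> by (simp add: diff_frac_eq algebra_simps)
  qed
  have "(LINT u|\<mu>. 1 / (1 - t * u) - 1 / (1 - s * u)) = 0"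
    using eq integrable_M[OF \<mu>(1), of t] integrable_M[OF \<mu>(1), of s] st by (simp add: M_tr_def)
  moreover have "AE u in \<mu>. 0 \<le> 1 / (1 - t * u) - 1 / (1 - s * u)"
    using Pplus_AE[OF \<mu>(1)]
  proof eventually_elim
    case (elim u)
    then show ?case unfolding diff[OF elim] using st pos[OF elim] by simp
  qed
  ultimately have "AE u in \<mu>. 1 / (1 - t * u) - 1 / (1 - s * u) = 0"
    using integral_nonneg_eq_0_iff_AE[OF int] by simp
  then have AE0: "AE u in \<mu>. u = 0"
    using Pplus_AE[OF \<mu>(1)]
  proof eventually_elim
    case (elim u)
    then show ?case using diff[OF elim(2)] pos[OF elim(2)] st by auto
  qed
  have "\<mu> = delta0"
  proof (rule M_unique[OF \<mu>(1) delta0_Pplus])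
    fix x :: real
    have "M_tr \<mu> x = (LINT u|\<mu>. 1)" unfolding M_tr_def
      by (rule integral_cong_AE) (use AE0 in auto)
    then show "M_tr \<mu> x = M_tr delta0 x" by (simp add: M_delta0 prob_space[simplified])
  qed
  then show False using \<mu>(2) by simp
qed

lemma M_at_bot:
  assumes \<mu>: "\<mu> \<in> Pplus"
  shows "(\<lambda>n. M_tr \<mu> (- real n)) \<longlonglongrightarrow> measure \<mu> {0}"
proof -
  interpret real_distribution \<mu> using \<mu> by (simp add: Pplus_def)
  have "(\<lambda>n. LINT u|\<mu>. 1 / (1 - (- real n) * u)) \<longlonglongrightarrow> (LINT u|\<mu>. indicator {0} u)"
  proof (rule integral_dominated_convergence[where w="\<lambda>_. 1"])
    show "AE u in \<mu>. norm (1 / (1 - (- real n) * u)) \<le> 1" for n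
      using Pplus_AE[OF \<mu>] by eventually_elim (use inverse_one_minus_le_1[of "- real n"] in auto)
    show "AE u in \<mu>. (\<lambda>n. 1 / (1 - (- real n) * u)) \<longlonglongrightarrow> indicator {0} u"
      using Pplus_AE[OF \<mu>]
    proof eventually_elim
      case (elim u)
      show ?case
      proof (cases "u = 0")
        case False
        then have "u > 0" using elim by simp
        then have "(\<lambda>n. 1 / (1 + real n * u)) \<longlonglongrightarrow> 0" by real_asymp
        then show ?thesis using False by simp
      qed simp
    qed
  qed auto
  then show ?thesis by (simp add: M_tr_def)
qed

lemma M_gt_atom:
  assumes \<mu>: "\<mu> \<in> Pplus" "\<mu> \<noteq> delta0" and t: "t < 0"
  shows "measure \<mu> {0} < M_tr \<mu> t"
proof -
  have "eventually (\<lambda>n. real n \<ge> - (t - 1)) sequentially"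
    by (rule eventually_compose_filterlim[OF eventually_ge_at_top filterlim_real_sequentially])
  then have "\<forall>\<^sub>F n in sequentially. M_tr \<mu> (- real n) \<le> M_tr \<mu> (t - 1)"
    by eventually_elim (use t in \<open>intro M_mono[OF \<mu>(1)], auto\<close>)
  then have "measure \<mu> {0} \<le> M_tr \<mu> (t - 1)"
    using tendsto_upperbound[OF M_at_bot[OF \<mu>(1)]] by simp
  also have "\<dots> < M_tr \<mu> t" using t by (intro M_strict_mono[OF \<mu>]) auto
  finally show ?thesis .
qed

text \<open>As t runs from 0 to - \<infinity>, M falls strictly from 1 towards the mass at 0;
  strictness excludes both end values.\<close>

lemma psi_range:
  assumes \<mu>: "\<mu> \<in> Pplus" "\<mu> \<noteq> delta0"
  shows "psi_tr \<mu> ` {..<0} = {-1 + measure \<mu> {0}<..<0}"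
proof safe
  fix z :: real assume z: "z < 0"
  have "M_tr \<mu> z < M_tr \<mu> (z / 2)" using z by (intro M_strict_mono[OF \<mu>]) auto
  also have "\<dots> \<le> 1" using z by (intro M_le_1[OF \<mu>(1)]) auto
  finally show "psi_tr \<mu> z \<in> {-1 + measure \<mu> {0}<..<0}"
    using M_gt_atom[OF \<mu> z] z by (simp add: psi_eq[OF \<mu>(1)])
next
  fix t assume t: "t \<in> {-1 + measure \<mu> {0}<..<0}"
  have "eventually (\<lambda>n. M_tr \<mu> (- real n) < 1 + t) sequentially"
    using t by (intro order_tendstoD(2)[OF M_at_bot[OF \<mu>(1)]]) auto
  then obtain N where N': "\<And>n. n \<ge> N \<Longrightarrow> M_tr \<mu> (- real n) < 1 + t" by (auto simp: eventually_sequentially)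
  have N: "M_tr \<mu> (- real (Suc N)) < 1 + t" by (rule N') simp
  have "eventually (\<lambda>x. M_tr \<mu> x > 1 + t) (at_left 0)"
    using t by (intro order_tendstoD(1)[OF M_lim[OF \<mu>(1)]]) auto
  moreover have "eventually (\<lambda>x. x \<in> {- real (Suc N)<..<0}) (at_left 0)"
    by (rule eventually_at_left_real) simp
  ultimately have "eventually (\<lambda>x. M_tr \<mu> x > 1 + t \<and> x \<in> {- real (Suc N)<..<0}) (at_left 0)"
    by (rule eventually_conj)
  then obtain x where x: "M_tr \<mu> x > 1 + t" "x < 0" "- real (Suc N) < x"
    using eventually_happens by (force simp: trivial_limit_at_left_real)
  have "\<exists>y\<ge>- real (Suc N). y \<le> x \<and> M_tr \<mu> y = 1 + t"
  proof (rule IVT')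
    show "continuous_on {- real (Suc N)..x} (M_tr \<mu>)"
      by (rule continuous_on_subset[OF M_continuous[OF \<mu>(1)]]) (use x in auto)
  qed (use N x in auto)
  then obtain y where "y \<le> x" "M_tr \<mu> y = 1 + t" by auto
  then have "psi_tr \<mu> y = t" "y < 0" using x psi_eq[OF \<mu>(1), of y] by auto
  then show "t \<in> psi_tr \<mu> ` {..<0}" by auto
qed

section \<open>The S-transform and its uniqueness\<close>

lemma psi_inj:
  assumes \<mu>: "\<mu> \<in> Pplus" "\<mu> \<noteq> delta0"
  shows "inj_on (psi_tr \<mu>) {..<0}"
  using M_strict_mono[OF \<mu>] psi_eq[OF \<mu>(1)] by (intro linorder_inj_onI') force

lemma S_psi:
  assumes \<mu>: "\<mu> \<in> Pplus" "\<mu> \<noteq> delta0" and z: "z < 0"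
  shows "S_tr \<mu> (psi_tr \<mu> z) = (1 + psi_tr \<mu> z) / psi_tr \<mu> z * z"
  unfolding S_tr_def using inv_into_f_f[OF psi_inj[OF \<mu>], of z] z by simp

text \<open>Only the atom of \<mu> is tied to the interval; that of \<nu> is unknown, since the
  description of \<open>boxtimes\<close> does not prescribe it for competitors. Whichever atom is
  larger, one range of \<psi> contains the other, and S determines the argument from the value of
  \<psi>.\<close>

lemma S_unique:
  assumes \<mu>: "\<mu> \<in> Pplus" "\<mu> \<noteq> delta0" and \<nu>: "\<nu> \<in> Pplus" "\<nu> \<noteq> delta0"
    and m: "measure \<mu> {0} = m"
    and eq: "\<And>t. -1 + m < t \<Longrightarrow> t < 0 \<Longrightarrow> S_tr \<mu> t = S_tr \<nu> t"
  shows "\<mu> = \<nu>"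
proof -
  have m0: "m \<ge> 0" using m by auto
  have zz: "z = z'" if z: "z < 0" "z' < 0" and p: "psi_tr \<mu> z = psi_tr \<nu> z'" "-1 + m < psi_tr \<mu> z" "psi_tr \<mu> z < 0" for z z'
  proof -
    have "(1 + psi_tr \<mu> z) / psi_tr \<mu> z * z = (1 + psi_tr \<mu> z) / psi_tr \<mu> z * z'"
      using S_psi[OF \<mu> z(1)] S_psi[OF \<nu> z(2)] eq[OF p(2,3)] p(1) by simp
    moreover have "(1 + psi_tr \<mu> z) / psi_tr \<mu> z \<noteq> 0" using p m0 by auto
    ultimately show ?thesis by simp
  qed
  have "M_tr \<mu> z = M_tr \<nu> z" if z: "z < 0" for z
  proof (cases "measure \<nu> {0} \<le> m")
    case True
    have p: "psi_tr \<mu> z \<in> {-1 + m<..<0}" using psi_range[OF \<mu>] m z by auto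
    then have "psi_tr \<mu> z \<in> psi_tr \<nu> ` {..<0}" using psi_range[OF \<nu>] True by auto
    then obtain z' where "z' < 0" "psi_tr \<mu> z = psi_tr \<nu> z'" by auto
    with zz[of z z'] p z show ?thesis by (auto simp: psi_eq \<mu> \<nu>)
  next
    case False
    have "psi_tr \<nu> z \<in> {-1 + measure \<nu> {0}<..<0}" using psi_range[OF \<nu>] z by blast
    then have p: "psi_tr \<nu> z \<in> {-1 + m<..<0}" using False by auto
    then have "psi_tr \<nu> z \<in> psi_tr \<mu> ` {..<0}" using psi_range[OF \<mu>] m by auto
    then obtain z' where "z' < 0" "psi_tr \<mu> z' = psi_tr \<nu> z" by auto
    with zz[of z' z] p z show ?thesis by (auto simp: psi_eq \<mu> \<nu>)
  qed
  then show ?thesis by (intro M_unique \<mu> \<nu>)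
qed

lemma boxtimes_eq:
  assumes "\<mu> \<noteq> delta0" "\<nu> \<noteq> delta0" and \<rho>: "\<rho> \<in> Pplus" "\<rho> \<noteq> delta0"
    and m: "measure \<rho> {0} = max (measure \<mu> {0}) (measure \<nu> {0})"
    and S: "\<And>t. -1 + max (measure \<mu> {0}) (measure \<nu> {0}) < t \<Longrightarrow> t < 0 \<Longrightarrow> S_tr \<rho> t = S_tr \<mu> t * S_tr \<nu> t"
  shows "boxtimes \<mu> \<nu> = \<rho>"
proof -
  let ?P = "\<lambda>\<rho>. \<rho> \<in> Pplus \<and> \<rho> \<noteq> delta0 \<and>
     (\<forall>t\<in>{-1 + max (measure \<mu> {0}) (measure \<nu> {0})<..<0}. S_tr \<rho> t = S_tr \<mu> t * S_tr \<nu> t)"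
  have "(THE \<rho>. ?P \<rho>) = \<rho>"
  proof (rule the_equality)
    show "?P \<rho>" using \<rho> S by auto
    fix \<rho>' assume "?P \<rho>'"
    then have "\<rho> = \<rho>'" using \<rho> S by (intro S_unique[OF \<rho> _ _ m]) auto
    then show "\<rho>' = \<rho>" by simp
  qed
  then show ?thesis unfolding boxtimes_def using assms(1,2) by simp
qed

section \<open>Geometric means and fractional powers\<close>

lemma mean_iteration:
  fixes a b :: real
  assumes "a > 0" "b > 0"
  defines "A \<equiv> rec_nat (a, b) (\<lambda>_ (x, y). ((x + y) / 2, 2 * x * y / (x + y)))"
  shows "(\<lambda>n. fst (A n)) \<longlonglongrightarrow> sqrt (a * b)"
proof -
  have AS: "A (Suc n) = ((fst (A n) + snd (A n)) / 2, 2 * fst (A n) * snd (A n) / (fst (A n) + snd (A n)))" for n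
    by (simp add: A_def case_prod_beta)
  have A0: "A 0 = (a, b)" by (simp add: A_def)
  have pos: "fst (A n) > 0 \<and> snd (A n) > 0" for n
    by (induction n) (use assms(1,2) in \<open>auto simp: A0 AS\<close>)
  \<comment> \<open>Arithmetic and harmonic mean have the same product as the original pair; this
    invariant makes the geometric mean the limit.\<close>
  have prod: "fst (A n) * snd (A n) = a * b" for n
  proof (induction n)
    case (Suc n)
    then show ?case using pos[of n] by (simp add: AS field_simps)
  qed (simp add: A0)
  have ge: "fst (A (Suc n)) \<ge> sqrt (a * b)" for n
    using arith_geo_mean_sqrt[of "fst (A n)" "snd (A n)"] pos[of n] prod[of n] by (simp add: AS less_imp_le)
  \<comment> \<open>From the first step on, the harmonic entry is below sqrt(a b), so averaging at
    least halves the distance of the arithmetic entry.\<close>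
  have bound: "fst (A (Suc n)) - sqrt (a * b) \<le> (fst (A 1) - sqrt (a * b)) / 2 ^ n" for n
  proof (induction n)
    case (Suc n)
    let ?x = "fst (A (Suc n))" and ?s = "sqrt (a * b)"
    have "snd (A (Suc n)) \<le> ?s"
    proof (rule ccontr)
      assume "\<not> snd (A (Suc n)) \<le> ?s"
      then have "?s * ?s < ?x * snd (A (Suc n))"
        using ge[of n] pos[of "Suc n"] assms by (intro mult_le_less_imp_less) auto
      then show False using prod[of "Suc n"] assms by simp
    qed
    then have "fst (A (Suc (Suc n))) - ?s \<le> (?x - ?s) / 2" by (simp add: AS[of "Suc n"])
    also have "\<dots> \<le> ((fst (A 1) - ?s) / 2 ^ n) / 2" by (rule divide_right_mono[OF Suc]) simp
    also have "\<dots> = (fst (A 1) - ?s) / 2 ^ Suc n" by (simp only: power_Suc2 divide_divide_eq_left)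
    finally show ?case .
  qed simp
  have "(\<lambda>n. (fst (A 1) - sqrt (a * b)) / 2 ^ n) \<longlonglongrightarrow> 0" by real_asymp
  then have "(\<lambda>n. fst (A (Suc n)) - sqrt (a * b)) \<longlonglongrightarrow> 0"
    by (rule real_tendsto_sandwich[OF _ _ tendsto_const, rotated 2]) (use ge bound in auto)
  then have "(\<lambda>n. fst (A (Suc n)) - sqrt (a * b) + sqrt (a * b)) \<longlonglongrightarrow> 0 + sqrt (a * b)"
    by (intro tendsto_add tendsto_const)
  then have "(\<lambda>n. fst (A (Suc n))) \<longlonglongrightarrow> sqrt (a * b)" by simp
  then show ?thesis by (rule LIMSEQ_imp_Suc)
qed

text \<open>The harmonic mean is twice the dual of the sum of the duals.\<close>

lemma cbf_hmean:
  assumes f: "f \<in> cbf" "f (-1) < 0" and g: "g \<in> cbf" "g (-1) < 0"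
  shows "(\<lambda>t. 2 * f t * g t / (f t + g t)) \<in> cbf"
proof -
  define k where "k t = - t / f t + - t / g t" for t
  have k: "k \<in> cbf" unfolding k_def by (intro cbf_add cbf_dual f g)
  have neg: "f t < 0" "g t < 0" if "t < 0" for t
    using cbf_neg[OF f(1) that f(2)] cbf_neg[OF g(1) that g(2)] by auto
  have "k (-1) < 0" using neg[of "-1"] unfolding k_def by (intro add_neg_neg divide_pos_neg) auto
  then have "(\<lambda>t. 2 * (- t / k t)) \<in> cbf" by (intro cbf_cmul cbf_dual k) auto
  then show ?thesis
  proof (rule cbf_cong)
    fix t :: real assume t: "t < 0"
    have "k t = - t * (f t + g t) / (f t * g t)" using neg[OF t] by (simp add: k_def field_simps)
    then show "2 * f t * g t / (f t + g t) = 2 * (- t / k t)" using t neg[OF t] by simp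
  qed
qed

text \<open>Both entries of the arithmetic-harmonic iteration stay in the class up to sign, so their
  common limit does as well.\<close>

lemma cbf_gmean:
  assumes f: "f \<in> cbf" "f (-1) < 0" and g: "g \<in> cbf" "g (-1) < 0"
  shows "(\<lambda>t. - sqrt (f t * g t)) \<in> cbf"
proof -
  have neg: "f t < 0" "g t < 0" if "t < 0" for t
    using cbf_neg[OF f(1) that f(2)] cbf_neg[OF g(1) that g(2)] by auto
  define A where "A t = rec_nat (- f t, - g t) (\<lambda>_ (x, y). ((x + y) / 2, 2 * x * y / (x + y)))" for t
  have AS: "A t (Suc n) = ((fst (A t n) + snd (A t n)) / 2, 2 * fst (A t n) * snd (A t n) / (fst (A t n) + snd (A t n)))" for t n
    by (simp add: A_def case_prod_beta)
  have A0: "A t 0 = (- f t, - g t)" for t by (simp add: A_def)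
  have A: "(\<lambda>t. - fst (A t n)) \<in> cbf \<and> (\<lambda>t. - snd (A t n)) \<in> cbf \<and> fst (A (-1) n) > 0 \<and> snd (A (-1) n) > 0" for n
  proof (induction n)
    case 0
    then show ?case using f g by (simp add: A0)
  next
    case (Suc n)
    have 1: "(\<lambda>t. 1 / 2 * (- fst (A t n) + - snd (A t n))) \<in> cbf"
      using Suc by (intro cbf_cmul cbf_add) auto
    have 2: "(\<lambda>t. 2 * - fst (A t n) * - snd (A t n) / (- fst (A t n) + - snd (A t n))) \<in> cbf"
      using Suc by (intro cbf_hmean) auto
    have e1: "1 / 2 * (- x + - y) = - ((x + y) / 2)" for x y :: real by (simp add: field_simps)
    have e2: "2 * - x * - y / (- x + - y) = - (2 * x * y / (x + y))" for x y :: real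
    proof -
      have "- x + - y = - (x + y)" by simp
      then show ?thesis by (simp only: divide_minus_right)
    qed
    show ?case using 1 2 Suc unfolding e1 e2 by (simp add: AS)
  qed
  show ?thesis
  proof (rule cbf_limit)
    show "(\<lambda>t. - fst (A t n)) \<in> cbf" for n using A by blast
    fix t :: real assume t: "t < 0"
    have "(\<lambda>n. fst (A t n)) \<longlonglongrightarrow> sqrt (- f t * - g t)"
      unfolding A_def by (rule mean_iteration) (use neg[OF t] in auto)
    then have "(\<lambda>n. - fst (A t n)) \<longlonglongrightarrow> - sqrt (- f t * - g t)" by (rule tendsto_minus)
    then show "(\<lambda>n. - fst (A t n)) \<longlonglongrightarrow> - sqrt (f t * g t)" by simp
  qed
qed

text \<open>A geometric mean of two powers has the midpoint exponent. Starting from the exponents 0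
  and 1 this reaches all dyadic exponents, and a limit reaches the others.\<close>

lemma cbf_powr:
  assumes "0 \<le> a" "a \<le> 1"
  shows "(\<lambda>t. - ((- t) powr a)) \<in> cbf"
proof -
  have mid: "(\<lambda>t. - ((- t) powr ((a + b) / 2))) \<in> cbf"
    if "(\<lambda>t. - ((- t) powr a)) \<in> cbf" "(\<lambda>t. - ((- t) powr b)) \<in> cbf" for a b
  proof -
    have "(\<lambda>t. - sqrt (- ((- t) powr a) * - ((- t) powr b))) \<in> cbf"
      by (rule cbf_gmean[OF that(1) _ that(2)]) auto
    then show ?thesis
    proof (rule cbf_cong)
      fix t :: real assume t: "t < 0"
      have "sqrt (- ((- t) powr a) * - ((- t) powr b)) = sqrt ((- t) powr (a + b))" by (simp add: powr_add)
      also have "\<dots> = ((- t) powr (a + b)) powr (1 / 2)" using t by (simp add: powr_half_sqrt)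
      also have "\<dots> = (- t) powr ((a + b) / 2)" by (simp add: powr_powr)
      finally show "- ((- t) powr ((a + b) / 2)) = - sqrt (- ((- t) powr a) * - ((- t) powr b))" by simp
    qed
  qed
  have dyadic: "(\<lambda>t. - ((- t) powr (real k / 2 ^ m))) \<in> cbf" if "k \<le> 2 ^ m" for k m :: nat
    using that
  proof (induction m arbitrary: k)
    case 0
    then consider "k = 0" | "k = 1" by fastforce
    then show ?case
    proof cases
      case 1
      \<comment> \<open>Exponent 0 is the constant -1, the kernel at v = 1.\<close>
      show ?thesis by (rule cbf_cong[OF cbf_cbf_kernel[of 1 1]]) (use 1 in \<open>auto simp: cbf_kernel_def\<close>)
    next
      case 2
      show ?thesis by (rule cbf_cong[OF cbf_id]) (use 2 in auto)
    qed
  next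
    case (Suc m)
    show ?case
    proof (cases "even k")
      case True
      then obtain j where "k = 2 * j" by auto
      then show ?thesis using Suc.IH[of j] Suc.prems by simp
    next
      case False
      then obtain j where j: "k = 2 * j + 1" using oddE by blast
      then have "j + 1 \<le> 2 ^ m" using Suc.prems by simp
      \<comment> \<open>For odd k = 2 j + 1 the exponent is the midpoint of the two neighbours of
        the coarser grid.\<close>
      then have "(\<lambda>t. - ((- t) powr ((real j / 2 ^ m + real (j + 1) / 2 ^ m) / 2))) \<in> cbf"
        by (intro mid Suc.IH) auto
      moreover have "(real j / 2 ^ m + real (j + 1) / 2 ^ m) / 2 = real k / 2 ^ Suc m"
        by (simp add: j add_divide_distrib[symmetric] ac_simps)
      ultimately show ?thesis by (simp only:)
    qed
  qed
  define q where "q m = real (nat \<lfloor>a * 2 ^ m\<rfloor>) / 2 ^ m" for m :: nat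
  have q: "q \<longlonglongrightarrow> a"
  proof (rule tendsto_sandwich)
    have fl: "real (nat \<lfloor>a * 2 ^ m\<rfloor>) = of_int \<lfloor>a * 2 ^ m\<rfloor>" for m using assms by simp
    show "\<forall>\<^sub>F m in sequentially. a - 1 / 2 ^ m \<le> q m"
    proof (intro always_eventually allI)
      fix m :: nat
      have "a - 1 / 2 ^ m = (a * 2 ^ m - 1) / 2 ^ m" by (simp add: diff_divide_distrib)
      also have "\<dots> \<le> q m" unfolding q_def fl by (intro divide_right_mono) (linarith, simp)
      finally show "a - 1 / 2 ^ m \<le> q m" .
    qed
    show "\<forall>\<^sub>F m in sequentially. q m \<le> a"
      unfolding q_def fl by (intro always_eventually allI) (simp add: divide_le_eq)
    show "(\<lambda>m. a - 1 / 2 ^ m) \<longlonglongrightarrow> a" by real_asymp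
  qed simp
  show ?thesis
  proof (rule cbf_limit)
    fix m :: nat
    have "a * 2 ^ m \<le> 2 ^ m" using assms by simp
    then have "\<lfloor>a * 2 ^ m\<rfloor> \<le> \<lfloor>of_int (2 ^ m) :: real\<rfloor>" by (intro floor_mono) simp
    then have "nat \<lfloor>a * 2 ^ m\<rfloor> \<le> 2 ^ m" by (simp only: floor_of_int) (simp add: nat_le_iff)
    then show "(\<lambda>t. - ((- t) powr (q m))) \<in> cbf" unfolding q_def by (rule dyadic)
  next
    fix t :: real assume "t < 0"
    then show "(\<lambda>m. - ((- t) powr (q m))) \<longlonglongrightarrow> - ((- t) powr a)"
      using q by (intro tendsto_intros) auto
  qed
qed


section \<open>Free multiplicative powers\<close>

text \<open>\<open>isT \<tau> h\<close> describes the measure \<open>\<tau> = \<pi>\<^sup>-\<^sup>1 \<boxtimes> \<mu>\<close> for \<open>\<mu> \<noteq> \<delta>\<^sub>0\<close> with R-transform \<open>h\<close>: its S-transform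
  is \<open>- t S\<^sub>\<mu>(t)\<close>, where \<open>t S\<^sub>\<mu>(t)\<close> is the inverse function of \<open>h\<close>.\<close>

definition isT :: "real measure \<Rightarrow> (real \<Rightarrow> real) \<Rightarrow> bool" where
  "isT \<tau> h \<longleftrightarrow> \<tau> \<in> Pplus \<and> h \<in> cbf0 \<and> h (-1) < 0 \<and>
     (\<forall>u<0. 1 + h u > 0 \<longrightarrow> M_tr \<tau> (- (u * h u) / (1 + h u)) = 1 + h u)"

lemma cbf0_continuous: "h \<in> cbf0 \<Longrightarrow> continuous_on {..<0} h"
  by (intro cbf_continuous cbf0_cbf)

lemma cbf0_neg: "h \<in> cbf0 \<Longrightarrow> h (-1) < 0 \<Longrightarrow> t < 0 \<Longrightarrow> h t < 0"
  by (rule cbf_neg[OF cbf0_cbf])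

text \<open>For y = h(u), the number - u y / (1 + y) is the point where \<psi> of \<tau> takes the
  value y once the S-transform of \<tau> at y is - u.\<close>

lemma zmap_neg:
  fixes u y :: real
  assumes "u < 0" "1 + y > 0" "y < 0"
  shows "- (u * y) / (1 + y) < 0"
  using assms by (simp add: mult_neg_neg)

text \<open>Intermediate values for \<phi>(u) = u h(u) + z (1 + h(u)), which tends to z < 0 at 0. At
  a root z (1 + h(u)) = - u h(u) < 0, so 1 + h(u) > 0 comes for free.\<close>

lemma zmap_surj:
  assumes h: "h \<in> cbf0" "h (-1) < 0" and z: "z < 0"
  obtains u where "u < 0" "1 + h u > 0" "z = - (u * h u) / (1 + h u)"
proof -
  define \<phi> where "\<phi> u = u * h u + z * (1 + h u)" for u
  have neg: "h u < 0" if "u < 0" for u using cbf0_neg[OF h that] .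
  obtain u1 where u1: "u1 \<le> -1" "\<phi> u1 \<ge> 0"
  proof -
    \<comment> \<open>Far enough to the left for u1 h(-1) \<ge> - z; monotonicity replaces h(-1) by
      h(u1).\<close>
    define u1 where "u1 = min (-1) (- z / h (-1))"
    have "u1 \<le> -1" by (simp add: u1_def)
    have le: "h u1 \<le> h (-1)" using \<open>u1 \<le> -1\<close> by (intro cbf_mono[OF cbf0_cbf[OF h(1)]]) auto
    have "- z = (- z / h (-1)) * h (-1)" using h(2) by simp
    also have "\<dots> \<le> u1 * h (-1)" using h(2) by (intro mult_right_mono_neg) (auto simp: u1_def)
    also have "\<dots> \<le> u1 * h u1" using le \<open>u1 \<le> -1\<close> by (intro mult_left_mono_neg) auto
    finally have "u1 * h u1 + z \<ge> 0" by simp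
    moreover have "z * h u1 > 0" using z neg[of u1] \<open>u1 \<le> -1\<close> by (intro mult_neg_neg) auto
    ultimately have "\<phi> u1 \<ge> 0" by (simp add: \<phi>_def distrib_left)
    then show ?thesis using that \<open>u1 \<le> -1\<close> by blast
  qed
  have "((\<lambda>u. u * h u + z * (1 + h u)) \<longlongrightarrow> 0 * 0 + z * (1 + 0)) (at_left 0)"
    using cbf0_lim[OF h(1)] by (intro tendsto_intros)
  then have "eventually (\<lambda>u. \<phi> u < 0) (at_left 0)" unfolding \<phi>_def using z by (intro order_tendstoD(2)) auto
  moreover have "eventually (\<lambda>u. u \<in> {-1<..<0}) (at_left (0::real))" by (rule eventually_at_left_real) simp
  ultimately obtain u2 where u2: "\<phi> u2 < 0" "u2 \<in> {-1<..<0}"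
    using eventually_happens[OF eventually_conj] by (force simp: trivial_limit_at_left_real)
  have "\<exists>u\<ge>u1. u \<le> u2 \<and> \<phi> u = 0"
  proof (rule IVT2')
    show "continuous_on {u1..u2} \<phi>" unfolding \<phi>_def
      by (intro continuous_intros continuous_on_subset[OF cbf0_continuous[OF h(1)]]) (use u2 in auto)
  qed (use u1 u2 in auto)
  then obtain u where u: "u \<le> u2" "\<phi> u = 0" by auto
  then have u0: "u < 0" using u2 by auto
  have "u * h u > 0" using u0 neg[OF u0] by (rule mult_neg_neg)
  then have "z * (1 + h u) < 0" using u(2) by (simp add: \<phi>_def)
  then have p: "1 + h u > 0" using z by (simp add: mult_less_0_iff)
  moreover have "z = - (u * h u) / (1 + h u)" using u(2) p by (simp add: \<phi>_def field_simps)
  ultimately show ?thesis using that u0 by blast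
qed

lemma isT_M: "isT \<tau> h \<Longrightarrow> u < 0 \<Longrightarrow> 1 + h u > 0 \<Longrightarrow> M_tr \<tau> (- (u * h u) / (1 + h u)) = 1 + h u"
  by (auto simp: isT_def)

lemma isT_Pplus: "isT \<tau> h \<Longrightarrow> \<tau> \<in> Pplus" by (simp add: isT_def)
lemma isT_neg: "isT \<tau> h \<Longrightarrow> t < 0 \<Longrightarrow> h t < 0" by (auto simp: isT_def intro: cbf0_neg)

lemma isT_unique:
  assumes "isT \<tau> h" "isT \<tau>' h'" "\<And>t. t < 0 \<Longrightarrow> h t = h' t"
  shows "\<tau> = \<tau>'"
proof (rule M_unique)
  show "\<tau> \<in> Pplus" "\<tau>' \<in> Pplus" using assms by (auto simp: isT_def)
  fix z :: real assume "z < 0"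
  then obtain u where u: "u < 0" "1 + h u > 0" "z = - (u * h u) / (1 + h u)"
    using zmap_surj[of h z] assms(1) by (auto simp: isT_def)
  show "M_tr \<tau> z = M_tr \<tau>' z"
    using isT_M[OF assms(1) u(1,2)] isT_M[OF assms(2) u(1)] u assms(3)[OF u(1)] by simp
qed

lemma isT_psi:
  assumes "isT \<tau> h" "u < 0" "1 + h u > 0"
  shows "psi_tr \<tau> (- (u * h u) / (1 + h u)) = h u"
  using isT_M[OF assms] psi_eq[OF isT_Pplus[OF assms(1)], of "- (u * h u) / (1 + h u)"]
    zmap_neg[of u "h u"] assms isT_neg[OF assms(1,2)] by simp

lemma isT_ne: assumes "isT \<tau> h" shows "\<tau> \<noteq> delta0"
proof
  assume d: "\<tau> = delta0"
  obtain u where u: "u < 0" "1 + h u > 0" "-1 = - (u * h u) / (1 + h u)"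
    using zmap_surj[of h "-1"] assms by (auto simp: isT_def)
  have "1 + h u = 1" using isT_M[OF assms u(1,2)] by (simp add: d M_delta0)
  then show False using isT_neg[OF assms u(1)] by simp
qed

lemma isT_range:
  assumes "isT \<tau> h"
  shows "{-1 + measure \<tau> {0}<..<0} = h ` {u. u < 0 \<and> 1 + h u > 0}"
  unfolding psi_range[OF isT_Pplus[OF assms] isT_ne[OF assms], symmetric]
proof safe
  fix z :: real assume "z < 0"
  then obtain u where u: "u < 0" "1 + h u > 0" "z = - (u * h u) / (1 + h u)"
    using zmap_surj[of h z] assms by (auto simp: isT_def)
  then show "psi_tr \<tau> z \<in> h ` {u. u < 0 \<and> 1 + h u > 0}" using isT_psi[OF assms u(1,2)] by auto
next
  fix u assume u: "u < 0" "1 + h u > 0"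
  show "h u \<in> psi_tr \<tau> ` {..<0}"
    using isT_psi[OF assms u] zmap_neg[OF u isT_neg[OF assms u(1)]]
    by (intro image_eqI[of _ _ "- (u * h u) / (1 + h u)"]) auto
qed

lemma isT_S:
  assumes "isT \<tau> h" "u < 0" "1 + h u > 0"
  shows "S_tr \<tau> (h u) = - u"
proof -
  have n: "h u < 0" by (rule isT_neg[OF assms(1,2)])
  have "S_tr \<tau> (h u) = (1 + h u) / h u * (- (u * h u) / (1 + h u))"
    using S_psi[OF isT_Pplus[OF assms(1)] isT_ne[OF assms(1)] zmap_neg[OF assms(2,3) n]] isT_psi[OF assms] by simp
  then show ?thesis using n assms by simp
qed

section \<open>Roots on the negative half-line and multiplicative powers\<close>

lemma interval_eq_endpoint:
  fixes a b :: real
  assumes "{a<..<0} = {b<..<0}" "a < 0" "b < 0"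
  shows "a = b"
  using assms by (simp add: greaterThanLessThan_eq_iff)

lemma atom_less_1:
  assumes "\<mu> \<in> Pplus" "\<mu> \<noteq> delta0"
  shows "measure \<mu> {0} < 1"
  using M_gt_atom[OF assms, of "-1"] M_le_1[OF assms(1), of "-1"] by simp

definition neg_root :: "nat \<Rightarrow> real \<Rightarrow> real" where
  "neg_root n t = - ((- t) powr (1 / real n))"

lemma neg_root_neg: "t < 0 \<Longrightarrow> neg_root n t < 0"
  by (simp add: neg_root_def)

lemma neg_root_power: "n \<ge> 1 \<Longrightarrow> a > 0 \<Longrightarrow> neg_root n (- (a ^ n)) = - a"
  by (simp add: neg_root_def powr_realpow[symmetric] powr_powr)

lemma neg_root_1: "t < 0 \<Longrightarrow> neg_root 1 t = t"
  by (simp add: neg_root_def)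

lemma cbf0_neg_root:
  assumes h: "h \<in> cbf0" and n: "n \<ge> 1"
  shows "(\<lambda>t. h (neg_root n t)) \<in> cbf0"
proof -
  have c: "neg_root n \<in> cbf" unfolding neg_root_def[abs_def] using n by (intro cbf_powr) auto
  have "((\<lambda>t. - ((- t) powr (1 / real n))) \<longlongrightarrow> - ((- 0) powr (1 / real n))) (at_left 0)"
    using n by (intro tendsto_minus tendsto_powr2 tendsto_intros) (auto simp: eventually_at_filter)
  then have "filterlim (neg_root n) (at_left 0) (at_left 0)"
    using neg_root_neg by (intro filterlim_at_leftI) (auto simp: neg_root_def[abs_def])
  from filterlim_compose[OF cbf0_lim[OF h] this]
  have "((\<lambda>t. h (neg_root n t)) \<longlongrightarrow> 0) (at_left 0)" .
  moreover have "(\<lambda>t. h (neg_root n t)) \<in> cbf" by (rule cbf_comp[OF cbf0_cbf[OF h] c]) (simp add: neg_root_neg)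
  ultimately show ?thesis by (simp add: cbf0_def)
qed

text \<open>At the common value h(- a) the S-transforms of \<tau> and of \<sigma>(n) are a and a^n,
  since \<open>neg_root\<close> takes - (a^n) to - a. So S-transforms multiply as required.\<close>

lemma nfold_boxtimes:
  assumes T: "isT \<tau> h" and \<sigma>: "\<And>n. n \<ge> 1 \<Longrightarrow> isT (\<sigma> n) (\<lambda>t. h (neg_root n t))" and n: "n \<ge> 1"
  shows "nfold boxtimes n \<tau> = \<sigma> n"
  using n
proof (induction n rule: dec_induct)
  case base
  have "\<tau> = \<sigma> 1" by (rule isT_unique[OF T \<sigma>]) (auto simp: neg_root_1[unfolded One_nat_def] neg_root_1)
  then show ?case by (simp add: nfold_def)
next
  case (step n)
  have n: "n \<ge> 1" "Suc n \<ge> 1" using step by auto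
  \<comment> \<open>Inserting the root permutes the arguments but keeps the set of values; hence all
    \<sigma>(k) have the same atom at 0 as \<tau>.\<close>
  have range_eq: "(\<lambda>t. h (neg_root k t)) ` {u. u < 0 \<and> 1 + h (neg_root k u) > 0} = h ` {u. u < 0 \<and> 1 + h u > 0}" if k: "k \<ge> 1" for k
  proof safe
    fix u :: real assume "u < 0" "1 + h (neg_root k u) > 0"
    then show "h (neg_root k u) \<in> h ` {u. u < 0 \<and> 1 + h u > 0}" using neg_root_neg by auto
  next
    fix u :: real assume u: "u < 0" "1 + h u > 0"
    have "neg_root k (- ((- u) ^ k)) = u" using neg_root_power[OF k, of "- u"] u by simp
    moreover have "- ((- u) ^ k) < 0" using u by simp
    ultimately show "h u \<in> (\<lambda>t. h (neg_root k t)) ` {u. u < 0 \<and> 1 + h (neg_root k u) > 0}"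
      using u by (intro image_eqI[of _ _ "- ((- u) ^ k)"]) auto
  qed
  have atom: "measure (\<sigma> k) {0} = measure \<tau> {0}" if k: "k \<ge> 1" for k
  proof -
    have "{-1 + measure (\<sigma> k) {0}<..<0} = {-1 + measure \<tau> {0}<..<0}"
      unfolding isT_range[OF \<sigma>[OF k]] isT_range[OF T] by (rule range_eq[OF k])
    then have "-1 + measure (\<sigma> k) {0} = -1 + measure \<tau> {0}"
      using atom_less_1[OF isT_Pplus[OF \<sigma>[OF k]] isT_ne[OF \<sigma>[OF k]]] atom_less_1[OF isT_Pplus[OF T] isT_ne[OF T]]
      by (intro interval_eq_endpoint) auto
    then show ?thesis by simp
  qed
  have "boxtimes \<tau> (\<sigma> n) = \<sigma> (Suc n)"
  proof (rule boxtimes_eq)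
    show "\<tau> \<noteq> delta0" "\<sigma> n \<noteq> delta0" "\<sigma> (Suc n) \<noteq> delta0" "\<sigma> (Suc n) \<in> Pplus"
      using isT_ne[OF T] isT_ne[OF \<sigma>[OF n(1)]] isT_ne[OF \<sigma>[OF n(2)]] isT_Pplus[OF \<sigma>[OF n(2)]] by auto
    show "measure (\<sigma> (Suc n)) {0} = max (measure \<tau> {0}) (measure (\<sigma> n) {0})"
      using atom[OF n(1)] atom[OF n(2)] by simp
    fix t assume "-1 + max (measure \<tau> {0}) (measure (\<sigma> n) {0}) < t" "t < 0"
    then have "t \<in> {-1 + measure \<tau> {0}<..<0}" using atom[OF n(1)] by simp
    then obtain u where u: "u < 0" "1 + h u > 0" "t = h u" unfolding isT_range[OF T] by auto
    define a where "a = - u"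
    have a: "a > 0" "u = - a" using u by (auto simp: a_def)
    have r: "neg_root n (- (a ^ n)) = u" "neg_root (Suc n) (- (a ^ Suc n)) = u" using neg_root_power[OF n(1) a(1)] neg_root_power[OF n(2) a(1)] a by auto
    have "S_tr (\<sigma> (Suc n)) (h (neg_root (Suc n) (- (a ^ Suc n)))) = - (- (a ^ Suc n))"
      by (rule isT_S[OF \<sigma>[OF n(2)]]) (use a u r in auto)
    moreover have "S_tr (\<sigma> n) (h (neg_root n (- (a ^ n)))) = - (- (a ^ n))"
      by (rule isT_S[OF \<sigma>[OF n(1)]]) (use a u r in auto)
    moreover have "S_tr \<tau> t = a" using isT_S[OF T u(1,2)] u(3) a by simp
    ultimately show "S_tr (\<sigma> (Suc n)) t = S_tr \<tau> t * S_tr (\<sigma> n) t" using r u(3) by simp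
  qed
  then show ?case using nfold_Suc[of n boxtimes \<tau>] step n by simp
qed

section \<open>Existence of the measures described by \<open>isT\<close>\<close>

lemma M_ge_atom:
  assumes \<mu>: "\<mu> \<in> Pplus" and t: "t < 0"
  shows "measure \<mu> {0} \<le> M_tr \<mu> t"
  using M_gt_atom[OF \<mu> _ t] by (cases "\<mu> = delta0") (auto simp: M_delta0 measure_return)

text \<open>An atom m > 0 would keep M \<ge> m. But then g(z) \<le> z m reaches any prescribed u,
  and M(z) = 1 + h(g(z)) \<le> 1 + h(u) drops below m.\<close>

lemma isR_atom0:
  assumes R: "isR \<mu> h" and unb: "\<And>c. c > -1 \<Longrightarrow> \<exists>u<0. h u < c"
  shows "measure \<mu> {0} = 0"
proof (rule ccontr)
  define m where "m = measure \<mu> {0}"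
  assume "measure \<mu> {0} \<noteq> 0"
  then have m: "m > 0" unfolding m_def by (simp add: zero_less_measure_iff)
  have \<mu>: "\<mu> \<in> Pplus" and h: "h \<in> cbf" and eq: "\<And>t. t < 0 \<Longrightarrow> M_tr \<mu> t = 1 + h (g_tr \<mu> t)"
    using R by (auto simp: isR_def cbf0_def)
  obtain u where u: "u < 0" "h u < -1 + m" using unb[of "-1 + m"] m by auto
  define z where "z = u / m"
  have z: "z < 0" using u m by (simp add: z_def divide_neg_pos)
  have M: "m \<le> M_tr \<mu> z" unfolding m_def by (rule M_ge_atom[OF \<mu> z])
  have "g_tr \<mu> z \<le> z * m" unfolding g_tr_def using M z by (intro mult_left_mono_neg) auto
  also have "\<dots> = u" using m by (simp add: z_def)
  finally have "h (g_tr \<mu> z) \<le> h u" by (intro cbf_mono[OF h] u(1))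
  then show False using M eq[OF z] u(2) by simp
qed

text \<open>1 / (1 - t / u) = 1 - 1 / (1 - u / t) for u > 0; the absence of an atom at 0 gives u > 0
  almost everywhere.\<close>

lemma inverse_measure:
  assumes \<mu>: "\<mu> \<in> Pplus" and 0: "measure \<mu> {0} = 0"
  shows "mpow \<mu> (-1) \<in> Pplus" "measure (mpow \<mu> (-1)) {0} = 0"
    "\<And>t. t < 0 \<Longrightarrow> M_tr (mpow \<mu> (-1)) t = 1 - M_tr \<mu> (1 / t)"
proof -
  interpret real_distribution \<mu> using \<mu> by (simp add: Pplus_def)
  show "mpow \<mu> (-1) \<in> Pplus" unfolding mpow_def by (rule Pplus_distr[OF \<mu>]) auto
  have "measure (mpow \<mu> (-1)) {0} = measure \<mu> ((\<lambda>x. x powr -1) -` {0} \<inter> space \<mu>)"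
    unfolding mpow_def by (rule measure_distr) auto
  also have "(\<lambda>x. x powr -1) -` {0} \<inter> space \<mu> = {0::real}" by auto
  finally show "measure (mpow \<mu> (-1)) {0} = 0" using 0 by simp
  have "AE u in \<mu>. u \<notin> {0}" using 0 by (subst prob_eq_0[symmetric]) auto
  then have AEpos: "AE u in \<mu>. u > 0" using Pplus_AE[OF \<mu>] by eventually_elim simp
  fix t :: real assume t: "t < 0"
  have "M_tr (mpow \<mu> (-1)) t = (LINT u|\<mu>. 1 / (1 - t * (u powr -1)))"
    unfolding M_tr_def mpow_def by (rule integral_distr) auto
  also have "\<dots> = (LINT u|\<mu>. 1 - 1 / (1 - 1 / t * u))"
  proof (rule integral_cong_AE)
    show "AE u in \<mu>. 1 / (1 - t * u powr - 1) = 1 - 1 / (1 - 1 / t * u)"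
      using AEpos
    proof eventually_elim
      case (elim u)
      have "1 - t * u powr -1 = (u - t) / u" using elim by (simp add: powr_minus field_simps)
      moreover have "1 - 1 / t * u = (t - u) / t" using t by (simp add: field_simps)
      moreover have "u - t > 0" using elim t by simp
      ultimately show ?case using elim t by (simp add: field_simps)
    qed
  qed measurable
  also have "\<dots> = 1 - M_tr \<mu> (1 / t)"
    unfolding M_tr_def using integrable_M[OF \<mu>, of "1 / t"] t
    by (subst Bochner_Integration.integral_diff) (auto simp: prob_space[simplified])
  finally show "M_tr (mpow \<mu> (-1)) t = 1 - M_tr \<mu> (1 / t)" .
qed

lemma isR_M:
  assumes R: "isR \<mu> h" and u: "u < 0" "1 + h u > 0"
  shows "M_tr \<mu> (u / (1 + h u)) = 1 + h u"
proof -
  have \<mu>: "\<mu> \<in> Pplus" and h: "h \<in> cbf" and eq: "\<And>t. t < 0 \<Longrightarrow> M_tr \<mu> t = 1 + h (g_tr \<mu> t)"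
    using R by (auto simp: isR_def cbf0_def)
  have x: "u / (1 + h u) < 0" using u by (simp add: divide_neg_pos)
  show ?thesis
  proof (rule fix_unique[OF h x])
    show "M_tr \<mu> (u / (1 + h u)) > 0" using M_pos[OF \<mu>] x by simp
    show "M_tr \<mu> (u / (1 + h u)) = 1 + h (u / (1 + h u) * M_tr \<mu> (u / (1 + h u)))"
      using eq[OF x] by (simp add: g_tr_def)
  qed (use u in auto)
qed

text \<open>Twice take the measure with a given R-transform and invert it. If \<mu> has R-transform
  h and \<nu> is its inverse, then the measure \<rho> with R-transform \<psi> of \<nu> plays the
  role of the product of the Marchenko-Pastur law with \<nu>, so its inverse is the measure sought.
  The condition on h rules out atoms at 0 in both inversions.\<close>

lemma isT_exists_unbounded:
  assumes h: "h \<in> cbf0" "h (-1) < 0" and unb: "\<And>c. c > -1 \<Longrightarrow> \<exists>u<0. h u < c"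
  obtains \<tau> where "isT \<tau> h"
proof -
  obtain \<mu> where R: "isR \<mu> h" using isR_exists[OF h(1)] by blast
  have \<mu>: "\<mu> \<in> Pplus" using R by (simp add: isR_def)
  define \<nu> where "\<nu> = mpow \<mu> (-1)"
  have "measure \<mu> {0} = 0" by (rule isR_atom0[OF R unb])
  note \<nu> = inverse_measure[OF \<mu> this, folded \<nu>_def]
  have psi\<nu>: "psi_tr \<nu> t = - M_tr \<mu> (1 / t)" if "t < 0" for t
    using psi_eq[OF \<nu>(1), of t] \<nu>(3)[OF that] that by simp
  obtain \<rho> where \<rho>: "isR \<rho> (psi_tr \<nu>)" using isR_exists[OF psi_cbf0[OF \<nu>(1)]] by blast
  have \<rho>P: "\<rho> \<in> Pplus" using \<rho> by (simp add: isR_def)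
  have unb2: "\<exists>u<0. psi_tr \<nu> u < c" if "c > -1" for c
  proof -
    have "eventually (\<lambda>x. M_tr \<mu> x > - c) (at_left 0)" using that by (intro order_tendstoD(1)[OF M_lim[OF \<mu>]]) auto
    moreover have "eventually (\<lambda>x. x < 0) (at_left (0::real))" by (auto simp: eventually_at_filter)
    ultimately obtain x where x: "M_tr \<mu> x > - c" "x < 0"
      using eventually_happens[OF eventually_conj] by (force simp: trivial_limit_at_left_real)
    then show ?thesis using psi\<nu>[of "1 / x"] by (intro exI[of _ "1 / x"]) (auto simp: divide_neg_pos)
  qed
  define \<tau> where "\<tau> = mpow \<rho> (-1)"
  have "measure \<rho> {0} = 0" by (rule isR_atom0[OF \<rho> unb2])
  note \<tau> = inverse_measure[OF \<rho>P this, folded \<tau>_def]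
  have "M_tr \<tau> (- (u * h u) / (1 + h u)) = 1 + h u" if u: "u < 0" "1 + h u > 0" for u
  proof -
    define z where "z = - (u * h u) / (1 + h u)"
    have n: "h u < 0" by (rule cbf0_neg[OF h u(1)])
    have z: "z < 0" unfolding z_def by (rule zmap_neg[OF u n])
    have z1: "1 / z < 0" using z by simp
    \<comment> \<open>- h(u) solves the fixed-point equation of \<rho> at 1 / z: the argument - h(u)
      / z equals (1 + h(u)) / u, where \<psi> of \<nu> is - (1 + h(u)).\<close>
    have "M_tr \<rho> (1 / z) = - h u"
    proof (rule fix_unique[OF psi_cbf[OF \<nu>(1)] z1])
      show "M_tr \<rho> (1 / z) > 0" using M_pos[OF \<rho>P, of "1 / z"] z1 by simp
      have "\<forall>t<0. M_tr \<rho> t = 1 + psi_tr \<nu> (t * M_tr \<rho> t)"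
        using \<rho> unfolding isR_def g_tr_def by blast
      then show "M_tr \<rho> (1 / z) = 1 + psi_tr \<nu> (1 / z * M_tr \<rho> (1 / z))" using z1 by blast
      have "1 / z * - h u = (1 + h u) / u" unfolding z_def using n u by (simp add: field_simps)
      moreover have "(1 + h u) / u < 0" using u by (simp add: divide_pos_neg)
      moreover have "psi_tr \<nu> ((1 + h u) / u) = - (1 + h u)"
        using psi\<nu>[of "(1 + h u) / u"] isR_M[OF R u] u by (simp add: divide_pos_neg)
      ultimately show "- h u = 1 + psi_tr \<nu> (1 / z * - h u)" by simp
    qed (use n in auto)
    then show ?thesis using \<tau>(3)[OF z] by (simp add: z_def)
  qed
  then have "isT \<tau> h" using \<tau>(1) h by (simp add: isT_def)
  then show ?thesis by (rule that)
qed

text \<open>Adding t / k to h makes it unbounded, so the perturbed problems have solutions. Their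
  functions t M have mass at most 1 and hence a limit along a subsequence; it remains to see that
  the defining equation and the normalisation survive.\<close>

lemma isT_exists:
  assumes h: "h \<in> cbf0" "h (-1) < 0"
  obtains \<tau> where "isT \<tau> h"
proof -
  define H where "H k t = h t + 1 / real (Suc k) * t" for k t
  have Hc: "H k \<in> cbf0" for k unfolding H_def by (intro cbf0_add cbf0_cmul cbf0_id h) auto
  have Hneg: "H k (-1) < 0" for k
  proof -
    have "1 / real (Suc k) > 0" by simp
    then show ?thesis using h(2) by (simp only: H_def)
  qed
  have "\<exists>\<tau>. isT \<tau> (H k)" for k
  proof -
    have "\<exists>u<0. H k u < c" if "c > -1" for c
    proof (intro exI conjI)
      \<comment> \<open>Here the added term equals -1, and h itself is negative.\<close>
      let ?u = "- real (Suc k) * 1"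
      show "?u < 0" by simp
      have "h ?u < 0" by (rule cbf0_neg[OF h]) simp
      then have "H k ?u < -1" by (simp add: H_def del: of_nat_Suc)
      then show "H k ?u < c" using that by simp
    qed
    then show ?thesis using isT_exists_unbounded[OF Hc Hneg] by metis
  qed
  then obtain \<tau> where \<tau>: "\<And>k. isT (\<tau> k) (H k)" by metis
  have \<tau>P: "\<tau> k \<in> Pplus" for k using \<tau> isT_Pplus by blast
  have gc: "g_tr (\<tau> k) \<in> cbf" for k using g_cbf[OF \<tau>P] .
  have "- g_tr (\<tau> k) (-1) \<le> 1" for k using M_le_1[OF \<tau>P, of "-1"] by (simp add: g_tr_def)
  then obtain r f where r: "strict_mono (r :: nat \<Rightarrow> nat)" and f: "f \<in> cbf"
    and lim: "\<And>t. t < 0 \<Longrightarrow> (\<lambda>n. g_tr (\<tau> (r n)) t) \<longlonglongrightarrow> f t"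
    using cbf_compact[of "\<lambda>k. g_tr (\<tau> k)" 1] gc by blast
  have fz: "f (- (u * h u) / (1 + h u)) = - (u * h u) / (1 + h u) * (1 + h u)" if u: "u < 0" "1 + h u > 0" for u
  proof -
    define z where "z = - (u * h u) / (1 + h u)"
    define zk where "zk k = - (u * H k u) / (1 + H k u)" for k
    have n: "h u < 0" by (rule cbf0_neg[OF h u(1)])
    have z: "z < 0" unfolding z_def by (rule zmap_neg[OF u n])
    have Hle: "H k u \<le> h u" for k using u by (simp add: H_def divide_nonpos_pos)
    have Hlim: "(\<lambda>k. H k u) \<longlonglongrightarrow> h u"
    proof -
      have "(\<lambda>k. 1 / real (Suc k)) \<longlonglongrightarrow> 0" by real_asymp
      then have "(\<lambda>k. h u + 1 / real (Suc k) * u) \<longlonglongrightarrow> h u + 0 * u" by (intro tendsto_intros)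
      then show ?thesis by (simp add: H_def)
    qed
    have ev: "eventually (\<lambda>k. 1 + H k u > 0) sequentially"
      using order_tendstoD(1)[OF Hlim, of "-1"] u by (auto elim: eventually_mono)
    have zklim: "zk \<longlonglongrightarrow> z" unfolding zk_def z_def using u by (intro tendsto_intros Hlim) auto
    have Alim: "(\<lambda>k. - (u * H k u)) \<longlonglongrightarrow> - (u * h u)" by (intro tendsto_intros Hlim)
    have Blim: "(\<lambda>k. z / zk k * - (u * H k u)) \<longlonglongrightarrow> z / z * - (u * h u)"
      using z by (intro tendsto_mult tendsto_divide tendsto_const zklim Alim) auto
    \<comment> \<open>The equation for \<tau>(k) holds at the moving point zk \<le> z. Monotonicity
      of g and of its slope carries it over to the fixed point z with an error that vanishes as zk
      \<rightarrow> z.\<close>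
    have est: "- (u * H k u) \<le> g_tr (\<tau> k) z \<and> g_tr (\<tau> k) z \<le> z / zk k * - (u * H k u)" if p: "1 + H k u > 0" for k
    proof -
      have Hn: "H k u < 0" using Hle[of k] n by simp
      have zkn: "zk k < 0" unfolding zk_def by (rule zmap_neg[OF u(1) p Hn])
      have ge: "g_tr (\<tau> k) (zk k) = - (u * H k u)"
        using isT_M[OF \<tau>[of k] u(1) p] p by (simp add: g_tr_def zk_def)
      have "- h u / (1 + h u) \<le> - H k u / (1 + H k u)" using Hle[of k] p n by (intro frac_le) auto
      then have "u * (- H k u / (1 + H k u)) \<le> u * (- h u / (1 + h u))" using u by (intro mult_left_mono_neg) auto
      then have le: "zk k \<le> z" by (simp add: zk_def z_def)
      have "g_tr (\<tau> k) (zk k) \<le> g_tr (\<tau> k) z" by (rule cbf_mono[OF gc le z])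
      moreover have "g_tr (\<tau> k) (zk k) / zk k \<le> g_tr (\<tau> k) z / z" by (rule cbf_slope[OF gc le z])
      then have "z * (g_tr (\<tau> k) z / z) \<le> z * (g_tr (\<tau> k) (zk k) / zk k)"
        using z by (intro mult_left_mono_neg) auto
      ultimately show ?thesis using z by (simp add: ge)
    qed
    have "(\<lambda>k. g_tr (\<tau> k) z) \<longlonglongrightarrow> - (u * h u)"
    proof (rule tendsto_sandwich[OF _ _ Alim])
      show "\<forall>\<^sub>F k in sequentially. - (u * H k u) \<le> g_tr (\<tau> k) z"
        using ev by eventually_elim (use est in blast)
      show "\<forall>\<^sub>F k in sequentially. g_tr (\<tau> k) z \<le> z / zk k * - (u * H k u)"
        using ev by eventually_elim (use est in blast)
      show "(\<lambda>k. z / zk k * - (u * H k u)) \<longlonglongrightarrow> - (u * h u)" using Blim z by simp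
    qed
    from LIMSEQ_subseq_LIMSEQ[OF this r] have "(\<lambda>n. g_tr (\<tau> (r n)) z) \<longlonglongrightarrow> - (u * h u)" by (simp add: o_def)
    then have "f z = - (u * h u)" using lim[OF z] LIMSEQ_unique by blast
    then show ?thesis using u by (simp add: z_def)
  qed
  have f_le: "f t / t \<le> 1" if t: "t < 0" for t
  proof -
    have "(\<lambda>n. g_tr (\<tau> (r n)) t / t) \<longlonglongrightarrow> f t / t" using lim[OF t] t by (intro tendsto_intros) auto
    then show ?thesis
    proof (rule LIMSEQ_le_const2)
      show "\<exists>N. \<forall>n\<ge>N. g_tr (\<tau> (r n)) t / t \<le> 1" using M_le_1[OF \<tau>P, of t] t by (simp add: g_tr_def)
    qed
  qed
  have "((\<lambda>t. f t / t) \<longlongrightarrow> 1) (at_left 0)"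
  proof (rule order_tendstoI)
    fix a :: real assume a: "a < 1"
    \<comment> \<open>One u close to 0 gives a z with f(z) / z = 1 + h(u) > a, and the slope is
      monotone on (z, 0).\<close>
    have "eventually (\<lambda>u. h u > max (a - 1) (-1)) (at_left 0)" using a by (intro order_tendstoD(1)[OF cbf0_lim[OF h(1)]]) auto
    moreover have "eventually (\<lambda>u. u < 0) (at_left (0::real))" by (auto simp: eventually_at_filter)
    ultimately obtain u where u: "h u > max (a - 1) (-1)" "u < 0"
      using eventually_happens[OF eventually_conj] by (force simp: trivial_limit_at_left_real)
    then have p: "1 + h u > 0" by simp
    define z where "z = - (u * h u) / (1 + h u)"
    have z: "z < 0" unfolding z_def by (rule zmap_neg[OF u(2) p cbf0_neg[OF h u(2)]])
    have "eventually (\<lambda>t. t \<in> {z<..<0}) (at_left 0)" using z by (rule eventually_at_left_real)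
    then show "eventually (\<lambda>t. f t / t > a) (at_left 0)"
    proof eventually_elim
      case (elim t)
      then have "f z / z \<le> f t / t" by (intro cbf_slope[OF f]) auto
      moreover have "f z / z = 1 + h u" using fz[OF u(2) p] z by (simp only: z_def[symmetric]) simp
      ultimately show ?case using u(1) by simp
    qed
  next
    fix a :: real assume "a > 1"
    then show "eventually (\<lambda>t. f t / t < a) (at_left 0)"
      unfolding eventually_at_filter by (intro always_eventually allI impI le_less_trans[OF f_le]) auto
  qed
  then obtain \<tau>' where \<tau>': "\<tau>' \<in> Pplus" "\<And>t. t < 0 \<Longrightarrow> M_tr \<tau>' t = f t / t" using cbf_prob[OF f] by blast
  have "isT \<tau>' h" unfolding isT_def
  proof (intro conjI \<tau>'(1) h allI impI)
    fix u :: real assume u: "u < 0" "1 + h u > 0"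
    have z: "- (u * h u) / (1 + h u) < 0" by (rule zmap_neg[OF u cbf0_neg[OF h u(1)]])
    show "M_tr \<tau>' (- (u * h u) / (1 + h u)) = 1 + h u"
      unfolding \<tau>'(2)[OF z] fz[OF u] by (rule nonzero_mult_div_cancel_left[OF less_imp_neq[OF z]])
  qed
  then show ?thesis by (rule that)
qed


section \<open>Distribution functions and the map \<open>\<Phi>\<close>\<close>

text \<open>Conditions are imposed for x \<ge> 0 only, since \<open>of_df\<close> sets the function
  to 0 to the left.\<close>

definition isdf :: "(real \<Rightarrow> real) \<Rightarrow> bool" where
  "isdf F \<longleftrightarrow> (\<forall>x\<ge>0. 0 \<le> F x) \<and> (\<forall>x y. 0 \<le> x \<longrightarrow> x \<le> y \<longrightarrow> F x \<le> F y) \<and>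
     (\<forall>x\<ge>0. (F \<longlongrightarrow> F x) (at_right x)) \<and> (F \<longlongrightarrow> 1) at_top"

lemma isdfD:
  assumes "isdf F"
  shows "x \<ge> 0 \<Longrightarrow> 0 \<le> F x" "0 \<le> x \<Longrightarrow> x \<le> y \<Longrightarrow> F x \<le> F y"
    "x \<ge> 0 \<Longrightarrow> (F \<longlongrightarrow> F x) (at_right x)" "(F \<longlongrightarrow> 1) at_top"
  using assms by (auto simp: isdf_def)

lemma isdf_le_1:
  assumes "isdf F" "x \<ge> 0"
  shows "F x \<le> 1"
proof (rule tendsto_lowerbound[OF isdfD(4)[OF assms(1)]])
  show "\<forall>\<^sub>F y in at_top. F x \<le> F y"
    using eventually_ge_at_top[of x] by eventually_elim (use isdfD(2)[OF assms(1,2)] in simp)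
qed simp

lemma cdf_neg_eq_0:
  assumes \<mu>: "\<mu> \<in> Pplus" and a: "a < 0"
  shows "cdf \<mu> a = 0"
proof -
  interpret real_distribution \<mu> using \<mu> by (simp add: Pplus_def)
  have "AE u in \<mu>. u \<notin> {..a}" using Pplus_AE[OF \<mu>] by eventually_elim (use a in auto)
  then show ?thesis unfolding cdf_def by (subst (asm) prob_eq_0[symmetric]) auto
qed

lemma measure_eq_cdf:
  assumes \<mu>: "\<mu> \<in> Pplus"
  shows "measure \<mu> {0..x} = cdf \<mu> x"
  unfolding cdf_def
proof (rule measure_eq_AE)
  show "AE u in \<mu>. u \<in> {0..x} \<longleftrightarrow> u \<in> {..x}" using Pplus_AE[OF \<mu>] by eventually_elim auto
qed (use Pplus_sets[OF \<mu>] in auto)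

text \<open>Right continuity recovers the atom at 0, so transforms evaluated at - 1 / x are
  enough.\<close>

lemma Pplus_eqI:
  assumes \<mu>: "\<mu> \<in> Pplus" and \<nu>: "\<nu> \<in> Pplus"
    and eq: "\<And>x. x > 0 \<Longrightarrow> measure \<mu> {0..x} = measure \<nu> {0..x}"
  shows "\<mu> = \<nu>"
proof (rule cdf_unique)
  show "real_distribution \<mu>" "real_distribution \<nu>" using \<mu> \<nu> by (auto simp: Pplus_def)
  then interpret \<mu>: real_distribution \<mu> + \<nu>: real_distribution \<nu> .
  have pos: "cdf \<mu> x = cdf \<nu> x" if "x > 0" for x
    using eq[OF that] by (simp add: measure_eq_cdf \<mu> \<nu>)
  show "cdf \<mu> = cdf \<nu>"
  proof
    fix x :: real
    consider "x < 0" | "x = 0" | "x > 0" by linarith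
    then show "cdf \<mu> x = cdf \<nu> x"
    proof cases
      case 2
      have "(cdf \<mu> \<longlongrightarrow> cdf \<mu> 0) (at_right 0)" "(cdf \<nu> \<longlongrightarrow> cdf \<nu> 0) (at_right 0)"
        using \<mu>.cdf_is_right_cont[of 0] \<nu>.cdf_is_right_cont[of 0] by (auto simp: continuous_within)
      moreover have "(cdf \<mu> \<longlongrightarrow> cdf \<mu> 0) (at_right 0) \<longleftrightarrow> (cdf \<nu> \<longlongrightarrow> cdf \<mu> 0) (at_right 0)"
        by (rule tendsto_cong) (auto simp: eventually_at_filter pos)
      ultimately have "(cdf \<nu> \<longlongrightarrow> cdf \<mu> 0) (at_right 0)" by simp
      from tendsto_unique[OF _ this \<open>(cdf \<nu> \<longlongrightarrow> cdf \<nu> 0) (at_right 0)\<close>] show ?thesis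
        using 2 by simp
    qed (simp_all add: cdf_neg_eq_0 \<mu> \<nu> pos)
  qed
qed

lemma of_df:
  assumes F: "isdf F"
  shows of_df_Pplus: "of_df F \<in> Pplus" and measure_of_df: "x \<ge> 0 \<Longrightarrow> measure (of_df F) {0..x} = F x"
proof -
  define G where "G t = (if t < 0 then 0 else F t)" for t
  have mono: "G x \<le> G y" if "x \<le> y" for x y
    using that isdfD(1,2)[OF F] by (auto simp: G_def)
  have rc: "continuous (at_right a) G" for a
  proof (cases "a < 0")
    case True
    have "eventually (\<lambda>t. t \<in> {a<..<0}) (at_right a)" using True by (rule eventually_at_right_real)
    then have "eventually (\<lambda>t. G t = 0) (at_right a)" by eventually_elim (simp add: G_def)
    then show ?thesis using True by (simp add: continuous_within G_def[of a] tendsto_eventually)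
  next
    case False
    have "(F \<longlongrightarrow> F a) (at_right a)" using isdfD(3)[OF F] False by simp
    moreover have "eventually (\<lambda>t. F t = G t) (at_right a)"
      using False by (auto simp: eventually_at_filter G_def intro!: always_eventually)
    ultimately have "(G \<longlongrightarrow> F a) (at_right a)" by (rule Lim_transform_eventually)
    then show ?thesis using False by (simp add: continuous_within G_def[of a])
  qed
  have bot: "(G \<longlongrightarrow> 0) at_bot"
    by (rule tendsto_eventually) (auto simp: G_def eventually_at_bot_dense)
  have "eventually (\<lambda>t. F t = G t) at_top"
    using eventually_ge_at_top[of 0] by eventually_elim (simp add: G_def)
  then have top: "(G \<longlongrightarrow> 1) at_top" by (rule Lim_transform_eventually[OF isdfD(4)[OF F]])
  have eq: "of_df F = interval_measure G" by (simp add: of_df_def G_def[abs_def])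
  have rd: "real_distribution (of_df F)" unfolding eq
    by (rule real_distribution_interval_measure[OF mono rc bot top])
  then interpret real_distribution "of_df F" .
  have cdf: "cdf (of_df F) = G" unfolding eq by (rule cdf_interval_measure[OF mono rc bot])
  have "AE u in of_df F. \<forall>n::nat. u \<notin> {..- 1 / real (Suc n)}"
  proof (subst AE_all_countable, rule allI)
    fix n
    have "prob {..- 1 / real (Suc n)} = 0"
      using fun_cong[OF cdf, of "- 1 / real (Suc n)"] by (simp add: cdf_def G_def)
    then show "AE u in of_df F. u \<notin> {..- 1 / real (Suc n)}" by (subst prob_eq_0[symmetric]) auto
  qed
  then have "AE u in of_df F. 0 \<le> u"
  proof eventually_elim
    case (elim u)
    show ?case
    proof (rule ccontr)
      assume "\<not> 0 \<le> u"
      then obtain n where "inverse (real (Suc n)) < - u" using reals_Archimedean[of "- u"] by auto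
      then show False using elim[rule_format, of n] by (simp add: inverse_eq_divide)
    qed
  qed
  then show P: "of_df F \<in> Pplus" by (rule PplusI[OF rd])
  show "measure (of_df F) {0..x} = F x" if "x \<ge> 0"
    using that by (simp add: measure_eq_cdf[OF P] cdf G_def)
qed

lemma isdf_Pplus:
  assumes \<mu>: "\<mu> \<in> Pplus"
  shows "isdf (\<lambda>x. measure \<mu> {0..x})"
proof -
  interpret real_distribution \<mu> using \<mu> by (simp add: Pplus_def)
  show ?thesis unfolding measure_eq_cdf[OF \<mu>] isdf_def
    using cdf_nonneg cdf_nondecreasing cdf_is_right_cont cdf_lim_at_top_prob by (auto simp: continuous_within)
qed

text \<open>Right continuity forces the value at 0: for a monotone function it is the
  infimum.\<close>

lemma isdf_extend:
  assumes mono: "\<And>x y. 0 < x \<Longrightarrow> x \<le> y \<Longrightarrow> F x \<le> F y" and nonneg: "\<And>x. x > 0 \<Longrightarrow> 0 \<le> F x"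
    and cont: "continuous_on {0<..} F" and lim: "(F \<longlongrightarrow> 1) at_top"
  shows "isdf (\<lambda>x. if x = 0 then Inf (F ` {0<..}) else F x)" (is "isdf ?G")
proof -
  have bdd: "bdd_below (F ` {0<..})" using nonneg by (intro bdd_belowI[of _ 0]) auto
  have Inf_le: "Inf (F ` {0<..}) \<le> F x" if "x > 0" for x using that by (intro cInf_lower bdd) auto
  have Inf_ge: "0 \<le> Inf (F ` {0<..})" using nonneg by (intro cInf_greatest) auto
  show ?thesis unfolding isdf_def
  proof (intro conjI allI impI)
    fix x :: real assume x: "x \<ge> 0"
    show "0 \<le> ?G x" using x nonneg Inf_ge by simp
    show "?G x \<le> ?G y" if "x \<le> y" for y using x that mono Inf_le by auto
    show "(?G \<longlongrightarrow> ?G x) (at_right x)"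
    proof (cases "x = 0")
      case False
      then have "isCont F x" using cont x by (simp add: continuous_on_eq_continuous_at)
      then have "(F \<longlongrightarrow> F x) (at_right x)"
        unfolding isCont_def by (rule filterlim_mono[OF _ order_refl at_within_le_at])
      then have "(?G \<longlongrightarrow> F x) (at_right x)"
        by (rule Lim_transform_eventually) (use False x in \<open>auto simp: eventually_at_filter intro!: always_eventually\<close>)
      then show ?thesis using False by simp
    next
      case True
      have "(?G \<longlongrightarrow> Inf (F ` {0<..})) (at_right 0)"
      proof (rule order_tendstoI)
        fix a assume "a < Inf (F ` {0<..})"
        then show "eventually (\<lambda>y. a < ?G y) (at_right 0)"
          unfolding eventually_at_filter using Inf_le by (intro always_eventually) (auto intro: less_le_trans)
      next
        fix a assume "Inf (F ` {0<..}) < a"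
        then obtain y where y: "y > 0" "F y < a" using cInf_lessD[of "F ` {0<..}" a] by auto
        have "eventually (\<lambda>t. t \<in> {0<..<y}) (at_right 0)" using y(1) by (rule eventually_at_right_real)
        then show "eventually (\<lambda>t. ?G t < a) (at_right 0)"
        proof eventually_elim
          case (elim t)
          then have "F t \<le> F y" using mono[of t y] by simp
          then show ?case using elim y by simp
        qed
      qed
      then show ?thesis using True by simp
    qed
  next
    show "(?G \<longlongrightarrow> 1) at_top"
    proof (rule Lim_transform_eventually[OF lim])
      show "\<forall>\<^sub>F x in at_top. F x = ?G x" using eventually_gt_at_top[of 0] by eventually_elim simp
    qed
  qed
qed

lemma cbf0_at_top: assumes h: "h \<in> cbf0" shows "((\<lambda>x. h (- 1 / x)) \<longlongrightarrow> 0) at_top"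
proof -
  have "filterlim (\<lambda>x::real. - 1 / x) (at_left 0) at_top" by real_asymp
  from filterlim_compose[OF cbf0_lim[OF h] this] show ?thesis .
qed

lemma isdf_R:
  assumes h: "h \<in> cbf0"
  defines "F \<equiv> \<lambda>x. max (1 + h (- 1 / x)) 0"
  shows "isdf (\<lambda>x. if x = 0 then Inf (F ` {0<..}) else F x)"
proof (rule isdf_extend)
  show "F x \<le> F y" if "0 < x" "x \<le> y" for x y
  proof -
    have "- 1 / x \<le> - 1 / y" "- 1 / y < 0" using that by (auto simp: frac_le)
    from cbf_mono[OF cbf0_cbf[OF h] this] show ?thesis by (simp add: F_def max.coboundedI1)
  qed
  show "continuous_on {0<..} F" unfolding F_def
    by (intro continuous_intros continuous_on_compose2[OF cbf0_continuous[OF h]]) auto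
  have "((\<lambda>x. max (1 + h (- 1 / x)) 0) \<longlongrightarrow> max (1 + 0) 0) at_top"
    by (intro tendsto_intros cbf0_at_top h)
  then show "(F \<longlongrightarrow> 1) at_top" by (simp add: F_def)
qed (simp add: F_def)

text \<open>The functions 1 / (1 - t u), clipped at u = 0 to be bounded and continuous on the whole
  line, are test functions whose integrals are M(t).\<close>

lemma weak_conv_unique:
  assumes \<mu>: "\<And>n. \<mu> n \<in> Pplus" and \<rho>: "\<rho> \<in> Pplus" "\<rho>' \<in> Pplus"
    and w: "weak_conv_m \<mu> \<rho>" "weak_conv_m \<mu> \<rho>'"
  shows "\<rho> = \<rho>'"
proof (rule M_unique[OF \<rho>])
  fix t :: real assume t: "t < 0"
  define f where "f u = 1 / (1 - t * max 0 u)" for u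
  have d: "1 - t * max 0 u \<ge> 1" for u using one_minus_ge_1[of t "max 0 u"] t by simp
  have c: "isCont f u" for u unfolding f_def using d[of u] by (intro continuous_intros) auto
  have b: "norm (f u) \<le> 1" for u unfolding f_def using d[of u] by simp
  have rd: "real_distribution (\<mu> n)" "real_distribution \<rho>" "real_distribution \<rho>'" for n
    using \<mu> \<rho> Pplus_real_distribution by auto
  have "(\<lambda>n. LINT u|\<mu> n. f u) \<longlonglongrightarrow> (LINT u|\<rho>. f u)"
    by (rule weak_conv_imp_integral_bdd_continuous_conv[OF rd(1,2) w(1) c b])
  moreover have "(\<lambda>n. LINT u|\<mu> n. f u) \<longlonglongrightarrow> (LINT u|\<rho>'. f u)"
    by (rule weak_conv_imp_integral_bdd_continuous_conv[OF rd(1,3) w(2) c b])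
  ultimately have "(LINT u|\<rho>. f u) = (LINT u|\<rho>'. f u)" by (rule LIMSEQ_unique)
  moreover have "(LINT u|\<nu>. f u) = M_tr \<nu> t" if "\<nu> \<in> Pplus" for \<nu>
    unfolding M_tr_def
  proof (rule integral_cong_AE)
    show "AE u in \<nu>. f u = 1 / (1 - t * u)"
      using Pplus_AE[OF that] by eventually_elim (simp add: f_def)
  qed (use Pplus_sets[OF that] in \<open>auto simp: f_def[abs_def] cong: measurable_cong_sets\<close>)
  ultimately show "M_tr \<rho> t = M_tr \<rho>' t" using \<rho> by simp
qed

section \<open>The limit that defines \<Phi>\<close>

lemma Phi_map_eq:
  assumes "\<And>n. mpow (nfold boxtimes n \<mu>) (1 / real n) \<in> Pplus" "\<rho> \<in> Pplus"
    "weak_conv_m (\<lambda>n. mpow (nfold boxtimes n \<mu>) (1 / real n)) \<rho>"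
  shows "Phi_map \<mu> = \<rho>"
  unfolding Phi_map_def
proof (rule the_equality)
  show "\<rho>' = \<rho>" if "\<rho>' \<in> Pplus \<and> weak_conv_m (\<lambda>n. mpow (nfold boxtimes n \<mu>) (1 / real n)) \<rho>'" for \<rho>'
    using that assms by (intro weak_conv_unique[where \<mu>="\<lambda>n. mpow (nfold boxtimes n \<mu>) (1 / real n)"]) auto
qed (use assms in auto)

lemma mpow_Pplus: "\<mu> \<in> Pplus \<Longrightarrow> mpow \<mu> a \<in> Pplus"
  unfolding mpow_def by (rule Pplus_distr) auto

lemma measure_mpow_root:
  assumes \<mu>: "\<mu> \<in> Pplus" and n: "n \<ge> 1" and x: "x > 0"
  shows "measure (mpow \<mu> (1 / real n)) {0..x} = cdf \<mu> (x ^ n)"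
proof -
  have [measurable_cong]: "sets \<mu> = sets borel" by (rule Pplus_sets[OF \<mu>])
  have "measure (mpow \<mu> (1 / real n)) {0..x} = measure \<mu> ((\<lambda>u. u powr (1 / real n)) -` {0..x} \<inter> space \<mu>)"
    unfolding mpow_def by (rule measure_distr) auto
  also have "\<dots> = measure \<mu> {..x ^ n}"
  proof (rule measure_eq_AE)
    show "AE u in \<mu>. u \<in> (\<lambda>u. u powr (1 / real n)) -` {0..x} \<inter> space \<mu> \<longleftrightarrow> u \<in> {..x ^ n}"
      using Pplus_AE[OF \<mu>]
    proof eventually_elim
      case (elim u)
      have "u powr (1 / real n) \<le> x \<longleftrightarrow> u \<le> x ^ n"
      proof (cases "u = 0")
        case False
        then have u: "u > 0" using elim by simp
        define w where "w = u powr (1 / real n)"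
        have "w ^ n = u" using u n by (simp add: w_def powr_realpow[symmetric] powr_powr)
        moreover have "w ^ n \<le> x ^ n \<longleftrightarrow> w \<le> x" using x n by (intro power_mono_iff) (auto simp: w_def)
        ultimately show ?thesis by (simp add: w_def)
      qed (use x in simp)
      then show ?case by (simp add: Pplus_space[OF \<mu>])
    qed
  qed measurable
  finally show ?thesis by (simp add: cdf_def)
qed

text \<open>M is known at z = - c a^n, namely 1 + h(- a), and its integrand 1 / (1 - z u) is
  compared with the indicator of [0, x^n]. At the end point it equals 1 / (1 + c (a x)^n), which
  tends to 1 if a x < 1 and to 0 if a x > 1.\<close>

lemma isT_cdf_bounds:
  assumes T: "isT \<tau> (\<lambda>t. h (neg_root n t))" and n: "n \<ge> 1" and a: "a > 0" "1 + h (- a) > 0" and x: "x > 0"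
  defines "c \<equiv> - h (- a) / (1 + h (- a))"
  shows "cdf \<tau> (x ^ n) \<le> (1 + h (- a)) * (1 + c * (a * x) ^ n)"
    "1 + h (- a) \<le> cdf \<tau> (x ^ n) + 1 / (1 + c * (a * x) ^ n)" "c > 0"
proof -
  have \<tau>: "\<tau> \<in> Pplus" by (rule isT_Pplus[OF T])
  interpret real_distribution \<tau> using \<tau> by (simp add: Pplus_def)
  have r: "neg_root n (- (a ^ n)) = - a" by (rule neg_root_power[OF n a(1)])
  have neg: "h (- a) < 0" using isT_neg[OF T, of "- (a ^ n)"] r a by simp
  show c: "c > 0" unfolding c_def using neg a by (simp add: divide_neg_pos)
  \<comment> \<open>The point - u y / (1 + y) for u = - (a^n) and y = h(- a).\<close>
  define z where "z = - (c * a ^ n)"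
  have z: "z < 0" using c a by (simp add: z_def)
  have "- (- (a ^ n) * h (neg_root n (- (a ^ n)))) / (1 + h (neg_root n (- (a ^ n)))) = z"
    unfolding r by (simp add: z_def c_def)
  then have Mz: "M_tr \<tau> z = 1 + h (- a)" using isT_M[OF T, of "- (a ^ n)"] r a by simp
  define y where "y = x ^ n"
  have y: "y > 0" using x by (simp add: y_def)
  have zy: "1 - z * y = 1 + c * (a * x) ^ n" by (simp add: z_def y_def power_mult_distrib)
  have zy1: "1 - z * y \<ge> 1" using one_minus_ge_1[of z y] z y by simp
  have ind: "integrable \<tau> (\<lambda>u. indicator {..y} u * b)" for b :: real by (auto simp: less_top[symmetric])
  have "(LINT u|\<tau>. indicator {..y} u * (1 / (1 - z * y))) \<le> M_tr \<tau> z" unfolding M_tr_def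
  proof (rule integral_mono_AE)
    show "AE u in \<tau>. indicator {..y} u * (1 / (1 - z * y)) \<le> 1 / (1 - z * u)"
      using Pplus_AE[OF \<tau>]
    proof eventually_elim
      case (elim u)
      have p: "1 - z * u \<ge> 1" using one_minus_ge_1[of z u] z elim by simp
      show ?case
      proof (cases "u \<le> y")
        case True
        then have "1 - z * u \<le> 1 - z * y" using z by simp
        then show ?thesis using True p by (simp add: frac_le)
      qed (use p in simp)
    qed
  qed (use integrable_M[OF \<tau>, of z] z ind in auto)
  then have "cdf \<tau> y * (1 / (1 - z * y)) \<le> 1 + h (- a)" using Mz by (simp add: cdf_def)
  then show "cdf \<tau> (x ^ n) \<le> (1 + h (- a)) * (1 + c * (a * x) ^ n)"
    using zy1 unfolding zy y_def[symmetric] by (simp add: field_simps)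
  have "M_tr \<tau> z \<le> (LINT u|\<tau>. indicator {..y} u * 1 + 1 / (1 - z * y))" unfolding M_tr_def
  proof (rule integral_mono_AE)
    show "AE u in \<tau>. 1 / (1 - z * u) \<le> indicator {..y} u * 1 + 1 / (1 - z * y)"
      using Pplus_AE[OF \<tau>]
    proof eventually_elim
      case (elim u)
      have p: "1 - z * u \<ge> 1" using one_minus_ge_1[of z u] z elim by simp
      show ?case
      proof (cases "u \<le> y")
        case True
        have "1 / (1 - z * u) \<le> 1" using p by simp
        moreover have "0 \<le> 1 / (1 - z * y)" using zy1 by simp
        ultimately have "1 / (1 - z * u) \<le> 1 + 1 / (1 - z * y)" by linarith
        then show ?thesis using True by simp
      next
        case False
        then have "1 - z * y \<le> 1 - z * u" using z by simp
        then show ?thesis using False zy1 by (simp add: frac_le)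
      qed
    qed
  qed (use integrable_M[OF \<tau>, of z] z ind[of 1] in auto)
  also have "\<dots> = cdf \<tau> y + 1 / (1 - z * y)"
    using ind[of 1] by (subst Bochner_Integration.integral_add) (auto simp: cdf_def prob_space[simplified])
  finally have "1 + h (- a) \<le> cdf \<tau> y + 1 / (1 + c * (a * x) ^ n)" unfolding zy Mz .
  then show "1 + h (- a) \<le> cdf \<tau> (x ^ n) + 1 / (1 + c * (a * x) ^ n)" by (simp only: y_def)
qed

text \<open>Upper bounds come from \<open>isT_cdf_bounds\<close> with a slightly below 1 / x, lower
  bounds with a slightly above.\<close>

lemma Phi_isT:
  assumes T: "isT \<tau> h"
  shows "Phi_map \<tau> \<in> Pplus" "\<And>x. x > 0 \<Longrightarrow> measure (Phi_map \<tau>) {0..x} = max (1 + h (- 1 / x)) 0"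
proof -
  have h: "h \<in> cbf0" and hneg: "h (-1) < 0" using T by (auto simp: isT_def)
  have "\<exists>\<sigma>. isT \<sigma> (\<lambda>t. h (neg_root n t))" if "n \<ge> 1" for n
    using isT_exists[OF cbf0_neg_root[OF h that]] cbf0_neg[OF h hneg] neg_root_neg[of "-1"] by (metis neg_less_0_iff_less zero_less_one)
  then obtain \<sigma> where \<sigma>: "\<And>n. n \<ge> 1 \<Longrightarrow> isT (\<sigma> n) (\<lambda>t. h (neg_root n t))" by metis
  have nf: "nfold boxtimes n \<tau> = \<sigma> n" if "n \<ge> 1" for n by (rule nfold_boxtimes[OF T \<sigma> that])
  \<comment> \<open>For n = 0 truncated subtraction makes \<open>nfold\<close> return \<tau> itself,
    so the membership holds for every index of the sequence.\<close>
  have nfP: "nfold boxtimes n \<tau> \<in> Pplus" for n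
    using nf[of n] isT_Pplus[OF \<sigma>[of n]] isT_Pplus[OF T] by (cases "n \<ge> 1") (auto simp: nfold_def)
  define F where "F x = max (1 + h (- 1 / x)) 0" for x
  define \<rho> where "\<rho> = of_df (\<lambda>x. if x = 0 then Inf (F ` {0<..}) else F x)"
  have dF: "isdf (\<lambda>x. if x = 0 then Inf (F ` {0<..}) else F x)"
    unfolding F_def[abs_def] by (rule isdf_R[OF h])
  have \<rho>: "\<rho> \<in> Pplus" unfolding \<rho>_def by (rule of_df_Pplus[OF dF])
  have \<rho>F: "measure \<rho> {0..x} = F x" if "x > 0" for x unfolding \<rho>_def using measure_of_df[OF dF, of x] that by simp
  have lim: "(\<lambda>n. measure (mpow (nfold boxtimes n \<tau>) (1 / real n)) {0..x}) \<longlonglongrightarrow> F x" if x: "x > 0" for x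
  proof -
    have eq: "measure (mpow (nfold boxtimes n \<tau>) (1 / real n)) {0..x} = cdf (\<sigma> n) (x ^ n)" if "n \<ge> 1" for n
      using measure_mpow_root[OF nfP[of n] that x] nf[OF that] by simp
    define \<phi> where "\<phi> a = 1 + h (- a)" for a
    have \<phi>c: "continuous_on {0<..} \<phi>" unfolding \<phi>_def
      by (intro continuous_intros continuous_on_compose2[OF cbf0_continuous[OF h]]) auto
    have \<phi>1: "\<phi> a < 1" if "a > 0" for a using cbf0_neg[OF h hneg, of "- a"] that by (simp add: \<phi>_def)
    have Fx: "F x = max (\<phi> (1 / x)) 0" by (simp add: F_def \<phi>_def)
    show ?thesis
    proof (rule order_tendstoI)
      fix b assume b: "F x < b"
      \<comment> \<open>A positive value between F(x) and b. Solving \<phi>(a) = v gives a < 1 / x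
        with 1 + h(- a) > 0 even when \<phi>(1 / x) is negative.\<close>
      define v where "v = (max (\<phi> (1 / x)) 0 + min b 1) / 2"
      have v: "\<phi> (1 / x) < v" "0 < v" "v < b" "v < 1" using b \<phi>1[of "1 / x"] x unfolding Fx v_def by auto
      have "filterlim (\<lambda>a::real. - a) (at_left 0) (at_right 0)" by real_asymp
      from filterlim_compose[OF cbf0_lim[OF h] this]
      have "((\<lambda>a. h (- a)) \<longlongrightarrow> 0) (at_right 0)" .
      then have "eventually (\<lambda>a. h (- a) > v - 1) (at_right 0)" using v by (intro order_tendstoD(1)) auto
      moreover have "eventually (\<lambda>a. a \<in> {0<..<1 / x}) (at_right 0)"
        by (rule eventually_at_right_real) (use x in simp)
      ultimately obtain a0 where a0: "h (- a0) > v - 1" "0 < a0" "a0 < 1 / x"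
        using eventually_happens[OF eventually_conj] by (force simp: trivial_limit_at_right_real)
      have "\<exists>a\<ge>a0. a \<le> 1 / x \<and> \<phi> a = v"
      proof (rule IVT2')
        show "continuous_on {a0..1 / x} \<phi>" by (rule continuous_on_subset[OF \<phi>c]) (use a0 in auto)
      qed (use v a0 in \<open>auto simp: \<phi>_def\<close>)
      then obtain a where a: "a0 \<le> a" "a \<le> 1 / x" "\<phi> a = v" by auto
      have "a \<noteq> 1 / x" using a(3) v(1) by auto
      then have a': "a > 0" "a < 1 / x" using a a0 by auto
      define c where "c = - h (- a) / (1 + h (- a))"
      have p: "1 + h (- a) > 0" using a(3) v by (simp add: \<phi>_def)
      have ax: "0 \<le> a * x" "a * x < 1" using a' x by (auto simp: field_simps)
      have "(\<lambda>n. (1 + h (- a)) * (1 + c * (a * x) ^ n)) \<longlonglongrightarrow> (1 + h (- a)) * (1 + c * 0)"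
        using ax by (intro tendsto_intros LIMSEQ_realpow_zero)
      then have "eventually (\<lambda>n. (1 + h (- a)) * (1 + c * (a * x) ^ n) < b) sequentially"
        using a(3) v by (intro order_tendstoD(2)) (auto simp: \<phi>_def)
      then show "eventually (\<lambda>n. measure (mpow (nfold boxtimes n \<tau>) (1 / real n)) {0..x} < b) sequentially"
        using eventually_ge_at_top[of 1]
      proof eventually_elim
        case (elim n)
        then show ?case using isT_cdf_bounds(1)[OF \<sigma>[OF elim(2)] elim(2) a'(1) p x] eq[OF elim(2)] by (simp add: c_def)
      qed
    next
      fix b assume b: "b < F x"
      show "eventually (\<lambda>n. b < measure (mpow (nfold boxtimes n \<tau>) (1 / real n)) {0..x}) sequentially"
      proof (cases "b < 0")
        case True
        then show ?thesis by (intro always_eventually allI) (auto intro: less_le_trans)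
      next
        case False
        \<comment> \<open>Since 0 \<le> b < F(x), the truncation at 0 is not active at x.\<close>
        then have b': "b < \<phi> (1 / x)" using b by (simp add: Fx)
        have "isCont \<phi> (1 / x)" using \<phi>c x by (simp add: continuous_on_eq_continuous_at)
        then have "(\<phi> \<longlongrightarrow> \<phi> (1 / x)) (at_right (1 / x))"
          unfolding isCont_def by (rule filterlim_mono[OF _ order_refl at_within_le_at])
        then have "eventually (\<lambda>a. \<phi> a > b) (at_right (1 / x))" using b' by (rule order_tendstoD)
        moreover have "eventually (\<lambda>a. a > 1 / x) (at_right (1 / x))" by (simp add: eventually_at_right_less)
        ultimately obtain a where a: "\<phi> a > b" "a > 1 / x"
          using eventually_happens[OF eventually_conj] by (force simp: trivial_limit_at_right_real)
        have a': "a > 0" using a(2) x by (meson less_trans zero_less_divide_1_iff)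
        define c where "c = - h (- a) / (1 + h (- a))"
        have p: "1 + h (- a) > 0" using a(1) False by (simp add: \<phi>_def)
        have ax: "1 < a * x" using a(2) x by (simp add: field_simps)
        have c: "c > 0" unfolding c_def using isT_cdf_bounds(3)[OF \<sigma>[of 1] _ a' p x] by simp
        have "(\<lambda>n. 1 + h (- a) - 1 / (1 + c * (a * x) ^ n)) \<longlonglongrightarrow> 1 + h (- a) - 0"
          using ax c by real_asymp
        then have "eventually (\<lambda>n. 1 + h (- a) - 1 / (1 + c * (a * x) ^ n) > b) sequentially"
          using a(1) by (intro order_tendstoD(1)) (auto simp: \<phi>_def)
        then show ?thesis using eventually_ge_at_top[of 1]
        proof eventually_elim
          case (elim n)
          then show ?case using isT_cdf_bounds(2)[OF \<sigma>[OF elim(2)] elim(2) a' p x] eq[OF elim(2)] by (simp add: c_def)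
        qed
      qed
    qed
  qed
  have mP: "mpow (nfold boxtimes n \<tau>) (1 / real n) \<in> Pplus" for n by (rule mpow_Pplus[OF nfP])
  interpret \<rho>: real_distribution \<rho> using \<rho> by (simp add: Pplus_def)
  have "weak_conv_m (\<lambda>n. mpow (nfold boxtimes n \<tau>) (1 / real n)) \<rho>"
    unfolding weak_conv_m_def weak_conv_def
  proof (intro allI impI)
    fix x assume cont: "isCont (cdf \<rho>) x"
    consider "x < 0" | "x = 0" | "x > 0" by linarith
    then show "(\<lambda>n. cdf (mpow (nfold boxtimes n \<tau>) (1 / real n)) x) \<longlonglongrightarrow> cdf \<rho> x"
    proof cases
      case 1
      then show ?thesis by (simp add: cdf_neg_eq_0 mP \<rho>)
    next
      case 3
      then show ?thesis using lim[OF 3] \<rho>F[OF 3] by (simp add: measure_eq_cdf mP \<rho>)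
    next
      \<comment> \<open>0 is a continuity point only if \<rho> has no atom there; then the values at
        0 are squeezed by those at small x > 0.\<close>
      case 2
      have "(cdf \<rho> \<longlongrightarrow> cdf \<rho> 0) (at_left 0)"
        using cont 2 unfolding isCont_def by (auto intro: filterlim_mono[OF _ order_refl at_within_le_at])
      moreover have "(cdf \<rho> \<longlongrightarrow> 0) (at_left 0)"
        by (rule tendsto_eventually) (auto simp: eventually_at_filter cdf_neg_eq_0 \<rho> intro!: always_eventually)
      ultimately have z: "cdf \<rho> 0 = 0" using tendsto_unique trivial_limit_at_left_real by blast
      have "(\<lambda>n. cdf (mpow (nfold boxtimes n \<tau>) (1 / real n)) 0) \<longlonglongrightarrow> 0"
      proof (rule order_tendstoI)
        fix b :: real assume "b < 0"
        then show "eventually (\<lambda>n. b < cdf (mpow (nfold boxtimes n \<tau>) (1 / real n)) 0) sequentially"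
          by (intro always_eventually allI) (auto simp: cdf_def intro: less_le_trans)
      next
        fix b :: real assume b: "0 < b"
        have "(cdf \<rho> \<longlongrightarrow> 0) (at_right 0)"
          using \<rho>.cdf_is_right_cont[of 0] z by (simp add: continuous_within)
        then have "eventually (\<lambda>x. cdf \<rho> x < b) (at_right 0)" using b by (rule order_tendstoD)
        moreover have "eventually (\<lambda>x. x > 0) (at_right (0::real))" by (simp add: eventually_at_right_less)
        ultimately obtain x where x: "cdf \<rho> x < b" "x > 0"
          using eventually_happens[OF eventually_conj] by (force simp: trivial_limit_at_right_real)
        have "(\<lambda>n. cdf (mpow (nfold boxtimes n \<tau>) (1 / real n)) x) \<longlonglongrightarrow> cdf \<rho> x"
          using lim[OF x(2)] \<rho>F[OF x(2)] by (simp add: measure_eq_cdf mP \<rho>)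
        then have "eventually (\<lambda>n. cdf (mpow (nfold boxtimes n \<tau>) (1 / real n)) x < b) sequentially"
          using x(1) by (rule order_tendstoD)
        then show "eventually (\<lambda>n. cdf (mpow (nfold boxtimes n \<tau>) (1 / real n)) 0 < b) sequentially"
        proof eventually_elim
          case (elim n)
          have "0 \<le> x" using x by simp
          then have "measure (mpow (nfold boxtimes n \<tau>) (1 / real n)) {0..0} \<le> measure (mpow (nfold boxtimes n \<tau>) (1 / real n)) {0..x}"
            by (rule isdfD(2)[OF isdf_Pplus[OF mP] order_refl])
          then show ?case using elim by (simp only: measure_eq_cdf[OF mP])
        qed
      qed
      then show ?thesis using 2 z by simp
    qed
  qed
  then have "Phi_map \<tau> = \<rho>" by (rule Phi_map_eq[OF mP \<rho>])
  then show "Phi_map \<tau> \<in> Pplus" "\<And>x. x > 0 \<Longrightarrow> measure (Phi_map \<tau>) {0..x} = max (1 + h (- 1 / x)) 0"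
    using \<rho> \<rho>F by (auto simp: F_def)
qed


section \<open>The Marchenko-Pastur law\<close>

definition mp_dens :: "real \<Rightarrow> real" where
  "mp_dens x = sqrt (x * (4 - x)) / (2 * pi * x)"

text \<open>The substitution x = 4 v^2 / (1 + v^2) rationalises the density.\<close>

lemma mp_sqrt_identities:
  assumes "0 < x" "x < (4::real)"
  defines "v \<equiv> sqrt (x / (4 - x))"
  shows "v > 0" "v\<^sup>2 = x / (4 - x)" "mp_dens x = 1 / (2 * pi * v)"
proof -
  have p: "x / (4 - x) > 0" using assms(1,2) by (intro divide_pos_pos) auto
  show v: "v > 0" using p by (simp add: v_def)
  show v2: "v\<^sup>2 = x / (4 - x)" unfolding v_def by (rule real_sqrt_pow2[OF less_imp_le[OF p]])
  have "sqrt (x * (4 - x)) * v = sqrt (x * (4 - x) * (x / (4 - x)))" unfolding v_def by (rule real_sqrt_mult[symmetric])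
  also have "x * (4 - x) * (x / (4 - x)) = x\<^sup>2" using assms by (simp add: power2_eq_square)
  finally have "sqrt (x * (4 - x)) * v = x" using assms by simp
  then show "mp_dens x = 1 / (2 * pi * v)" using v assms by (simp add: mp_dens_def field_simps)
qed

lemma mp_v_deriv:
  assumes x: "0 < x" "x < (4::real)"
  defines "v \<equiv> sqrt (x / (4 - x))"
  shows "((\<lambda>x. sqrt (x / (4 - x))) has_real_derivative (1 + v\<^sup>2)\<^sup>2 / (8 * v)) (at x)"
proof -
  note v = mp_sqrt_identities[OF x, folded v_def]
  have p: "x / (4 - x) > 0" using x by (intro divide_pos_pos) auto
  have q: "((\<lambda>x. x / (4 - x)) has_real_derivative 4 / ((4 - x) * (4 - x))) (at x)"
    using x by (auto intro!: derivative_eq_intros simp: field_simps)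
  have "inverse (sqrt (x / (4 - x))) / 2 * (4 / ((4 - x) * (4 - x))) = (1 + v\<^sup>2)\<^sup>2 / (8 * v)"
  proof -
    have e: "1 + v\<^sup>2 = 4 / (4 - x)" unfolding v(2) using x by (simp add: field_simps)
    show ?thesis unfolding e v_def[symmetric] by (simp add: power2_eq_square inverse_eq_divide)
  qed
  then show ?thesis using DERIV_chain2[OF DERIV_real_sqrt[OF p] q] by simp
qed

text \<open>In the variable v one has 1 - z x = (1 + b^2 v^2) / (1 + v^2), which is where b = sqrt(1
  - 4 z) comes from. Partial fractions give two arctangents, each growing from 0 to \<pi> / 2 as x
  runs through (0, 4).\<close>

lemma mp_integral:
  assumes z: "z < 0"
  defines "b \<equiv> sqrt (1 - 4 * z)"
  shows "set_integrable lborel {0<..<4} (\<lambda>x. mp_dens x / (1 - z * x))"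
    "(LINT x:{0<..<4}|lborel. mp_dens x / (1 - z * x)) = 2 / (1 + b)"
proof -
  have b: "b > 1" "b\<^sup>2 = 1 - 4 * z" using z by (auto simp: b_def)
  \<comment> \<open>After substitution the integrand is (4 / \<pi>) / ((1 + v^2) (1 + b^2 v^2)),
    that is 4 / (\<pi> (1 - b^2)) times the difference of 1 / (1 + v^2) and b^2 / (1 + b^2
    v^2).\<close>
  define A where "A x = 4 / (pi * (1 - b\<^sup>2)) * (arctan (sqrt (x / (4 - x))) - b * arctan (b * sqrt (x / (4 - x))))" for x
  have F: "DERIV A x :> mp_dens x / (1 - z * x)" if x: "0 < x" "x < 4" for x
  proof -
    define v where "v = sqrt (x / (4 - x))"
    note v = mp_sqrt_identities[OF x, folded v_def]
    have dv: "((\<lambda>x. sqrt (x / (4 - x))) has_real_derivative (1 + v\<^sup>2)\<^sup>2 / (8 * v)) (at x)"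
      using mp_v_deriv[OF x] by (simp add: v_def)
    have D: "DERIV A x :> 4 / (pi * (1 - b\<^sup>2)) * ((1 + v\<^sup>2)\<^sup>2 / (8 * v) * inverse (1 + v\<^sup>2) - b * (b * ((1 + v\<^sup>2)\<^sup>2 / (8 * v)) * inverse (1 + (b * v)\<^sup>2)))"
      unfolding A_def
      by (rule derivative_eq_intros dv refl | simp add: v_def[symmetric])+
    have p: "1 + v\<^sup>2 > 0" "1 + b\<^sup>2 * v\<^sup>2 > 0" by (auto intro!: add_pos_nonneg)
    have nb: "1 - b\<^sup>2 \<noteq> 0" using b z by simp
    have "4 / (pi * (1 - b\<^sup>2)) * ((1 + v\<^sup>2)\<^sup>2 / (8 * v) * inverse (1 + v\<^sup>2) - b * (b * ((1 + v\<^sup>2)\<^sup>2 / (8 * v)) * inverse (1 + (b * v)\<^sup>2)))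
       = (4 * (1 + v\<^sup>2)\<^sup>2 / (8 * v * pi * (1 - b\<^sup>2))) * (1 / (1 + v\<^sup>2) - b\<^sup>2 / (1 + b\<^sup>2 * v\<^sup>2))"
      by (simp add: inverse_eq_divide power_mult_distrib power2_eq_square[of b] algebra_simps diff_divide_distrib)
    also have "1 / (1 + v\<^sup>2) - b\<^sup>2 / (1 + b\<^sup>2 * v\<^sup>2) = (1 - b\<^sup>2) / ((1 + v\<^sup>2) * (1 + b\<^sup>2 * v\<^sup>2))"
      using p by (simp add: diff_frac_eq algebra_simps)
    also have "(4 * (1 + v\<^sup>2)\<^sup>2 / (8 * v * pi * (1 - b\<^sup>2))) * ((1 - b\<^sup>2) / ((1 + v\<^sup>2) * (1 + b\<^sup>2 * v\<^sup>2)))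
       = (1 + v\<^sup>2) / (2 * pi * v * (1 + b\<^sup>2 * v\<^sup>2))"
      using p nb v(1) by (simp add: power2_eq_square[of "1 + v\<^sup>2"])
    also have "\<dots> = mp_dens x / (1 - z * x)"
    proof -
      have e1: "1 + v\<^sup>2 = 4 / (4 - x)" unfolding v(2) using x by (simp add: field_simps)
      have e2: "1 + b\<^sup>2 * v\<^sup>2 = 4 * (1 - z * x) / (4 - x)" unfolding v(2) b(2) using x by (simp add: field_simps)
      have gen: "4 / D / (c * (4 * e / D)) = 1 / c / e" if "D \<noteq> 0" for c e D :: real using that by simp
      show ?thesis unfolding e1 e2 v(3) by (rule gen) (use x in simp)
    qed
    finally have "4 / (pi * (1 - b\<^sup>2)) * ((1 + v\<^sup>2)\<^sup>2 / (8 * v) * inverse (1 + v\<^sup>2) - b * (b * ((1 + v\<^sup>2)\<^sup>2 / (8 * v)) * inverse (1 + (b * v)\<^sup>2))) = mp_dens x / (1 - z * x)" .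
    then show ?thesis using D by (simp only:)
  qed
  have den: "1 - z * x \<ge> 1" if "0 < x" for x using one_minus_ge_1[of z x] z that by simp
  have f: "isCont (\<lambda>x. mp_dens x / (1 - z * x)) x" if x: "0 < x" "x < 4" for x
    unfolding mp_dens_def using x den[OF x(1)] by (intro continuous_intros) auto
  have pos: "0 \<le> mp_dens x / (1 - z * x)" if x: "0 < x" "x < 4" for x
    using x den[OF x(1)] by (simp add: mp_dens_def)
  have l0: "(A \<longlongrightarrow> 0) (at_right 0)"
  proof -
    have "((\<lambda>x. sqrt (x / (4 - x))) \<longlongrightarrow> sqrt (0 / (4 - 0))) (at_right 0)" by (intro tendsto_intros) auto
    then have s: "((\<lambda>x. sqrt (x / (4 - x))) \<longlongrightarrow> 0) (at_right 0)" by simp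
    have "(A \<longlongrightarrow> 4 / (pi * (1 - b\<^sup>2)) * (arctan 0 - b * arctan (b * 0))) (at_right 0)"
      unfolding A_def by (intro tendsto_intros s)
    then show ?thesis by simp
  qed
  have l4: "(A \<longlongrightarrow> 2 / (1 + b)) (at_left 4)"
  proof -
    have v: "filterlim (\<lambda>x::real. sqrt (x / (4 - x))) at_top (at_left 4)" by real_asymp
    have "((\<lambda>x. arctan (sqrt (x / (4 - x)))) \<longlongrightarrow> pi / 2) (at_left 4)"
      by (rule filterlim_compose[OF tendsto_arctan_at_top v])
    moreover have "filterlim (\<lambda>x. b * sqrt (x / (4 - x))) at_top (at_left 4)"
      using b by (intro filterlim_tendsto_pos_mult_at_top[OF tendsto_const _ v]) auto
    then have "((\<lambda>x. arctan (b * sqrt (x / (4 - x)))) \<longlongrightarrow> pi / 2) (at_left 4)"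
      by (rule filterlim_compose[OF tendsto_arctan_at_top])
    ultimately have "(A \<longlongrightarrow> 4 / (pi * (1 - b\<^sup>2)) * (pi / 2 - b * (pi / 2))) (at_left 4)"
      unfolding A_def by (intro tendsto_intros)
    moreover have "4 / (pi * (1 - b\<^sup>2)) * (pi / 2 - b * (pi / 2)) = 2 / (1 + b)"
    proof -
      have e1: "1 - b\<^sup>2 = (1 - b) * (1 + b)" by (simp add: power2_eq_square algebra_simps)
      have e2: "pi / 2 - b * (pi / 2) = pi * (1 - b) / 2" by (simp add: algebra_simps)
      have gen: "4 / (pi * (d * e)) * (pi * d / 2) = 2 / e" if "d \<noteq> 0" for d e :: real using that by simp
      show ?thesis unfolding e1 e2 by (rule gen) (use b in simp)
    qed
    ultimately show ?thesis by simp
  qed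
  have L0: "((A \<circ> real_of_ereal) \<longlongrightarrow> 0) (at_right (ereal 0))" and L4: "((A \<circ> real_of_ereal) \<longlongrightarrow> 2 / (1 + b)) (at_left (ereal 4))"
    using l0 l4 by (simp_all only: ereal_tendsto_simps1)
  have pos_AE: "AE x in lborel. ereal 0 < ereal x \<longrightarrow> ereal x < ereal 4 \<longrightarrow> 0 \<le> mp_dens x / (1 - z * x)"
    using pos by simp
  note ft = interval_integral_FTC_nonneg[where a="ereal 0" and b="ereal 4" and F=A and f="\<lambda>x. mp_dens x / (1 - z * x)", OF _ _ _ pos_AE L0 L4]
  have e: "einterval (ereal 0) (ereal 4) = {0<..<4}" by (auto simp: einterval_def)
  show "set_integrable lborel {0<..<4} (\<lambda>x. mp_dens x / (1 - z * x))"
    using ft(1) F f unfolding e by simp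
  have "(LBINT x=ereal 0..ereal 4. mp_dens x / (1 - z * x)) = 2 / (1 + b) - 0"
    using F f by (intro ft(2)) auto
  then show "(LINT x:{0<..<4}|lborel. mp_dens x / (1 - z * x)) = 2 / (1 + b)"
    by (simp add: interval_lebesgue_integral_def e)
qed

lemma mp_dens_measurable [measurable]: "mp_dens \<in> borel_measurable borel"
  unfolding mp_dens_def by measurable

lemma MP_eq: "MP = density lborel (\<lambda>x. ennreal (mp_dens x * indicator {0<..<4} x))"
  by (simp add: MP_def mp_dens_def)

lemma mp_dens_nonneg: "0 \<le> mp_dens x * indicator {0<..<4} x"
  by (auto simp: mp_dens_def indicator_def)

lemma MP_nn_integral:
  assumes z: "z < 0"
  shows "(\<integral>\<^sup>+ x. ennreal (1 / (1 - z * max 0 x)) \<partial>MP) = ennreal (2 / (1 + sqrt (1 - 4 * z)))"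
proof -
  have "(\<integral>\<^sup>+ x. ennreal (1 / (1 - z * max 0 x)) \<partial>MP) = (\<integral>\<^sup>+ x. ennreal (mp_dens x * indicator {0<..<4} x) * ennreal (1 / (1 - z * max 0 x)) \<partial>lborel)"
    unfolding MP_eq by (rule nn_integral_density) auto
  also have "\<dots> = (\<integral>\<^sup>+ x. ennreal (indicator {0<..<4} x *\<^sub>R (mp_dens x / (1 - z * x))) \<partial>lborel)"
    by (intro nn_integral_cong) (auto simp: ennreal_mult'[symmetric] mp_dens_def indicator_def)
  also have "\<dots> = ennreal (LINT x|lborel. indicator {0<..<4} x *\<^sub>R (mp_dens x / (1 - z * x)))"
  proof (rule nn_integral_eq_integral)
    show "integrable lborel (\<lambda>x. indicator {0<..<4} x *\<^sub>R (mp_dens x / (1 - z * x)))"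
      using mp_integral(1)[OF z] by (simp add: set_integrable_def)
    show "AE x in lborel. 0 \<le> indicator {0<..<4} x *\<^sub>R (mp_dens x / (1 - z * x))"
    proof (intro AE_I2)
      fix x :: real
      show "0 \<le> indicator {0<..<4} x *\<^sub>R (mp_dens x / (1 - z * x))"
        using mp_dens_nonneg[of x] one_minus_ge_1[of z x] z by (auto simp: indicator_def)
    qed
  qed
  also have "\<dots> = ennreal (2 / (1 + sqrt (1 - 4 * z)))"
    using mp_integral(2)[OF z] by (simp add: set_lebesgue_integral_def)
  finally show ?thesis .
qed

text \<open>The total mass is obtained from the integrals of 1 / (1 - z x) by monotone convergence
  along z = - 1 / (n + 1), since 2 / (1 + sqrt(1 - 4 z)) \<rightarrow> 1.\<close>

lemma MP_Pplus: "MP \<in> Pplus"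
proof (rule PplusI)
  define f where "f n x = ennreal (1 / (1 + 1 / real (Suc n) * max 0 x))" for n and x :: real
  have "(\<lambda>n. \<integral>\<^sup>+ x. f n x \<partial>MP) \<longlonglongrightarrow> (\<integral>\<^sup>+ x. 1 \<partial>MP)"
  proof (rule nn_integral_LIMSEQ)
    show "incseq f" unfolding f_def incseq_def le_fun_def
      by (intro allI impI ennreal_leI frac_le add_left_mono mult_right_mono) (auto intro!: add_pos_nonneg)
    show "f n \<in> borel_measurable MP" for n unfolding f_def MP_eq by measurable
    show "(\<lambda>n. f n x) \<longlonglongrightarrow> 1" for x
    proof -
      have "(\<lambda>n. 1 / real (Suc n)) \<longlonglongrightarrow> 0" by real_asymp
      then have "(\<lambda>n. 1 / (1 + 1 / real (Suc n) * max 0 x)) \<longlonglongrightarrow> 1 / (1 + 0 * max 0 x)"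
        by (intro tendsto_intros) auto
      then have "(\<lambda>n. f n x) \<longlonglongrightarrow> ennreal (1 / (1 + 0 * max 0 x))" unfolding f_def by (rule tendsto_ennrealI)
      then show ?thesis by simp
    qed
  qed
  moreover have "(\<integral>\<^sup>+ x. f n x \<partial>MP) = ennreal (2 / (1 + sqrt (1 - 4 * (- 1 / real (Suc n)))))" for n
    using MP_nn_integral[of "- 1 / real (Suc n)"] by (simp add: f_def del: of_nat_Suc)
  ultimately have "(\<lambda>n. ennreal (2 / (1 + sqrt (1 - 4 * (- 1 / real (Suc n)))))) \<longlonglongrightarrow> emeasure MP (space MP)" by simp
  moreover have "(\<lambda>n. ennreal (2 / (1 + sqrt (1 - 4 * (- 1 / real (Suc n)))))) \<longlonglongrightarrow> ennreal 1"
  proof (rule tendsto_ennrealI)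
    show "(\<lambda>n. 2 / (1 + sqrt (1 - 4 * (- 1 / real (Suc n))))) \<longlonglongrightarrow> 1" by real_asymp
  qed
  ultimately have "emeasure MP (space MP) = 1" using LIMSEQ_unique by fastforce
  then have "prob_space MP" by (rule prob_spaceI)
  then show "real_distribution MP"
    by (simp add: real_distribution_def real_distribution_axioms_def MP_eq)
  show "AE u in MP. 0 \<le> u" unfolding MP_eq
    by (subst AE_density) (auto simp: indicator_def)
qed

lemma MP_M:
  assumes z: "z < 0"
  shows "M_tr MP z = 2 / (1 + sqrt (1 - 4 * z))"
proof -
  interpret real_distribution MP using MP_Pplus by (simp add: Pplus_def)
  have "ennreal (M_tr MP z) = (\<integral>\<^sup>+ x. ennreal (1 / (1 - z * x)) \<partial>MP)"
    unfolding M_tr_def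
  proof (rule nn_integral_eq_integral[symmetric])
    show "AE x in MP. 0 \<le> 1 / (1 - z * x)"
      using Pplus_AE[OF MP_Pplus]
    proof eventually_elim
      case (elim x)
      then show ?case using one_minus_ge_1[of z x] z by simp
    qed
  qed (use integrable_M[OF MP_Pplus, of z] z in simp)
  also have "\<dots> = (\<integral>\<^sup>+ x. ennreal (1 / (1 - z * max 0 x)) \<partial>MP)"
    by (rule nn_integral_cong_AE) (use Pplus_AE[OF MP_Pplus] in \<open>eventually_elim, simp\<close>)
  also have "\<dots> = ennreal (2 / (1 + sqrt (1 - 4 * z)))" by (rule MP_nn_integral[OF z])
  finally show ?thesis using M_pos[OF MP_Pplus, of z] z by (subst (asm) ennreal_inj) auto
qed

text \<open>The form in which the explicit transform enters \<open>S_MPi\<close> and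
  \<open>isR_MP\<close>.\<close>

lemma MP_quadratic:
  assumes z: "z < 0"
  shows "M_tr MP z = 1 + z * (M_tr MP z)\<^sup>2"
proof -
  define b where "b = sqrt (1 - 4 * z)"
  have b: "b > 1" "b\<^sup>2 = 1 - 4 * z" using z by (auto simp: b_def)
  have z_eq: "z = (1 - b\<^sup>2) / 4" using b by simp
  have m: "M_tr MP z = 2 / (1 + b)" using MP_M[OF z] by (simp add: b_def)
  have k: "1 + (1 - b\<^sup>2) / 4 * (2 / (1 + b))\<^sup>2 = 2 / (1 + b)"
  proof -
    have "(1 - b\<^sup>2) / 4 * (2 / (1 + b))\<^sup>2 = (1 - b) / (1 + b)"
    proof -
      have "1 - b\<^sup>2 = (1 - b) * (1 + b)" by (simp add: power2_eq_square algebra_simps)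
      then show ?thesis using b by (simp add: power2_eq_square)
    qed
    moreover have "1 + (1 - b) / (1 + b) = 2 / (1 + b)" using b by (simp add: field_simps)
    ultimately show ?thesis by (simp only:)
  qed
  show ?thesis unfolding m by (subst z_eq) (rule k[symmetric])
qed

lemma MP_atom: "measure MP {0} = 0"
proof -
  have "emeasure MP {0} = (\<integral>\<^sup>+ x\<in>{0}. ennreal (mp_dens x * indicator {0<..<4} x) \<partial>lborel)"
    unfolding MP_eq by (rule emeasure_density) auto
  also have "\<dots> = 0" by (rule nn_integral_null_set) (simp add: null_sets_def)
  finally have "emeasure MP {0} = 0" .
  then show ?thesis by (simp add: measure_def)
qed

section \<open>Multiplication by the inverse Marchenko-Pastur law\<close>

lemma atom_0_ne_delta0: "measure \<mu> {0} = 0 \<Longrightarrow> \<mu> \<noteq> delta0"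
  by (auto simp: measure_return)

lemmas MPi = inverse_measure[OF MP_Pplus MP_atom]

text \<open>If t = \<psi>(z) for the inverse law, then - t is M of the law itself at 1 / z; the
  quadratic equation becomes z (1 + t) = - t^2.\<close>

lemma S_MPi:
  assumes "-1 < t" "t < 0"
  shows "S_tr (mpow MP (-1)) t = - t"
proof -
  let ?N = "mpow MP (-1)"
  have ne: "?N \<noteq> delta0" by (rule atom_0_ne_delta0[OF MPi(2)])
  have "t \<in> psi_tr ?N ` {..<0}" using psi_range[OF MPi(1) ne] MPi(2) assms by simp
  then obtain z where z: "z < 0" "t = psi_tr ?N z" by auto
  have m: "M_tr MP (1 / z) = - t" using psi_eq[OF MPi(1), of z] MPi(3)[OF z(1)] z by simp
  have "1 / z < 0" using z(1) by simp
  from MP_quadratic[OF this] have "- t = 1 + 1 / z * (- t)\<^sup>2" unfolding m .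
  then have "z * (- t) = z * (1 + 1 / z * (- t)\<^sup>2)" by (simp only:)
  also have "\<dots> = z + t\<^sup>2" using z(1) by (simp add: distrib_left)
  finally have "z * (1 + t) = - t\<^sup>2" by (simp add: distrib_left)
  moreover have "S_tr ?N t = (1 + t) / t * z" using S_psi[OF MPi(1) ne z(1)] z(2) by simp
  ultimately show ?thesis using assms by (simp add: power2_eq_square field_simps)
qed

lemma isT_atom:
  assumes T: "isT \<tau> h" and \<mu>: "\<mu> \<in> Pplus" "\<mu> \<noteq> delta0"
    and eq: "h ` {u. u < 0 \<and> 1 + h u > 0} = psi_tr \<mu> ` {..<0}"
  shows "measure \<tau> {0} = measure \<mu> {0}"
proof -
  have "{-1 + measure \<tau> {0}<..<0} = {-1 + measure \<mu> {0}<..<0}"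
    unfolding isT_range[OF T] psi_range[OF \<mu>, symmetric] by (rule eq)
  then have "-1 + measure \<tau> {0} = -1 + measure \<mu> {0}"
    using atom_less_1[OF isT_Pplus[OF T] isT_ne[OF T]] atom_less_1[OF \<mu>] by (intro interval_eq_endpoint) auto
  then show ?thesis by simp
qed

text \<open>With t = \<psi>(z) and u = g(z) one has t = h(u) and S(t) = u / t for \<mu>; the factor
  - t from \<open>S_MPi\<close> leaves - u, the S-transform in \<open>isT_S\<close>. Equal ranges of
  \<psi> give equal atoms.\<close>

lemma boxtimes_MPi:
  assumes R: "isR \<mu> h" and hneg: "h (-1) < 0"
  obtains \<tau> where "isT \<tau> h" "boxtimes (mpow MP (-1)) \<mu> = \<tau>"
proof -
  have \<mu>: "\<mu> \<in> Pplus" and h: "h \<in> cbf0" and M: "\<And>t. t < 0 \<Longrightarrow> M_tr \<mu> t = 1 + h (g_tr \<mu> t)"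
    using R by (auto simp: isR_def)
  obtain \<tau> where T: "isT \<tau> h" using isT_exists[OF h hneg] by blast
  have psi: "psi_tr \<mu> z = h (g_tr \<mu> z)" if "z < 0" for z using psi_eq[OF \<mu>, of z] M[OF that] that by simp
  have ne: "\<mu> \<noteq> delta0"
  proof
    assume "\<mu> = delta0"
    then have "h (g_tr \<mu> (-1)) = 0" using M[of "-1"] by (simp add: M_delta0)
    then show False using cbf0_neg[OF h hneg g_neg[OF \<mu>, of "-1"]] by simp
  qed
  have "h ` {u. u < 0 \<and> 1 + h u > 0} = h ` (g_tr \<mu> ` {..<0})"
    using isR_dom[OF R] R_dom_eq[OF \<mu>] by simp
  also have "\<dots> = psi_tr \<mu> ` {..<0}" unfolding image_image using psi by (intro image_cong) auto
  finally have atom: "measure \<tau> {0} = measure \<mu> {0}" by (rule isT_atom[OF T \<mu> ne])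
  have "boxtimes (mpow MP (-1)) \<mu> = \<tau>"
  proof (rule boxtimes_eq[OF atom_0_ne_delta0[OF MPi(2)] ne isT_Pplus[OF T] isT_ne[OF T]])
    show "measure \<tau> {0} = max (measure (mpow MP (-1)) {0}) (measure \<mu> {0})" using atom MPi(2) by simp
    fix t assume t: "-1 + max (measure (mpow MP (-1)) {0}) (measure \<mu> {0}) < t" "t < 0"
    then have "t \<in> psi_tr \<mu> ` {..<0}" using psi_range[OF \<mu> ne] MPi(2) by simp
    then obtain z where z: "z < 0" "t = psi_tr \<mu> z" by auto
    have t1: "-1 < t"
      using t(1) measure_nonneg[of "mpow MP (-1)" "{0}"] max.cobounded1[of "measure (mpow MP (-1)) {0}" "measure \<mu> {0}"]
      by linarith
    define u where "u = g_tr \<mu> z"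
    have u: "u < 0" "t = h u" "1 + h u > 0"
      using g_neg[OF \<mu> z(1)] psi[OF z(1)] z(2) t1 by (auto simp: u_def)
    have uz: "u = z * (1 + t)" using z psi_eq[OF \<mu>, of z] by (simp add: u_def g_tr_def)
    have "S_tr \<mu> t = (1 + t) / t * z" using S_psi[OF \<mu> ne z(1)] z(2) by simp
    then have "S_tr (mpow MP (-1)) t * S_tr \<mu> t = - u" using S_MPi[OF t1 t(2)] t(2) uz by simp
    then show "S_tr \<tau> t = S_tr (mpow MP (-1)) t * S_tr \<mu> t" using isT_S[OF T u(1,3)] u(2) by simp
  qed
  then show ?thesis using that[OF T] by simp
qed

section \<open>The maps \<Theta> and \<Xi>\<close>

lemma Phi_delta0: "Phi_map delta0 = delta0"
proof -
  have b: "boxtimes delta0 delta0 = delta0" by (simp add: boxtimes_def)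
  have "(boxtimes delta0 ^^ k) delta0 = delta0" for k by (induction k) (simp_all add: b)
  then have n: "nfold boxtimes n delta0 = delta0" for n by (simp add: nfold_def)
  have m: "mpow delta0 a = delta0" for a by (simp add: mpow_def distr_return)
  show ?thesis by (rule Phi_map_eq) (simp_all add: n m delta0_Pplus weak_conv_m_def weak_conv_def)
qed

lemma Theta_isR:
  assumes R: "isR \<mu> h"
  shows "Theta_map \<mu> \<in> Pplus" "\<And>x. x > 0 \<Longrightarrow> measure (Theta_map \<mu>) {0..x} = max (1 + h (- 1 / x)) 0"
proof -
  have \<mu>: "\<mu> \<in> Pplus" and h: "h \<in> cbf0" and M: "\<And>t. t < 0 \<Longrightarrow> M_tr \<mu> t = 1 + h (g_tr \<mu> t)"
    using R by (auto simp: isR_def)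
  have "Theta_map \<mu> \<in> Pplus \<and> (\<forall>x>0. measure (Theta_map \<mu>) {0..x} = max (1 + h (- 1 / x)) 0)"
  proof (cases "h (-1) < 0")
    case True
    obtain \<tau> where "isT \<tau> h" "boxtimes (mpow MP (-1)) \<mu> = \<tau>" using boxtimes_MPi[OF R True] by blast
    then show ?thesis using Phi_isT by (simp add: Theta_map_def)
  next
    \<comment> \<open>Then h vanishes identically and \<mu> is \<open>delta0\<close>, where the
      convention in \<open>boxtimes\<close> takes over.\<close>
    case False
    have h0: "h t = 0" if "t < 0" for t using cbf_eq_0[OF cbf0_cbf[OF h] that False] .
    have "\<mu> = delta0"
      by (rule M_unique[OF \<mu> delta0_Pplus]) (use M h0 g_neg[OF \<mu>] in \<open>simp add: M_delta0\<close>)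
    then have "Theta_map \<mu> = delta0" by (simp add: Theta_map_def boxtimes_def Phi_delta0)
    then show ?thesis using h0 delta0_Pplus by (simp add: measure_return)
  qed
  then show "Theta_map \<mu> \<in> Pplus" "\<And>x. x > 0 \<Longrightarrow> measure (Theta_map \<mu>) {0..x} = max (1 + h (- 1 / x)) 0" by auto
qed

lemma psi_delta1: "psi_tr (return borel 1) t = t / (1 - t)"
  unfolding psi_tr_def by (subst integral_return) auto

lemma delta1_Pplus: "return borel 1 \<in> Pplus"
proof (rule PplusI)
  show "real_distribution (return borel (1::real))"
    by (simp add: real_distribution_def real_distribution_axioms_def prob_space_return)
  show "AE u in return borel (1::real). 0 \<le> u" by (subst AE_return) auto
qed

text \<open>The R-transform t / (1 - t) is written as \<psi> of the unit mass at 1, so that its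
  membership in \<open>cbf0\<close> is an instance of \<open>psi_cbf0\<close>.\<close>

lemma isR_MP: "isR MP (psi_tr (return borel 1))"
  unfolding isR_def
proof (intro conjI MP_Pplus psi_cbf0[OF delta1_Pplus] allI impI)
  fix z :: real assume z: "z < 0"
  have m: "M_tr MP z > 0" using M_pos[OF MP_Pplus, of z] z by simp
  have g: "g_tr MP z < 0" by (rule g_neg[OF MP_Pplus z])
  have "M_tr MP z * (1 - g_tr MP z) = 1" using MP_quadratic[OF z] by (simp add: g_tr_def power2_eq_square algebra_simps)
  then show "M_tr MP z = 1 + psi_tr (return borel 1) (g_tr MP z)"
    unfolding psi_delta1 using g by (simp add: field_simps)
qed

text \<open>The product \<beta> of the two laws has S-transform - t / (1 + t). At t = \<psi>(z) this
  cancels the prefactor of S of \<mu> and leaves - z, so the product with \<mu> is described by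
  \<open>isT\<close> with h = \<psi>. Since 1 + \<psi> = M > 0, the truncation at 0
  disappears.\<close>

lemma Xi_cdf:
  assumes \<mu>: "\<mu> \<in> Pplus"
  shows "Xi_map \<mu> \<in> Pplus" "\<And>x. x > 0 \<Longrightarrow> measure (Xi_map \<mu>) {0..x} = M_tr \<mu> (- 1 / x)"
proof -
  let ?k = "psi_tr (return borel 1)"
  obtain \<beta> where \<beta>: "isT \<beta> ?k" "boxtimes (mpow MP (-1)) MP = \<beta>"
    using boxtimes_MPi[OF isR_MP] by (auto simp: psi_delta1)
  have kpos: "1 + ?k u > 0" if "u < 0" for u using that by (simp add: psi_delta1 field_simps)
  have S\<beta>: "S_tr \<beta> t = - t / (1 + t)" if t: "-1 < t" "t < 0" for t
  proof -
    define u where "u = t / (1 + t)"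
    have u: "u < 0" using t by (simp add: u_def divide_neg_pos)
    have "?k u = t" using t by (simp add: psi_delta1 u_def field_simps)
    then show ?thesis using isT_S[OF \<beta>(1) u kpos[OF u]] by (simp add: u_def)
  qed
  have "Xi_map \<mu> \<in> Pplus \<and> (\<forall>x>0. measure (Xi_map \<mu>) {0..x} = M_tr \<mu> (- 1 / x))"
  proof (cases "\<mu> = delta0")
    case True
    then have "Xi_map \<mu> = delta0" by (simp add: Xi_map_def boxtimes_def Phi_delta0)
    then show ?thesis using True delta0_Pplus by (simp add: measure_return M_delta0)
  next
    case False
    have neg: "psi_tr \<mu> (-1) < 0" using psi_range[OF \<mu> False] by force
    obtain \<tau> where T: "isT \<tau> (psi_tr \<mu>)" using isT_exists[OF psi_cbf0[OF \<mu>] neg] by blast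
    have pos: "1 + psi_tr \<mu> z > 0" if "z < 0" for z using psi_eq[OF \<mu>, of z] M_pos[OF \<mu>, of z] that by simp
    have \<beta>0: "measure \<beta> {0} = 0"
    proof -
      have "measure \<beta> {0} = measure (return borel (1::real)) {0}"
      proof (rule isT_atom[OF \<beta>(1) delta1_Pplus])
        show "return borel 1 \<noteq> delta0" by (rule atom_0_ne_delta0) (simp add: measure_return)
        show "?k ` {u. u < 0 \<and> 0 < 1 + ?k u} = ?k ` {..<0}" using kpos by auto
      qed
      then show ?thesis by (simp add: measure_return)
    qed
    have atom: "measure \<tau> {0} = measure \<mu> {0}"
      by (rule isT_atom[OF T \<mu> False]) (use pos in auto)
    have "boxtimes \<beta> \<mu> = \<tau>"
    proof (rule boxtimes_eq[OF isT_ne[OF \<beta>(1)] False isT_Pplus[OF T] isT_ne[OF T]])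
      show "measure \<tau> {0} = max (measure \<beta> {0}) (measure \<mu> {0})" using atom \<beta>0 by simp
      fix t assume t: "-1 + max (measure \<beta> {0}) (measure \<mu> {0}) < t" "t < 0"
      then have "t \<in> psi_tr \<mu> ` {..<0}" using psi_range[OF \<mu> False] \<beta>0 by simp
      then obtain z where z: "z < 0" "t = psi_tr \<mu> z" by auto
      have t1: "-1 < t"
        using t(1) measure_nonneg[of \<beta> "{0}"] max.cobounded1[of "measure \<beta> {0}" "measure \<mu> {0}"] by linarith
      have "S_tr \<mu> t = (1 + t) / t * z" using S_psi[OF \<mu> False z(1)] z(2) by simp
      then have "S_tr \<beta> t * S_tr \<mu> t = - z" using S\<beta>[OF t1 t(2)] t t1 by simp
      then show "S_tr \<tau> t = S_tr \<beta> t * S_tr \<mu> t" using isT_S[OF T z(1) pos[OF z(1)]] z(2) by simp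
    qed
    then have "Xi_map \<mu> = Phi_map \<tau>" by (simp add: Xi_map_def \<beta>(2))
    moreover have "max (1 + psi_tr \<mu> (- 1 / x)) 0 = M_tr \<mu> (- 1 / x)" if "x > 0" for x
      using that psi_eq[OF \<mu>, of "- 1 / x"] M_pos[OF \<mu>, of "- 1 / x"] by simp
    ultimately show ?thesis using Phi_isT[OF T] by simp
  qed
  then show "Xi_map \<mu> \<in> Pplus" "\<And>x. x > 0 \<Longrightarrow> measure (Xi_map \<mu>) {0..x} = M_tr \<mu> (- 1 / x)" by auto
qed


section \<open>Classical infinite divisibility\<close>

lemma conv_Pplus:
  assumes \<mu>: "\<mu> \<in> Pplus" and \<nu>: "\<nu> \<in> Pplus"
  shows "convolution \<mu> \<nu> \<in> Pplus" "\<And>t. t \<le> 0 \<Longrightarrow> L_tr (convolution \<mu> \<nu>) t = L_tr \<mu> t * L_tr \<nu> t"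
proof -
  interpret \<mu>: real_distribution \<mu> using \<mu> by (simp add: Pplus_def)
  interpret \<nu>: real_distribution \<nu> using \<nu> by (simp add: Pplus_def)
  interpret P: pair_prob_space \<mu> \<nu> ..
  have m: "(\<lambda>(x, y). x + y) \<in> borel_measurable (\<mu> \<Otimes>\<^sub>M \<nu>)" by measurable
  have AEp: "AE z in \<mu> \<Otimes>\<^sub>M \<nu>. 0 \<le> fst z \<and> 0 \<le> snd z"
  proof (rule P.AE_pair_measure)
    show "{x \<in> space (\<mu> \<Otimes>\<^sub>M \<nu>). 0 \<le> fst x \<and> 0 \<le> snd x} \<in> sets (\<mu> \<Otimes>\<^sub>M \<nu>)" by measurable
    show "AE x in \<mu>. AE y in \<nu>. 0 \<le> fst (x, y) \<and> 0 \<le> snd (x, y)"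
      using Pplus_AE[OF \<mu>]
    proof eventually_elim
      case (elim x)
      show ?case using Pplus_AE[OF \<nu>] by eventually_elim (use elim in simp)
    qed
  qed
  show "convolution \<mu> \<nu> \<in> Pplus" unfolding convolution_def
  proof (rule PplusI)
    show "real_distribution (distr (\<mu> \<Otimes>\<^sub>M \<nu>) borel (\<lambda>(x, y). x + y))"
      by (rule P.real_distribution_distr[OF m])
    show "AE u in distr (\<mu> \<Otimes>\<^sub>M \<nu>) borel (\<lambda>(x, y). x + y). 0 \<le> u"
      by (subst AE_distr_iff[OF m]) (use AEp in \<open>auto\<close>)
  qed
  fix t :: real assume t: "t \<le> 0"
  have "L_tr (convolution \<mu> \<nu>) t = (LINT z|(\<mu> \<Otimes>\<^sub>M \<nu>). exp (t * (case z of (x, y) \<Rightarrow> x + y)))"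
    unfolding L_tr_def convolution_def by (rule integral_distr[OF m]) simp
  also have "\<dots> = (LINT z|(\<mu> \<Otimes>\<^sub>M \<nu>). (case z of (x, y) \<Rightarrow> exp (t * x) * exp (t * y)))"
    by (intro Bochner_Integration.integral_cong refl) (auto simp: distrib_left exp_add)
  also have "\<dots> = (LINT y|\<nu>. LINT x|\<mu>. exp (t * x) * exp (t * y))"
  proof (rule P.integral_snd[symmetric])
    show "integrable (\<mu> \<Otimes>\<^sub>M \<nu>) (\<lambda>(x, y). exp (t * x) * exp (t * y))"
    proof (rule P.integrable_const_bound[where B=1])
      show "AE z in \<mu> \<Otimes>\<^sub>M \<nu>. norm (case z of (x, y) \<Rightarrow> exp (t * x) * exp (t * y)) \<le> 1"
        using AEp by eventually_elim (use t in \<open>auto simp: mult_nonpos_nonneg intro!: mult_le_one\<close>)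
    qed measurable
  qed
  also have "\<dots> = L_tr \<mu> t * L_tr \<nu> t" by (simp add: L_tr_def)
  finally show "L_tr (convolution \<mu> \<nu>) t = L_tr \<mu> t * L_tr \<nu> t" .
qed

lemma C_conv:
  assumes "\<mu> \<in> Pplus" "\<nu> \<in> Pplus" "t \<le> 0"
  shows "C_tr (convolution \<mu> \<nu>) t = C_tr \<mu> t + C_tr \<nu> t"
  using conv_Pplus(2)[OF assms] L_pos[OF assms(1,3)] L_pos[OF assms(2,3)] by (simp add: C_eq ln_mult)

lemma nfold_conv:
  assumes \<nu>: "\<nu> \<in> Pplus" and n: "n \<ge> 1"
  shows "nfold convolution n \<nu> \<in> Pplus \<and> (\<forall>t\<le>0. C_tr (nfold convolution n \<nu>) t = real n * C_tr \<nu> t)"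
  using n
proof (induction n rule: dec_induct)
  case base
  then show ?case using \<nu> by (simp add: nfold_def)
next
  case (step n)
  then show ?case using conv_Pplus(1)[OF \<nu>] C_conv[OF \<nu>] by (simp add: nfold_Suc algebra_simps)
qed

section \<open>The transform LC under classical convolution\<close>

lemma C_mono:
  assumes \<mu>: "\<mu> \<in> Pplus" and "s \<le> t" "t \<le> 0"
  shows "L_tr \<mu> s \<le> L_tr \<mu> t" "C_tr \<mu> s \<le> C_tr \<mu> t"
proof -
  interpret real_distribution \<mu> using \<mu> by (simp add: Pplus_def)
  show "L_tr \<mu> s \<le> L_tr \<mu> t" unfolding L_tr_def
  proof (rule integral_mono_AE)
    show "AE u in \<mu>. exp (s * u) \<le> exp (t * u)"
      using Pplus_AE[OF \<mu>] by eventually_elim (use assms in \<open>simp add: mult_right_mono\<close>)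
  qed (use assms integrable_L[OF \<mu>] in auto)
  then show "C_tr \<mu> s \<le> C_tr \<mu> t" unfolding C_eq using assms by (intro ln_mono L_pos[OF \<mu>]) auto
qed

lemma integrable_C_expm:
  assumes \<mu>: "\<mu> \<in> Pplus" and t: "t \<le> 0"
  shows "integrable expm (\<lambda>x. C_tr \<mu> (t * x))"
proof -
  have [measurable]: "C_tr \<mu> \<in> borel_measurable borel" by (rule C_measurable[OF \<mu>])
  obtain A where A: "A \<ge> 0" "\<And>t. t \<le> 0 \<Longrightarrow> \<bar>C_tr \<mu> t\<bar> \<le> A * (1 - t)" using C_bound[OF \<mu>] by blast
  show ?thesis
  proof (rule integrable_expm[where A="A * (1 - t)"])
    fix x :: real assume x: "x > 0"
    have "\<bar>C_tr \<mu> (t * x)\<bar> \<le> A * (1 - t * x)" using A(2)[of "t * x"] t x by (simp add: mult_nonpos_nonneg)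
    also have "\<dots> \<le> A * ((1 - t) * (1 + x))"
      using A(1) t x by (intro mult_left_mono) (auto simp: algebra_simps)
    finally show "\<bar>C_tr \<mu> (t * x)\<bar> \<le> A * (1 - t) * (1 + x)" by (simp only: mult.assoc)
  qed measurable
qed

lemma LC_conv:
  assumes "\<mu> \<in> Pplus" "\<nu> \<in> Pplus" "t < 0"
  shows "LC (convolution \<mu> \<nu>) t = LC \<mu> t + LC \<nu> t"
proof -
  have "LC (convolution \<mu> \<nu>) t = (LINT x|expm. C_tr (convolution \<mu> \<nu>) (t * x))"
    by (rule LC_expm[OF conv_Pplus(1)[OF assms(1,2)]])
  also have "\<dots> = (LINT x|expm. C_tr \<mu> (t * x) + C_tr \<nu> (t * x))"
  proof (rule integral_cong_AE)
    have [measurable]: "C_tr \<mu> \<in> borel_measurable borel" "C_tr \<nu> \<in> borel_measurable borel"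
      "C_tr (convolution \<mu> \<nu>) \<in> borel_measurable borel"
      by (auto intro!: C_measurable conv_Pplus assms)
    show "(\<lambda>x. C_tr (convolution \<mu> \<nu>) (t * x)) \<in> borel_measurable expm" by measurable
    show "(\<lambda>x. C_tr \<mu> (t * x) + C_tr \<nu> (t * x)) \<in> borel_measurable expm" by measurable
    show "AE x in expm. C_tr (convolution \<mu> \<nu>) (t * x) = C_tr \<mu> (t * x) + C_tr \<nu> (t * x)"
      using AE_expm by eventually_elim (use assms in \<open>intro C_conv, auto simp: mult_neg_pos less_imp_le\<close>)
  qed
  also have "\<dots> = LC \<mu> t + LC \<nu> t"
    using assms integrable_C_expm by (subst Bochner_Integration.integral_add) (auto simp: LC_expm)
  finally show ?thesis .
qed

lemma LC_nfold:
  assumes \<nu>: "\<nu> \<in> Pplus" and n: "n \<ge> 1" and t: "t < 0"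
  shows "LC (nfold convolution n \<nu>) t = real n * LC \<nu> t"
  using n
proof (induction n rule: dec_induct)
  case base
  then show ?case by (simp add: nfold_def)
next
  case (step n)
  then show ?case using LC_conv[OF \<nu>, of "nfold convolution n \<nu>"] nfold_conv[OF \<nu>, of n] t
    by (simp add: nfold_Suc algebra_simps)
qed

lemma LC_lim:
  assumes \<mu>: "\<mu> \<in> Pplus"
  shows "(LC \<mu> \<longlongrightarrow> 0) (at_left 0)"
proof (rule tendsto_at_left_sequentially[of "-1"])
  have [measurable]: "C_tr \<mu> \<in> borel_measurable borel" by (rule C_measurable[OF \<mu>])
  fix S :: "nat \<Rightarrow> real" assume S: "\<And>n. S n < 0" "\<And>n. -1 < S n" "S \<longlonglongrightarrow> 0"
  have "(\<lambda>n. LINT x|expm. C_tr \<mu> (S n * x)) \<longlonglongrightarrow> (LINT x|expm. 0)"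
  proof (rule integral_dominated_convergence[where w="\<lambda>x. - C_tr \<mu> (-1 * x)"])
    show "integrable expm (\<lambda>x. - C_tr \<mu> (-1 * x))"
      using integrable_C_expm[OF \<mu>, of "-1"] by simp
    show "AE x in expm. (\<lambda>n. C_tr \<mu> (S n * x)) \<longlonglongrightarrow> 0" using AE_expm
    proof eventually_elim
      case (elim x)
      have "(\<lambda>n. S n * x) \<longlonglongrightarrow> 0 * x" using S by (intro tendsto_intros)
      then have "(\<lambda>n. C_tr \<mu> (S n * x)) \<longlonglongrightarrow> C_tr \<mu> (0 * x)"
        using S elim by (intro continuous_on_tendsto_compose[OF C_continuous[OF \<mu>]] always_eventually allI)
          (auto simp: mult_nonpos_nonneg less_imp_le)
      then show ?case by (simp add: C_0[OF \<mu>])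
    qed
    show "AE x in expm. norm (C_tr \<mu> (S n * x)) \<le> - C_tr \<mu> (-1 * x)" for n using AE_expm
    proof eventually_elim
      case (elim x)
      have "-1 * x \<le> S n * x" using S(2)[of n] elim by (intro mult_right_mono) auto
      moreover have "S n * x \<le> 0" using S(1)[of n] elim by (simp add: mult_nonpos_nonneg less_imp_le)
      ultimately
      show ?case using C_mono(2)[OF \<mu>, of "-1 * x" "S n * x"] C_nonpos[OF \<mu>, of "S n * x"] by simp
    qed
  qed auto
  then show "(\<lambda>n. LC \<mu> (S n)) \<longlonglongrightarrow> 0" by (simp add: LC_expm[OF \<mu>])
qed simp

lemma psi_expm:
  assumes \<mu>: "\<mu> \<in> Pplus" and t: "t \<le> 0"
  shows "psi_tr \<mu> t = (LINT x|expm. L_tr \<mu> (t * x) - 1)" "integrable expm (\<lambda>x. L_tr \<mu> (t * x) - 1)"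
proof -
  have [measurable]: "L_tr \<mu> \<in> borel_measurable borel" by (rule L_measurable[OF \<mu>])
  have b: "0 < L_tr \<mu> (t * x) \<and> L_tr \<mu> (t * x) \<le> 1" if "x > 0" for x
    using L_pos[OF \<mu>] L_le_1[OF \<mu>] t that by (simp add: mult_nonpos_nonneg)
  have i: "integrable expm (\<lambda>x. L_tr \<mu> (t * x))"
  proof (rule integrable_expm[where A=1])
    show "\<bar>L_tr \<mu> (t * x)\<bar> \<le> 1 * (1 + x)" if "x > 0" for x using b[OF that] that by simp
  qed measurable
  then show "integrable expm (\<lambda>x. L_tr \<mu> (t * x) - 1)" by simp
  show "psi_tr \<mu> t = (LINT x|expm. L_tr \<mu> (t * x) - 1)"
    unfolding psi_eq[OF \<mu> t] M_eq_expm_L[OF \<mu> t]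
    using i expm.prob_space by (subst Bochner_Integration.integral_diff) auto
qed

text \<open>The derivative of exp at 0. The difference quotient is completed continuously by 1,
  since c(n) may vanish.\<close>

lemma exp_scaled_limit:
  fixes c :: "nat \<Rightarrow> real"
  assumes c: "c \<longlonglongrightarrow> L" and r: "filterlim r at_top sequentially" and pos: "\<And>n. r n > 0"
  shows "(\<lambda>n. r n * (exp (c n / r n) - 1)) \<longlonglongrightarrow> L"
proof -
  have "((\<lambda>y::real. (exp y - 1) / y) \<longlongrightarrow> 1) (at 0)" by real_asymp
  then have cont: "isCont (\<lambda>y. if y = 0 then 1 else (exp y - 1) / y) (0::real)"
    unfolding isCont_def by (auto intro: Lim_transform_eventually simp: eventually_at_filter)
  have "(\<lambda>n. c n / r n) \<longlonglongrightarrow> 0"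
    by (rule tendsto_divide_0[OF c]) (use filterlim_at_top_imp_at_infinity[OF r] in simp)
  from isCont_tendsto_compose[OF cont this]
  have "(\<lambda>n. if c n / r n = 0 then 1 else (exp (c n / r n) - 1) / (c n / r n)) \<longlonglongrightarrow> 1" by simp
  from tendsto_mult[OF c this]
  have "(\<lambda>n. c n * (if c n / r n = 0 then 1 else (exp (c n / r n) - 1) / (c n / r n))) \<longlonglongrightarrow> L" by simp
  moreover have "c n * (if c n / r n = 0 then 1 else (exp (c n / r n) - 1) / (c n / r n)) = r n * (exp (c n / r n) - 1)" for n
    using pos[of n] by auto
  ultimately show ?thesis by simp
qed

text \<open>For n-th roots \<nu> one has L = exp(C / n), so n \<psi> of \<nu> is the exponential
  average of n (exp(C / n) - 1). This converges to the average of C, dominated by - C, and each n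
  \<psi> is in the class.\<close>

lemma LC_cbf0:
  assumes "\<mu> \<in> ID convolution"
  shows "LC \<mu> \<in> cbf0"
proof -
  have \<mu>: "\<mu> \<in> Pplus" using assms by (simp add: ID_def)
  have "\<forall>n. \<exists>\<nu>\<in>Pplus. \<mu> = nfold convolution (Suc n) \<nu>" using assms by (auto simp: ID_def)
  then obtain \<nu> where \<nu>: "\<And>n. \<nu> n \<in> Pplus" and eq: "\<And>n. \<mu> = nfold convolution (Suc n) (\<nu> n)" by metis
  have C: "C_tr \<mu> t = real (Suc n) * C_tr (\<nu> n) t" if "t \<le> 0" for n t
    using nfold_conv[OF \<nu>[of n], of "Suc n"] eq[of n] that by simp
  have L: "L_tr (\<nu> n) t = exp (C_tr \<mu> t / real (Suc n))" if "t \<le> 0" for n t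
    using C[OF that, of n] L_pos[OF \<nu> that, of n] by (simp add: C_eq[of "\<nu> n"] del: of_nat_Suc)
  have "LC \<mu> \<in> cbf"
  proof (rule cbf_limit)
    show "(\<lambda>t. real (Suc n) * psi_tr (\<nu> n) t) \<in> cbf" for n using \<nu> by (intro cbf_cmul psi_cbf) auto
    fix t :: real assume t: "t < 0"
    have [measurable]: "C_tr \<mu> \<in> borel_measurable borel" by (rule C_measurable[OF \<mu>])
    have [measurable]: "L_tr (\<nu> n) \<in> borel_measurable borel" for n by (rule L_measurable[OF \<nu>])
    have "(\<lambda>n. LINT x|expm. real (Suc n) * (L_tr (\<nu> n) (t * x) - 1)) \<longlonglongrightarrow> (LINT x|expm. C_tr \<mu> (t * x))"
    proof (rule integral_dominated_convergence[where w="\<lambda>x. - C_tr \<mu> (t * x)"])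
      show "integrable expm (\<lambda>x. - C_tr \<mu> (t * x))" using integrable_C_expm[OF \<mu>, of t] t by simp
      show "AE x in expm. (\<lambda>n. real (Suc n) * (L_tr (\<nu> n) (t * x) - 1)) \<longlonglongrightarrow> C_tr \<mu> (t * x)"
        using AE_expm
      proof eventually_elim
        case (elim x)
        have tx: "t * x \<le> 0" using t elim by (simp add: mult_nonpos_nonneg)
        have "filterlim (\<lambda>n. real (Suc n)) at_top sequentially" by real_asymp
        from exp_scaled_limit[OF tendsto_const this, of "C_tr \<mu> (t * x)"]
        show ?case unfolding L[OF tx] by simp
      qed
      show "AE x in expm. norm (real (Suc n) * (L_tr (\<nu> n) (t * x) - 1)) \<le> - C_tr \<mu> (t * x)" for n
        using AE_expm
      proof eventually_elim
        case (elim x)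
        have tx: "t * x \<le> 0" using t elim by (simp add: mult_nonpos_nonneg)
        have "1 + C_tr \<mu> (t * x) / real (Suc n) \<le> L_tr (\<nu> n) (t * x)" unfolding L[OF tx] by (rule exp_ge_add_one_self)
        then have "real (Suc n) * (1 - L_tr (\<nu> n) (t * x)) \<le> real (Suc n) * (- (C_tr \<mu> (t * x) / real (Suc n)))"
          by (intro mult_left_mono) auto
        then have "real (Suc n) * (1 - L_tr (\<nu> n) (t * x)) \<le> - C_tr \<mu> (t * x)" by simp
        moreover have "\<bar>L_tr (\<nu> n) (t * x) - 1\<bar> = 1 - L_tr (\<nu> n) (t * x)" using L_le_1[OF \<nu> tx, of n] by simp
        ultimately show ?case by (simp only: real_norm_def abs_mult abs_of_nat)
      qed
    qed measurable
    then show "(\<lambda>n. real (Suc n) * psi_tr (\<nu> n) t) \<longlonglongrightarrow> LC \<mu> t"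
      using psi_expm(1)[OF \<nu>, of t] t by (simp add: LC_expm[OF \<mu>])
  qed
  then show ?thesis using LC_lim[OF \<mu>] by (simp add: cbf0_def)
qed

section \<open>Tail estimates, the atom of \<Omega> and existence for prescribed LC\<close>

lemma expm_tail_pos: "measure expm {1..} > 0"
proof -
  have "emeasure expm {1..} = (\<integral>\<^sup>+ x. ennreal (indicator {0<..} x * exp (- x)) * indicator {1..} x \<partial>lborel)"
    unfolding expm_def by (rule emeasure_density) auto
  also have "\<dots> \<ge> (\<integral>\<^sup>+ x. ennreal (exp (- 2)) * indicator {1..2} (x :: real) \<partial>lborel)"
    by (intro nn_integral_mono) (auto simp: indicator_def intro!: ennreal_leI)
  finally have "ennreal (exp (- 2)) \<le> emeasure expm {1..}"
    by (simp add: nn_integral_cmult_indicator)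
  then have "emeasure expm {1..} \<noteq> 0" by auto
  then show ?thesis by (simp add: expm.emeasure_eq_measure zero_less_measure_iff)
qed

text \<open>For x \<ge> 1 monotonicity gives f(t x) \<le> f(t), and the part x < 1 contributes
  nothing positive. An average thus controls the value at a single point.\<close>

lemma expm_tail_bound:
  assumes int: "integrable expm (\<lambda>x. f (t * x))" and t: "t < 0"
    and nonpos: "\<And>s. s \<le> 0 \<Longrightarrow> f s \<le> 0" and mono: "\<And>s s'. s \<le> s' \<Longrightarrow> s' \<le> 0 \<Longrightarrow> f s \<le> f s'"
  shows "(LINT x|expm. f (t * x)) \<le> measure expm {1..} * f t"
proof -
  have "(LINT x|expm. f (t * x)) \<le> (LINT x|expm. f t * indicator {1..} x)"
  proof (rule integral_mono_AE[OF int])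
    show "integrable expm (\<lambda>x. f t * indicator {1..} x)" by (auto simp: less_top[symmetric])
    show "AE x in expm. f (t * x) \<le> f t * indicator {1..} x" using AE_expm
    proof eventually_elim
      case (elim x)
      show ?case
      proof (cases "x \<ge> 1")
        case True
        then have "t * x \<le> t" using t by simp
        then show ?thesis using mono[of "t * x" t] True t by simp
      next
        case False
        then show ?thesis using nonpos[of "t * x"] elim t by (simp add: mult_nonpos_nonneg)
      qed
    qed
  qed
  then show ?thesis by (simp add: mult.commute)
qed

lemma L_at_bot:
  assumes \<mu>: "\<mu> \<in> Pplus"
  shows "(L_tr \<mu> \<longlongrightarrow> measure \<mu> {0}) at_bot"
proof -
  interpret real_distribution \<mu> using \<mu> by (simp add: Pplus_def)
  have "((\<lambda>s. L_tr \<mu> (- s)) \<longlongrightarrow> (LINT u|\<mu>. indicator {0} u)) at_top" unfolding L_tr_def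
  proof (rule integral_dominated_convergence_at_top[where w="\<lambda>_. 1"])
    show "\<forall>\<^sub>F s in at_top. AE u in \<mu>. norm (exp (- s * u)) \<le> 1"
      using eventually_ge_at_top[of 0]
    proof eventually_elim
      case (elim s)
      show ?case using Pplus_AE[OF \<mu>] by eventually_elim (use elim in simp)
    qed
    show "AE u in \<mu>. ((\<lambda>s. exp (- s * u)) \<longlongrightarrow> indicator {0} u) at_top"
      using Pplus_AE[OF \<mu>]
    proof eventually_elim
      case (elim u)
      show ?case
      proof (cases "u = 0")
        case False
        then have "u > 0" using elim by simp
        then have "((\<lambda>s. exp (- s * u)) \<longlongrightarrow> 0) at_top" by real_asymp
        then show ?thesis using False by simp
      qed simp
    qed
  qed auto
  then show ?thesis by (simp add: filterlim_at_bot_mirror)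
qed

text \<open>This justifies the value of \<Omega> at 0. With an atom, C is bounded below by its
  logarithm and dominated convergence applies. Without one, C tends to - \<infinity> and is not
  dominated; the tail bound then gives exp(LC) \<le> L^p, which tends to 0.\<close>

lemma Omega_at_0:
  assumes \<mu>: "\<mu> \<in> Pplus"
  shows "((\<lambda>x. exp (LC \<mu> (- 1 / x))) \<longlongrightarrow> measure \<mu> {0}) (at_right 0)"
proof -
  have xb: "filterlim (\<lambda>x::real. - 1 / x) at_bot (at_right 0)" by real_asymp
  have Lx: "((\<lambda>x. L_tr \<mu> (- 1 / x)) \<longlongrightarrow> measure \<mu> {0}) (at_right 0)"
    by (rule filterlim_compose[OF L_at_bot[OF \<mu>] xb])
  have [measurable]: "C_tr \<mu> \<in> borel_measurable borel" by (rule C_measurable[OF \<mu>])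
  interpret real_distribution \<mu> using \<mu> by (simp add: Pplus_def)
  have L_ge_atom: "measure \<mu> {0} \<le> L_tr \<mu> s" if "s \<le> 0" for s
  proof (rule tendsto_upperbound[OF L_at_bot[OF \<mu>]])
    show "\<forall>\<^sub>F r in at_bot. L_tr \<mu> r \<le> L_tr \<mu> s"
      using eventually_le_at_bot[of s] by eventually_elim (use C_mono(1)[OF \<mu>] that in auto)
  qed simp
  show ?thesis
  proof (cases "measure \<mu> {0} = 0")
    case True
    define p where "p = measure expm {1..}"
    have p: "p > 0" unfolding p_def by (rule expm_tail_pos)
    show ?thesis
    proof (rule tendsto_sandwich[where f="\<lambda>_. measure \<mu> {0}" and h="\<lambda>x. L_tr \<mu> (- 1 / x) powr p"])
      have "((\<lambda>x. L_tr \<mu> (- 1 / x) powr p) \<longlongrightarrow> 0 powr p) (at_right 0)"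
        using Lx True p L_pos[OF \<mu>] by (intro tendsto_powr2 tendsto_intros) (auto simp: eventually_at_filter intro!: always_eventually less_imp_le)
      then show "((\<lambda>x. L_tr \<mu> (- 1 / x) powr p) \<longlongrightarrow> measure \<mu> {0}) (at_right 0)" using True p by simp
      have "exp (LC \<mu> (- 1 / x)) \<le> L_tr \<mu> (- 1 / x) powr p" if "x > 0" for x
      proof -
        have t: "- 1 / x < 0" using that by simp
        have "LC \<mu> (- 1 / x) \<le> p * C_tr \<mu> (- 1 / x)"
          unfolding LC_expm[OF \<mu>] p_def
          using integrable_C_expm[OF \<mu>, of "- 1 / x"] t
          by (intro expm_tail_bound[where f="C_tr \<mu>"]) (auto intro: C_nonpos[OF \<mu>] C_mono(2)[OF \<mu>])
        then show ?thesis using L_pos[OF \<mu>, of "- 1 / x"] t by (simp add: powr_def C_eq)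
      qed
      then show "\<forall>\<^sub>F x in at_right 0. exp (LC \<mu> (- 1 / x)) \<le> L_tr \<mu> (- 1 / x) powr p"
        by (auto simp: eventually_at_filter intro!: always_eventually)
      show "\<forall>\<^sub>F x in at_right 0. measure \<mu> {0} \<le> exp (LC \<mu> (- 1 / x))" using True by simp
    qed simp
  next
    case False
    then have m: "measure \<mu> {0} > 0" by (simp add: zero_less_measure_iff)
    define c where "c = ln (measure \<mu> {0})"
    have Cb: "c \<le> C_tr \<mu> s" if "s \<le> 0" for s unfolding c_def C_eq using L_ge_atom[OF that] m by (intro ln_mono) auto
    have Clim: "(C_tr \<mu> \<longlongrightarrow> c) at_bot" unfolding C_eq[abs_def] c_def using L_at_bot[OF \<mu>] m by (intro tendsto_intros) auto
    have "((\<lambda>s. LINT x|expm. C_tr \<mu> (- s * x)) \<longlongrightarrow> (LINT x|expm. c)) at_top"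
    proof (rule integral_dominated_convergence_at_top[where w="\<lambda>_. - c"])
      show "\<forall>\<^sub>F s in at_top. AE x in expm. norm (C_tr \<mu> (- s * x)) \<le> - c"
        using eventually_ge_at_top[of 0]
      proof eventually_elim
        case (elim s)
        show ?case using AE_expm
        proof eventually_elim
          case (elim x)
          then have "- s * x \<le> 0" using \<open>0 \<le> s\<close> by simp
          then show ?case using Cb[of "- s * x"] C_nonpos[OF \<mu>, of "- s * x"] by simp
        qed
      qed
      show "AE x in expm. ((\<lambda>s. C_tr \<mu> (- s * x)) \<longlongrightarrow> c) at_top" using AE_expm
      proof eventually_elim
        case (elim x)
        have "filterlim (\<lambda>s. - s * x) at_bot at_top" using elim by real_asymp
        from filterlim_compose[OF Clim this] show ?case .
      qed
    qed auto
    then have "((\<lambda>s. LC \<mu> (- s)) \<longlongrightarrow> c) at_top" using expm.prob_space by (simp add: LC_expm[OF \<mu>])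
    then have "(LC \<mu> \<longlongrightarrow> c) at_bot" by (simp add: filterlim_at_bot_mirror)
    from filterlim_compose[OF this xb] have "((\<lambda>x. LC \<mu> (- 1 / x)) \<longlongrightarrow> c) (at_right 0)" .
    then have "((\<lambda>x. exp (LC \<mu> (- 1 / x))) \<longlongrightarrow> exp c) (at_right 0)" by (intro tendsto_intros)
    then show ?thesis using m by (simp add: c_def)
  qed
qed

text \<open>Take \<mu>(n) with \<eta> = h / n and its n-fold classical convolution \<nu>(n). The
  tail bound turns the explicit averages into pointwise bounds, these give tightness, and a weak
  limit has LC = h.\<close>

lemma LC_exists:
  assumes h: "h \<in> cbf0"
  obtains \<nu> where "\<nu> \<in> Pplus" "\<And>t. t < 0 \<Longrightarrow> LC \<nu> t = h t"
proof -
  have "\<exists>\<mu>. \<mu> \<in> Pplus \<and> (\<forall>t<0. M_tr \<mu> t = 1 / (1 - 1 / real (Suc n) * h t))" for n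
    using cbf0_eta[OF cbf0_cmul[OF h, of "1 / real (Suc n)"]] by (metis divide_nonneg_nonneg of_nat_0_le_iff zero_le_one)
  then obtain \<mu> where \<mu>: "\<And>n. \<mu> n \<in> Pplus"
    and M: "\<And>n t. t < 0 \<Longrightarrow> M_tr (\<mu> n) t = 1 / (1 - 1 / real (Suc n) * h t)" by metis
  have [measurable]: "L_tr (\<mu> n) \<in> borel_measurable borel" for n by (rule L_measurable[OF \<mu>])
  define \<nu> where "\<nu> n = nfold convolution (Suc n) (\<mu> n)" for n
  have \<nu>: "\<nu> n \<in> Pplus" and C\<nu>: "\<And>t. t \<le> 0 \<Longrightarrow> C_tr (\<nu> n) t = real (Suc n) * C_tr (\<mu> n) t" for n
    using nfold_conv[OF \<mu>[of n], of "Suc n"] by (auto simp: \<nu>_def)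
  \<comment> \<open>n (L - 1) replaces n ln L = C of \<nu>(n): being affine in L, its exponential
    average is explicit, and both have the same limit.\<close>
  define D where "D n t = real (Suc n) * (L_tr (\<mu> n) t - 1)" for n t
  have D_psi: "(LINT x|expm. D n (t * x)) = real (Suc n) * psi_tr (\<mu> n) t" "integrable expm (\<lambda>x. D n (t * x))" if "t < 0" for n t
    using psi_expm[OF \<mu>[of n], of t] that unfolding D_def by (simp_all add: integrable_mult_right)
  have D_int: "(LINT x|expm. D n (t * x)) = h t / (1 - h t / real (Suc n))" if t: "t < 0" for n t
  proof -
    have ht: "h t \<le> 0" by (rule cbf_nonpos[OF cbf0_cbf[OF h] t])
    have gen: "N * (1 / (1 - 1 / N * y) - 1) = y / (1 - y / N)" if "N > 0" "y \<le> 0" for N y :: real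
    proof -
      have "1 - y / N > 0" using that divide_nonpos_pos[of y N] by linarith
      then show ?thesis using that by (simp add: field_simps)
    qed
    show ?thesis unfolding D_psi(1)[OF t] using psi_eq[OF \<mu>[of n], of t] M[OF t, of n] t gen[of "real (Suc n)" "h t"] ht
      by simp
  qed
  define p where "p = measure expm {1..}"
  have p: "p > 0" unfolding p_def by (rule expm_tail_pos)
  have D_nonpos: "D n t \<le> 0" if "t \<le> 0" for n t
    unfolding D_def using L_le_1[OF \<mu> that, of n] by (intro mult_nonneg_nonpos) auto
  have D_ge: "h t / p \<le> D n t" if t: "t < 0" for n t
  proof -
    have ht: "h t \<le> 0" by (rule cbf_nonpos[OF cbf0_cbf[OF h] t])
    have q: "1 \<le> 1 - h t / real (Suc n)" using ht by (simp add: divide_nonpos_pos)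
    have "h t * (1 - h t / real (Suc n)) \<le> h t * 1" using q ht by (rule mult_left_mono_neg)
    then have "h t \<le> h t / (1 - h t / real (Suc n))" using q by (subst le_divide_eq) auto
    also have "\<dots> = (LINT x|expm. D n (t * x))" using D_int[OF t] by simp
    also have "\<dots> \<le> p * D n t" unfolding p_def
    proof (rule expm_tail_bound[OF D_psi(2)[OF t] t D_nonpos])
      show "D n s \<le> D n s'" if "s \<le> s'" "s' \<le> 0" for s s'
        unfolding D_def using C_mono(1)[OF \<mu>[of n] that] by (intro mult_left_mono) auto
    qed
    finally show ?thesis using p by (simp add: divide_le_eq mult.commute)
  qed
  have L\<nu>: "1 + h t / p \<le> L_tr (\<nu> n) t" if t: "t < 0" for n t
  proof -
    have Lp: "L_tr (\<mu> n) t > 0" using L_pos[OF \<mu>] t by simp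
    have "1 + h t / p \<le> 1 + real (Suc n) * (L_tr (\<mu> n) t - 1)" using D_ge[OF t, of n] by (simp add: D_def)
    \<comment> \<open>Bernoulli's inequality passes from the bound on D to the power of L that is
      the Laplace transform of \<nu>(n).\<close>
    also have "\<dots> \<le> (1 + (L_tr (\<mu> n) t - 1)) ^ Suc n" using Lp by (intro Bernoulli_inequality) simp
    also have "\<dots> = exp (C_tr (\<nu> n) t)" using C\<nu>[of t n] t Lp by (simp add: C_eq[of "\<mu> n"] exp_of_nat_mult del: of_nat_Suc)
    also have "\<dots> = L_tr (\<nu> n) t" using L_pos[OF \<nu>, of t n] t by (simp add: C_eq)
    finally show ?thesis .
  qed
  have "tight \<nu>" unfolding tight_def
  proof (intro conjI allI impI)
    show "real_distribution (\<nu> n)" for n using \<nu> Pplus_real_distribution by blast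
    fix \<epsilon> :: real assume e: "\<epsilon> > 0"
    have "eventually (\<lambda>t. h t > - (\<epsilon> * p / 2)) (at_left 0)" using e p by (intro order_tendstoD(1)[OF cbf0_lim[OF h]]) simp
    moreover have "eventually (\<lambda>t. t < 0) (at_left (0::real))" by (auto simp: eventually_at_filter)
    ultimately obtain t where t: "h t > - (\<epsilon> * p / 2)" "t < 0"
      using eventually_happens[OF eventually_conj] by (force simp: trivial_limit_at_left_real)
    \<comment> \<open>Beyond K the integrand exp(t u) is at most 1 / 2, whence the mass of (-1, K]
      is at least 1 + 2 h(t) / p; this also explains the threshold \<epsilon> p / 2 for
      h(t).\<close>
    define K where "K = ln 2 / (- t)"
    have K: "K > 0" unfolding K_def using t by (intro divide_pos_pos) auto
    have etK: "exp (t * K) = 1 / 2" using t by (simp add: K_def exp_minus)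
    have "1 - \<epsilon> < measure (\<nu> n) {-1<..K}" for n
    proof -
      interpret real_distribution "\<nu> n" using \<nu> by (simp add: Pplus_def)
      have i: "integrable (\<nu> n) (\<lambda>u. 1 / 2 + 1 / 2 * indicat_real {-1<..K} u)"
        by (auto intro!: Bochner_Integration.integrable_add simp: less_top[symmetric])
      have "L_tr (\<nu> n) t \<le> (LINT u|\<nu> n. 1 / 2 + 1 / 2 * indicator {-1<..K} u)" unfolding L_tr_def
      proof (rule integral_mono_AE[OF _ i])
        show "integrable (\<nu> n) (\<lambda>u. exp (t * u))" using integrable_L[OF \<nu>] t by simp
        show "AE u in \<nu> n. exp (t * u) \<le> 1 / 2 + 1 / 2 * indicator {-1<..K} u"
          using Pplus_AE[OF \<nu>[of n]]
        proof eventually_elim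
          case (elim u)
          show ?case
          proof (cases "u \<le> K")
            case True
            then show ?thesis using elim t by (simp add: mult_nonpos_nonneg)
          next
            case False
            then have "exp (t * u) \<le> exp (t * K)" using t by simp
            then show ?thesis using etK False by simp
          qed
        qed
      qed
      also have "\<dots> = 1 / 2 + 1 / 2 * measure (\<nu> n) {-1<..K}"
        by (subst Bochner_Integration.integral_add) (auto simp: prob_space[simplified] less_top[symmetric] intro!: integrable_mult_right)
      finally have "1 + h t / p \<le> 1 / 2 + 1 / 2 * measure (\<nu> n) {-1<..K}" using L\<nu>[OF t(2), of n] by simp
      moreover have "h t / p > - (\<epsilon> / 2)" using t(1) p by (simp add: field_simps)
      ultimately show ?thesis by linarith
    qed
    then show "\<exists>a b. a < b \<and> (\<forall>n. 1 - \<epsilon> < measure (\<nu> n) {a<..b})"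
      using K by (intro exI[of _ "-1"] exI[of _ K]) auto
  qed
  then obtain r \<rho> where r: "strict_mono (r :: nat \<Rightarrow> nat)" and \<rho>: "real_distribution \<rho>" "weak_conv_m (\<nu> \<circ> id \<circ> r) \<rho>"
    using tight_imp_convergent_subsubsequence[of \<nu> id] strict_mono_id by blast
  interpret \<rho>: real_distribution \<rho> by fact
  \<comment> \<open>Transporting the limit by max 0 puts it on the half-line without examining its
    support; the test functions exp(t max 0 u) do not see the difference.\<close>
  define \<nu>' where "\<nu>' = distr \<rho> borel (max 0)"
  have \<nu>': "\<nu>' \<in> Pplus" unfolding \<nu>'_def
  proof (rule PplusI)
    show "real_distribution (distr \<rho> borel (max 0))" by (rule \<rho>.real_distribution_distr) simp
    show "AE u in distr \<rho> borel (max 0). 0 \<le> u" by (subst AE_distr_iff) auto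
  qed
  have L_lim: "(\<lambda>n. L_tr (\<nu> (r n)) t) \<longlonglongrightarrow> L_tr \<nu>' t" if t: "t \<le> 0" for t
  proof -
    have rd: "real_distribution ((\<nu> \<circ> id \<circ> r) n)" for n using \<nu> Pplus_real_distribution by simp
    have c: "isCont (\<lambda>u. exp (t * max 0 u)) u" for u by (intro continuous_intros)
    have b: "norm (exp (t * max 0 u)) \<le> 1" for u using t by (simp add: mult_nonpos_nonneg)
    have "(\<lambda>n. LINT u|(\<nu> \<circ> id \<circ> r) n. exp (t * max 0 u)) \<longlonglongrightarrow> (LINT u|\<rho>. exp (t * max 0 u))"
      by (rule weak_conv_imp_integral_bdd_continuous_conv[where \<mu>="\<nu> \<circ> id \<circ> r", OF rd \<rho> c b])
    moreover have "(LINT u|\<rho>. exp (t * max 0 u)) = L_tr \<nu>' t"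
      unfolding L_tr_def \<nu>'_def by (subst integral_distr) auto
    moreover have "(LINT u|\<nu> k. exp (t * max 0 u)) = L_tr (\<nu> k) t" for k
      unfolding L_tr_def
    proof (rule integral_cong_AE)
      show "AE u in \<nu> k. exp (t * max 0 u) = exp (t * u)" using Pplus_AE[OF \<nu>[of k]] by eventually_elim simp
    qed (use Pplus_sets[OF \<nu>[of k]] in \<open>auto cong: measurable_cong_sets\<close>)
    ultimately show ?thesis by simp
  qed
  have [measurable]: "C_tr \<nu>' \<in> borel_measurable borel" by (rule C_measurable[OF \<nu>'])
  have D_lim: "(\<lambda>n. D (r n) t) \<longlonglongrightarrow> C_tr \<nu>' t" if t: "t \<le> 0" for t
  proof -
    have c: "(\<lambda>n. C_tr (\<nu> (r n)) t) \<longlonglongrightarrow> C_tr \<nu>' t"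
      unfolding C_eq using L_lim[OF t] L_pos[OF \<nu>' t] by (intro tendsto_intros) auto
    have f: "filterlim (\<lambda>n. real (Suc (r n))) at_top sequentially"
      by (intro filterlim_compose[OF filterlim_real_sequentially] filterlim_compose[OF filterlim_Suc] filterlim_subseq r)
    have "(\<lambda>n. real (Suc (r n)) * (exp (C_tr (\<nu> (r n)) t / real (Suc (r n))) - 1)) \<longlonglongrightarrow> C_tr \<nu>' t"
      by (rule exp_scaled_limit[OF c f]) simp
    moreover have "real (Suc k) * (exp (C_tr (\<nu> k) t / real (Suc k)) - 1) = D k t" for k
      unfolding D_def C\<nu>[OF t] using L_pos[OF \<mu> t, of k] by (simp add: C_eq[of "\<mu> k"] del: of_nat_Suc)
    ultimately show ?thesis by simp
  qed
  have "LC \<nu>' t = h t" if t: "t < 0" for t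
  proof -
    have ht: "h t \<le> 0" by (rule cbf_nonpos[OF cbf0_cbf[OF h] t])
    have Dm: "(\<lambda>x. D n (t * x)) \<in> borel_measurable expm" for n unfolding D_def by measurable
    have "(\<lambda>n. LINT x|expm. D (r n) (t * x)) \<longlonglongrightarrow> (LINT x|expm. C_tr \<nu>' (t * x))"
    proof (rule integral_dominated_convergence[where w="\<lambda>x. - h t / p * (1 + x)"])
      show "integrable expm (\<lambda>x. - h t / p * (1 + x))" by (rule integrable_expm_linear)
      show "AE x in expm. (\<lambda>n. D (r n) (t * x)) \<longlonglongrightarrow> C_tr \<nu>' (t * x)"
        using AE_expm by eventually_elim (use t in \<open>intro D_lim, simp add: mult_nonpos_nonneg\<close>)
      show "AE x in expm. norm (D (r n) (t * x)) \<le> - h t / p * (1 + x)" for n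
        using AE_expm
      proof eventually_elim
        case (elim x)
        have tx: "t * x < 0" using t elim by (simp add: mult_neg_pos)
        \<comment> \<open>A dominating function of linear growth: monotonicity for x \<le> 1, the
          slope bound for x > 1.\<close>
        have "h t * (1 + x) \<le> h (t * x)"
        proof (cases "x \<le> 1")
          case True
          then have "t \<le> t * x" using t by simp
          then have "h t \<le> h (t * x)" by (rule cbf_mono[OF cbf0_cbf[OF h] _ tx])
          moreover have "h t * x \<le> 0" using ht elim by (simp add: mult_nonpos_nonneg)
          ultimately show ?thesis by (simp add: distrib_left)
        next
          case False
          then have "t * x \<le> t" using t by simp
          then have "h (t * x) / (t * x) \<le> h t / t" using t by (intro cbf_slope[OF cbf0_cbf[OF h]])
          then have "(t * x) * (h t / t) \<le> (t * x) * (h (t * x) / (t * x))" using tx by (intro mult_left_mono_neg) auto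
          then have "h t * x \<le> h (t * x)" using t elim by (simp add: mult.commute)
          then show ?thesis using ht by (simp add: distrib_left)
        qed
        then have "h t * (1 + x) / p \<le> h (t * x) / p" using p by (simp add: divide_right_mono)
        also have "\<dots> \<le> D (r n) (t * x)" by (rule D_ge[OF tx])
        finally show ?case using D_nonpos[of "t * x" "r n"] tx by simp
      qed
    qed (use Dm in measurable)
    then have "(\<lambda>n. h t / (1 - h t / real (Suc (r n)))) \<longlonglongrightarrow> LC \<nu>' t"
      using D_int[OF t] by (simp add: LC_expm[OF \<nu>'])
    moreover have "(\<lambda>n. h t / (1 - h t / real (Suc (r n)))) \<longlonglongrightarrow> h t / (1 - 0)"
    proof (intro tendsto_divide tendsto_diff tendsto_const)
      have "(\<lambda>n. h t / real (Suc n)) \<longlonglongrightarrow> 0" by real_asymp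
      from LIMSEQ_subseq_LIMSEQ[OF this r] show "(\<lambda>n. h t / real (Suc (r n))) \<longlonglongrightarrow> 0" by (simp add: o_def)
    qed simp
    ultimately show ?thesis using LIMSEQ_unique by fastforce
  qed
  then show ?thesis using that \<nu>' by blast
qed

text \<open>Roots are the measures belonging to h / n; that their convolution powers give \<nu>
  follows from injectivity of LC.\<close>

lemma LC_exists_ID:
  assumes h: "h \<in> cbf0"
  obtains \<nu> where "\<nu> \<in> ID convolution" "\<And>t. t < 0 \<Longrightarrow> LC \<nu> t = h t"
proof -
  obtain \<nu> where \<nu>: "\<nu> \<in> Pplus" "\<And>t. t < 0 \<Longrightarrow> LC \<nu> t = h t" using LC_exists[OF h] by blast
  have "\<exists>\<rho>\<in>Pplus. \<nu> = nfold convolution n \<rho>" if n: "n \<ge> 1" for n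
  proof -
    have "(\<lambda>t. 1 / real n * h t) \<in> cbf0" by (rule cbf0_cmul[OF h]) simp
    then obtain \<rho> where \<rho>: "\<rho> \<in> Pplus" "\<And>t. t < 0 \<Longrightarrow> LC \<rho> t = 1 / real n * h t" using LC_exists by blast
    have "\<nu> = nfold convolution n \<rho>"
      by (rule LC_unique) (use \<nu> \<rho> nfold_conv[OF \<rho>(1) n] LC_nfold[OF \<rho>(1) n] n in auto)
    then show ?thesis using \<rho>(1) by blast
  qed
  then have "\<nu> \<in> ID convolution" using \<nu>(1) by (simp add: ID_def)
  then show ?thesis using that \<nu>(2) by blast
qed

section \<open>The bijections \<X> and \<Lambda>\<close>

lemma ID_Pplus: "\<mu> \<in> ID f \<Longrightarrow> \<mu> \<in> Pplus" by (simp add: ID_def)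

lemma X_map:
  assumes \<mu>: "\<mu> \<in> Pplus"
  shows "X_map \<mu> \<in> ID convolution" "\<And>t. t < 0 \<Longrightarrow> LC (X_map \<mu>) t = eta_tr \<mu> t"
proof -
  obtain \<nu> where \<nu>: "\<nu> \<in> ID convolution" "\<And>t. t < 0 \<Longrightarrow> LC \<nu> t = eta_tr \<mu> t"
    using LC_exists_ID[OF eta_cbf0[OF \<mu>]] by blast
  have "X_map \<mu> = \<nu>" unfolding X_map_def
  proof (rule the_equality)
    fix \<nu>' assume "\<nu>' \<in> ID convolution \<and> (\<forall>t<0. eta_tr \<mu> t = LC \<nu>' t)"
    then show "\<nu>' = \<nu>" using \<nu> ID_Pplus by (intro LC_unique) auto
  qed (use \<nu> in auto)
  then show "X_map \<mu> \<in> ID convolution" "\<And>t. t < 0 \<Longrightarrow> LC (X_map \<mu>) t = eta_tr \<mu> t" using \<nu> by auto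
qed

lemma Lambda_map_isR:
  assumes \<mu>: "\<mu> \<in> ID convolution"
  shows "isR (Lambda_map \<mu>) (LC \<mu>)"
proof -
  obtain \<nu> where \<nu>: "isR \<nu> (LC \<mu>)" using isR_exists[OF LC_cbf0[OF \<mu>]] by blast
  have "Lambda_map \<mu> = \<nu>" unfolding Lambda_map_def
  proof (rule the_equality)
    show "\<nu> \<in> ID boxplus \<and> (\<forall>t\<in>R_dom \<nu>. R_tr \<nu> t = LC \<mu> t)" using isR_ID[OF \<nu>] isR_R[OF \<nu>] by blast
    fix \<nu>' assume "\<nu>' \<in> ID boxplus \<and> (\<forall>t\<in>R_dom \<nu>'. R_tr \<nu>' t = LC \<mu> t)"
    then show "\<nu>' = \<nu>" using isR_R[OF \<nu>] \<nu> ID_Pplus by (intro R_unique[where f="LC \<mu>"]) (auto simp: isR_def)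
  qed
  then show ?thesis using \<nu> by simp
qed


section \<open>Max-convolutions and the commuting diagram\<close>

text \<open>A common frame for pointwise operations on distribution functions. Maps of one argument
  enter as operations constant in the second argument, so that one preservation lemma serves all of
  them.\<close>

definition df_op :: "(real \<Rightarrow> real \<Rightarrow> real) \<Rightarrow> bool" where
  "df_op \<phi> \<longleftrightarrow> continuous_on ({0..1} \<times> {0..1}) (\<lambda>p. \<phi> (fst p) (snd p)) \<and>
     (\<forall>a b a' b'. 0 \<le> a \<longrightarrow> a \<le> a' \<longrightarrow> a' \<le> 1 \<longrightarrow> 0 \<le> b \<longrightarrow> b \<le> b' \<longrightarrow> b' \<le> 1 \<longrightarrow> \<phi> a b \<le> \<phi> a' b') \<and>
     0 \<le> \<phi> 0 0 \<and> \<phi> 1 1 = 1"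

lemma isdf_df_op:
  assumes \<phi>: "df_op \<phi>" and F: "isdf F" and G: "isdf G"
  shows "isdf (\<lambda>x. \<phi> (F x) (G x))"
proof -
  have mono: "\<phi> a b \<le> \<phi> a' b'" if "0 \<le> a" "a \<le> a'" "a' \<le> 1" "0 \<le> b" "b \<le> b'" "b' \<le> 1" for a b a' b'
    using \<phi> that unfolding df_op_def by blast
  have cont: "((\<lambda>x. \<phi> (F x) (G x)) \<longlongrightarrow> \<phi> a b) A"
    if "(F \<longlongrightarrow> a) A" "(G \<longlongrightarrow> b) A" "\<forall>\<^sub>F x in A. 0 \<le> x" "0 \<le> a" "a \<le> 1" "0 \<le> b" "b \<le> 1" for a b A
  proof -
    have c: "continuous_on ({0..1} \<times> {0..1}) (\<lambda>p. \<phi> (fst p) (snd p))" using \<phi> by (simp add: df_op_def)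
    have "\<forall>\<^sub>F x in A. (F x, G x) \<in> {0..1} \<times> {0..1}"
      using that(3) by eventually_elim (use isdfD(1) isdf_le_1 F G in auto)
    from continuous_on_tendsto_compose[OF c tendsto_Pair[OF that(1,2)] _ this]
    have "((\<lambda>x. \<phi> (fst (F x, G x)) (snd (F x, G x))) \<longlongrightarrow> \<phi> (fst (a, b)) (snd (a, b))) A"
      using that by simp
    then show ?thesis by simp
  qed
  have b: "0 \<le> F x" "F x \<le> 1" "0 \<le> G x" "G x \<le> 1" if "x \<ge> 0" for x
    using isdfD(1) isdf_le_1 F G that by auto
  show ?thesis unfolding isdf_def
  proof (intro conjI allI impI)
    fix x :: real assume x: "x \<ge> 0"
    have "0 \<le> \<phi> 0 0" using \<phi> by (simp add: df_op_def)
    also have "\<dots> \<le> \<phi> (F x) (G x)" using b[OF x] by (intro mono) auto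
    finally show "0 \<le> \<phi> (F x) (G x)" .
    show "\<phi> (F x) (G x) \<le> \<phi> (F y) (G y)" if "x \<le> y" for y
      using b[OF x] b[of y] isdfD(2)[OF F x that] isdfD(2)[OF G x that] x that by (intro mono) auto
    show "((\<lambda>x. \<phi> (F x) (G x)) \<longlongrightarrow> \<phi> (F x) (G x)) (at_right x)"
      using b[OF x] isdfD(3)[OF F x] isdfD(3)[OF G x] x by (intro cont) (auto simp: eventually_at_filter)
  next
    have "((\<lambda>x. \<phi> (F x) (G x)) \<longlongrightarrow> \<phi> 1 1) at_top"
      using isdfD(4)[OF F] isdfD(4)[OF G] by (intro cont) (auto simp: eventually_ge_at_top)
    then show "((\<lambda>x. \<phi> (F x) (G x)) \<longlongrightarrow> 1) at_top" using \<phi> by (simp add: df_op_def)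
  qed
qed

lemma of_df_op:
  assumes "df_op \<phi>" "\<mu> \<in> Pplus" "\<nu> \<in> Pplus"
  shows "of_df (\<lambda>t. \<phi> (measure \<mu> {0..t}) (measure \<nu> {0..t})) \<in> Pplus"
    "t \<ge> 0 \<Longrightarrow> measure (of_df (\<lambda>t. \<phi> (measure \<mu> {0..t}) (measure \<nu> {0..t}))) {0..t} = \<phi> (measure \<mu> {0..t}) (measure \<nu> {0..t})"
proof -
  have i: "isdf (\<lambda>t. \<phi> (measure \<mu> {0..t}) (measure \<nu> {0..t}))" by (rule isdf_df_op[OF assms(1) isdf_Pplus[OF assms(2)] isdf_Pplus[OF assms(3)]])
  show "of_df (\<lambda>t. \<phi> (measure \<mu> {0..t}) (measure \<nu> {0..t})) \<in> Pplus" by (rule of_df_Pplus[OF i])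
  show "t \<ge> 0 \<Longrightarrow> measure (of_df (\<lambda>t. \<phi> (measure \<mu> {0..t}) (measure \<nu> {0..t}))) {0..t} = \<phi> (measure \<mu> {0..t}) (measure \<nu> {0..t})"
    by (rule measure_of_df[OF i])
qed

lemma df_bounds:
  assumes "\<mu> \<in> Pplus"
  shows "0 \<le> measure \<mu> {0..t}" "measure \<mu> {0..t} \<le> 1"
proof -
  interpret real_distribution \<mu> using assms by (simp add: Pplus_def)
  show "0 \<le> measure \<mu> {0..t}" "measure \<mu> {0..t} \<le> 1" by auto
qed

lemma semigroup_df_op:
  assumes \<phi>: "df_op \<phi>"
    and assoc: "\<And>a b c. \<lbrakk>0 \<le> a; a \<le> 1; 0 \<le> b; b \<le> 1; 0 \<le> c; c \<le> 1\<rbrakk> \<Longrightarrow> \<phi> (\<phi> a b) c = \<phi> a (\<phi> b c)"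
    and op: "\<And>\<mu> \<nu>. op \<mu> \<nu> = of_df (\<lambda>t. \<phi> (measure \<mu> {0..t}) (measure \<nu> {0..t}))"
  shows "semigroup_on Pplus op"
  unfolding semigroup_on_def
proof (intro conjI ballI)
  fix x y assume xy: "x \<in> Pplus" "y \<in> Pplus"
  show "op x y \<in> Pplus" unfolding op by (rule of_df_op[OF \<phi> xy])
  fix z assume z: "z \<in> Pplus"
  show "op (op x y) z = op x (op y z)"
    by (rule Pplus_eqI) (auto simp: op of_df_op[OF \<phi>] xy z assoc df_bounds)
qed

text \<open>Where m > 0 continuity is local on a relatively open set; where m = 0 it follows by
  squeezing. It handles formulas containing 1 / a that are set to 0 at a = 0.\<close>

lemma continuous_on_squeezed:
  fixes \<phi> m :: "'a :: topological_space \<Rightarrow> real"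
  assumes m: "continuous_on S m" and cont: "continuous_on {p \<in> S. 0 < m p} \<phi>"
    and b: "\<And>p. p \<in> S \<Longrightarrow> 0 \<le> \<phi> p \<and> \<phi> p \<le> m p"
  shows "continuous_on S \<phi>"
  unfolding continuous_on_def
proof
  fix a assume a: "a \<in> S"
  have ma: "(m \<longlongrightarrow> m a) (at a within S)" using m a by (simp add: continuous_on_def)
  show "(\<phi> \<longlongrightarrow> \<phi> a) (at a within S)"
  proof (cases "0 < m a")
    case True
    obtain T where T: "open T" "T \<inter> S = m -` {0<..} \<inter> S"
      using m unfolding continuous_on_open_invariant by (meson open_greaterThan)
    have "at a within S = at a within {p \<in> S. 0 < m p}"
      by (rule at_within_nhd[of _ T]) (use T True a in auto)
    then show ?thesis using cont a True by (simp add: continuous_on_def)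
  next
    case False
    then have 0: "m a = 0" "\<phi> a = 0" using b[OF a] by auto
    have "\<forall>\<^sub>F p in at a within S. 0 \<le> \<phi> p" "\<forall>\<^sub>F p in at a within S. \<phi> p \<le> m p"
      using b by (auto simp: eventually_at_filter)
    from tendsto_sandwich[OF this tendsto_const ma[unfolded 0]]
    have "(\<phi> \<longlongrightarrow> 0) (at a within S)" .
    then show ?thesis by (simp add: 0)
  qed
qed

section \<open>The concrete operations on distribution functions\<close>

lemma df_op_times: "df_op (\<lambda>a b. a * b)"
  unfolding df_op_def by (auto intro!: continuous_intros mult_mono)

lemma df_op_free: "df_op (\<lambda>a b. max (a + b - 1) 0)"
  unfolding df_op_def by (auto intro!: continuous_intros)

definition harm_op :: "real \<Rightarrow> real \<Rightarrow> real" where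
  "harm_op a b = (if a = 0 \<or> b = 0 then 0 else 1 / (1 / a + 1 / b - 1))"

definition X_df :: "real \<Rightarrow> real" where
  "X_df a = (if a = 0 then 0 else exp (1 - 1 / a))"

definition Lambda_df :: "real \<Rightarrow> real" where
  "Lambda_df a = (if a = 0 then 0 else max (1 + ln a) 0)"

lemma harm_op_bounds:
  assumes "0 \<le> a" "a \<le> 1" "0 \<le> b" "b \<le> 1"
  shows "0 \<le> harm_op a b" "harm_op a b \<le> min a b"
proof -
  have "0 \<le> harm_op a b \<and> harm_op a b \<le> min a b"
  proof (cases "a = 0 \<or> b = 0")
    case True
    then show ?thesis using assms by (auto simp: harm_op_def)
  next
    case False
    then have ab: "0 < a" "0 < b" using assms by auto
    then have "1 \<le> 1 / a" "1 \<le> 1 / b" using assms by auto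
    then have "1 / (1 / a + 1 / b - 1) \<le> 1 / (1 / a)" "1 / (1 / a + 1 / b - 1) \<le> 1 / (1 / b)"
      using ab by (intro frac_le; linarith)+
    moreover have "0 \<le> 1 / (1 / a + 1 / b - 1)"
      using \<open>1 \<le> 1 / a\<close> \<open>1 \<le> 1 / b\<close> by (intro divide_nonneg_nonneg) linarith+
    ultimately show ?thesis using False by (simp add: harm_op_def)
  qed
  then show "0 \<le> harm_op a b" "harm_op a b \<le> min a b" by auto
qed

lemma df_op_harm: "df_op harm_op"
  unfolding df_op_def
proof (intro conjI allI impI)
  show "continuous_on ({0..1} \<times> {0..1}) (\<lambda>p. harm_op (fst p) (snd p))"
  proof (rule continuous_on_squeezed[where m="\<lambda>p. min (fst p) (snd p)"])
    have "continuous_on {p \<in> {0..1} \<times> {0..1}. 0 < min (fst p) (snd p)} (\<lambda>p. 1 / (1 / fst p + 1 / snd p - 1 :: real))"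
    proof (intro continuous_intros ballI)
      fix p :: "real \<times> real" assume "p \<in> {p \<in> {0..1} \<times> {0..1}. 0 < min (fst p) (snd p)}"
      then have p: "0 < fst p" "fst p \<le> 1" "0 < snd p" "snd p \<le> 1" by auto
      then show "fst p \<noteq> 0" "snd p \<noteq> 0" by auto
      have "1 \<le> 1 / fst p" "1 \<le> 1 / snd p" using p by auto
      then show "1 / fst p + 1 / snd p - 1 \<noteq> 0" by linarith
    qed
    then show "continuous_on {p \<in> {0..1} \<times> {0..1}. 0 < min (fst p) (snd p)} (\<lambda>p. harm_op (fst p) (snd p))"
      by (rule continuous_on_eq) (auto simp: harm_op_def)
  next
    show "continuous_on ({0..1} \<times> {0..1}) (\<lambda>p. min (fst p) (snd p :: real))" by (intro continuous_intros)
    fix p :: "real \<times> real" assume "p \<in> {0..1} \<times> {0..1}"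
    then show "0 \<le> harm_op (fst p) (snd p) \<and> harm_op (fst p) (snd p) \<le> min (fst p) (snd p)"
      using harm_op_bounds[of "fst p" "snd p"] by auto
  qed
  fix a b a' b' :: real assume as: "0 \<le> a" "a \<le> a'" "a' \<le> 1" "0 \<le> b" "b \<le> b'" "b' \<le> 1"
  show "harm_op a b \<le> harm_op a' b'"
  proof (cases "a = 0 \<or> b = 0")
    case True
    then show ?thesis using harm_op_bounds(1)[of a' b'] as by (auto simp: harm_op_def)
  next
    case False
    then have p: "0 < a" "0 < b" "0 < a'" "0 < b'" using as by auto
    have "1 \<le> 1 / a'" "1 \<le> 1 / b'" "1 / a' \<le> 1 / a" "1 / b' \<le> 1 / b" using p as by (auto simp: frac_le)
    then have "1 / (1 / a + 1 / b - 1) \<le> 1 / (1 / a' + 1 / b' - 1)" by (intro frac_le; linarith)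
    then show ?thesis using p by (simp add: harm_op_def)
  qed
qed (auto simp: harm_op_def)

lemma harm_op_assoc:
  assumes "0 \<le> a" "a \<le> 1" "0 \<le> b" "b \<le> 1" "0 \<le> c" "c \<le> 1"
  shows "harm_op (harm_op a b) c = harm_op a (harm_op b c)"
proof (cases "a = 0 \<or> b = 0 \<or> c = 0")
  case True
  then show ?thesis by (auto simp: harm_op_def)
next
  case False
  then have "1 \<le> 1 / a" "1 \<le> 1 / b" "1 \<le> 1 / c" using assms by auto
  then have "1 / a + 1 / b - 1 \<noteq> 0" "1 / b + 1 / c - 1 \<noteq> 0" by linarith+
  then show ?thesis using False by (simp add: harm_op_def add.assoc add_diff_eq)
qed

lemma df_op_X: "df_op (\<lambda>a b. X_df a)"
  unfolding df_op_def
proof (intro conjI allI impI)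
  \<comment> \<open>From ln y \<le> y - 1 at y = 1 / a; this is the majorant for
    \<open>continuous_on_squeezed\<close>.\<close>
  have le: "0 \<le> X_df a \<and> X_df a \<le> a" if "0 \<le> a" for a
  proof (cases "a = 0")
    case False
    then have "ln (1 / a) \<le> 1 / a - 1" using that by (intro ln_le_minus_one) simp
    then have "1 - 1 / a \<le> ln a" using False that by (simp add: ln_div)
    then have "exp (1 - 1 / a) \<le> exp (ln a)" by (simp only: exp_le_cancel_iff)
    then show ?thesis using False that by (simp add: X_df_def)
  qed (simp add: X_df_def)
  have "continuous_on {p \<in> {0..1} \<times> {0..1}. 0 < fst p} (\<lambda>p :: real \<times> real. exp (1 - 1 / fst p) :: real)"
    by (intro continuous_intros) auto
  then have "continuous_on {p \<in> {0..1} \<times> {0..1}. 0 < fst p} (\<lambda>p :: real \<times> real. X_df (fst p))"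
    by (rule continuous_on_eq) (auto simp: X_df_def)
  moreover have "continuous_on ({0..1} \<times> {0..1}) (fst :: real \<times> real \<Rightarrow> real)" by (intro continuous_intros)
  moreover have "0 \<le> X_df (fst p) \<and> X_df (fst p) \<le> fst p" if "p \<in> {0..1} \<times> {0..1}" for p :: "real \<times> real"
    using le[of "fst p"] that by auto
  ultimately show "continuous_on ({0..1} \<times> {0..1}) (\<lambda>p :: real \<times> real. X_df (fst p))"
    using continuous_on_squeezed[where S="{0..1} \<times> {0..1}" and m=fst and \<phi>="\<lambda>p :: real \<times> real. X_df (fst p)"] by blast
  fix a a' :: real assume as: "0 \<le> a" "a \<le> a'" "a' \<le> 1"
  show "X_df a \<le> X_df a'"
  proof (cases "a = 0")
    case True
    then show ?thesis using le[of a'] as by (simp add: X_df_def)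
  next
    case False
    then have "1 / a' \<le> 1 / a" using as by (intro frac_le) auto
    then show ?thesis using False as by (simp add: X_df_def)
  qed
qed (auto simp: X_df_def)

text \<open>Moving the truncation inside the logarithm removes its singularity and makes continuity
  and monotonicity evident.\<close>

lemma Lambda_df_eq:
  assumes "0 \<le> a"
  shows "Lambda_df a = 1 + ln (max a (exp (- 1)))"
proof (cases "a \<le> exp (- 1)")
  case True
  then have "ln a \<le> - 1" if "a \<noteq> 0" using that assms by (subst ln_le_cancel_iff[of a "exp (- 1)", unfolded ln_exp]) auto
  then show ?thesis using True by (cases "a = 0") (simp_all add: Lambda_df_def max_def)
next
  case False
  then have "a > 0" by (metis exp_gt_zero less_trans not_le)
  moreover have "ln a > - 1" using False calculation by (metis exp_ln exp_le_cancel_iff not_le)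
  ultimately show ?thesis using False by (simp add: Lambda_df_def max_def)
qed

lemma df_op_Lambda: "df_op (\<lambda>a b. Lambda_df a)"
  unfolding df_op_def
proof (intro conjI allI impI)
  have pos: "max a (exp (- 1)) > (0 :: real)" for a by (simp add: less_max_iff_disj)
  have "continuous_on ({0..1} \<times> {0..1}) (\<lambda>p. 1 + ln (max (fst p) (exp (- 1))) :: real)"
    using pos by (intro continuous_intros ballI) (metis less_irrefl)
  then show "continuous_on ({0..1} \<times> {0..1}) (\<lambda>p. Lambda_df (fst p))"
    by (rule continuous_on_eq) (auto simp: Lambda_df_eq)
  show "Lambda_df a \<le> Lambda_df a'" if "0 \<le> a" "a \<le> a'" for a a'
    using that pos by (auto simp: Lambda_df_eq intro!: ln_mono)
qed (auto simp: Lambda_df_def)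

lemma X_df_harm:
  assumes "0 \<le> a" "a \<le> 1" "0 \<le> b" "b \<le> 1"
  shows "X_df (harm_op a b) = X_df a * X_df b"
proof (cases "a = 0 \<or> b = 0")
  case False
  then have "1 \<le> 1 / a" "1 \<le> 1 / b" using assms by auto
  then have "1 / a + 1 / b - 1 \<noteq> 0" by linarith
  then show ?thesis using False by (simp add: X_df_def harm_op_def exp_add[symmetric])
qed (auto simp: X_df_def harm_op_def)

text \<open>Both logarithms are nonpositive: if one summand is truncated at 0, the untruncated total
  is already nonpositive.\<close>

lemma Lambda_df_times:
  assumes "0 \<le> a" "a \<le> 1" "0 \<le> b" "b \<le> 1"
  shows "Lambda_df (a * b) = max (Lambda_df a + Lambda_df b - 1) 0"
proof (cases "a = 0 \<or> b = 0")
  case True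
  have "ln a \<le> 0" if "a \<noteq> 0" using that assms by simp
  moreover have "ln b \<le> 0" if "b \<noteq> 0" using that assms by simp
  ultimately show ?thesis using True by (auto simp: Lambda_df_def)
next
  case False
  then have p: "0 < a" "0 < b" using assms by auto
  then have "ln a \<le> 0" "ln b \<le> 0" using assms by auto
  then have "max (1 + (ln a + ln b)) 0 = max (max (1 + ln a) 0 + max (1 + ln b) 0 - 1) 0" by linarith
  then show ?thesis using p by (simp add: Lambda_df_def ln_mult)
qed

lemma bool_max_conv_op: "bool_max_conv \<mu> \<nu> = of_df (\<lambda>t. harm_op (measure \<mu> {0..t}) (measure \<nu> {0..t}))"
  by (simp add: bool_max_conv_def harm_op_def)

lemma X_max_op: "X_max \<mu> = of_df (\<lambda>t. X_df (measure \<mu> {0..t}))"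
  by (simp add: X_max_def X_df_def)

lemma Lambda_max_op: "Lambda_max \<mu> = of_df (\<lambda>t. Lambda_df (measure \<mu> {0..t}))"
  by (simp add: Lambda_max_def Lambda_df_def)

lemmas max_conv_df = of_df_op[OF df_op_times, folded max_conv_def]
lemmas free_max_conv_df = of_df_op[OF df_op_free, folded free_max_conv_def]
lemmas bool_max_conv_df = of_df_op[OF df_op_harm, folded bool_max_conv_op]

lemma X_max_df:
  assumes "\<mu> \<in> Pplus"
  shows "X_max \<mu> \<in> Pplus" "t \<ge> 0 \<Longrightarrow> measure (X_max \<mu>) {0..t} = X_df (measure \<mu> {0..t})"
  using of_df_op[OF df_op_X assms assms] by (simp_all add: X_max_op)

lemma Lambda_max_df:
  assumes "\<mu> \<in> Pplus"
  shows "Lambda_max \<mu> \<in> Pplus" "t \<ge> 0 \<Longrightarrow> measure (Lambda_max \<mu>) {0..t} = Lambda_df (measure \<mu> {0..t})"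
  using of_df_op[OF df_op_Lambda assms assms] by (simp_all add: Lambda_max_op)

section \<open>Semigroups and homomorphisms\<close>

lemma semigroup_max_conv: "semigroup_on Pplus max_conv"
  by (rule semigroup_df_op[OF df_op_times]) (simp_all add: max_conv_def mult.assoc)

lemma semigroup_free_max_conv: "semigroup_on Pplus free_max_conv"
  by (rule semigroup_df_op[OF df_op_free]) (auto simp: free_max_conv_def max_def)

lemma semigroup_bool_max_conv: "semigroup_on Pplus bool_max_conv"
  by (rule semigroup_df_op[OF df_op_harm]) (simp_all add: bool_max_conv_op harm_op_assoc)

lemma hom_X_max: "semigroup_hom Pplus bool_max_conv Pplus max_conv X_max"
  unfolding semigroup_hom_def
proof (intro conjI ballI semigroup_bool_max_conv semigroup_max_conv)
  fix x y assume x: "x \<in> Pplus" and y: "y \<in> Pplus"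
  show "X_max (bool_max_conv x y) = max_conv (X_max x) (X_max y)"
    by (rule Pplus_eqI)
      (auto simp: X_max_df x y bool_max_conv_df max_conv_df X_df_harm df_bounds)
qed (rule X_max_df)

lemma hom_Lambda_max: "semigroup_hom Pplus max_conv Pplus free_max_conv Lambda_max"
  unfolding semigroup_hom_def
proof (intro conjI ballI semigroup_free_max_conv semigroup_max_conv)
  fix x y assume x: "x \<in> Pplus" and y: "y \<in> Pplus"
  show "Lambda_max (max_conv x y) = free_max_conv (Lambda_max x) (Lambda_max y)"
    by (rule Pplus_eqI)
      (auto simp: Lambda_max_df x y free_max_conv_df max_conv_df Lambda_df_times df_bounds)
qed (rule Lambda_max_df)

lemma Omega_df:
  assumes ID: "\<mu> \<in> ID convolution"
  shows "Omega_map \<mu> \<in> Pplus" "t > 0 \<Longrightarrow> measure (Omega_map \<mu>) {0..t} = exp (LC \<mu> (- 1 / t))"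
proof -
  have \<mu>: "\<mu> \<in> Pplus" and h: "LC \<mu> \<in> cbf0" using ID_Pplus[OF ID] LC_cbf0[OF ID] by auto
  let ?F = "\<lambda>t. if t = 0 then measure \<mu> {0} else exp (LC \<mu> (- 1 / t))"
  have mono: "LC \<mu> (- 1 / x) \<le> LC \<mu> (- 1 / y)" if "0 < x" "x \<le> y" for x y
  proof (rule cbf_mono[OF cbf0_cbf[OF h]])
    show "- 1 / x \<le> - 1 / y" "- 1 / y < 0" using that by (auto simp: frac_le)
  qed
  have 0: "(?F \<longlongrightarrow> measure \<mu> {0}) (at_right 0)"
    by (rule Lim_transform_eventually[OF Omega_at_0[OF \<mu>]]) (auto simp: eventually_at_filter)
  have at0: "measure \<mu> {0} \<le> exp (LC \<mu> (- 1 / y))" if "y > 0" for y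
  proof (rule tendsto_upperbound[OF Omega_at_0[OF \<mu>]])
    have "eventually (\<lambda>x. x \<in> {0<..<y}) (at_right 0)" by (rule eventually_at_right_real[OF that])
    then show "\<forall>\<^sub>F x in at_right 0. exp (LC \<mu> (- 1 / x)) \<le> exp (LC \<mu> (- 1 / y))"
      by eventually_elim (use mono in auto)
  qed simp
  have cont: "isCont (\<lambda>x. exp (LC \<mu> (- 1 / x))) x" if "x > 0" for x
  proof -
    have "isCont (LC \<mu>) (- 1 / x)"
      using cbf0_continuous[OF h] that by (auto simp: continuous_on_eq_continuous_at)
    with that have "isCont (\<lambda>x. LC \<mu> (- 1 / x)) x"
      by (intro isCont_o2[where f="\<lambda>x. - 1 / x" and g="LC \<mu>"]) auto
    then show ?thesis by simp
  qed
  have i: "isdf ?F" unfolding isdf_def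
  proof (intro conjI allI impI)
    fix x :: real assume x: "x \<ge> 0"
    show "0 \<le> ?F x" by simp
    show "?F x \<le> ?F y" if "x \<le> y" for y using that x at0 mono by auto
    show "(?F \<longlongrightarrow> ?F x) (at_right x)"
    proof (cases "x = 0")
      case False
      then have "((\<lambda>x. exp (LC \<mu> (- 1 / x))) \<longlongrightarrow> exp (LC \<mu> (- 1 / x))) (at_right x)"
        using cont[of x] x by (auto simp: isCont_def filterlim_at_split)
      then have "(?F \<longlongrightarrow> exp (LC \<mu> (- 1 / x))) (at_right x)"
        by (rule Lim_transform_eventually) (use x in \<open>auto simp: eventually_at_filter\<close>)
      then show ?thesis using False by simp
    qed (use 0 in simp)
  next
    have "filterlim (\<lambda>x::real. - 1 / x) (at_left 0) at_top" by real_asymp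
    from filterlim_compose[OF cbf0_lim[OF h] this]
    have "((\<lambda>x. exp (LC \<mu> (- 1 / x))) \<longlongrightarrow> exp 0) at_top" by (intro tendsto_intros)
    then have "((\<lambda>x. exp (LC \<mu> (- 1 / x))) \<longlongrightarrow> 1) at_top" by simp
    then show "(?F \<longlongrightarrow> 1) at_top"
      by (rule Lim_transform_eventually) (use eventually_gt_at_top[of 0] in eventually_elim, simp)
  qed
  show "Omega_map \<mu> \<in> Pplus" unfolding Omega_map_def by (rule of_df_Pplus[OF i])
  show "t > 0 \<Longrightarrow> measure (Omega_map \<mu>) {0..t} = exp (LC \<mu> (- 1 / t))"
    unfolding Omega_map_def by (subst measure_of_df[OF i]) auto
qed

text \<open>Since LC is injective and additive, closure and associativity reduce to identities
  between sums.\<close>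

lemma semigroup_ID_convolution: "semigroup_on (ID convolution) convolution"
  unfolding semigroup_on_def
proof (intro conjI ballI)
  fix x y assume x: "x \<in> ID convolution" and y: "y \<in> ID convolution"
  have xy: "x \<in> Pplus" "y \<in> Pplus" using x y ID_Pplus by auto
  have "\<exists>\<nu>\<in>Pplus. convolution x y = nfold convolution n \<nu>" if n: "n \<ge> 1" for n
  proof -
    obtain x' y' where x': "x' \<in> Pplus" "x = nfold convolution n x'" and y': "y' \<in> Pplus" "y = nfold convolution n y'"
      using x y n unfolding ID_def by blast
    have "convolution x y = nfold convolution n (convolution x' y')"
    proof (rule LC_unique)
      fix t :: real assume t: "t < 0"
      show "LC (convolution x y) t = LC (nfold convolution n (convolution x' y')) t"
        unfolding LC_nfold[OF conv_Pplus(1)[OF x'(1) y'(1)] n t] LC_conv[OF x'(1) y'(1) t] LC_conv[OF xy t]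
        using LC_nfold[OF x'(1) n t] LC_nfold[OF y'(1) n t] x'(2) y'(2) by (simp add: distrib_left)
    qed (use xy nfold_conv[OF conv_Pplus(1)[OF x'(1) y'(1)] n] conv_Pplus(1) in auto)
    then show ?thesis using conv_Pplus(1) x'(1) y'(1) by blast
  qed
  then show "convolution x y \<in> ID convolution" using conv_Pplus(1)[OF xy] by (simp add: ID_def)
  fix z assume z: "z \<in> ID convolution"
  then show "convolution (convolution x y) z = convolution x (convolution y z)"
    using xy ID_Pplus[OF z] by (intro LC_unique) (auto simp: conv_Pplus(1) LC_conv)
qed

lemma eta_unique:
  assumes \<mu>: "\<mu> \<in> Pplus" and \<nu>: "\<nu> \<in> Pplus" and eq: "\<And>t. t < 0 \<Longrightarrow> eta_tr \<mu> t = eta_tr \<nu> t"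
  shows "\<mu> = \<nu>"
proof (rule M_unique[OF \<mu> \<nu>])
  fix t :: real assume t: "t < 0"
  then have "1 / M_tr \<mu> t = 1 / M_tr \<nu> t" using eq[OF t] by (simp add: eta_eq \<mu> \<nu>)
  then show "M_tr \<mu> t = M_tr \<nu> t" by simp
qed

lemma uplus:
  assumes \<mu>: "\<mu> \<in> Pplus" and \<nu>: "\<nu> \<in> Pplus"
  shows "uplus \<mu> \<nu> \<in> Pplus" "\<And>t. t < 0 \<Longrightarrow> eta_tr (uplus \<mu> \<nu>) t = eta_tr \<mu> t + eta_tr \<nu> t"
proof -
  obtain \<rho> where \<rho>: "\<rho> \<in> Pplus" "\<And>t. t < 0 \<Longrightarrow> eta_tr \<rho> t = eta_tr \<mu> t + eta_tr \<nu> t"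
    by (rule cbf0_eta[OF cbf0_add[OF eta_cbf0[OF \<mu>] eta_cbf0[OF \<nu>]]]) (rule that)
  have "uplus \<mu> \<nu> = \<rho>" unfolding uplus_def
  proof (rule the_equality)
    fix \<rho>' assume "\<rho>' \<in> Pplus \<and> (\<forall>t<0. eta_tr \<rho>' t = eta_tr \<mu> t + eta_tr \<nu> t)"
    then show "\<rho>' = \<rho>" using \<rho> by (intro eta_unique) auto
  qed (use \<rho> in auto)
  then show "uplus \<mu> \<nu> \<in> Pplus" "\<And>t. t < 0 \<Longrightarrow> eta_tr (uplus \<mu> \<nu>) t = eta_tr \<mu> t + eta_tr \<nu> t"
    using \<rho> by auto
qed

lemma semigroup_uplus: "semigroup_on Pplus uplus"
  unfolding semigroup_on_def by (intro conjI ballI eta_unique) (simp_all add: uplus)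

lemma hom_X_map: "semigroup_hom Pplus uplus (ID convolution) convolution X_map"
  unfolding semigroup_hom_def
proof (intro conjI ballI semigroup_uplus semigroup_ID_convolution)
  fix x y assume xy: "x \<in> Pplus" "y \<in> Pplus"
  show "X_map (uplus x y) = convolution (X_map x) (X_map y)"
    using xy by (intro LC_unique) (auto simp: uplus X_map ID_Pplus[OF X_map(1)] LC_conv conv_Pplus(1))
qed (rule X_map)

lemma hom_Lambda_map: "semigroup_hom (ID convolution) convolution (ID boxplus) boxplus Lambda_map"
  unfolding semigroup_hom_def
proof (intro conjI ballI semigroup_ID_boxplus semigroup_ID_convolution)
  fix x assume x: "x \<in> ID convolution"
  show "Lambda_map x \<in> ID boxplus" by (rule isR_ID[OF Lambda_map_isR[OF x]])
  fix y assume y: "y \<in> ID convolution"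
  have "convolution x y \<in> ID convolution" using semigroup_ID_convolution x y by (simp add: semigroup_on_def)
  from Lambda_map_isR[OF this] boxplus_isR[OF Lambda_map_isR[OF x] Lambda_map_isR[OF y]]
  show "Lambda_map (convolution x y) = boxplus (Lambda_map x) (Lambda_map y)"
    by (rule isR_unique) (simp add: LC_conv ID_Pplus[OF x] ID_Pplus[OF y])
qed

text \<open>The distribution function of the image is M(- 1 / x), and additivity of 1 - 1 / M is
  exactly the rule for reciprocals in the Boolean max-convolution.\<close>

lemma hom_Xi_map: "semigroup_hom Pplus uplus Pplus bool_max_conv Xi_map"
  unfolding semigroup_hom_def
proof (intro conjI ballI semigroup_uplus semigroup_bool_max_conv)
  fix x y assume xy: "x \<in> Pplus" "y \<in> Pplus"
  show "Xi_map (uplus x y) = bool_max_conv (Xi_map x) (Xi_map y)"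
  proof (rule Pplus_eqI)
    fix u :: real assume u: "u > 0"
    let ?t = "- 1 / u"
    have t: "?t < 0" using u by simp
    have p: "M_tr x ?t > 0" "M_tr y ?t > 0" "M_tr (uplus x y) ?t > 0"
      using M_pos xy uplus(1)[OF xy] t by (auto simp: less_imp_le)
    have "1 / M_tr (uplus x y) ?t = 1 / M_tr x ?t + 1 / M_tr y ?t - 1"
      using uplus(2)[OF xy t] eta_eq[of _ ?t] xy uplus(1)[OF xy] t by simp
    then have "M_tr (uplus x y) ?t = 1 / (1 / M_tr x ?t + 1 / M_tr y ?t - 1)" using p(3) by (metis inverse_eq_divide inverse_inverse_eq)
    then have "M_tr (uplus x y) ?t = harm_op (M_tr x ?t) (M_tr y ?t)" using p by (simp add: harm_op_def)
    then show "measure (Xi_map (uplus x y)) {0..u} = measure (bool_max_conv (Xi_map x) (Xi_map y)) {0..u}"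
      using u xy by (simp add: Xi_cdf uplus bool_max_conv_df)
  qed (use xy in \<open>auto simp: Xi_cdf uplus bool_max_conv_df\<close>)
qed (rule Xi_cdf)

lemma hom_Omega_map: "semigroup_hom (ID convolution) convolution Pplus max_conv Omega_map"
  unfolding semigroup_hom_def
proof (intro conjI ballI semigroup_max_conv semigroup_ID_convolution)
  fix x y assume x: "x \<in> ID convolution" and y: "y \<in> ID convolution"
  have "convolution x y \<in> ID convolution" using semigroup_ID_convolution x y by (simp add: semigroup_on_def)
  then show "Omega_map (convolution x y) = max_conv (Omega_map x) (Omega_map y)"
    using x y by (intro Pplus_eqI) (auto simp: Omega_df max_conv_df LC_conv ID_Pplus[OF x] ID_Pplus[OF y] exp_add)
qed (rule Omega_df)

text \<open>R-transforms add and are nonpositive, so truncating each summand at 0 before adding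
  gives the same truncated total.\<close>

lemma hom_Theta_map: "semigroup_hom (ID boxplus) boxplus Pplus free_max_conv Theta_map"
  unfolding semigroup_hom_def
proof (intro conjI ballI semigroup_free_max_conv semigroup_ID_boxplus)
  fix x assume "x \<in> ID boxplus"
  then obtain h where h: "isR x h" by (rule ID_isR)
  show Tx: "Theta_map x \<in> Pplus" by (rule Theta_isR[OF h])
  fix y assume "y \<in> ID boxplus"
  then obtain k where k: "isR y k" by (rule ID_isR)
  show "Theta_map (boxplus x y) = free_max_conv (Theta_map x) (Theta_map y)"
  proof (rule Pplus_eqI)
    fix u :: real assume u: "u > 0"
    have "h (- 1 / u) \<le> 0" "k (- 1 / u) \<le> 0"
      using h k u cbf_nonpos[OF cbf0_cbf, of h "- 1 / u"] cbf_nonpos[OF cbf0_cbf, of k "- 1 / u"]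
      by (simp_all add: isR_def)
    then show "measure (Theta_map (boxplus x y)) {0..u} = measure (free_max_conv (Theta_map x) (Theta_map y)) {0..u}"
      using u by (simp add: Theta_isR[OF boxplus_isR[OF h k]] Theta_isR[OF h] Theta_isR[OF k] free_max_conv_df max_def)
  qed (auto intro: Theta_isR[OF boxplus_isR[OF h k]] free_max_conv_df Theta_isR[OF h] Theta_isR[OF k])
qed

section \<open>The two commuting squares\<close>

lemma Lambda_max_Omega:
  assumes \<mu>: "\<mu> \<in> ID convolution"
  shows "Lambda_max (Omega_map \<mu>) = Theta_map (Lambda_map \<mu>)"
  by (rule Pplus_eqI)
    (auto simp: Lambda_max_df Omega_df[OF \<mu>] Theta_isR[OF Lambda_map_isR[OF \<mu>]] Lambda_df_def)

lemma Omega_X: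
  assumes \<mu>: "\<mu> \<in> Pplus"
  shows "Omega_map (X_map \<mu>) = X_max (Xi_map \<mu>)"
proof (rule Pplus_eqI)
  fix u :: real assume u: "u > 0"
  have "M_tr \<mu> (- 1 / u) > 0" using u by (intro M_pos[OF \<mu>]) simp
  then show "measure (Omega_map (X_map \<mu>)) {0..u} = measure (X_max (Xi_map \<mu>)) {0..u}"
    using u by (simp add: Omega_df X_map[OF \<mu>] X_max_df Xi_cdf[OF \<mu>] X_df_def eta_eq[OF \<mu>])
qed (auto simp: Omega_df X_map[OF \<mu>] X_max_df Xi_cdf[OF \<mu>])

theorem theorem4p3:
  shows
    "(\<forall>\<mu>\<in>ID convolution. (Lambda_max \<circ> Omega_map) \<mu> = (Theta_map \<circ> Lambda_map) \<mu>) \<and>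
     (\<forall>\<mu>\<in>Pplus. (Omega_map \<circ> X_map) \<mu> = (X_max \<circ> Xi_map) \<mu>) \<and>
     (\<forall>\<mu>\<in>Pplus. (Theta_map \<circ> Lambda_map \<circ> X_map) \<mu> = (Lambda_max \<circ> X_max \<circ> Xi_map) \<mu>) \<and>
     semigroup_hom Pplus uplus (ID convolution) convolution X_map \<and>
     semigroup_hom (ID convolution) convolution (ID boxplus) boxplus Lambda_map \<and>
     semigroup_hom Pplus bool_max_conv Pplus max_conv X_max \<and>
     semigroup_hom Pplus max_conv Pplus free_max_conv Lambda_max \<and>
     semigroup_hom Pplus uplus Pplus bool_max_conv Xi_map \<and>
     semigroup_hom (ID convolution) convolution Pplus max_conv Omega_map \<and>
     semigroup_hom (ID boxplus) boxplus Pplus free_max_conv Theta_map"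
proof (intro conjI ballI hom_X_map hom_Lambda_map hom_X_max hom_Lambda_max hom_Xi_map hom_Omega_map hom_Theta_map)
  show "(Lambda_max \<circ> Omega_map) \<mu> = (Theta_map \<circ> Lambda_map) \<mu>" if "\<mu> \<in> ID convolution" for \<mu>
    using Lambda_max_Omega[OF that] by simp
  show "(Omega_map \<circ> X_map) \<mu> = (X_max \<circ> Xi_map) \<mu>" if "\<mu> \<in> Pplus" for \<mu>
    using Omega_X[OF that] by simp
  show "(Theta_map \<circ> Lambda_map \<circ> X_map) \<mu> = (Lambda_max \<circ> X_max \<circ> Xi_map) \<mu>" if "\<mu> \<in> Pplus" for \<mu>
    using Lambda_max_Omega[OF X_map(1)[OF that]] Omega_X[OF that] by simp
qed

end
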